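(* Let $G=(V,E)$ be a locally finite, connected, transitive, non-amenable, unimodular graph, and let $b_r$ denote the number of vertices in a ball of radius $r$ in $G$. Let $\Pi$ be a perturbed vertex set or a Poisson process on $G$. Let $\Pi'$ be another such process (of either type), independent of $\Pi$. Assume that there exists an $\mathbb{R}$-valued factor $(\mathcal{O}_v)_{v\in V}$ of $(\Pi,\Pi')$ such that almost surely the values $\{\mathcal{O}_v\}_{v\in V}$ are distinct. Then there exist a constant $c>0$ and a perfect matching $M:\Pi\to\Pi'$ which is a factor of $(\Pi,\Pi')$ such that $$\mathbb{E}\,\big|\{x\in\Pi\cap\{v\} : \mathrm{dist}(M(x),x)\ge r\}\big|\le \exp(-c\,b_r)$$ for all $v\in V$ and for all $r$ large enough.
   Context: Graph notions. $G=(V,E)$ is transitive if for all $v_1,v_2\in V$ there is an automorphism $\gamma$ of $G$ with $\gamma(v_1)=v_2$. The Cheeger constant is $h(G)=\inf\{|\partial A|/|A| : A\subset V \text{ finite, non-empty}\}$, where $\partial A=\{y\in V:\mathrm{dist}(y,A)=1\}$ is the external boundary and $\mathrm{dist}$ is the graph distance; $G$ is non-amenable if $h(G)>0$. A function $f:V\times V\to[0,\infty]$ is diagonally invariant if $f(\gamma(v_1),\gamma(v_2))=f(v_1,v_2)$ for all $v_1,v_2\in V$ and all automorphisms $\gamma$. $G$ is unimodular if it satisfies the mass transport principle: for every diagonally invariant $f$ and every $x\in V$, $\sum_{v\in V}f(v,x)=\sum_{v\in V}f(x,v)$. Point processes. A point process $\Pi$ on $G$ is a random multiset of vertices, all of whose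 elements are regarded as distinguishable; formally, $\Pi=\{(v,i):v\in V,\ 1\le i\le \ell_v\}$, where $\ell_v\in\{0,1,\dots\}$ is the number of occurrences of $v$. For $S\subset V$, $\Pi\cap S$ denotes the points of $\Pi$ located in $S$. When measuring distances, a point $(v,i)$ is identified with the vertex $v$. Automorphisms $\gamma$ of $G$ act on points by $(v,i)\mapsto(\gamma(v),i)$. A Poisson process is a random multiset $\Pi$ such that $\{|\Pi\cap\{v\}|\}_{v\in V}$ are independent Poisson(1) random variables. A perturbed vertex set is a random multiset of the form $\Pi=\{X_v:v\in V\}$, where $(X_v)_{v\in V}$ are independent $V$-valued random variables, and $\gamma(X_v)$ has the same law as $X_{\gamma(v)}$ for every $v\in V$ and every automorphism $\gamma$ of $G$. Matchings and factors. A matching between multisets $\Pi$ and $\Pi'$ is an injective map $M:\Pi\to\Pi'$; it is perfect if it is also onto $\Pi'$. A random object $Y$ (e.g. a matching $M$, or a process $(\mathcal{O}_v)_{v\in V}$) is a factor of $(\Pi,\Pi')$ if $Y=f(\Pi,\Pi')$ almost surely for some deterministic (measurable) equivariant function $f$, where equivariant means that $f(T\circ(\Pi,\Pi'))=T\circ f(\Pi,\Pi')$ almost surely for every automorphism $T$ of $G$. *)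

theory Defs
  imports "HOL-Probability.Probability"
begin

text \<open>
  A graph is given by its adjacency relation on a vertex type: the vertex set is \<^term>\<open>UNIV\<close>,
  and simplicity is expressed by \<^const>\<open>symp\<close> and \<^const>\<open>irreflp\<close>.
\<close>

definition graph_connected :: "('v \<Rightarrow> 'v \<Rightarrow> bool) \<Rightarrow> bool" where
  "graph_connected E \<longleftrightarrow> (\<forall>x y. E\<^sup>*\<^sup>* x y)"

definition locally_finite :: "('v \<Rightarrow> 'v \<Rightarrow> bool) \<Rightarrow> bool" where
  "locally_finite E \<longleftrightarrow> (\<forall>x. finite {y. E x y})"

definition automorphism :: "('v \<Rightarrow> 'v \<Rightarrow> bool) \<Rightarrow> ('v \<Rightarrow> 'v) \<Rightarrow> bool" where
  "automorphism E \<gamma> \<longleftrightarrow> bij \<gamma> \<and> (\<forall>x y. E (\<gamma> x) (\<gamma> y) \<longleftrightarrow> E x y)"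

definition graph_transitive :: "('v \<Rightarrow> 'v \<Rightarrow> bool) \<Rightarrow> bool" where
  "graph_transitive E \<longleftrightarrow> (\<forall>v1 v2. \<exists>\<gamma>. automorphism E \<gamma> \<and> \<gamma> v1 = v2)"

text \<open>The distances below are meaningful for connected graphs (and nonempty sets) only.\<close>

definition gdist :: "('v \<Rightarrow> 'v \<Rightarrow> bool) \<Rightarrow> 'v \<Rightarrow> 'v \<Rightarrow> nat" where
  "gdist E x y = (LEAST n. (E ^^ n) x y)"

definition gdist_set :: "('v \<Rightarrow> 'v \<Rightarrow> bool) \<Rightarrow> 'v \<Rightarrow> 'v set \<Rightarrow> nat" where
  "gdist_set E y A = (INF a\<in>A. gdist E y a)"

definition gball :: "('v \<Rightarrow> 'v \<Rightarrow> bool) \<Rightarrow> 'v \<Rightarrow> nat \<Rightarrow> 'v set" where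
  "gball E x r = {y. gdist E x y \<le> r}"

definition external_boundary :: "('v \<Rightarrow> 'v \<Rightarrow> bool) \<Rightarrow> 'v set \<Rightarrow> 'v set" where
  "external_boundary E A = {y. gdist_set E y A = 1}"

definition cheeger :: "('v \<Rightarrow> 'v \<Rightarrow> bool) \<Rightarrow> real" where
  "cheeger E = (INF A\<in>{A. finite A \<and> A \<noteq> {}}. real (card (external_boundary E A)) / real (card A))"

definition nonamenable :: "('v \<Rightarrow> 'v \<Rightarrow> bool) \<Rightarrow> bool" where
  "nonamenable E \<longleftrightarrow> cheeger E > 0"

definition diagonally_invariant ::
    "('v \<Rightarrow> 'v \<Rightarrow> bool) \<Rightarrow> ('v \<Rightarrow> 'v \<Rightarrow> ennreal) \<Rightarrow> bool" where
  "diagonally_invariant E f \<longleftrightarrow>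
     (\<forall>\<gamma>. automorphism E \<gamma> \<longrightarrow> (\<forall>v1 v2. f (\<gamma> v1) (\<gamma> v2) = f v1 v2))"

definition unimodular :: "('v \<Rightarrow> 'v \<Rightarrow> bool) \<Rightarrow> bool" where
  "unimodular E \<longleftrightarrow> (\<forall>f. diagonally_invariant E f \<longrightarrow>
     (\<forall>x. (\<Sum>\<^sub>\<infinity>v. f v x) = (\<Sum>\<^sub>\<infinity>v. f x v)))"

text \<open>
  A multiset of vertices is encoded by its multiplicity function \<open>\<xi> :: 'v \<Rightarrow> nat\<close> (it may be infinite,
  so the library type of finite multisets does not apply). Its distinguishable points
  are the pairs \<open>(v, i)\<close> with \<open>1 \<le> i \<le> \<xi> v\<close>.
\<close>

definition points :: "('v \<Rightarrow> nat) \<Rightarrow> ('v \<times> nat) set" where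
  "points \<xi> = {(v, i). 1 \<le> i \<and> i \<le> \<xi> v}"

definition config_space :: "('v \<Rightarrow> nat) measure" where
  "config_space = (\<Pi>\<^sub>M v\<in>UNIV. count_space UNIV)"

definition poisson_process :: "'w measure \<Rightarrow> ('w \<Rightarrow> 'v \<Rightarrow> nat) \<Rightarrow> bool" where
  "poisson_process P \<Phi> \<longleftrightarrow>
     \<Phi> \<in> P \<rightarrow>\<^sub>M config_space \<and>
     prob_space.indep_vars P (\<lambda>_. count_space UNIV) (\<lambda>v \<omega>. \<Phi> \<omega> v) UNIV \<and>
     (\<forall>v. distr P (count_space UNIV) (\<lambda>\<omega>. \<Phi> \<omega> v) = measure_pmf (poisson_pmf 1))"

definition perturbed_vertex_set ::
    "('v \<Rightarrow> 'v \<Rightarrow> bool) \<Rightarrow> 'w measure \<Rightarrow> ('w \<Rightarrow> 'v \<Rightarrow> nat) \<Rightarrow> bool" where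
  "perturbed_vertex_set E P \<Phi> \<longleftrightarrow>
     \<Phi> \<in> P \<rightarrow>\<^sub>M config_space \<and>
     (\<exists>X :: 'v \<Rightarrow> 'w \<Rightarrow> 'v.
        prob_space.indep_vars P (\<lambda>_. count_space UNIV) X UNIV \<and>
        (\<forall>\<gamma> v. automorphism E \<gamma> \<longrightarrow>
           distr P (count_space UNIV) (\<lambda>\<omega>. \<gamma> (X v \<omega>)) = distr P (count_space UNIV) (X (\<gamma> v))) \<and>
        (AE \<omega> in P. \<forall>v. finite {u. X u \<omega> = v} \<and> \<Phi> \<omega> v = card {u. X u \<omega> = v}))"

text \<open>
  Automorphisms act on fields indexed by the vertices, in particular on multiplicity functions,
  by \<open>(\<gamma> \<cdot> g) (\<gamma> v) = g v\<close>; on multisets this is the action \<open>(v, i) \<mapsto> (\<gamma> v, i)\<close> on points.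
\<close>

definition act_field :: "('v \<Rightarrow> 'v) \<Rightarrow> ('v \<Rightarrow> 'a) \<Rightarrow> 'v \<Rightarrow> 'a" where
  "act_field \<gamma> g = (\<lambda>v. g (inv \<gamma> v))"

lemma points_act_field:
  assumes "bij \<gamma>"
  shows "points (act_field \<gamma> \<xi>) = (\<lambda>(v, i). (\<gamma> v, i)) ` points \<xi>"
proof -
  have "(v, i) \<in> (\<lambda>(v, i). (\<gamma> v, i)) ` points \<xi>" if "1 \<le> i" "i \<le> \<xi> (inv \<gamma> v)" for v i
    using that assms
    by (auto simp: points_def bij_is_surj surj_f_inv_f intro!: image_eqI[where x = "(inv \<gamma> v, i)"])
  then show ?thesis
    using assms by (auto simp: points_def act_field_def bij_is_inj)
qed

text \<open>
  A map between the points of two multisets is a partial map on \<^typ>\<open>'v \<times> nat\<close> whose domain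
  is the first set of points. The action of an automorphism moves its graph:
  if \<open>(v, i)\<close> is matched to \<open>(w, j)\<close> then \<open>(\<gamma> v, i)\<close> is matched to \<open>(\<gamma> w, j)\<close>.
\<close>

definition matching :: "('a \<rightharpoonup> 'b) \<Rightarrow> 'a set \<Rightarrow> 'b set \<Rightarrow> bool" where
  "matching M A B \<longleftrightarrow> dom M = A \<and> ran M \<subseteq> B \<and> inj_on M A"

definition perfect_matching :: "('a \<rightharpoonup> 'b) \<Rightarrow> 'a set \<Rightarrow> 'b set \<Rightarrow> bool" where
  "perfect_matching M A B \<longleftrightarrow> matching M A B \<and> ran M = B"

definition matching_space :: "('v \<times> nat \<rightharpoonup> 'v \<times> nat) measure" where
  "matching_space = (\<Pi>\<^sub>M x\<in>UNIV. count_space UNIV)"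

definition act_matching ::
    "('v \<Rightarrow> 'v) \<Rightarrow> ('v \<times> nat \<rightharpoonup> 'v \<times> nat) \<Rightarrow> ('v \<times> nat \<rightharpoonup> 'v \<times> nat)" where
  "act_matching \<gamma> M = (\<lambda>(v, i). map_option (\<lambda>(w, j). (\<gamma> w, j)) (M (inv \<gamma> v, i)))"

text \<open>
  \<open>N\<close> is the measurable space in which \<open>Y\<close> takes its values and \<open>act\<close> the action of the
  automorphisms on it. The exceptional null set in the equivariance may depend on the automorphism.
\<close>

definition is_factor ::
    "('v \<Rightarrow> 'v \<Rightarrow> bool) \<Rightarrow> 'w measure \<Rightarrow> ('w \<Rightarrow> 'v \<Rightarrow> nat) \<Rightarrow> ('w \<Rightarrow> 'v \<Rightarrow> nat) \<Rightarrow>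
     'y measure \<Rightarrow> (('v \<Rightarrow> 'v) \<Rightarrow> 'y \<Rightarrow> 'y) \<Rightarrow> ('w \<Rightarrow> 'y) \<Rightarrow> bool" where
  "is_factor E P \<Phi> \<Phi>' N act Y \<longleftrightarrow>
     Y \<in> P \<rightarrow>\<^sub>M N \<and>
     (\<exists>f \<in> config_space \<Otimes>\<^sub>M config_space \<rightarrow>\<^sub>M N.
        (AE \<omega> in P. Y \<omega> = f (\<Phi> \<omega>, \<Phi>' \<omega>)) \<and>
        (\<forall>\<gamma>. automorphism E \<gamma> \<longrightarrow>
           (AE \<omega> in P. f (act_field \<gamma> (\<Phi> \<omega>), act_field \<gamma> (\<Phi>' \<omega>)) = act \<gamma> (f (\<Phi> \<omega>, \<Phi>' \<omega>)))))"

end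

(*
  Write each process as a superposition of independent emissions, one from each vertex. Non-amenability
  gives a spectral gap for equivariant events of the emission field (Efron-Stein decomposition and
  mass transport), so that the k-neighbourhood of an equivariant random set of small density s has
  density at least s / (s + lam^k).

  A connected set W of side b is bad if it contains too many points of side b, or if its
  rho-neighbourhood contains too few points of the other side; Chernoff bounds and the exponential
  growth of neighbourhoods give P(W bad) <= exp(-a |W|), hence P(some bad set of size at least n
  contains v) <= exp(-n). Two points of opposite sides are joined if their distance is bounded or if
  one of them lies in a bad set of size comparable to a ball of radius their distance. Since a
  long edge requires a bad set as large as a ball, every matching along such edges has tail
  exp(-c b_r). Away from bad sets the spectral gap makes this bipartite graph expand; near bad
  sets the definition of badness itself does.

  A perfect matching is the limit of a sequence of partial ones. In every step a maximal disjoint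
  family of short augmenting paths, selected with the help of the distinct labels, is flipped. If only
  few points were covered by such a family, the alternating paths issuing from the remaining
  unmatched points would, by expansion, cover nearly everything and end in another augmenting path.
  So the density al of unmatched points drops by a factor 1 - c sqrt al with paths of
  length C / sqrt al, whence al tends to 0 and, by Borel-Cantelli, each point is rematched only
  finitely often.
*)
theory Submission
  imports Defs
begin

section \<open>Neighbourhoods, mass transport and the lazy walk\<close>

text \<open>The field of indicators of an equivariant event has the same norm at every vertex, so
  the l2 contraction of the walk cannot act on it directly. It acts on the Efron-Stein components:
  for a finite index set J, the norm of the J-component at u is a function of u, and mass transport
  exchanges the sum over J at one vertex for the sum over vertices at one J. Emissions, rather than
  multiplicities, serve as independent coordinates because the multiplicities of a perturbed vertex
  set are dependent. A spectral gap says little about sets concentrated where the points are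
  atypical. Expansion there is read off finite clusters, whose finiteness needs an argument of its
  own. The constants are compatible since the entropy of connected sets at scale rho is linear in
  rho, so the threshold Lc may be linear too, while neighbourhoods grow exponentially in rho. Paths
  of length about log (1 / al) would make progress as well; the longer 1 / sqrt al lets the drop of
  al and the density of rematched points telescope.\<close>

locale nonamenable_graph =
 fixes E :: "'v \<Rightarrow> 'v \<Rightarrow> bool"
 assumes E_symp: "symp E" and E_irreflp: "irreflp E"
  and E_locally_finite: "locally_finite E" and E_connected: "graph_connected E"
  and E_transitive: "graph_transitive E" and E_nonamenable: "nonamenable E"
  and E_unimodular: "unimodular E"
begin

lemma E_sym: "E x y \<longleftrightarrow> E y x"
 using E_symp by (auto simp: symp_def)

abbreviation aut where "aut \<gamma> \<equiv> automorphism E \<gamma>"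
abbreviation dd where "dd \<equiv> gdist E"

definition nbhd :: "'v set \<Rightarrow> nat \<Rightarrow> 'v set" where
 "nbhd W r = {u. \<exists>w\<in>W. dd w u \<le> r}"

text \<open>The centre is an arbitrary choice; transitivity makes the size of a ball independent of
  it (\<open>card_gball\<close>), so this is the quantity b_r.\<close>

definition bsize :: "nat \<Rightarrow> nat" where
 "bsize r = card (gball E (SOME v. True) r)"

lemma relpowp_sym: "(E ^^ n) x y \<Longrightarrow> (E ^^ n) y x"
proof (induction n arbitrary: y)
 case (Suc n)
 then obtain z where z: "(E ^^ n) x z" "E z y" by (auto elim: relpowp_Suc_E)
 then show ?case using Suc.IH[OF z(1)] E_sym relpowp_Suc_I2 by metis
qed simp

lemma ex_relpowp: "\<exists>n. (E ^^ n) x y"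
 using E_connected by (auto simp: graph_connected_def rtranclp_power)

lemma relpowp_dd: "(E ^^ dd x y) x y"
 unfolding gdist_def using ex_relpowp by (rule LeastI_ex)

lemma dd_le: "(E ^^ n) x y \<Longrightarrow> dd x y \<le> n"
 unfolding gdist_def by (rule Least_le)

lemma dd_sym: "dd x y = dd y x"
 using relpowp_sym relpowp_dd dd_le by (metis antisym)

lemma dd_refl [simp]: "dd x x = 0"
 using dd_le[of 0 x x] by simp

lemma dd_0_iff [simp]: "dd x y = 0 \<longleftrightarrow> x = y"
 using relpowp_dd[of x y] by (auto)

lemma dd_triangle: "dd x z \<le> dd x y + dd y z"
 using relpowp_dd[of x y] relpowp_dd[of y z] by (intro dd_le) (auto simp: relpowp_add)

lemma dd_E: "E x y \<Longrightarrow> dd x y = 1"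
proof -
 assume "E x y"
 then have "dd x y \<le> 1" "x \<noteq> y"
  using E_irreflp dd_le[of 1 x y] by (auto simp: irreflp_def)
 then show ?thesis using dd_0_iff[of x y] by linarith
qed

lemma dd_1_iff: "dd x y = 1 \<longleftrightarrow> E x y"
 using dd_E relpowp_dd[of x y] by auto

text \<open>A shortest walk is cut after \<open>m\<close> steps; the triangle inequality forces both
  pieces to be geodesic.\<close>

lemma dd_split: "dd x y = m + n \<Longrightarrow> \<exists>z. dd x z = m \<and> dd z y = n"
proof -
 assume a: "dd x y = m + n"
 then have "(E ^^ (m + n)) x y" using relpowp_dd[of x y] by simp
 then obtain z where z: "(E ^^ m) x z" "(E ^^ n) z y" by (auto simp: relpowp_add)
 then have "dd x z \<le> m" "dd z y \<le> n" by (auto intro: dd_le)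
 with a dd_triangle[of x y z] show ?thesis by (intro exI[of _ z]) linarith
qed

lemma finite_gball [simp]: "finite (gball E x r)"
proof (induction r)
 case 0
 have "gball E x 0 = {x}" by (auto simp: gball_def)
 then show ?case by simp
next
 case (Suc r)
 have "gball E x (Suc r) \<subseteq> gball E x r \<union> (\<Union>y\<in>gball E x r. {z. E y z})"
 proof
  fix z assume z: "z \<in> gball E x (Suc r)"
  show "z \<in> gball E x r \<union> (\<Union>y\<in>gball E x r. {z. E y z})"
  proof (cases "dd x z \<le> r")
   case False
   with z have "dd x z = r + 1" by (auto simp: gball_def)
   then obtain y where "dd x y = r" "dd y z = 1" using dd_split by blast
   then show ?thesis unfolding dd_1_iff by (auto simp: gball_def)
  qed (auto simp: gball_def)
 qed
 moreover have "finite (gball E x r \<union> (\<Union>y\<in>gball E x r. {z. E y z}))"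
  using Suc E_locally_finite by (auto simp: locally_finite_def)
 ultimately show ?case by (rule finite_subset)
qed

lemma mem_gball [simp]: "y \<in> gball E x r \<longleftrightarrow> dd x y \<le> r"
 by (simp add: gball_def)

lemma countable_V: "countable (UNIV :: 'v set)"
proof -
 have "(UNIV :: 'v set) = (\<Union>r. gball E (SOME v. True) r)" by auto
 moreover have "countable (\<Union>r. gball E (SOME v. True) r)"
  by (intro countable_UN) (auto intro: countable_finite)
 ultimately show ?thesis by simp
qed

lemma aut_bij: "aut \<gamma> \<Longrightarrow> bij \<gamma>"
 by (simp add: automorphism_def)

lemma aut_inv: "aut \<gamma> \<Longrightarrow> aut (inv \<gamma>)"
 unfolding automorphism_def
 by (metis bij_betw_def bij_imp_bij_inv surj_f_inv_f)

lemma aut_relpowp: "aut \<gamma> \<Longrightarrow> (E ^^ n) x y \<Longrightarrow> (E ^^ n) (\<gamma> x) (\<gamma> y)"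
proof (induction n arbitrary: y)
 case (Suc n)
 then show ?case by (auto simp: automorphism_def elim!: relpowp_Suc_E intro!: relpowp_Suc_I)
qed simp

lemma aut_dd [simp]: "aut \<gamma> \<Longrightarrow> dd (\<gamma> x) (\<gamma> y) = dd x y"
proof (rule antisym)
 assume a: "aut \<gamma>"
 show "dd (\<gamma> x) (\<gamma> y) \<le> dd x y" using aut_relpowp[OF a] relpowp_dd dd_le by metis
 have "dd (inv \<gamma> (\<gamma> x)) (inv \<gamma> (\<gamma> y)) \<le> dd (\<gamma> x) (\<gamma> y)"
  using aut_relpowp[OF aut_inv[OF a]] relpowp_dd dd_le by metis
 then show "dd x y \<le> dd (\<gamma> x) (\<gamma> y)" using aut_bij[OF a] by (simp add: bij_is_inj)
qed

lemma aut_apply_inv [simp]: "aut \<gamma> \<Longrightarrow> \<gamma> (inv \<gamma> x) = x" "aut \<gamma> \<Longrightarrow> inv \<gamma> (\<gamma> x) = x"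
 using aut_bij by (auto simp: bij_is_surj surj_f_inv_f bij_is_inj)

lemma aut_inj_iff [simp]: "aut \<gamma> \<Longrightarrow> \<gamma> x = \<gamma> y \<longleftrightarrow> x = y"
 by (metis aut_apply_inv(2))

lemma aut_inj: "aut \<gamma> \<Longrightarrow> inj \<gamma>"
 using aut_bij bij_is_inj by blast

lemma ex_aut: "\<exists>\<gamma>. aut \<gamma> \<and> \<gamma> x = y"
 using E_transitive by (auto simp: graph_transitive_def)

lemma aut_gball: "aut \<gamma> \<Longrightarrow> gball E (\<gamma> x) r = \<gamma> ` gball E x r"
proof -
 assume a: "aut \<gamma>"
 have "y \<in> \<gamma> ` gball E x r" if "dd (\<gamma> x) y \<le> r" for y
  using that a by (intro image_eqI[of _ _ "inv \<gamma> y"]) (auto, metis aut_apply_inv(1) aut_dd)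
 then show ?thesis using a by auto
qed

lemma aut_nbhd: "aut \<gamma> \<Longrightarrow> nbhd (\<gamma> ` W) r = \<gamma> ` nbhd W r"
proof -
 assume a: "aut \<gamma>"
 have "nbhd W r = (\<Union>w\<in>W. gball E w r)" for W by (auto simp: nbhd_def)
 then show ?thesis by (auto simp: aut_gball[OF a])
qed

lemma card_gball: "card (gball E x r) = bsize r"
proof -
 obtain \<gamma> where g: "aut \<gamma>" "\<gamma> (SOME v. True) = x" using ex_aut by blast
 then show ?thesis unfolding bsize_def using aut_gball[OF g(1)] g(2)
  by (metis card_image aut_inj inj_on_subset subset_UNIV)
qed

lemma nbhd_Un: "nbhd W r = (\<Union>w\<in>W. gball E w r)"
 by (auto simp: nbhd_def)

lemma finite_nbhd [simp]: "finite W \<Longrightarrow> finite (nbhd W r)"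
 by (simp add: nbhd_Un)

lemma card_nbhd_le: "finite W \<Longrightarrow> card (nbhd W r) \<le> card W * bsize r"
 unfolding nbhd_Un using card_UN_le[of W "\<lambda>w. gball E w r"] by (simp add: card_gball)

lemma subset_nbhd: "W \<subseteq> nbhd W r"
 by (auto simp: nbhd_def intro!: bexI)

lemma nbhd_mono: "W \<subseteq> W' \<Longrightarrow> r \<le> r' \<Longrightarrow> nbhd W r \<subseteq> nbhd W' r'"
 by (force simp: nbhd_def)

text \<open>Equality and not just inclusion, because geodesics have points at every intermediate
  distance.\<close>

lemma nbhd_add: "nbhd (nbhd W r) s = nbhd W (r + s)"
proof (intro equalityI subsetI)
 fix x assume "x \<in> nbhd (nbhd W r) s"
 then obtain u w where "w \<in> W" "dd w u \<le> r" "dd u x \<le> s" by (auto simp: nbhd_def)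
 then show "x \<in> nbhd W (r + s)" using dd_triangle[of w x u] by (force simp: nbhd_def)
next
 fix x assume "x \<in> nbhd W (r + s)"
 then obtain w where w: "w \<in> W" "dd w x \<le> r + s" by (auto simp: nbhd_def)
 show "x \<in> nbhd (nbhd W r) s"
 proof (cases "dd w x \<le> r")
  case True then show ?thesis using w by (auto simp: nbhd_def intro!: exI[of _ x])
 next
  case False
  then obtain z where "dd w z = r" "dd z x = dd w x - r" using dd_split[of w x r "dd w x - r"] by auto
  then show ?thesis using w by (auto simp: nbhd_def intro!: exI[of _ z])
 qed
qed

lemma gball_eq_nbhd: "gball E x r = nbhd {x} r"
 by (auto simp: nbhd_def)

text \<open>The distance to a set is an infimum of naturals, hence attained for non-empty
  \<open>A\<close>; the boundary thereby becomes one layer of growth.\<close>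

lemma external_boundary_eq:
 assumes "A \<noteq> {}" shows "external_boundary E A = nbhd A 1 - A"
proof -
 have "gdist_set E y A = 1 \<longleftrightarrow> (\<exists>a\<in>A. dd a y \<le> 1) \<and> y \<notin> A" for y
 proof -
  have ne: "dd y ` A \<noteq> {}" using assms by auto
  have "gdist_set E y A \<in> dd y ` A"
   unfolding gdist_set_def using Inf_nat_def1[OF ne] by simp
  then obtain a where a: "a \<in> A" "gdist_set E y A = dd y a" by auto
  have le: "gdist_set E y A \<le> dd y b" if "b \<in> A" for b
   unfolding gdist_set_def using that by (intro cInf_lower) auto
  show ?thesis
  proof
   assume "gdist_set E y A = 1"
   with a le[of y] show "(\<exists>a\<in>A. dd a y \<le> 1) \<and> y \<notin> A" using dd_sym by force
  next
   assume r: "(\<exists>a\<in>A. dd a y \<le> 1) \<and> y \<notin> A"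
   then have "gdist_set E y A \<le> 1" using le dd_sym by (metis le_trans)
   moreover have "gdist_set E y A \<noteq> 0" using a r by (metis dd_0_iff)
   ultimately show "gdist_set E y A = 1" by linarith
  qed
 qed
 then show ?thesis by (auto simp: external_boundary_def nbhd_def)
qed

definition hh :: real where "hh = cheeger E"

lemma hh_pos: "hh > 0"
 using E_nonamenable by (simp add: hh_def nonamenable_def)

lemma card_boundary_ge:
 assumes "finite A" "A \<noteq> {}"
 shows "real (card (external_boundary E A)) \<ge> hh * real (card A)"
proof -
 have "cheeger E \<le> real (card (external_boundary E A)) / real (card A)"
  unfolding cheeger_def using assms
  by (intro cINF_lower) (auto intro!: bdd_belowI2[where m=0])
 moreover have "card A > 0" using assms by (simp add: card_gt_0_iff)
 ultimately show ?thesis by (simp add: hh_def field_simps)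
qed

text \<open>Each unit of radius adds an external boundary of at least \<open>hh\<close> times the
  current size.\<close>

lemma card_nbhd_ge: "finite W \<Longrightarrow> real (card (nbhd W r)) \<ge> (1 + hh) ^ r * real (card W)"
proof (induction r)
 case 0
 have "nbhd W 0 = W" by (auto simp: nbhd_def)
 then show ?case by simp
next
 case (Suc r)
 show ?case
 proof (cases "W = {}")
  case False
  let ?A = "nbhd W r"
  have A: "finite ?A" "?A \<noteq> {}" using Suc.prems False subset_nbhd[of W r] by auto
  have "nbhd W (Suc r) = ?A \<union> external_boundary E ?A"
   using nbhd_add[of W r 1] subset_nbhd[of ?A 1] external_boundary_eq[OF A(2)] by auto
  moreover have "?A \<inter> external_boundary E ?A = {}" using external_boundary_eq[OF A(2)] by auto
  moreover have "finite (external_boundary E ?A)" using A by (simp add: external_boundary_eq[OF A(2)])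
  ultimately have "real (card (nbhd W (Suc r))) = real (card ?A) + real (card (external_boundary E ?A))"
   using A by (simp add: card_Un_disjoint)
  also have "\<dots> \<ge> (1 + hh) * real (card ?A)" using card_boundary_ge[OF A] by (simp add: algebra_simps)
  finally have "(1 + hh) * real (card ?A) \<le> real (card (nbhd W (Suc r)))" .
  moreover have "(1 + hh) * ((1 + hh) ^ r * real (card W)) \<le> (1 + hh) * real (card ?A)"
   using Suc.IH[OF Suc.prems] hh_pos by (intro mult_left_mono) auto
  ultimately show ?thesis by simp
 qed simp
qed

lemma bsize_0 [simp]: "bsize 0 = 1"
proof -
 have "gball E x 0 = {x}" for x by auto
 then show ?thesis by (simp add: bsize_def)
qed

lemma bsize_add: "bsize (r + s) \<le> bsize r * bsize s"
proof -
 have "card (nbhd {x} (r + s)) \<le> card (nbhd {x} r) * bsize s" for x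
  unfolding nbhd_add[symmetric] by (intro card_nbhd_le) simp
 then show ?thesis by (simp add: gball_eq_nbhd[symmetric] card_gball)
qed

lemma bsize_Suc_gt: "bsize r < bsize (Suc r)"
proof -
 fix x :: 'v
 have f: "finite (gball E x r)" "gball E x r \<noteq> {}"
  by (simp, metis mem_gball dd_refl le0 empty_iff)
 have "real (card (external_boundary E (gball E x r))) \<ge> hh * real (card (gball E x r))"
  by (rule card_boundary_ge[OF f])
 moreover have "card (gball E x r) > 0" using f by (simp add: card_gt_0_iff)
 ultimately have "card (external_boundary E (gball E x r)) > 0"
  using hh_pos by (metis of_nat_0_less_iff less_le_trans zero_less_mult_iff)
 then have ne: "external_boundary E (gball E x r) \<noteq> {}" by auto
 have "gball E x (Suc r) = nbhd (gball E x r) 1"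
  unfolding gball_eq_nbhd nbhd_add by simp
 then have "gball E x r \<subset> gball E x (Suc r)"
  using ne external_boundary_eq[OF f(2)] subset_nbhd[of "gball E x r" 1] by blast
 then have "card (gball E x r) < card (gball E x (Suc r))" by (intro psubset_card_mono) auto
 then show ?thesis by (simp add: card_gball)
qed

lemma bsize_strict_mono: "strict_mono bsize"
 using bsize_Suc_gt by (simp add: strict_mono_Suc_iff)

lemma bsize_mono: "r \<le> s \<Longrightarrow> bsize r \<le> bsize s"
 using bsize_strict_mono by (simp add: strict_mono_less_eq)

lemma bsize_ge: "bsize r \<ge> Suc r"
proof (induction r)
 case (Suc r) then show ?case using bsize_Suc_gt[of r] by simp
qed simp

lemma bsize_le_power: "bsize r \<le> bsize 1 ^ r"
proof (induction r)
 case (Suc r)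
 have "bsize (1 + r) \<le> bsize 1 * bsize r" by (rule bsize_add)
 also have "\<dots> \<le> bsize 1 * bsize 1 ^ r" using Suc by simp
 finally show ?case by simp
qed simp

definition deg :: nat where "deg = bsize 1 - 1"

lemma card_nbrs: "card {y. E x y} = deg"
proof -
 have "gball E x 1 = insert x {y. E x y}"
 proof (intro set_eqI)
  fix y show "y \<in> gball E x 1 \<longleftrightarrow> y \<in> insert x {y. E x y}"
   using dd_1_iff[of x y] dd_0_iff[of x y] by (cases "dd x y") auto
 qed
 moreover have "x \<notin> {y. E x y}" using E_irreflp by (auto simp: irreflp_def)
 moreover have "finite {y. E x y}" using E_locally_finite by (auto simp: locally_finite_def)
 ultimately show ?thesis unfolding deg_def by (metis card_gball card_insert_disjoint diff_Suc_1)
qed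

lemma deg_pos: "deg > 0"
 using bsize_ge[of 1] by (simp add: deg_def)

lemma finite_nbrs [simp]: "finite {y. E x y}"
 using E_locally_finite by (auto simp: locally_finite_def)

text \<open>Unimodularity is stated with unordered sums, whereas Fubini and monotone convergence are
  at hand for integrals over the counting measure. In the harder direction, a simple function below
  \<open>f\<close> with infinite support takes some nonzero value infinitely often, which makes the
  sum infinite.\<close>

lemma infsum_eq_nn_integral:
 fixes f :: "'a \<Rightarrow> ennreal"
 shows "infsum f UNIV = (\<integral>\<^sup>+x. f x \<partial>count_space UNIV)"
proof (rule antisym)
 have le: "sum f F \<le> (\<integral>\<^sup>+x. f x \<partial>count_space UNIV)" if "finite F" for F
 proof -
  have "sum f F = (\<integral>\<^sup>+x. f x * indicator F x \<partial>count_space UNIV)"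
   using that by (simp add: nn_integral_count_space_indicator[symmetric] nn_integral_count_space_finite)
  also have "\<dots> \<le> (\<integral>\<^sup>+x. f x \<partial>count_space UNIV)"
   by (intro nn_integral_mono) (auto split: split_indicator)
  finally show ?thesis .
 qed
 then show "infsum f UNIV \<le> (\<integral>\<^sup>+x. f x \<partial>count_space UNIV)"
  by (subst nonneg_infsum_complete) (auto intro!: SUP_least)
 show "(\<integral>\<^sup>+x. f x \<partial>count_space UNIV) \<le> infsum f UNIV"
  unfolding nn_integral_def
 proof (intro SUP_least, clarify)
  fix s assume s: "simple_function (count_space UNIV) s" "s \<le> f"
  show "integral\<^sup>S (count_space UNIV) s \<le> infsum f UNIV"
  proof -
   have 1: "(\<integral>\<^sup>+x. s x \<partial>count_space UNIV) = integral\<^sup>S (count_space UNIV) s"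
    using s by (intro nn_integral_eq_simple_integral)
   have rg: "finite (range s)" using s by (simp add: simple_function_def)
   show ?thesis
   proof (cases "finite {x. s x \<noteq> 0}")
    case True
    have "(\<integral>\<^sup>+x. s x \<partial>count_space UNIV) = sum s {x. s x \<noteq> 0}"
     using True by (subst nn_integral_count_space'[of "{x. s x \<noteq> 0}"]) auto
    also have "\<dots> \<le> sum f {x. s x \<noteq> 0}" using s by (intro sum_mono) (auto simp: le_fun_def)
    also have "\<dots> \<le> infsum f UNIV"
     by (subst nonneg_infsum_complete) (auto intro!: SUP_upper True)
    finally show ?thesis using 1 by simp
   next
    case False
    have "{x. s x \<noteq> 0} = (\<Union>c\<in>range s - {0}. s -` {c})" by auto
    then obtain c where c: "c \<in> range s - {0}" "infinite (s -` {c})"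
     using False rg by (metis finite_Diff finite_UN)
    have "of_nat n * c \<le> infsum f UNIV" for n
    proof -
     obtain F where F: "finite F" "card F = n" "F \<subseteq> s -` {c}"
      using infinite_arbitrarily_large[OF c(2)] by blast
     have "of_nat n * c = sum s F" using F by (subst sum.cong[of F F s "\<lambda>_. c"]) auto
     also have "\<dots> \<le> sum f F" using s by (intro sum_mono) (auto simp: le_fun_def)
     also have "\<dots> \<le> infsum f UNIV"
      by (subst nonneg_infsum_complete) (auto intro!: SUP_upper F)
     finally show ?thesis .
    qed
    then have "(SUP n. of_nat n * c) \<le> infsum f UNIV" by (intro SUP_least)
    moreover have "(SUP n. of_nat n * c) = (top::ennreal)"
     using c(1) by (simp add: SUP_mult_right_ennreal[symmetric] ennreal_SUP_of_nat_eq_top ennreal_top_mult)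
    ultimately show ?thesis by (simp add: top_unique)
   qed
  qed
 qed
qed

lemma mass_transport:
 assumes "\<And>\<gamma> u v. aut \<gamma> \<Longrightarrow> f (\<gamma> u) (\<gamma> v) = (f u v :: ennreal)"
 shows "(\<integral>\<^sup>+v. f v x \<partial>count_space UNIV) = (\<integral>\<^sup>+v. f x v \<partial>count_space UNIV)"
 using E_unimodular assms unfolding unimodular_def diagonally_invariant_def infsum_eq_nn_integral[symmetric]
 by blast

end

section \<open>Sets connected at scale D and their number\<close>

context nonamenable_graph begin

text \<open>Connectedness in the graph joining vertices at distance at most \<open>D\<close>,
  phrased through cuts rather than paths: growing a set vertex by vertex and uniting two sets both
  use the cut condition directly.\<close>

definition conn :: "nat \<Rightarrow> 'v set \<Rightarrow> bool" where
 "conn D W \<longleftrightarrow> finite W \<and> W \<noteq> {} \<and>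
  (\<forall>A\<subseteq>W. A \<noteq> {} \<longrightarrow> A \<noteq> W \<longrightarrow> (\<exists>a\<in>A. \<exists>b\<in>W - A. dd a b \<le> D))"

definition walks :: "nat \<Rightarrow> 'v \<Rightarrow> nat \<Rightarrow> 'v list set" where
 "walks D v n = {ws. length ws = Suc n \<and> hd ws = v \<and> successively (\<lambda>a b. dd a b \<le> D) ws}"

lemma walks_0: "walks D v 0 = {[v]}"
 by (auto simp: walks_def length_Suc_conv)

lemma walks_Suc: "walks D v (Suc n) = (\<Union>u\<in>gball E v D. (#) v ` walks D u n)"
 by (force simp: walks_def length_Suc_conv)

lemma card_walks: "finite (walks D v n) \<and> card (walks D v n) \<le> bsize D ^ n"
proof (induction n arbitrary: v)
 case 0 then show ?case by (simp add: walks_0)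
next
 case (Suc n)
 have "card (walks D v (Suc n)) \<le> (\<Sum>u\<in>gball E v D. card ((#) v ` walks D u n))"
  unfolding walks_Suc by (intro card_UN_le) simp
 also have "\<dots> \<le> (\<Sum>u\<in>gball E v D. bsize D ^ n)"
  using Suc by (intro sum_mono) (metis card_image_le le_trans)
 also have "\<dots> = bsize D ^ Suc n" by (simp add: card_gball)
 finally show ?case using Suc by (simp add: walks_Suc)
qed

text \<open>The detour from \<open>u\<close> to \<open>w\<close> and back is spliced in at a visit
  of \<open>u\<close>, at the price of two steps.\<close>

lemma walk_insert:
 assumes "ws \<in> walks D v n" "u \<in> set ws" "dd u w \<le> D"
 shows "\<exists>ws'\<in>walks D v (n + 2). set ws' = insert w (set ws)"
proof -
 obtain p q where pq: "ws = p @ u # q" using assms(2) by (meson split_list)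
 have "p @ u # w # u # q \<in> walks D v (n + 2)"
  using assms(1,3) dd_sym[of w u] unfolding pq walks_def
  by (auto simp: successively_append_iff successively_Cons hd_append split: if_splits)
 then show ?thesis unfolding pq by (intro bexI) auto
qed

text \<open>As long as the visited set is not all of \<open>W\<close>, the cut condition supplies a
  new vertex, and each of the \<open>card W - 1\<close> additions costs two steps.\<close>

lemma conn_walk:
 assumes "conn D W" "v \<in> W"
 shows "\<exists>ws\<in>walks D v (2 * card W - 2). set ws = W"
proof -
 have "\<exists>B ws. B \<subseteq> W \<and> card B = Suc k \<and> ws \<in> walks D v (2 * k) \<and> set ws = B" if "Suc k \<le> card W" for k
  using that
 proof (induction k)
  case 0
  show ?case using assms(2) by (intro exI[of _ "{v}"] exI[of _ "[v]"]) (auto simp: walks_0)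
 next
  case (Suc k)
  then obtain B ws where B: "B \<subseteq> W" "card B = Suc k" "ws \<in> walks D v (2 * k)" "set ws = B" by auto
  have "B \<noteq> {}" "B \<noteq> W" using B Suc.prems by auto
  then obtain a b where ab: "a \<in> B" "b \<in> W - B" "dd a b \<le> D" using assms B(1) unfolding conn_def by metis
  obtain ws' where ws': "ws' \<in> walks D v (2 * k + 2)" "set ws' = insert b (set ws)"
   using walk_insert[OF B(3) _ ab(3)] ab B by auto
  have "finite B" using B(4) by auto
  then show ?case using ws' ab B by (intro exI[of _ "insert b B"] exI[of _ ws']) auto
 qed
 from this[of "card W - 1"] obtain B ws where
  B: "B \<subseteq> W" "card B = card W" "ws \<in> walks D v (2 * (card W - 1))" "set ws = B"
  using assms by (auto simp: conn_def card_gt_0_iff Suc_le_eq)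
 then have "B = W" using assms by (metis card_subset_eq conn_def)
 then show ?thesis using B by (auto simp: right_diff_distrib')
qed

text \<open>A connected set is the range of a walk from \<open>v\<close>, so such sets are no more
  numerous than walks; the exponent is rounded up from \<open>2 * n - 2\<close>.\<close>

lemma count_conn:
 "finite {W. conn D W \<and> v \<in> W \<and> card W = n}"
 "card {W. conn D W \<and> v \<in> W \<and> card W = n} \<le> bsize D ^ (2 * n)"
proof -
 let ?A = "{W. conn D W \<and> v \<in> W \<and> card W = n}"
 have sub: "?A \<subseteq> set ` walks D v (2 * n - 2)" using conn_walk by fast
 show "finite ?A" using sub card_walks by (meson finite_imageI finite_subset)
 have "card ?A \<le> card (walks D v (2 * n - 2))" using sub card_walks by (meson surj_card_le)
 also have "\<dots> \<le> bsize D ^ (2 * n - 2)" using card_walks by blast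
 also have "\<dots> \<le> bsize D ^ (2 * n)" using bsize_ge[of D] by (intro power_increasing) auto
 finally show "card ?A \<le> bsize D ^ (2 * n)" .
qed

lemma conn_aut:
 assumes "aut \<gamma>" "conn D W" shows "conn D (\<gamma> ` W)"
 unfolding conn_def
proof (intro conjI allI impI)
 show "finite (\<gamma> ` W)" "\<gamma> ` W \<noteq> {}" using assms by (auto simp: conn_def)
 fix A assume A: "A \<subseteq> \<gamma> ` W" "A \<noteq> {}" "A \<noteq> \<gamma> ` W"
 let ?B = "inv \<gamma> ` A"
 have AB: "A = \<gamma> ` ?B" using assms(1) by (auto simp: image_image)
 have "?B \<subseteq> W" "?B \<noteq> {}" "?B \<noteq> W" using A assms(1) AB by auto
 then obtain a b where "a \<in> ?B" "b \<in> W - ?B" "dd a b \<le> D" using assms(2) unfolding conn_def by meson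
 then have "\<gamma> a \<in> A" "\<gamma> b \<in> \<gamma> ` W - A" "dd (\<gamma> a) (\<gamma> b) \<le> D"
  using assms(1) AB by (auto simp: image_iff)
 then show "\<exists>a\<in>A. \<exists>b\<in>\<gamma> ` W - A. dd a b \<le> D" by blast
qed

text \<open>A cut either divides one of the two sets, or separates them exactly and is then crossed
  by the pair \<open>a\<close>, \<open>b\<close>.\<close>

lemma conn_Un:
 assumes "conn D A" "conn D B" "a \<in> A" "b \<in> B" "dd a b \<le> D"
 shows "conn D (A \<union> B)"
 unfolding conn_def
proof (intro conjI allI impI)
 show "finite (A \<union> B)" "A \<union> B \<noteq> {}" using assms by (auto simp: conn_def)
 fix C assume C: "C \<subseteq> A \<union> B" "C \<noteq> {}" "C \<noteq> A \<union> B"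
 show "\<exists>x\<in>C. \<exists>y\<in>A \<union> B - C. dd x y \<le> D"
 proof (cases "(C \<inter> A \<noteq> {} \<and> C \<inter> A \<noteq> A) \<or> (C \<inter> B \<noteq> {} \<and> C \<inter> B \<noteq> B)")
  case True
  then consider "C \<inter> A \<noteq> {}" "C \<inter> A \<noteq> A" | "C \<inter> B \<noteq> {}" "C \<inter> B \<noteq> B" by auto
  then show ?thesis
  proof cases
   case 1
   then obtain x y where "x \<in> C \<inter> A" "y \<in> A - C \<inter> A" "dd x y \<le> D"
    using assms(1) unfolding conn_def by (metis Int_lower2)
   then show ?thesis by blast
  next
   case 2
   then obtain x y where "x \<in> C \<inter> B" "y \<in> B - C \<inter> B" "dd x y \<le> D"
    using assms(2) unfolding conn_def by (metis Int_lower2)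
   then show ?thesis by blast
  qed
 next
  case False
  then have "(A \<subseteq> C \<and> C \<inter> B = {}) \<or> (B \<subseteq> C \<and> C \<inter> A = {})" using C by blast
  then show ?thesis
  proof
   assume "A \<subseteq> C \<and> C \<inter> B = {}"
   then show ?thesis using assms by blast
  next
   assume "B \<subseteq> C \<and> C \<inter> A = {}"
   then show ?thesis using assms dd_sym[of a b] by fastforce
  qed
 qed
qed

text \<open>On the side of the cut that misses the centre, a vertex closest to the centre has its
  predecessor on a geodesic on the other side. Writing the scale as \<open>Suc D\<close> makes it at
  least one.\<close>

lemma conn_gball: "conn (Suc D) (gball E v r)"
 unfolding conn_def
proof (intro conjI allI impI)
 show "finite (gball E v r)" "gball E v r \<noteq> {}" by (simp, metis mem_gball dd_refl le0 empty_iff)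
 fix A assume A: "A \<subseteq> gball E v r" "A \<noteq> {}" "A \<noteq> gball E v r"
 have step: "\<exists>z. dd v z < dd v x \<and> dd z x = 1 \<and> dd v z \<le> r" if "x \<in> gball E v r" "x \<noteq> v" for x
 proof -
  have "dd v x = (dd v x - 1) + 1" using that by (metis dd_0_iff Suc_eq_plus1 Suc_pred' gr0I)
  then obtain z where "dd v z = dd v x - 1" "dd z x = 1" using dd_split by metis
  then show ?thesis using that \<open>dd v x = (dd v x - 1) + 1\<close> by (intro exI[of _ z]) auto
 qed
 have vb: "v \<in> gball E v r" by simp
 show "\<exists>a\<in>A. \<exists>b\<in>gball E v r - A. dd a b \<le> Suc D"
 proof (cases "v \<in> A")
  case True
  obtain b where b: "b \<in> gball E v r - A" and mn: "\<And>y. y \<in> gball E v r - A \<Longrightarrow> dd v b \<le> dd v y"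
   using A ex_has_least_nat[of "\<lambda>b. b \<in> gball E v r - A" _ "dd v"] by blast
  then obtain z where "dd v z < dd v b" "dd z b = 1" "dd v z \<le> r" using step[of b] True by auto
  then have "z \<in> A" using mn[of z] by auto
  then show ?thesis using b \<open>dd z b = 1\<close> by (intro bexI[of _ z] bexI[of _ b]) auto
 next
  case False
  obtain b where b: "b \<in> A" and mn: "\<And>y. y \<in> A \<Longrightarrow> dd v b \<le> dd v y"
   using A ex_has_least_nat[of "\<lambda>b. b \<in> A" _ "dd v"] by blast
  then obtain z where "dd v z < dd v b" "dd z b = 1" "dd v z \<le> r"
   using step[of b] False A by (metis subsetD)
  then have "z \<in> gball E v r - A" using mn[of z] by auto
  then show ?thesis using b \<open>dd z b = 1\<close> dd_sym[of z b] by (intro bexI[of _ b] bexI[of _ z]) auto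
 qed
qed

section \<open>Cheeger's inequality for the lazy walk\<close>

lemma coarea:
 fixes g :: "'v \<Rightarrow> real"
 assumes "finite S" "\<And>x. g x \<ge> 0" "\<And>x. x \<notin> S \<Longrightarrow> g x = 0"
 shows "hh * (\<Sum>x\<in>S. g x) \<le> (\<Sum>x\<in>nbhd S 1. \<Sum>y\<in>{y. E x y}. max 0 (g y - g x))"
 using assms(2,3)
proof (induction "card {x. g x \<noteq> 0}" arbitrary: g rule: less_induct)
 case (less g)
 let ?A = "{x. g x \<noteq> 0}"
 have AS: "?A \<subseteq> S" using less.prems by auto
 then have fA: "finite ?A" using assms(1) finite_subset by blast
 show ?case
 proof (cases "?A = {}")
  case True
  then have "g x = 0" for x by auto
  then show ?thesis by simp
 next
  case False
  \<comment> \<open>The lowest positive value is peeled off the whole support: \<open>g\<close> is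
    \<open>m\<close> times an indicator plus a function with smaller support. The Cheeger bound
    handles the indicator, induction the rest.\<close>
  define m where "m = Min (g ` ?A)"
  have mle: "m \<le> g x" if "x \<in> ?A" for x using that fA by (simp add: m_def)
  have "m \<in> g ` ?A" unfolding m_def using fA False by (intro Min_in) auto
  then obtain x0 where x0: "x0 \<in> ?A" "g x0 = m" by auto
  have mpos: "m > 0" using x0 less.prems(1)[of x0] by auto
  define g' where "g' x = g x - m * indicator ?A x" for x
  have g'0: "g' x \<ge> 0" for x using mle[of x] less.prems(1)[of x] by (auto simp: g'_def indicator_def)
  have sub: "{x. g' x \<noteq> 0} \<subset> ?A" using x0 by (auto simp: g'_def indicator_def)
  have IH: "hh * (\<Sum>x\<in>S. g' x) \<le> (\<Sum>x\<in>nbhd S 1. \<Sum>y\<in>{y. E x y}. max 0 (g' y - g' x))"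
   using sub fA g'0 less.prems by (intro less.hyps psubset_card_mono) (auto simp: g'_def indicator_def)
  \<comment> \<open>Only increments from outside the support into it change when the layer is
    removed, and they lose exactly \<open>m\<close>.\<close>
  have tw: "max 0 (g y - g x) \<ge> max 0 (g' y - g' x) + m * indicator ?A y * indicator (- ?A) x" for x y
   using mpos g'0[of x] g'0[of y] less.prems(1)[of x] less.prems(1)[of y]
   by (auto simp: g'_def indicator_def max_def)
  have bd: "(\<Sum>y\<in>{y. E x y}. m * indicator ?A y * indicator (- ?A) x) \<ge> m * indicator (external_boundary E ?A) x" for x
  proof (cases "x \<in> external_boundary E ?A")
   case True
   then have x: "x \<in> nbhd ?A 1" "x \<notin> ?A" using external_boundary_eq[OF False] by auto
   then obtain a where a: "a \<in> ?A" "dd a x \<le> 1" by (auto simp: nbhd_def)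
   with x(2) have "dd x a = 1" using dd_sym[of x a] dd_0_iff[of a x] by (cases "dd a x") auto
   then have "a \<in> {y. E x y}" using dd_1_iff by simp
   then have "m * indicator ?A a * indicator (- ?A) x \<le> (\<Sum>y\<in>{y. E x y}. m * indicator ?A y * indicator (- ?A) x)"
    using mpos by (intro member_le_sum) auto
   then show ?thesis using a x True by (simp add: indicator_def)
  qed (use mpos in \<open>auto intro!: sum_nonneg\<close>)
  have fb: "finite (external_boundary E ?A)" "external_boundary E ?A \<subseteq> nbhd S 1"
   using external_boundary_eq[OF False] fA nbhd_mono[OF AS order_refl, of 1] by auto
  have cA: "(\<Sum>x\<in>S. m * indicator ?A x) = m * real (card ?A)"
   using AS assms(1) by (simp add: sum_distrib_left[symmetric] sum.inter_filter[symmetric] indicator_def Int_absorb1)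
  have "hh * (\<Sum>x\<in>S. g x) = hh * (\<Sum>x\<in>S. g' x) + hh * (m * card ?A)"
   unfolding cA[symmetric] by (simp add: g'_def sum_subtractf algebra_simps)
  also have "hh * (m * card ?A) \<le> m * card (external_boundary E ?A)"
   using card_boundary_ge[OF fA False] mpos by (simp add: mult.left_commute)
  also have "m * card (external_boundary E ?A) = (\<Sum>x\<in>nbhd S 1. m * indicator (external_boundary E ?A) x)"
   using fb assms(1) by (simp add: sum_distrib_left[symmetric] indicator_def sum.If_cases Int_absorb1)
  also have "\<dots> \<le> (\<Sum>x\<in>nbhd S 1. \<Sum>y\<in>{y. E x y}. m * indicator ?A y * indicator (- ?A) x)"
   by (intro sum_mono bd)
  also have "hh * (\<Sum>x\<in>S. g' x) \<le> (\<Sum>x\<in>nbhd S 1. \<Sum>y\<in>{y. E x y}. max 0 (g' y - g' x))" by (rule IH)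
  also have "(\<Sum>x\<in>nbhd S 1. \<Sum>y\<in>{y. E x y}. max 0 (g' y - g' x)) + (\<Sum>x\<in>nbhd S 1. \<Sum>y\<in>{y. E x y}. m * indicator ?A y * indicator (- ?A) x)
   \<le> (\<Sum>x\<in>nbhd S 1. \<Sum>y\<in>{y. E x y}. max 0 (g y - g x))"
   unfolding sum.distrib[symmetric] by (intro sum_mono tw)
  finally show ?thesis by simp
 qed
qed

text \<open>Transition operator of the walk that stays put with probability one half. Staying put
  keeps the spectrum non-negative, so that a one-sided bound on the correlation of neighbouring
  values yields a norm bound.\<close>

definition lazy :: "('v \<Rightarrow> real) \<Rightarrow> 'v \<Rightarrow> real" where
 "lazy f x = (f x + (\<Sum>y\<in>{y. E x y}. f y) / real deg) / 2"

text \<open>The deficit is what Cheeger's inequality yields for the squared norm; the lower bound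
  one half makes positivity immediate.\<close>

definition lam :: real where "lam = max (1/2) (1 - hh\<^sup>2 / (16 * (real deg)\<^sup>2))"

lemma lam_bounds: "0 < lam" "lam < 1"
 using hh_pos deg_pos by (auto simp: lam_def)

text \<open>Double counting of edges: a vertex of \<open>S\<close> has exactly \<open>deg\<close>
  neighbours, and all of them lie in \<open>nbhd S 1\<close>.\<close>

lemma sum_nbrs:
 fixes f :: "'v \<Rightarrow> real"
 assumes "finite S" "\<And>x. x \<notin> S \<Longrightarrow> f x = 0"
 shows "(\<Sum>x\<in>nbhd S 1. \<Sum>y\<in>{y. E x y}. f y) = real deg * (\<Sum>x\<in>S. f x)"
proof -
 let ?N = "nbhd S 1"
 have "(\<Sum>x\<in>?N. \<Sum>y\<in>{y. E x y}. f y) = (\<Sum>x\<in>?N. \<Sum>y\<in>S. if E x y then f y else 0)"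
 proof (rule sum.cong[OF refl])
  fix x
  have "(\<Sum>y\<in>S. if E x y then f y else 0) = (\<Sum>y\<in>{y\<in>S. E x y}. f y)"
   using assms(1) by (simp add: sum.inter_filter)
  also have "\<dots> = (\<Sum>y\<in>{y. E x y}. f y)"
   using assms by (intro sum.mono_neutral_left) auto
  finally show "(\<Sum>y\<in>{y. E x y}. f y) = (\<Sum>y\<in>S. if E x y then f y else 0)" by simp
 qed
 also have "\<dots> = (\<Sum>y\<in>S. \<Sum>x\<in>?N. if E x y then f y else 0)" by (rule sum.swap)
 also have "\<dots> = (\<Sum>y\<in>S. real deg * f y)"
 proof (intro sum.cong refl)
  fix y assume y: "y \<in> S"
  have "{x \<in> ?N. E x y} = {x. E y x}"
   using y E_sym dd_E[of y] unfolding nbhd_def by (auto intro!: bexI[of _ y])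
  then show "(\<Sum>x\<in>?N. if E x y then f y else 0) = real deg * f y"
   using assms(1) card_nbrs[of y] by (simp add: sum.inter_filter[symmetric])
 qed
 finally show ?thesis by (simp add: sum_distrib_left)
qed

text \<open>Cheeger's argument: \<open>coarea\<close> applied to the squares bounds their total
  increment from below, while a difference of squares is a difference times a sum. The resulting
  lower bound on the Dirichlet form says that neighbouring values correlate by less than the full
  norm, and this passes to the lazy average.\<close>

lemma lazy_l2_finite:
 fixes f :: "'v \<Rightarrow> real"
 assumes S: "finite S" and f0: "\<And>x. f x \<ge> 0" and fS: "\<And>x. x \<notin> S \<Longrightarrow> f x = 0"
 shows "(\<Sum>x\<in>nbhd S 1. (lazy f x)\<^sup>2) \<le> lam * (\<Sum>x\<in>S. (f x)\<^sup>2)"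
proof -
 let ?N = "nbhd S 1"
 let ?n = "\<lambda>x. {y. E x y}"
 define F where "F = (\<Sum>x\<in>S. (f x)\<^sup>2)"
 define C where "C = (\<Sum>x\<in>?N. \<Sum>y\<in>?n x. f x * f y)"
 \<comment> \<open>Weight in the arithmetic-geometric inequality for difference times sum; with this
   value the error term \<open>2 * (real deg * F) / t\<close> is exactly half of
   \<open>hh * F\<close>.\<close>
 define t where "t = 4 * real deg / hh"
 have t: "t > 0" using hh_pos deg_pos by (simp add: t_def)
 have F0: "F \<ge> 0" by (simp add: F_def sum_nonneg)
 have FN: "(\<Sum>x\<in>?N. (f x)\<^sup>2) = F" unfolding F_def
  using fS S subset_nbhd[of S 1] by (intro sum.mono_neutral_right) auto
 have F1: "(\<Sum>x\<in>?N. \<Sum>y\<in>?n x. (f y)\<^sup>2) = real deg * F" unfolding F_def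
  using fS S by (intro sum_nbrs) auto
 have F2: "(\<Sum>x\<in>?N. \<Sum>y\<in>?n x. (f x)\<^sup>2) = real deg * F"
  by (simp add: card_nbrs sum_distrib_left[symmetric] FN del: One_nat_def)
 have "hh * F \<le> (\<Sum>x\<in>?N. \<Sum>y\<in>?n x. max 0 ((f y)\<^sup>2 - (f x)\<^sup>2))"
  unfolding F_def using fS S by (intro coarea) auto
 also have "\<dots> \<le> (\<Sum>x\<in>?N. \<Sum>y\<in>?n x. t/2 * (f y)\<^sup>2 + t/2 * (f x)\<^sup>2 - t * (f x * f y) + (f x)\<^sup>2/t + (f y)\<^sup>2/t)"
 proof (intro sum_mono)
  fix x y
  have "0 \<le> (t * (f y - f x) - (f y + f x))\<^sup>2" by simp
  then have "2 * t * ((f y)\<^sup>2 - (f x)\<^sup>2) \<le> t\<^sup>2 * (f y - f x)\<^sup>2 + (f y + f x)\<^sup>2"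
   by (simp add: power2_eq_square algebra_simps)
  also have "(f y + f x)\<^sup>2 \<le> 2 * (f x)\<^sup>2 + 2 * (f y)\<^sup>2"
   using sum_squares_bound[of "f x" "f y"] by (simp add: power2_sum mult_ac)
  finally have "(f y)\<^sup>2 - (f x)\<^sup>2 \<le> (t\<^sup>2 * (f y - f x)\<^sup>2 + (2 * (f x)\<^sup>2 + 2 * (f y)\<^sup>2)) / (2 * t)"
   using t by (simp add: pos_le_divide_eq mult.commute)
  also have "\<dots> = t/2 * (f y)\<^sup>2 + t/2 * (f x)\<^sup>2 - t * (f x * f y) + (f x)\<^sup>2/t + (f y)\<^sup>2/t"
   using t by (simp add: field_simps power2_eq_square)
  finally have le: "(f y)\<^sup>2 - (f x)\<^sup>2 \<le> \<dots>" .
  have eq: "t/2 * (f y)\<^sup>2 + t/2 * (f x)\<^sup>2 - t * (f x * f y) = t/2 * (f y - f x)\<^sup>2"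
   by (simp add: power2_eq_square algebra_simps)
  have "0 \<le> t/2 * (f y)\<^sup>2 + t/2 * (f x)\<^sup>2 - t * (f x * f y)" unfolding eq using t by simp
  then have "0 \<le> t/2 * (f y)\<^sup>2 + t/2 * (f x)\<^sup>2 - t * (f x * f y) + (f x)\<^sup>2/t + (f y)\<^sup>2/t"
   using t by (intro add_nonneg_nonneg) auto
  with le show "max 0 ((f y)\<^sup>2 - (f x)\<^sup>2) \<le> t/2 * (f y)\<^sup>2 + t/2 * (f x)\<^sup>2 - t * (f x * f y) + (f x)\<^sup>2/t + (f y)\<^sup>2/t"
   by simp
 qed
 also have "\<dots> = t * (real deg * F) - t * C + 2 * (real deg * F) / t"
  unfolding sum.distrib sum_subtractf sum_distrib_left[symmetric] sum_divide_distrib[symmetric] F1 F2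
  using t by (simp add: field_simps) (simp add: C_def sum_distrib_left)
 also have "2 * (real deg * F) / t = hh / 2 * F" using deg_pos hh_pos by (simp add: t_def)
 finally have "hh / 2 * F \<le> t * (real deg * F - C)" by (simp add: algebra_simps)
 then have "hh / 2 * F * hh \<le> 4 * real deg * (real deg * F - C)"
  using hh_pos by (simp add: t_def field_simps)
 then have CF: "C / real deg \<le> (1 - hh\<^sup>2 / (8 * (real deg)\<^sup>2)) * F"
  using deg_pos by (simp add: field_simps power2_eq_square)
 \<comment> \<open>Only the square of the neighbour average is estimated, by Cauchy-Schwarz; the
   mixed term is kept because it carries the gain.\<close>
 have lz: "(lazy f x)\<^sup>2 \<le> ((f x)\<^sup>2 + 2 * (\<Sum>y\<in>?n x. f x * f y) / real deg + (\<Sum>y\<in>?n x. (f y)\<^sup>2) / real deg) / 4" for x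
 proof -
  have "(\<Sum>y\<in>?n x. f y)\<^sup>2 \<le> real (card (?n x)) * (\<Sum>y\<in>?n x. (f y)\<^sup>2)"
   using Cauchy_Schwarz_ineq_sum[of "\<lambda>_. 1" f "?n x"] by simp
  then have "((\<Sum>y\<in>?n x. f y) / real deg)\<^sup>2 \<le> (\<Sum>y\<in>?n x. (f y)\<^sup>2) / real deg"
   using deg_pos by (simp add: card_nbrs power2_eq_square divide_simps algebra_simps)
  moreover have "2 * (\<Sum>y\<in>?n x. f x * f y) / real deg = 2 * f x * ((\<Sum>y\<in>?n x. f y) / real deg)"
   by (simp add: sum_distrib_left[symmetric])
  moreover have "(lazy f x)\<^sup>2 = ((f x)\<^sup>2 + 2 * f x * ((\<Sum>y\<in>?n x. f y) / real deg) + ((\<Sum>y\<in>?n x. f y) / real deg)\<^sup>2) / 4"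
   unfolding lazy_def power_divide power2_sum by simp
  ultimately show ?thesis by argo
 qed
 have "(\<Sum>x\<in>?N. (lazy f x)\<^sup>2) \<le> (\<Sum>x\<in>?N. ((f x)\<^sup>2 + 2 * (\<Sum>y\<in>?n x. f x * f y) / real deg + (\<Sum>y\<in>?n x. (f y)\<^sup>2) / real deg) / 4)"
  by (intro sum_mono lz)
 also have "\<dots> = (F + 2 * C / real deg + (real deg * F) / real deg) / 4"
  unfolding sum_divide_distrib[symmetric] sum.distrib FN F1[symmetric] C_def
  by (simp add: sum_distrib_left[symmetric] sum_divide_distrib[symmetric])
 also have "\<dots> = (F + C / real deg) / 2" using deg_pos by (simp add: field_simps)
 also have "\<dots> \<le> (F + (1 - hh\<^sup>2 / (8 * (real deg)\<^sup>2)) * F) / 2" using CF by argo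
 also have "\<dots> = (1 - hh\<^sup>2 / (16 * (real deg)\<^sup>2)) * F" by (simp add: field_simps)
 also have "\<dots> \<le> lam * F" using F0 by (intro mult_right_mono) (auto simp: lam_def)
 finally show ?thesis by (simp add: F_def)
qed

text \<open>On a finite set the walk sees \<open>g\<close> only through its 1-neighbourhood, so
  truncation reduces to the finite case.\<close>

lemma lazy_l2:
 fixes g :: "'v \<Rightarrow> real"
 assumes "\<And>x. g x \<ge> 0"
 shows "(\<integral>\<^sup>+x. ennreal ((lazy g x)\<^sup>2) \<partial>count_space UNIV) \<le> ennreal lam * (\<integral>\<^sup>+x. ennreal ((g x)\<^sup>2) \<partial>count_space UNIV)"
proof -
 have "sum (\<lambda>x. ennreal ((lazy g x)\<^sup>2)) F \<le> ennreal lam * (\<integral>\<^sup>+x. ennreal ((g x)\<^sup>2) \<partial>count_space UNIV)" if F: "finite F" for F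
 proof -
  define S where "S = nbhd F 1"
  define f where "f x = (if x \<in> S then g x else 0)" for x
  have S: "finite S" using F by (simp add: S_def)
  have eq: "lazy g x = lazy f x" if "x \<in> F" for x
  proof -
   have "x \<in> S" "y \<in> S" if "E x y" for y using \<open>x \<in> F\<close> that dd_E[of x y] by (auto simp: S_def nbhd_def intro!: bexI[of _ x])
   moreover have "x \<in> S" using \<open>x \<in> F\<close> subset_nbhd by (auto simp: S_def)
   ultimately show ?thesis unfolding lazy_def f_def by auto
  qed
  have "(\<Sum>x\<in>F. (lazy g x)\<^sup>2) \<le> (\<Sum>x\<in>nbhd S 1. (lazy f x)\<^sup>2)"
   using F S eq subset_nbhd[of F 1] subset_nbhd[of S 1] by (subst sum.cong[OF refl, of F _ "\<lambda>x. (lazy f x)\<^sup>2"]) (auto intro!: sum_mono2 simp: S_def)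
  also have "\<dots> \<le> lam * (\<Sum>x\<in>S. (f x)\<^sup>2)" using S assms by (intro lazy_l2_finite) (auto simp: f_def)
  finally have "ennreal (\<Sum>x\<in>F. (lazy g x)\<^sup>2) \<le> ennreal (lam * (\<Sum>x\<in>S. (g x)\<^sup>2))"
   by (intro ennreal_leI) (simp add: f_def)
  also have "\<dots> = ennreal lam * (\<Sum>x\<in>S. ennreal ((g x)\<^sup>2))"
   using lam_bounds by (subst ennreal_mult) (auto intro!: sum_nonneg)
  also have "(\<Sum>x\<in>S. ennreal ((g x)\<^sup>2)) \<le> infsum (\<lambda>x. ennreal ((g x)\<^sup>2)) UNIV"
   by (subst nonneg_infsum_complete) (auto intro!: SUP_upper S)
  finally show ?thesis by (simp add: infsum_eq_nn_integral mult_left_mono)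
 qed
 then show ?thesis
  unfolding infsum_eq_nn_integral[symmetric] by (subst nonneg_infsum_complete) (auto intro!: SUP_least)
qed

end

section \<open>Efron--Stein decomposition of product spaces\<close>

text \<open>Moebius transform on the lattice of finite sets; applied to conditional expectations it
  isolates the part that depends on exactly the given coordinates.\<close>

definition mobius :: "('i set \<Rightarrow> 'a::comm_ring_1) \<Rightarrow> 'i set \<Rightarrow> 'a" where
 "mobius \<phi> J = (\<Sum>I\<in>Pow J. (-1) ^ card (J - I) * \<phi> I)"

lemma sum_Pow_insert:
 assumes "finite J" "i \<notin> J"
 shows "(\<Sum>I\<in>Pow (insert i J). f I) = (\<Sum>I\<in>Pow J. f I + (f (insert i I) :: 'a::comm_monoid_add))"
proof -
 have "inj_on (insert i) (Pow J)" using assms(2) by (auto simp: inj_on_def)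
 moreover have "Pow J \<inter> insert i ` Pow J = {}" using assms(2) by auto
 ultimately show ?thesis
  using assms(1) unfolding Pow_insert by (subst sum.union_disjoint) (auto simp: sum.reindex sum.distrib)
qed

text \<open>Subsets are paired according to whether they contain \<open>i\<close>; the sign flips
  within a pair and leaves a difference in direction \<open>i\<close>.\<close>

lemma mobius_insert:
 assumes "finite J" "i \<notin> J"
 shows "mobius \<phi> (insert i J) = mobius (\<lambda>I. \<phi> (insert i I) - \<phi> I) J"
proof -
 have 1: "card (insert i J - I) = Suc (card (J - I))" if "I \<subseteq> J" for I
  using that assms by (subst insert_Diff_if) (auto simp: card_insert_if)
 have 2: "insert i J - insert i I = J - I" "J - insert i I = J - I" if "I \<subseteq> J" for I
  using that assms by auto
 show ?thesis unfolding mobius_def sum_Pow_insert[OF assms]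
  by (intro sum.cong refl) (simp add: 1 2 algebra_simps del: Diff_insert)
qed

lemma mobius_inversion:
 assumes "finite K" shows "(\<Sum>J\<in>Pow K. mobius \<phi> J) = \<phi> K"
 using assms
proof (induction K arbitrary: \<phi> rule: finite_induct)
 case empty then show ?case by (simp add: mobius_def)
next
 case (insert i K)
 have "(\<Sum>J\<in>Pow K. mobius \<phi> (insert i J)) = (\<Sum>J\<in>Pow K. mobius (\<lambda>I. \<phi> (insert i I) - \<phi> I) J)"
  using insert.hyps by (intro sum.cong refl mobius_insert) (auto intro: finite_subset)
 then show ?case using insert by (simp add: sum_Pow_insert sum.distrib)
qed

text \<open>Coordinates outside \<open>I\<close> are resampled from \<open>y\<close>. Conditional
  expectation then becomes an integral over \<open>y\<close>, defined at every point and free of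
  null sets.\<close>

definition mrg :: "'i set \<Rightarrow> ('i \<Rightarrow> 's) \<Rightarrow> ('i \<Rightarrow> 's) \<Rightarrow> 'i \<Rightarrow> 's" where
 "mrg I x y = (\<lambda>i. if i \<in> I then x i else y i)"

locale pmf_product =
 fixes q :: "'i \<Rightarrow> 's pmf"
begin

definition mu :: "('i \<Rightarrow> 's) measure" where
 "mu = (\<Pi>\<^sub>M i\<in>UNIV. measure_pmf (q i))"

sublocale PP: product_prob_space "\<lambda>i. measure_pmf (q i)" UNIV ..

sublocale M: prob_space mu
 unfolding mu_def by (rule prob_space_PiM) (rule prob_space_measure_pmf)

sublocale MM: pair_prob_space mu mu ..

lemma space_mu [simp]: "space mu = UNIV"
 by (simp add: mu_def space_PiM)

lemma sets_mu: "sets mu = sets (\<Pi>\<^sub>M i\<in>UNIV. count_space UNIV)"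
 unfolding mu_def by (rule sets_PiM_cong) auto

lemma measurable_coord [measurable]: "(\<lambda>x. x i) \<in> mu \<rightarrow>\<^sub>M count_space UNIV"
proof -
 have "(\<lambda>x. x i) \<in> (\<Pi>\<^sub>M i\<in>UNIV. count_space UNIV) \<rightarrow>\<^sub>M count_space UNIV" by measurable
 then show ?thesis by (subst measurable_cong_sets[OF sets_mu refl])
qed

lemma measurable_into_mu:
 assumes "\<And>i. (\<lambda>x. f x i) \<in> N \<rightarrow>\<^sub>M count_space UNIV"
 shows "f \<in> N \<rightarrow>\<^sub>M mu"
 unfolding measurable_cong_sets[OF refl sets_mu]
 using assms by (intro measurable_PiM_single') auto

lemma measurable_mrg [measurable]: "(\<lambda>p. mrg I (fst p) (snd p)) \<in> mu \<Otimes>\<^sub>M mu \<rightarrow>\<^sub>M mu"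
 unfolding mrg_def by (intro measurable_into_mu) (case_tac "i \<in> I"; simp)

lemma measurable_mrg1 [measurable]: "mrg I x \<in> mu \<rightarrow>\<^sub>M mu"
 unfolding mrg_def by (intro measurable_into_mu) (case_tac "i \<in> I"; simp)

lemma emeasure_cylinder:
 assumes "finite J" shows "emeasure mu {x. \<forall>i\<in>J. x i \<in> A i} = (\<Prod>i\<in>J. emeasure (measure_pmf (q i)) (A i))"
 using PP.emeasure_PiM_Collect[of J A] assms by (simp add: mu_def[symmetric])

lemma cylinder_sets [measurable]:
 assumes "finite J" shows "{x. \<forall>i\<in>J. x i \<in> A i} \<in> sets mu"
proof -
 have "{x \<in> space mu. \<forall>i\<in>J. x i \<in> A i} \<in> sets mu"
 proof (intro sets.sets_Collect_finite_All assms)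
  fix i show "{x \<in> space mu. x i \<in> A i} \<in> sets mu"
   using measurable_sets[OF measurable_coord[of i], of "A i"] by (simp add: vimage_def)
 qed
 then show ?thesis by simp
qed

lemma mu_eqI:
 assumes "sets N = sets mu" "finite_measure N"
  and "\<And>J A. finite J \<Longrightarrow> emeasure N {x. \<forall>i\<in>J. x i \<in> A i} = (\<Prod>i\<in>J. emeasure (measure_pmf (q i)) (A i))"
 shows "N = mu"
proof (rule sym, rule measure_eqI_PiM_infinite[where I=UNIV and M="\<lambda>i. measure_pmf (q i)"])
 show "sets mu = sets (PiM UNIV (\<lambda>i. measure_pmf (q i)))" by (simp add: mu_def)
 then show "sets N = sets (PiM UNIV (\<lambda>i. measure_pmf (q i)))" using assms(1) by simp
 show "finite_measure mu" by unfold_locales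
 fix A :: "'i \<Rightarrow> 's set" and J :: "'i set"
 assume J: "finite J"
 have "prod_emb UNIV (\<lambda>i. measure_pmf (q i)) J (Pi\<^sub>E J A) = {x. \<forall>i\<in>J. x i \<in> A i}"
  by (auto simp: prod_emb_def PiE_iff)
 then show "emeasure mu (prod_emb UNIV (\<lambda>i. measure_pmf (q i)) J (Pi\<^sub>E J A)) =
  emeasure N (prod_emb UNIV (\<lambda>i. measure_pmf (q i)) J (Pi\<^sub>E J A))"
  using emeasure_cylinder[OF J] assms(3)[OF J] by simp
qed

text \<open>Partial resampling preserves the law: a cylinder factors into a condition on one copy
  for the coordinates in \<open>I\<close> and a condition on the independent copy for the
  others.\<close>

lemma distr_mrg: "distr (mu \<Otimes>\<^sub>M mu) mu (\<lambda>p. mrg I (fst p) (snd p)) = mu"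
proof (rule mu_eqI)
 interpret D: prob_space "distr (mu \<Otimes>\<^sub>M mu) mu (\<lambda>p. mrg I (fst p) (snd p))"
  by (rule MM.prob_space_distr) simp
 show "finite_measure (distr (mu \<Otimes>\<^sub>M mu) mu (\<lambda>p. mrg I (fst p) (snd p)))" by unfold_locales
 fix J :: "'i set" and A :: "'i \<Rightarrow> 's set" assume J: "finite J"
 let ?C = "\<lambda>J. {x. \<forall>i\<in>J. x i \<in> A i}"
 have "(\<lambda>p. mrg I (fst p) (snd p)) -` ?C J \<inter> space (mu \<Otimes>\<^sub>M mu) = ?C (J \<inter> I) \<times> ?C (J - I)"
  by (auto simp: mrg_def space_pair_measure split: if_splits)
 then have "emeasure (distr (mu \<Otimes>\<^sub>M mu) mu (\<lambda>p. mrg I (fst p) (snd p))) (?C J)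
  = emeasure (mu \<Otimes>\<^sub>M mu) (?C (J \<inter> I) \<times> ?C (J - I))"
  using J by (subst emeasure_distr) simp_all
 also have "\<dots> = emeasure mu (?C (J \<inter> I)) * emeasure mu (?C (J - I))"
  using J by (intro M.emeasure_pair_measure_Times) auto
 also have "\<dots> = (\<Prod>i\<in>(J \<inter> I) \<union> (J - I). emeasure (measure_pmf (q i)) (A i))"
  using J by (subst prod.union_disjoint) (auto simp: emeasure_cylinder)
 also have "(J \<inter> I) \<union> (J - I) = J" by auto
 finally show "emeasure (distr (mu \<Otimes>\<^sub>M mu) mu (\<lambda>p. mrg I (fst p) (snd p))) (?C J)
  = (\<Prod>i\<in>J. emeasure (measure_pmf (q i)) (A i))" .
qed simp

definition bm :: "(('i \<Rightarrow> 's) \<Rightarrow> real) \<Rightarrow> bool" where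
 "bm F \<longleftrightarrow> F \<in> borel_measurable mu \<and> (\<exists>c. \<forall>x. \<bar>F x\<bar> \<le> c)"

lemma bm_measurable [measurable_dest]: "bm F \<Longrightarrow> F \<in> borel_measurable mu"
 by (simp add: bm_def)

lemma bm_integrable: "bm F \<Longrightarrow> integrable mu F"
 unfolding bm_def by (metis (mono_tags, lifting) AE_I2 M.integrable_const_bound real_norm_def)

lemma bm_mult: "bm F \<Longrightarrow> bm G \<Longrightarrow> bm (\<lambda>x. F x * G x)"
 unfolding bm_def
proof (elim conjE exE, intro conjI)
 fix c d assume "\<forall>x. \<bar>F x\<bar> \<le> c" "\<forall>x. \<bar>G x\<bar> \<le> d"
 then have "\<bar>F x * G x\<bar> \<le> c * d" for x
  unfolding abs_mult by (intro mult_mono) (auto intro: order_trans[OF abs_ge_zero])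
 then show "\<exists>c. \<forall>x. \<bar>F x * G x\<bar> \<le> c" by blast
qed simp

lemma bm_add: "bm F \<Longrightarrow> bm G \<Longrightarrow> bm (\<lambda>x. F x + G x)"
 unfolding bm_def
proof (elim conjE exE, intro conjI)
 fix c d assume "\<forall>x. \<bar>F x\<bar> \<le> c" "\<forall>x. \<bar>G x\<bar> \<le> d"
 then have "\<bar>F x + G x\<bar> \<le> c + d" for x by (meson abs_triangle_ineq add_mono order_trans)
 then show "\<exists>c. \<forall>x. \<bar>F x + G x\<bar> \<le> c" by blast
qed simp

lemma bm_const: "bm (\<lambda>_. c)"
 by (auto simp: bm_def)

lemma bm_cmult: "bm F \<Longrightarrow> bm (\<lambda>x. c * F x)"
 by (rule bm_mult[OF bm_const])

lemma bm_sum: "(\<And>i. i \<in> S \<Longrightarrow> bm (F i)) \<Longrightarrow> bm (\<lambda>x. \<Sum>i\<in>S. F i x)"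
 by (induction S rule: infinite_finite_induct) (auto intro: bm_const bm_add)

lemma bm_indicator: "A \<in> sets mu \<Longrightarrow> bm (indicator A)"
 by (auto simp: bm_def indicator_def intro!: exI[of _ 1])

lemma bm_mrg: "bm F \<Longrightarrow> bm (\<lambda>y. F (mrg I x y))"
 by (auto simp: bm_def)

lemma integral_mrg: "bm F \<Longrightarrow> (\<integral>x. \<integral>y. F (mrg I x y) \<partial>mu \<partial>mu) = (\<integral>x. F x \<partial>mu)"
proof -
 assume F: "bm F"
 then obtain c where c: "\<And>x. \<bar>F x\<bar> \<le> c" by (auto simp: bm_def)
 note [measurable] = bm_measurable[OF F]
 have i: "integrable (mu \<Otimes>\<^sub>M mu) (\<lambda>p. F (mrg I (fst p) (snd p)))"
  using c by (intro MM.integrable_const_bound[of _ c]) auto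
 have "(\<integral>x. \<integral>y. F (mrg I x y) \<partial>mu \<partial>mu) = (\<integral>p. F (mrg I (fst p) (snd p)) \<partial>(mu \<Otimes>\<^sub>M mu))"
  using MM.integral_fst'[OF i] by simp
 also have "\<dots> = (\<integral>x. F x \<partial>distr (mu \<Otimes>\<^sub>M mu) mu (\<lambda>p. mrg I (fst p) (snd p)))"
  by (subst integral_distr) auto
 finally show ?thesis by (simp add: distr_mrg)
qed

definition EI :: "'i set \<Rightarrow> (('i \<Rightarrow> 's) \<Rightarrow> real) \<Rightarrow> ('i \<Rightarrow> 's) \<Rightarrow> real" where
 "EI I F x = (\<integral>y. F (mrg I x y) \<partial>mu)"

definition IP :: "(('i \<Rightarrow> 's) \<Rightarrow> real) \<Rightarrow> (('i \<Rightarrow> 's) \<Rightarrow> real) \<Rightarrow> real" where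
 "IP F G = (\<integral>x. F x * G x \<partial>mu)"

lemma bm_EI: "bm F \<Longrightarrow> bm (EI I F)"
proof -
 assume F: "bm F"
 then obtain c where c: "\<And>x. \<bar>F x\<bar> \<le> c" by (auto simp: bm_def)
 note [measurable] = bm_measurable[OF F]
 have "(\<lambda>p. F (mrg I (fst p) (snd p))) \<in> borel_measurable (mu \<Otimes>\<^sub>M mu)" by measurable
 then have "EI I F \<in> borel_measurable mu" unfolding EI_def[abs_def]
  by (intro M.borel_measurable_lebesgue_integral) (simp add: split_beta')
 moreover have "\<bar>EI I F x\<bar> \<le> c" for x
 proof -
  have "\<bar>EI I F x\<bar> \<le> (\<integral>y. \<bar>F (mrg I x y)\<bar> \<partial>mu)" unfolding EI_def by (rule integral_abs_bound)
  also have "\<dots> \<le> (\<integral>y. c \<partial>mu)"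
   using c bm_integrable[OF bm_mrg[OF F]] by (intro integral_mono) auto
  finally show ?thesis by (simp add: M.prob_space[simplified])
 qed
 ultimately show ?thesis by (auto simp: bm_def)
qed

lemma EI_mrg: "EI I F (mrg I x y) = EI I F x"
proof -
 have "mrg I (mrg I x y) z = mrg I x z" for z by (auto simp: mrg_def)
 then show ?thesis by (simp add: EI_def)
qed

text \<open>Merging twice is merging once along the intersection, with a resampled second argument
  whose law is again \<open>mu\<close>.\<close>

lemma EI_EI: assumes "bm F" shows "EI I (EI J F) x = EI (I \<inter> J) F x"
proof -
 have *: "mrg J (mrg I x y) z = mrg (I \<inter> J) x (mrg J y z)" for y z by (auto simp: mrg_def)
 show ?thesis unfolding EI_def * using integral_mrg[OF bm_mrg[OF assms, of "I \<inter> J" x]] by simp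
qed

text \<open>\<open>EI I F\<close> does not notice resampling outside \<open>I\<close>; averaging the
  product over such a resampling replaces \<open>G\<close> by its conditional expectation.\<close>

lemma IP_EI: assumes "bm F" "bm G" shows "IP (EI I F) G = IP (EI I F) (EI I G)"
proof -
 have "IP (EI I F) (EI I G) = (\<integral>x. \<integral>y. EI I F (mrg I x y) * G (mrg I x y) \<partial>mu \<partial>mu)"
  unfolding IP_def EI_mrg using bm_integrable[OF bm_mrg[OF assms(2)]] by (simp add: EI_def[of I G])
 also have "\<dots> = IP (EI I F) G"
  unfolding IP_def by (rule integral_mrg) (intro bm_mult bm_EI assms)
 finally show ?thesis by simp
qed

lemma IP_sym: "IP F G = IP G F"
 by (simp add: IP_def mult.commute)

lemma IP_EI_adj: "bm F \<Longrightarrow> bm G \<Longrightarrow> IP (EI I F) G = IP F (EI I G)"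
 using IP_EI IP_sym by metis

lemma EI_lin:
 assumes "\<And>i. i \<in> S \<Longrightarrow> bm (F i)"
 shows "EI I (\<lambda>x. \<Sum>i\<in>S. c i * F i x) x = (\<Sum>i\<in>S. c i * EI I (F i) x)"
 unfolding EI_def using assms by (subst Bochner_Integration.integral_sum) (auto intro!: bm_integrable bm_cmult bm_mrg)

lemma IP_lin:
 assumes "\<And>i. i \<in> S \<Longrightarrow> bm (F i)" "bm G"
 shows "IP (\<lambda>x. \<Sum>i\<in>S. c i * F i x) G = (\<Sum>i\<in>S. c i * IP (F i) G)"
proof -
 have "IP (\<lambda>x. \<Sum>i\<in>S. c i * F i x) G = (\<integral>x. (\<Sum>i\<in>S. c i * (F i x * G x)) \<partial>mu)"
  unfolding IP_def by (simp add: sum_distrib_right mult.assoc)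
 also have "\<dots> = (\<Sum>i\<in>S. c i * IP (F i) G)"
  unfolding IP_def using assms by (subst Bochner_Integration.integral_sum) (auto intro!: bm_integrable bm_cmult bm_mult)
 finally show ?thesis .
qed

lemma IP_nonneg: "IP F F \<ge> 0"
 by (simp add: IP_def)

text \<open>The integrated form of 2ab <= t a^2 + b^2 / t is optimised in \<open>t\<close>; when one
  of the norms vanishes, an extreme \<open>t\<close> rules out a positive inner product.\<close>

lemma IP_CS:
 assumes "bm F" "bm G" shows "IP F G \<le> sqrt (IP F F) * sqrt (IP G G)"
proof -
 have q: "2 * IP F G \<le> t * IP F F + IP G G / t" if "t > 0" for t
 proof -
  have "2 * IP F G = (\<integral>x. 2 * (F x * G x) \<partial>mu)" by (simp add: IP_def)
  also have "\<dots> \<le> (\<integral>x. t * (F x * F x) + (1/t) * (G x * G x) \<partial>mu)"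
  proof (intro integral_mono)
   fix x
   have "0 \<le> (t * F x - G x)\<^sup>2 / t" using that by simp
   also have "\<dots> = t * (F x * F x) + (1/t) * (G x * G x) - 2 * (F x * G x)"
    using that by (simp add: power2_eq_square field_simps)
   finally show "2 * (F x * G x) \<le> t * (F x * F x) + (1/t) * (G x * G x)" by simp
  qed (intro bm_integrable bm_add bm_cmult bm_mult assms)+
  also have "\<dots> = t * IP F F + IP G G / t"
   unfolding IP_def by (subst Bochner_Integration.integral_add) ((intro bm_integrable bm_cmult bm_mult assms)+, simp)
  finally show ?thesis .
 qed
 consider "IP F F = 0" | "IP G G = 0" | "IP F F > 0" "IP G G > 0" using IP_nonneg[of F] IP_nonneg[of G] by linarith
 then show ?thesis
 proof cases
  case 1
  have "IP F G \<le> 0"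
  proof (rule ccontr)
   assume n: "\<not> IP F G \<le> 0"
   have "2 * IP F G \<le> IP G G / ((IP G G + 1) / IP F G)"
    using q[of "(IP G G + 1) / IP F G"] 1 n IP_nonneg[of G] by auto
   also have "\<dots> \<le> IP F G" using n IP_nonneg[of G] by (simp add: field_simps)
   finally show False using n by simp
  qed
  then show ?thesis using 1 by simp
 next
  case 2
  have "IP F G \<le> 0"
  proof (rule ccontr)
   assume n: "\<not> IP F G \<le> 0"
   have "2 * IP F G \<le> IP F G / (IP F F + 1) * IP F F"
    using q[of "IP F G / (IP F F + 1)"] 2 n IP_nonneg[of F] by auto
   also have "\<dots> \<le> IP F G" using n IP_nonneg[of F] by (simp add: field_simps)
   finally show False using n by simp
  qed
  then show ?thesis using 2 by simp
 next
  case 3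
  have r: "sqrt (IP G G / IP F F) * IP F F = sqrt (IP F F) * sqrt (IP G G)"
   "IP G G / sqrt (IP G G / IP F F) = sqrt (IP F F) * sqrt (IP G G)"
   using 3 by (auto simp: real_sqrt_divide field_simps)
  show ?thesis using q[of "sqrt (IP G G / IP F F)"] 3 unfolding r by simp
 qed
qed

lemma IP_norm_sum:
 assumes "\<And>i. i \<in> S \<Longrightarrow> bm (F i)" "\<And>i. i \<in> S \<Longrightarrow> c i \<ge> 0"
 shows "IP (\<lambda>x. \<Sum>i\<in>S. c i * F i x) (\<lambda>x. \<Sum>i\<in>S. c i * F i x) \<le> (\<Sum>i\<in>S. c i * sqrt (IP (F i) (F i)))\<^sup>2"
proof -
 let ?G = "\<lambda>x. \<Sum>i\<in>S. c i * F i x"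
 have G: "bm ?G" using assms by (intro bm_sum bm_cmult)
 have "IP ?G ?G = (\<Sum>i\<in>S. c i * IP (F i) ?G)" using assms(1) G by (rule IP_lin)
 also have "\<dots> = (\<Sum>i\<in>S. c i * (\<Sum>j\<in>S. c j * IP (F j) (F i)))"
 proof (intro sum.cong refl arg_cong2[where f=times])
  fix i assume "i \<in> S"
  then show "IP (F i) ?G = (\<Sum>j\<in>S. c j * IP (F j) (F i))"
   using assms(1) by (subst IP_sym, intro IP_lin)
 qed
 also have "\<dots> \<le> (\<Sum>i\<in>S. c i * (\<Sum>j\<in>S. c j * (sqrt (IP (F j) (F j)) * sqrt (IP (F i) (F i)))))"
  using assms by (intro sum_mono mult_left_mono IP_CS) auto
 also have "\<dots> = (\<Sum>i\<in>S. c i * sqrt (IP (F i) (F i)))\<^sup>2"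
  by (simp add: power2_eq_square sum_product sum_distrib_left mult_ac)
 finally show ?thesis .
qed

text \<open>The Efron-Stein (or Hoeffding) component of \<open>F\<close> belonging to the coordinate
  set \<open>J\<close>.\<close>

definition HJ :: "'i set \<Rightarrow> (('i \<Rightarrow> 's) \<Rightarrow> real) \<Rightarrow> ('i \<Rightarrow> 's) \<Rightarrow> real" where
 "HJ J F x = mobius (\<lambda>I. EI I F x) J"

lemma bm_HJ: "bm F \<Longrightarrow> bm (HJ J F)"
 unfolding HJ_def[abs_def] mobius_def by (intro bm_sum bm_cmult bm_EI)

text \<open>Once coordinate \<open>i\<close> is averaged out, a set with \<open>i\<close> and the
  same set without \<open>i\<close> give equal conditional expectations, and the Moebius transform
  pairs them with opposite signs.\<close>

lemma EI_HJ_0: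
 assumes "bm F" "finite J" "i \<in> J" shows "EI (- {i}) (HJ J F) x = 0"
proof -
 define J0 where "J0 = J - {i}"
 have J: "J = insert i J0" "i \<notin> J0" "finite J0" using assms by (auto simp: J0_def)
 have "EI (- {i}) (HJ J F) x = mobius (\<lambda>I. EI (- {i} \<inter> I) F x) J"
  unfolding HJ_def[abs_def] mobius_def using assms(1) by (simp add: EI_lin bm_EI EI_EI)
 also have "\<dots> = mobius (\<lambda>I. EI (- {i} \<inter> insert i I) F x - EI (- {i} \<inter> I) F x) J0"
  unfolding J(1) using J by (intro mobius_insert)
 also have "(\<lambda>I. EI (- {i} \<inter> insert i I) F x - EI (- {i} \<inter> I) F x) = (\<lambda>_. 0)"
 proof
  fix I
  have "- {i} \<inter> insert i I = - {i} \<inter> I" by auto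
  then show "EI (- {i} \<inter> insert i I) F x - EI (- {i} \<inter> I) F x = 0" by simp
 qed
 finally show ?thesis by (simp add: mobius_def)
qed

lemma EI_HJ_id:
 assumes "bm F" "i \<notin> J" shows "EI (- {i}) (HJ J F) x = HJ J F x"
proof -
 have "- {i} \<inter> I = I" if "I \<subseteq> J" for I using that assms(2) by auto
 then show ?thesis
  unfolding HJ_def[abs_def] mobius_def using assms(1) by (simp add: EI_lin bm_EI EI_EI)
qed

text \<open>Averaging out \<open>i\<close> kills one component, fixes the other, and is
  self-adjoint.\<close>

lemma HJ_orth_aux:
 assumes "bm F" "finite J" "i \<in> J" "i \<notin> J'"
 shows "IP (HJ J F) (HJ J' F) = 0"
proof -
 have "EI (- {i}) (HJ J' F) = HJ J' F" using EI_HJ_id[OF assms(1,4)] by (simp add: fun_eq_iff)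
 then have "IP (HJ J F) (HJ J' F) = IP (HJ J F) (EI (- {i}) (HJ J' F))" by simp
 also have "\<dots> = IP (EI (- {i}) (HJ J F)) (HJ J' F)" using assms(1) by (simp add: IP_EI_adj bm_HJ)
 also have "\<dots> = 0" using EI_HJ_0[OF assms(1-3)] by (simp add: IP_def)
 finally show ?thesis .
qed

lemma HJ_orth:
 assumes "bm F" "finite J" "finite J'" "J \<noteq> J'"
 shows "IP (HJ J F) (HJ J' F) = 0"
 using assms HJ_orth_aux[of F J _ J'] HJ_orth_aux[of F J' _ J] IP_sym[of "HJ J F" "HJ J' F"] by (metis subsetI subset_antisym)

lemma HJ_parseval_finite:
 assumes "bm F" "finite K"
 shows "IP F (EI K F) = (\<Sum>J\<in>Pow K. IP (HJ J F) (HJ J F))"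
proof -
 have K: "EI K F x = (\<Sum>J\<in>Pow K. 1 * HJ J F x)" for x
  unfolding HJ_def using mobius_inversion[OF assms(2), of "\<lambda>I. EI I F x"] by simp
 have "IP F (EI K F) = IP (EI K F) (EI K F)" using assms IP_EI[of F F K] IP_sym by metis
 also have "\<dots> = (\<Sum>J\<in>Pow K. 1 * IP (HJ J F) (EI K F))"
  unfolding K[abs_def] using assms by (intro IP_lin bm_sum bm_cmult bm_HJ)
 also have "\<dots> = (\<Sum>J\<in>Pow K. IP (HJ J F) (HJ J F))"
 proof (intro sum.cong refl)
  fix J assume J: "J \<in> Pow K"
  have "IP (HJ J F) (EI K F) = (\<Sum>J'\<in>Pow K. 1 * IP (HJ J' F) (HJ J F))"
   unfolding K[abs_def] using assms by (subst IP_sym, intro IP_lin bm_HJ)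
  also have "\<dots> = (\<Sum>J'\<in>Pow K. if J' = J then IP (HJ J F) (HJ J F) else 0)"
  proof (intro sum.cong refl)
   fix J' assume "J' \<in> Pow K"
   then show "1 * IP (HJ J' F) (HJ J F) = (if J' = J then IP (HJ J F) (HJ J F) else 0)"
    using J assms HJ_orth[OF assms(1), of J' J] by (auto intro: finite_subset)
  qed
  finally show "1 * IP (HJ J F) (EI K F) = IP (HJ J F) (HJ J F)" using J assms by simp
 qed
 finally show ?thesis .
qed

section \<open>Approximation by functions of finitely many coordinates\<close>

definition appr :: "(nat \<Rightarrow> 'i set) \<Rightarrow> (('i \<Rightarrow> 's) \<Rightarrow> real) \<Rightarrow> bool" where
 "appr K F \<longleftrightarrow> (\<lambda>n. \<integral>p. \<bar>F (fst p) - F (mrg (K n) (fst p) (snd p))\<bar> \<partial>(mu \<Otimes>\<^sub>M mu)) \<longlonglongrightarrow> 0"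

lemma appr_integrable:
 "bm F \<Longrightarrow> integrable (mu \<Otimes>\<^sub>M mu) (\<lambda>p. \<bar>F (fst p) - F (mrg I (fst p) (snd p))\<bar>)"
proof -
 assume F: "bm F"
 then obtain c where c: "\<And>x. \<bar>F x\<bar> \<le> c" by (auto simp: bm_def)
 note [measurable] = bm_measurable[OF F]
 have "\<bar>F x - F y\<bar> \<le> 2 * c" for x y using c[of x] c[of y] by linarith
 then show ?thesis by (intro MM.integrable_const_bound[of _ "2 * c"]) auto
qed

lemma appr_add:
 assumes "bm F" "bm G" "appr K F" "appr K G" shows "appr K (\<lambda>x. F x + G x)"
proof -
 let ?i = "\<lambda>F n. \<integral>p. \<bar>F (fst p) - F (mrg (K n) (fst p) (snd p))\<bar> \<partial>(mu \<Otimes>\<^sub>M mu)"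
 define d where "d F n p = \<bar>F (fst p) - F (mrg (K n) (fst p) (snd p))\<bar>" for F :: "('i \<Rightarrow> 's) \<Rightarrow> real" and n p
 have i: "integrable (mu \<Otimes>\<^sub>M mu) (d F n)" if "bm F" for F n
  unfolding d_def by (rule appr_integrable[OF that])
 have pt: "d (\<lambda>x. F x + G x) n p \<le> d F n p + d G n p" for n p
  unfolding d_def
  using abs_triangle_ineq[of "F (fst p) - F (mrg (K n) (fst p) (snd p))" "G (fst p) - G (mrg (K n) (fst p) (snd p))"]
  by (simp add: algebra_simps)
 have "(\<integral>p. d (\<lambda>x. F x + G x) n p \<partial>(mu \<Otimes>\<^sub>M mu)) \<le> (\<integral>p. d F n p + d G n p \<partial>(mu \<Otimes>\<^sub>M mu))" for n
  by (rule integral_mono[OF i[OF bm_add[OF assms(1,2)]] Bochner_Integration.integrable_add[OF i[OF assms(1)] i[OF assms(2)]] pt])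
 then have le: "(\<integral>p. d (\<lambda>x. F x + G x) n p \<partial>(mu \<Otimes>\<^sub>M mu)) \<le> (\<integral>p. d F n p \<partial>(mu \<Otimes>\<^sub>M mu)) + (\<integral>p. d G n p \<partial>(mu \<Otimes>\<^sub>M mu))" for n
  using Bochner_Integration.integral_add[OF i[OF assms(1)] i[OF assms(2)]] by metis
 have lim: "(\<lambda>n. (\<integral>p. d F n p \<partial>(mu \<Otimes>\<^sub>M mu)) + (\<integral>p. d G n p \<partial>(mu \<Otimes>\<^sub>M mu))) \<longlonglongrightarrow> 0"
  using tendsto_add[OF assms(3)[unfolded appr_def d_def[symmetric]] assms(4)[unfolded appr_def d_def[symmetric]]] by simp
 have nn: "0 \<le> (\<integral>p. d (\<lambda>x. F x + G x) n p \<partial>(mu \<Otimes>\<^sub>M mu))" for n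
  unfolding d_def by simp
 have "(\<lambda>n. \<integral>p. d (\<lambda>x. F x + G x) n p \<partial>(mu \<Otimes>\<^sub>M mu)) \<longlonglongrightarrow> 0"
  by (rule tendsto_sandwich[OF _ _ tendsto_const lim]) (use le nn in \<open>auto intro!: always_eventually\<close>)
 then show ?thesis unfolding appr_def d_def .
qed

lemma appr_cmult: assumes "appr K F" shows "appr K (\<lambda>x. c * F x)"
 using tendsto_mult_right_zero[OF assms[unfolded appr_def], of "\<bar>c\<bar>"]
 unfolding appr_def right_diff_distrib[symmetric] abs_mult by simp

lemma appr_const: "appr K (\<lambda>_. c)"
 by (simp add: appr_def)

lemma appr_sum:
 "(\<And>i. i \<in> S \<Longrightarrow> bm (F i)) \<Longrightarrow> (\<And>i. i \<in> S \<Longrightarrow> appr K (F i)) \<Longrightarrow> appr K (\<lambda>x. \<Sum>i\<in>S. F i x)"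
proof (induction S rule: infinite_finite_induct)
 case (insert i S)
 then have "appr K (\<lambda>x. F i x + (\<Sum>i\<in>S. F i x))" by (intro appr_add bm_sum) auto
 then show ?case using insert by simp
qed (simp_all add: appr_const)

text \<open>\<open>EI (K n) F\<close> averages \<open>F\<close> over the resampling, so the
  resampling error in L1 times a bound on \<open>F\<close> controls the difference of inner
  products. This takes the place of martingale convergence.\<close>

lemma appr_IP:
 assumes "bm F" "appr K F" shows "(\<lambda>n. IP F (EI (K n) F)) \<longlonglongrightarrow> IP F F"
proof -
 obtain c where c: "\<And>x. \<bar>F x\<bar> \<le> c" using assms(1) by (auto simp: bm_def)
 note [measurable] = bm_measurable[OF assms(1)]
 let ?i = "\<lambda>n. \<integral>p. \<bar>F (fst p) - F (mrg (K n) (fst p) (snd p))\<bar> \<partial>(mu \<Otimes>\<^sub>M mu)"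
 have cb: "\<bar>F x * F y\<bar> \<le> c * c" for x y
  unfolding abs_mult using c by (intro mult_mono) (auto intro: order_trans[OF abs_ge_zero])
 have int1: "integrable (mu \<Otimes>\<^sub>M mu) (\<lambda>p. F (fst p) * F (mrg I (fst p) (snd p)))" for I
  by (intro MM.integrable_const_bound[of _ "c * c"] AE_I2) (simp_all only: real_norm_def cb, simp)
 have int2: "integrable (mu \<Otimes>\<^sub>M mu) (\<lambda>p. F (fst p) * F (fst p))"
  by (intro MM.integrable_const_bound[of _ "c * c"] AE_I2) (simp_all only: real_norm_def cb, simp)
 have le: "\<bar>IP F (EI (K n) F) - IP F F\<bar> \<le> c * ?i n" for n
 proof -
  have 1: "IP F (EI (K n) F) = (\<integral>p. F (fst p) * F (mrg (K n) (fst p) (snd p)) \<partial>(mu \<Otimes>\<^sub>M mu))"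
   using MM.integral_fst'[OF int1[of "K n"]] by (simp add: IP_def EI_def)
  have 2: "IP F F = (\<integral>p. F (fst p) * F (fst p) \<partial>(mu \<Otimes>\<^sub>M mu))"
   using MM.integral_fst'[OF int2] by (simp add: IP_def M.prob_space[simplified])
  have "IP F F - IP F (EI (K n) F) = (\<integral>p. F (fst p) * (F (fst p) - F (mrg (K n) (fst p) (snd p))) \<partial>(mu \<Otimes>\<^sub>M mu))"
   unfolding 1 2 using int1[of "K n"] int2 by (subst Bochner_Integration.integral_diff[symmetric]) (auto simp: right_diff_distrib)
  also have "\<bar>\<dots>\<bar> \<le> (\<integral>p. \<bar>F (fst p) * (F (fst p) - F (mrg (K n) (fst p) (snd p)))\<bar> \<partial>(mu \<Otimes>\<^sub>M mu))"
   by (rule integral_abs_bound)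
  also have "\<dots> \<le> (\<integral>p. c * \<bar>F (fst p) - F (mrg (K n) (fst p) (snd p))\<bar> \<partial>(mu \<Otimes>\<^sub>M mu))"
  proof (intro integral_mono)
   show "integrable (mu \<Otimes>\<^sub>M mu) (\<lambda>p. \<bar>F (fst p) * (F (fst p) - F (mrg (K n) (fst p) (snd p)))\<bar>)"
    using int1[of "K n"] int2 unfolding right_diff_distrib by auto
  qed (auto intro!: appr_integrable assms mult_right_mono c simp: abs_mult)
  finally show ?thesis by (simp add: abs_minus_commute)
 qed
 have lim: "(\<lambda>n. c * ?i n) \<longlonglongrightarrow> 0"
  using assms(2) unfolding appr_def by (rule tendsto_mult_right_zero)
 have "(\<lambda>n. IP F (EI (K n) F) - IP F F) \<longlonglongrightarrow> 0"
  by (rule Lim_null_comparison[OF always_eventually lim]) (simp only: real_norm_def le simp_thms)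
 then show ?thesis using LIM_zero_iff by blast
qed

end

context pmf_product begin

text \<open>A point and its resampled version both have law \<open>mu\<close>, so each contributes
  the L1 norm once.\<close>

lemma appr_D_le:
 assumes "bm H"
 shows "(\<integral>p. \<bar>H (fst p) - H (mrg I (fst p) (snd p))\<bar> \<partial>(mu \<Otimes>\<^sub>M mu)) \<le> 2 * (\<integral>x. \<bar>H x\<bar> \<partial>mu)"
proof -
 obtain c where c: "\<And>x. \<bar>H x\<bar> \<le> c" using assms by (auto simp: bm_def)
 note [measurable] = bm_measurable[OF assms]
 have i1: "integrable (mu \<Otimes>\<^sub>M mu) (\<lambda>p. \<bar>H (fst p)\<bar>)"
  using c by (intro MM.integrable_const_bound[of _ c]) auto
 have i2: "integrable (mu \<Otimes>\<^sub>M mu) (\<lambda>p. \<bar>H (mrg I (fst p) (snd p))\<bar>)"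
  using c by (intro MM.integrable_const_bound[of _ c]) auto
 have bmH: "bm (\<lambda>x. \<bar>H x\<bar>)" using c by (auto simp: bm_def)
 have "(\<integral>p. \<bar>H (fst p) - H (mrg I (fst p) (snd p))\<bar> \<partial>(mu \<Otimes>\<^sub>M mu))
  \<le> (\<integral>p. \<bar>H (fst p)\<bar> + \<bar>H (mrg I (fst p) (snd p))\<bar> \<partial>(mu \<Otimes>\<^sub>M mu))"
  by (rule integral_mono[OF appr_integrable[OF assms] Bochner_Integration.integrable_add[OF i1 i2]]) (rule abs_triangle_ineq4)
 also have "\<dots> = (\<integral>p. \<bar>H (fst p)\<bar> \<partial>(mu \<Otimes>\<^sub>M mu)) + (\<integral>p. \<bar>H (mrg I (fst p) (snd p))\<bar> \<partial>(mu \<Otimes>\<^sub>M mu))"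
  by (rule Bochner_Integration.integral_add[OF i1 i2])
 also have "(\<integral>p. \<bar>H (fst p)\<bar> \<partial>(mu \<Otimes>\<^sub>M mu)) = (\<integral>x. \<bar>H x\<bar> \<partial>mu)"
  using MM.integral_fst'[OF i1] by (simp add: M.prob_space[simplified])
 also have "(\<integral>p. \<bar>H (mrg I (fst p) (snd p))\<bar> \<partial>(mu \<Otimes>\<^sub>M mu)) = (\<integral>x. \<bar>H x\<bar> \<partial>mu)"
  using MM.integral_fst'[OF i2] integral_mrg[OF bmH, of I] by simp
 finally show ?thesis by simp
qed

lemma appr_closed:
 assumes "bm F" and cl: "\<And>e. e > 0 \<Longrightarrow> \<exists>G. bm G \<and> appr K G \<and> (\<integral>x. \<bar>F x - G x\<bar> \<partial>mu) \<le> e"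
 shows "appr K F"
 unfolding appr_def
proof (rule LIMSEQ_I)
 fix r :: real assume r: "r > 0"
 obtain G where G: "bm G" "appr K G" "(\<integral>x. \<bar>F x - G x\<bar> \<partial>mu) \<le> r / 4" using cl[of "r/4"] r by auto
 define d where "d F n p = \<bar>F (fst p) - F (mrg (K n) (fst p) (snd p))\<bar>" for F :: "('i \<Rightarrow> 's) \<Rightarrow> real" and n p
 have i: "integrable (mu \<Otimes>\<^sub>M mu) (d F n)" if "bm F" for F n
  unfolding d_def by (rule appr_integrable[OF that])
 let ?H = "\<lambda>x. F x + (-1) * G x"
 have H: "bm ?H" by (intro bm_add bm_cmult assms G)
 obtain N where N: "\<And>n. n \<ge> N \<Longrightarrow> norm ((\<integral>p. d G n p \<partial>(mu \<Otimes>\<^sub>M mu)) - 0) < r / 2"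
  using LIMSEQ_D[OF G(2)[unfolded appr_def d_def[symmetric]], of "r/2"] r by auto
 have "norm ((\<integral>p. d F n p \<partial>(mu \<Otimes>\<^sub>M mu)) - 0) < r" if "n \<ge> N" for n
 proof -
  have pt: "d F n p \<le> d G n p + d ?H n p" for p
   unfolding d_def
   using abs_triangle_ineq[of "G (fst p) - G (mrg (K n) (fst p) (snd p))" "?H (fst p) - ?H (mrg (K n) (fst p) (snd p))"]
   by (simp add: algebra_simps)
  have "(\<integral>p. d F n p \<partial>(mu \<Otimes>\<^sub>M mu)) \<le> (\<integral>p. d G n p + d ?H n p \<partial>(mu \<Otimes>\<^sub>M mu))"
   by (rule integral_mono[OF i[OF assms(1)] Bochner_Integration.integrable_add[OF i[OF G(1)] i[OF H]] pt])
  also have "\<dots> = (\<integral>p. d G n p \<partial>(mu \<Otimes>\<^sub>M mu)) + (\<integral>p. d ?H n p \<partial>(mu \<Otimes>\<^sub>M mu))"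
   by (rule Bochner_Integration.integral_add[OF i[OF G(1)] i[OF H]])
  also have "(\<integral>p. d ?H n p \<partial>(mu \<Otimes>\<^sub>M mu)) \<le> r / 2"
   using appr_D_le[OF H, of "K n"] G(3) unfolding d_def by simp
  also have "(\<integral>p. d G n p \<partial>(mu \<Otimes>\<^sub>M mu)) < r / 2" using N[OF that] by simp
  finally have "(\<integral>p. d F n p \<partial>(mu \<Otimes>\<^sub>M mu)) < r" by simp
  moreover have "0 \<le> (\<integral>p. d F n p \<partial>(mu \<Otimes>\<^sub>M mu))" unfolding d_def by simp
  ultimately show ?thesis by simp
 qed
 then show "\<exists>N. \<forall>n\<ge>N. norm ((\<integral>p. \<bar>F (fst p) - F (mrg (K n) (fst p) (snd p))\<bar> \<partial>(mu \<Otimes>\<^sub>M mu)) - 0) < r"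
  unfolding d_def by blast
qed

text \<open>Induction over the generating cylinders: a cylinder is eventually determined by
  \<open>K n\<close>, a complement has the same error, and a disjoint union is an L1 limit of finite
  unions, to which \<open>appr_closed\<close> applies.\<close>

lemma appr_indicator:
 assumes K: "\<And>i. eventually (\<lambda>n. i \<in> K n) sequentially" and A: "A \<in> sets mu"
 shows "appr K (indicator A)"
proof -
 let ?G = "prod_algebra UNIV (\<lambda>i. measure_pmf (q i))"
 have sp: "(\<Pi>\<^sub>E i\<in>UNIV. space (measure_pmf (q i))) = UNIV" by auto
 have sm: "sets mu = sigma_sets UNIV ?G" unfolding mu_def sets_PiM sp ..
 have As: "A \<in> sigma_sets UNIV ?G" using A sm by simp
 have "?G \<subseteq> Pow UNIV" by simp
 from Int_stable_prod_algebra this As show ?thesis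
 proof (induction rule: sigma_sets_induct_disjoint)
  case (basic A)
  then obtain J B where J: "finite J" "A = prod_emb UNIV (\<lambda>i. measure_pmf (q i)) J (Pi\<^sub>E J B)"
   by (auto elim!: prod_algebraE)
  then have A: "x \<in> A \<longleftrightarrow> (\<forall>i\<in>J. x i \<in> B i)" for x by (auto simp: prod_emb_def PiE_iff)
  have "eventually (\<lambda>n. \<forall>i\<in>J. i \<in> K n) sequentially" using J(1) K by (simp add: eventually_ball_finite)
  then have "eventually (\<lambda>n. (\<integral>p. \<bar>indicator A (fst p) - indicator A (mrg (K n) (fst p) (snd p)) :: real\<bar> \<partial>(mu \<Otimes>\<^sub>M mu)) = 0) sequentially"
  proof eventually_elim
   case (elim n)
   then have "indicator A (mrg (K n) x y) = (indicator A x :: real)" for x y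
    by (auto simp: indicator_def A mrg_def)
   then show ?case by simp
  qed
  then show ?case unfolding appr_def by (simp add: tendsto_eventually)
 next
  case empty show ?case using appr_const[of K 0] by (simp add: appr_def)
 next
  case (compl A)
  have "indicator (UNIV - A) x = (1 - indicator A x :: real)" for x by (auto simp: indicator_def)
  then show ?case using compl(2) unfolding appr_def by (simp add: abs_minus_commute)
 next
  case (union A)
  then have Am: "A i \<in> sets mu" for i using sm by auto
  show ?case
  proof (rule appr_closed)
   show "bm (indicator (\<Union> (range A)))" using Am by (intro bm_indicator) auto
   fix e :: real assume e: "e > 0"
   have "(\<lambda>n. measure mu (A n)) sums measure mu (\<Union>n. A n)"
    using union(1) Am by (intro M.finite_measure_UNION) auto
   then obtain N where N: "\<bar>measure mu (\<Union>n. A n) - (\<Sum>i<N. measure mu (A i))\<bar> < e"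
    using e unfolding sums_def LIMSEQ_iff by (metis abs_minus_commute order_refl real_norm_def)
   let ?G = "\<lambda>x. \<Sum>i<N. indicator (A i) x :: real"
   have GU: "?G x = indicator (\<Union>i<N. A i) x" for x
    using union(1) by (subst indicator_UN_disjoint) (auto simp: disjoint_family_on_def)
   have Gle: "?G x \<le> indicator (\<Union>(range A)) x" for x unfolding GU by (auto simp: indicator_def)
   have "(\<integral>x. \<bar>indicator (\<Union>(range A)) x - ?G x\<bar> \<partial>mu) = (\<integral>x. indicator (\<Union>(range A)) x - ?G x \<partial>mu)"
    using Gle by (intro Bochner_Integration.integral_cong) auto
   also have "\<dots> = measure mu (\<Union>(range A)) - (\<integral>x. ?G x \<partial>mu)"
    using Am by (subst Bochner_Integration.integral_diff)
     (auto intro!: bm_integrable bm_indicator bm_sum)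
   also have "(\<integral>x. ?G x \<partial>mu) = (\<Sum>i<N. measure mu (A i))"
    using Am by (subst Bochner_Integration.integral_sum) (auto intro!: bm_integrable bm_indicator)
   finally have "(\<integral>x. \<bar>indicator (\<Union>(range A)) x - ?G x\<bar> \<partial>mu) \<le> e" using N by simp
   then show "\<exists>G. bm G \<and> appr K G \<and> (\<integral>x. \<bar>indicator (\<Union>(range A)) x - G x\<bar> \<partial>mu) \<le> e"
    using union Am by (intro exI[of _ ?G] conjI bm_sum appr_sum bm_indicator)
  qed
 qed
qed

text \<open>The finite Parseval identities for \<open>K n\<close> increase to the sum over all
  finite sets, and their left sides converge by \<open>appr_IP\<close>.\<close>

lemma HJ_parseval:
 assumes "bm F" "appr K F" "incseq K" "\<And>n. finite (K n)" "(\<Union>n. K n) = UNIV"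
 shows "(\<integral>\<^sup>+J. ennreal (IP (HJ J F) (HJ J F)) \<partial>count_space {J. finite J}) = ennreal (IP F F)"
proof -
 let ?f = "\<lambda>J. ennreal (IP (HJ J F) (HJ J F))"
 let ?g = "\<lambda>n J. ?f J * indicator (Pow (K n)) J"
 have cov: "\<exists>n. J \<subseteq> K n" if "finite J" for J
 proof -
  have "eventually (\<lambda>n. i \<in> K n) sequentially" for i
  proof -
   obtain n where "i \<in> K n" using assms(5) by blast
   then show ?thesis using assms(3) unfolding eventually_sequentially incseq_def by blast
  qed
  then have "eventually (\<lambda>n. \<forall>i\<in>J. i \<in> K n) sequentially" using that by (simp add: eventually_ball_finite)
  then show ?thesis unfolding eventually_sequentially by blast
 qed
 have inc: "incseq ?g"
  using assms(3) by (auto simp: incseq_def le_fun_def indicator_def)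
 have sup: "(SUP n. ?g n J) = ?f J" if fJ: "finite J" for J
 proof (rule antisym)
  show "(SUP n. ?g n J) \<le> ?f J" by (auto intro!: SUP_least simp: indicator_def)
  obtain n where "J \<subseteq> K n" using cov[OF fJ] by auto
  then show "?f J \<le> (SUP n. ?g n J)" using SUP_upper[of n UNIV "\<lambda>n. ?g n J"] by simp
 qed
 have "(\<integral>\<^sup>+J. ?f J \<partial>count_space {J. finite J}) = (\<integral>\<^sup>+J. (SUP n. ?g n J) \<partial>count_space {J. finite J})"
  by (intro nn_integral_cong) (simp add: sup)
 also have "\<dots> = (SUP n. \<integral>\<^sup>+J. ?g n J \<partial>count_space {J. finite J})"
  using inc by (intro nn_integral_monotone_convergence_SUP) auto
 also have "\<dots> = (SUP n. ennreal (IP F (EI (K n) F)))"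
 proof (intro SUP_cong refl)
  fix n
  have "(\<integral>\<^sup>+J. ?g n J \<partial>count_space {J. finite J}) = (\<integral>\<^sup>+J. ?f J \<partial>count_space (Pow (K n)))"
   using assms(4)[of n] by (subst nn_integral_count_space_indicator, simp, subst nn_integral_count_space_indicator, simp)
    (auto intro!: nn_integral_cong simp: indicator_def finite_subset)
  also have "\<dots> = (\<Sum>J\<in>Pow (K n). ?f J)" using assms(4) by (simp add: nn_integral_count_space_finite)
  also have "\<dots> = ennreal (IP F (EI (K n) F))"
   using assms by (subst HJ_parseval_finite) (auto simp: IP_nonneg)
  finally show "(\<integral>\<^sup>+J. ?g n J \<partial>count_space {J. finite J}) = ennreal (IP F (EI (K n) F))" .
 qed
 also have "\<dots> = ennreal (IP F F)"
 proof (rule LIMSEQ_unique)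
  have "incseq (\<lambda>n. IP F (EI (K n) F))"
  proof (rule incseq_SucI)
   fix n
   have "Pow (K n) \<subseteq> Pow (K (Suc n))" using assms(3) by (auto simp: incseq_Suc_iff)
   then show "IP F (EI (K n) F) \<le> IP F (EI (K (Suc n)) F)"
    using assms by (subst (1 2) HJ_parseval_finite) (auto intro!: sum_mono2 IP_nonneg)
  qed
  then show "(\<lambda>n. ennreal (IP F (EI (K n) F))) \<longlonglongrightarrow> (SUP n. ennreal (IP F (EI (K n) F)))"
   by (intro LIMSEQ_SUP) (auto simp: incseq_def intro!: ennreal_leI)
  show "(\<lambda>n. ennreal (IP F (EI (K n) F))) \<longlonglongrightarrow> ennreal (IP F F)"
   using appr_IP[OF assms(1,2)] by (rule tendsto_ennrealI)
 qed
 finally show ?thesis .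
qed

end

section \<open>The spectral gap of equivariant fields\<close>

locale spectral_graph = nonamenable_graph E + pmf_product q
 for E :: "'v \<Rightarrow> 'v \<Rightarrow> bool" and q :: "bool \<times> 'v \<Rightarrow> 's pmf"
begin

definition gi :: "('v \<Rightarrow> 'v) \<Rightarrow> bool \<times> 'v \<Rightarrow> bool \<times> 'v" where
 "gi \<gamma> = map_prod id \<gamma>"

definition KK :: "nat \<Rightarrow> (bool \<times> 'v) set" where
 "KK n = from_nat_into UNIV ` {..<n}"

lemma countable_I: "countable (UNIV :: (bool \<times> 'v) set)"
proof -
 have "(UNIV :: (bool \<times> 'v) set) = UNIV \<times> UNIV" by simp
 then show ?thesis using countable_V by (metis countableI_type countable_SIGMA)
qed

lemma KK: "incseq KK" "finite (KK n)" "(\<Union>n. KK n) = UNIV" "eventually (\<lambda>n. i \<in> KK n) sequentially"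
proof -
 show inc: "incseq KK" by (auto simp: KK_def incseq_def)
 show "finite (KK n)" by (simp add: KK_def)
 have mem: "i \<in> KK (Suc (to_nat_on UNIV i))" for i
  using countable_I by (auto simp: KK_def intro!: image_eqI[of _ _ "to_nat_on UNIV i"])
 then show "(\<Union>n. KK n) = UNIV" by auto
 show "eventually (\<lambda>n. i \<in> KK n) sequentially"
  using mem[of i] inc unfolding eventually_sequentially incseq_def by blast
qed

text \<open>Equivariance in a weak form that survives averaging over neighbours and tolerates null
  sets: it is required only of means and of correlations of one value with conditional expectations
  of another. These correlations already determine the norms of all components.\<close>

definition eqv :: "('v \<Rightarrow> (bool \<times> 'v \<Rightarrow> 's) \<Rightarrow> real) \<Rightarrow> bool" where
 "eqv F \<longleftrightarrow> (\<forall>u. bm (F u)) \<and> (\<forall>u. appr KK (F u)) \<and> (\<forall>u w. (\<integral>x. F u x \<partial>mu) = (\<integral>x. F w x \<partial>mu)) \<and>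
  (\<forall>\<gamma> u w I. aut \<gamma> \<longrightarrow> finite I \<longrightarrow> IP (F (\<gamma> u)) (EI (gi \<gamma> ` I) (F (\<gamma> w))) = IP (F u) (EI I (F w)))"

definition lazyf :: "('v \<Rightarrow> (bool \<times> 'v \<Rightarrow> 's) \<Rightarrow> real) \<Rightarrow> 'v \<Rightarrow> (bool \<times> 'v \<Rightarrow> 's) \<Rightarrow> real" where
 "lazyf F u x = lazy (\<lambda>w. F w x) u"

definition lw :: "'v \<Rightarrow> 'v \<Rightarrow> real" where
 "lw u w = (if w = u then 1 / 2 else 1 / (2 * real deg))"

abbreviation st :: "'v \<Rightarrow> 'v set" where "st u \<equiv> insert u {y. E u y}"

lemma lazy_lw: "lazy f u = (\<Sum>w\<in>st u. lw u w * f w)"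
proof -
 have n: "u \<notin> {y. E u y}" using E_irreflp by (auto simp: irreflp_def)
 have "(\<Sum>w\<in>{y. E u y}. lw u w * f w) = (\<Sum>w\<in>{y. E u y}. f w / (2 * real deg))"
  using n by (intro sum.cong) (auto simp: lw_def)
 then show ?thesis using n by (simp add: lazy_def lw_def sum_divide_distrib[symmetric] field_simps)
qed

lemma lw_nonneg: "lw u w \<ge> 0" by (simp add: lw_def)

lemma lw_sum: "(\<Sum>w\<in>st u. lw u w) = 1"
 using lazy_lw[of "\<lambda>_. 1" u] deg_pos by (simp add: lazy_def card_nbrs)

lemma st_aut: "aut \<gamma> \<Longrightarrow> st (\<gamma> u) = \<gamma> ` st u"
proof -
 assume a: "aut \<gamma>"
 have "st u = gball E u 1" for u
 proof (intro set_eqI)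
  fix y show "y \<in> st u \<longleftrightarrow> y \<in> gball E u 1"
   using dd_1_iff[of u y] dd_0_iff[of u y] by (cases "dd u y") auto
 qed
 then show ?thesis using aut_gball[OF a] by metis
qed

lemma lw_aut: "aut \<gamma> \<Longrightarrow> lw (\<gamma> u) (\<gamma> w) = lw u w"
 by (simp add: lw_def)

lemma sum_st_aut: "aut \<gamma> \<Longrightarrow> (\<Sum>w\<in>st (\<gamma> u). f w) = (\<Sum>w\<in>st u. f (\<gamma> w))"
 unfolding st_aut by (subst sum.reindex) (auto intro: inj_on_subset[OF aut_inj])

text \<open>Means are linear and correlations bilinear in the field, and the weights
  \<open>lw\<close> are invariant, so sums over stars can be relabelled by the automorphism.\<close>

lemma eqv_lazyf: assumes F: "eqv F" shows "eqv (lazyf F)"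
proof -
 have bF: "bm (F u)" and aF: "appr KK (F u)" and mF: "(\<integral>x. F u x \<partial>mu) = (\<integral>x. F w x \<partial>mu)" for u w
  using F by (auto simp: eqv_def)
 have lf: "lazyf F u = (\<lambda>x. \<Sum>w\<in>st u. lw u w * F w x)" for u by (auto simp: lazyf_def lazy_lw fun_eq_iff)
 have bl: "bm (lazyf F u)" for u unfolding lf by (intro bm_sum bm_cmult bF)
 have "appr KK (lazyf F u)" for u unfolding lf by (intro appr_sum appr_cmult bm_cmult bF aF)
 moreover have lm: "(\<integral>x. lazyf F u x \<partial>mu) = (\<integral>x. F v x \<partial>mu)" for u v
 proof -
  have "(\<integral>x. lazyf F u x \<partial>mu) = (\<Sum>w\<in>st u. lw u w * (\<integral>x. F w x \<partial>mu))"
   unfolding lf by (subst Bochner_Integration.integral_sum) (auto intro!: bm_integrable bm_cmult bF)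
  also have "\<dots> = (\<Sum>w\<in>st u. lw u w) * (\<integral>x. F v x \<partial>mu)"
   unfolding sum_distrib_right by (intro sum.cong refl arg_cong2[where f=times] mF)
  finally show ?thesis by (simp only: lw_sum mult_1_left)
 qed
 moreover have "IP (lazyf F (\<gamma> u)) (EI (gi \<gamma> ` I) (lazyf F (\<gamma> w))) = IP (lazyf F u) (EI I (lazyf F w))"
  if g: "aut \<gamma>" "finite I" for \<gamma> u w I
 proof -
  have ex: "IP (lazyf F u) (EI I (lazyf F w)) = (\<Sum>a\<in>st u. lw u a * (\<Sum>b\<in>st w. lw w b * IP (F a) (EI I (F b))))" for u w I
  proof -
   have "IP (lazyf F u) (EI I (lazyf F w)) = (\<Sum>a\<in>st u. lw u a * IP (F a) (EI I (lazyf F w)))"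
    unfolding lf[of u] by (intro IP_lin bF bm_EI bl)
   also have "\<dots> = (\<Sum>a\<in>st u. lw u a * (\<Sum>b\<in>st w. lw w b * IP (F a) (EI I (F b))))"
   proof (intro sum.cong refl arg_cong2[where f=times])
    fix a
    have "EI I (lazyf F w) = (\<lambda>x. \<Sum>b\<in>st w. lw w b * EI I (F b) x)"
     unfolding lf by (intro ext EI_lin bF)
    then have "IP (F a) (EI I (lazyf F w)) = (\<Sum>b\<in>st w. lw w b * IP (EI I (F b)) (F a))"
     by (subst IP_sym) (simp only: IP_lin bF bm_EI)
    then show "IP (F a) (EI I (lazyf F w)) = (\<Sum>b\<in>st w. lw w b * IP (F a) (EI I (F b)))"
     by (simp only: IP_sym)
   qed
   finally show ?thesis .
  qed
  show ?thesis unfolding ex sum_st_aut[OF g(1)] lw_aut[OF g(1)]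
   using F g by (simp add: eqv_def)
 qed
 moreover have "(\<integral>x. lazyf F u x \<partial>mu) = (\<integral>x. lazyf F w x \<partial>mu)" for u w
  unfolding lm[of u u] lm[of w u] ..
 ultimately show ?thesis using bl unfolding eqv_def by blast
qed

definition nb :: "('v \<Rightarrow> (bool \<times> 'v \<Rightarrow> 's) \<Rightarrow> real) \<Rightarrow> (bool \<times> 'v) set \<Rightarrow> 'v \<Rightarrow> real" where
 "nb F J u = IP (HJ J (F u)) (HJ J (F u))"

lemma gi_inj: "aut \<gamma> \<Longrightarrow> inj (gi \<gamma>)"
 unfolding gi_def by (intro prod.inj_map inj_on_id aut_inj)

text \<open>Correlations control only the sum of the component norms over all subsets of
  \<open>J\<close>; strong induction removes the proper subsets.\<close>

lemma nb_aut:
 assumes F: "eqv F" and g: "aut \<gamma>" and J: "finite J"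
 shows "nb F (gi \<gamma> ` J) (\<gamma> u) = nb F J u"
 using J
proof (induction "card J" arbitrary: J rule: less_induct)
 case less
 have bF: "bm (F u)" for u using F by (auto simp: eqv_def)
 have inj: "inj_on ((`) (gi \<gamma>)) A" for A
  using gi_inj[OF g] by (metis inj_image_eq_iff inj_onI)
 have P: "Pow (gi \<gamma> ` J) = (`) (gi \<gamma>) ` Pow J" by (rule image_Pow_surj[symmetric]) simp
 have "(\<Sum>I\<in>Pow (gi \<gamma> ` J). nb F I (\<gamma> u)) = (\<Sum>I\<in>Pow J. nb F I u)"
 proof -
  have "IP (F (\<gamma> u)) (EI (gi \<gamma> ` J) (F (\<gamma> u))) = IP (F u) (EI J (F u))"
   using F g less.prems unfolding eqv_def by blast
  then show ?thesis
   using less.prems HJ_parseval_finite[OF bF[of "\<gamma> u"], of "gi \<gamma> ` J"] HJ_parseval_finite[OF bF[of u], of J]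
   by (simp add: nb_def)
 qed
 then have "(\<Sum>I\<in>Pow J. nb F (gi \<gamma> ` I) (\<gamma> u)) = (\<Sum>I\<in>Pow J. nb F I u)"
  unfolding P by (simp add: sum.reindex[OF inj] o_def)
 moreover have "(\<Sum>I\<in>Pow J - {J}. nb F (gi \<gamma> ` I) (\<gamma> u)) = (\<Sum>I\<in>Pow J - {J}. nb F I u)"
 proof (intro sum.cong refl)
  fix I assume "I \<in> Pow J - {J}"
  then have "I \<subset> J" by auto
  then show "nb F (gi \<gamma> ` I) (\<gamma> u) = nb F I u"
   using less.prems by (intro less.hyps psubset_card_mono) (auto intro: finite_subset)
 qed
 ultimately show ?case using less.prems by (simp add: sum.remove[of "Pow J" J])
qed

lemma nb_nonneg: "nb F J u \<ge> 0" by (simp add: nb_def IP_nonneg)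

text \<open>Taking components is linear, so this is the triangle inequality for a weighted
  average.\<close>

lemma nb_lazyf:
 assumes F: "eqv F" shows "nb (lazyf F) J u \<le> (lazy (\<lambda>w. sqrt (nb F J w)) u)\<^sup>2"
proof -
 have bF: "bm (F u)" for u using F by (auto simp: eqv_def)
 have lf: "lazyf F u = (\<lambda>x. \<Sum>w\<in>st u. lw u w * F w x)" by (auto simp: lazyf_def lazy_lw fun_eq_iff)
 have "HJ J (lazyf F u) = (\<lambda>x. \<Sum>w\<in>st u. lw u w * HJ J (F w) x)"
 proof
  fix x
  have "HJ J (lazyf F u) x = (\<Sum>I\<in>Pow J. (\<Sum>w\<in>st u. (-1) ^ card (J - I) * (lw u w * EI I (F w) x)))"
   unfolding HJ_def mobius_def lf EI_lin[OF bF] sum_distrib_left ..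
  also have "\<dots> = (\<Sum>w\<in>st u. (\<Sum>I\<in>Pow J. (-1) ^ card (J - I) * (lw u w * EI I (F w) x)))"
   by (rule sum.swap)
  also have "\<dots> = (\<Sum>w\<in>st u. lw u w * HJ J (F w) x)"
   unfolding HJ_def mobius_def sum_distrib_left by (simp only: mult_ac)
  finally show "HJ J (lazyf F u) x = (\<Sum>w\<in>st u. lw u w * HJ J (F w) x)" .
 qed
 then show ?thesis unfolding nb_def lazy_lw
  using IP_norm_sum[of "st u" "\<lambda>w. HJ J (F w)" "lw u"] bF by (simp only: bm_HJ lw_nonneg)
qed

definition Fin :: "(bool \<times> 'v) set set" where "Fin = {J. finite J \<and> J \<noteq> {}}"

text \<open>Mass transport in which \<open>v\<close> spreads the weight \<open>f J v\<close> evenly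
  over the vertices occurring in \<open>J\<close>. On the receiving side a fixed \<open>J\<close>
  sees the function \<open>f J\<close> on the entire graph.\<close>

lemma Fin_transport:
 fixes f :: "(bool \<times> 'v) set \<Rightarrow> 'v \<Rightarrow> ennreal"
 assumes "\<And>\<gamma> J u. aut \<gamma> \<Longrightarrow> J \<in> Fin \<Longrightarrow> f (gi \<gamma> ` J) (\<gamma> u) = f J u"
 shows "(\<integral>\<^sup>+J. f J z \<partial>count_space Fin)
  = (\<integral>\<^sup>+J. indicator (snd ` J) z / of_nat (card (snd ` J)) * (\<integral>\<^sup>+v. f J v \<partial>count_space UNIV) \<partial>count_space Fin)"
proof -
 let ?w = "\<lambda>J z. indicator (snd ` J) z / of_nat (card (snd ` J)) :: ennreal"
 define \<phi> where "\<phi> v w = (\<integral>\<^sup>+J. ?w J w * f J v \<partial>count_space Fin)" for v w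
 have inv: "\<phi> (\<gamma> v) (\<gamma> w) = \<phi> v w" if g: "aut \<gamma>" for \<gamma> v w
 proof -
  have bij: "bij_betw ((`) (gi \<gamma>)) Fin Fin"
  proof (rule bij_betwI[of _ _ _ "(`) (gi (inv \<gamma>))"])
   have "gi \<gamma> (gi (inv \<gamma>) x) = x" "gi (inv \<gamma>) (gi \<gamma> x) = x" for x
    using g by (cases x; simp add: gi_def)+
   then show "gi (inv \<gamma>) ` gi \<gamma> ` J = J" "gi \<gamma> ` gi (inv \<gamma>) ` J = J" for J
    by (simp_all add: image_image)
  qed (auto simp: Fin_def)
  have sn: "snd ` gi \<gamma> ` J = \<gamma> ` snd ` J" for J by (auto simp: gi_def image_image)
  have "\<phi> (\<gamma> v) (\<gamma> w) = (\<integral>\<^sup>+J. ?w (gi \<gamma> ` J) (\<gamma> w) * f (gi \<gamma> ` J) (\<gamma> v) \<partial>count_space Fin)"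
   unfolding \<phi>_def by (rule nn_integral_bij_count_space[OF bij, symmetric])
  also have "\<dots> = \<phi> v w"
   unfolding \<phi>_def
  proof (intro nn_integral_cong)
   fix J assume "J \<in> space (count_space Fin)"
   then have J: "J \<in> Fin" by simp
   have "card (\<gamma> ` snd ` J) = card (snd ` J)"
    using aut_inj[OF g] by (intro card_image) (metis inj_on_subset subset_UNIV)
   moreover have "indicator (\<gamma> ` snd ` J) (\<gamma> w) = (indicator (snd ` J) w :: ennreal)"
    using aut_inj[OF g] by (auto simp: indicator_def inj_image_mem_iff simp del: image_image)
   ultimately show "?w (gi \<gamma> ` J) (\<gamma> w) * f (gi \<gamma> ` J) (\<gamma> v) = ?w J w * f J v"
    unfolding sn assms[OF g J] by simp
  qed
  finally show ?thesis .
 qed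
 have "(\<integral>\<^sup>+w. \<phi> z w \<partial>count_space UNIV) = (\<integral>\<^sup>+J. (\<integral>\<^sup>+w. ?w J w * f J z \<partial>count_space UNIV) \<partial>count_space Fin)"
  unfolding \<phi>_def using countable_V by (subst nn_integral_count_space_nn_integral) auto
 also have "\<dots> = (\<integral>\<^sup>+J. f J z \<partial>count_space Fin)"
 proof (intro nn_integral_cong)
  fix J assume "J \<in> space (count_space Fin)"
  then have J: "finite (snd ` J)" "card (snd ` J) > 0" by (auto simp: Fin_def card_gt_0_iff)
  have "(\<integral>\<^sup>+w. ?w J w * f J z \<partial>count_space UNIV)
    = (\<integral>\<^sup>+w. (f J z / of_nat (card (snd ` J))) * indicator (snd ` J) w \<partial>count_space UNIV)"
   by (intro nn_integral_cong) (simp add: divide_ennreal_def mult_ac)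
  also have "\<dots> = f J z / of_nat (card (snd ` J)) * of_nat (card (snd ` J))"
   using J by (simp add: nn_integral_cmult)
  also have "\<dots> = f J z"
   unfolding ennreal_divide_times using J(2) by (subst ennreal_divide_self) (auto simp: of_nat_less_top)
  finally show "(\<integral>\<^sup>+w. ?w J w * f J z \<partial>count_space UNIV) = f J z" .
 qed
 finally have 1: "(\<integral>\<^sup>+w. \<phi> z w \<partial>count_space UNIV) = (\<integral>\<^sup>+J. f J z \<partial>count_space Fin)" .
 have 2: "(\<integral>\<^sup>+v. \<phi> v z \<partial>count_space UNIV)
  = (\<integral>\<^sup>+J. ?w J z * (\<integral>\<^sup>+v. f J v \<partial>count_space UNIV) \<partial>count_space Fin)"
  unfolding \<phi>_def using countable_V
  by (subst nn_integral_count_space_nn_integral[symmetric, where M="count_space Fin"])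
   (auto simp: nn_integral_cmult)
 show ?thesis using mass_transport[of \<phi> z, OF inv] 1 2 by simp
qed

text \<open>The variance of the field at \<open>z\<close>, as \<open>VV_total\<close> confirms: the
  omitted empty set carries the squared mean.\<close>

definition VV :: "('v \<Rightarrow> (bool \<times> 'v \<Rightarrow> 's) \<Rightarrow> real) \<Rightarrow> 'v \<Rightarrow> ennreal" where
 "VV F z = (\<integral>\<^sup>+J. ennreal (nb F J z) \<partial>count_space Fin)"

lemma lazy_aut: "aut \<gamma> \<Longrightarrow> lazy f (\<gamma> u) = lazy (\<lambda>w. f (\<gamma> w)) u"
 unfolding lazy_lw by (simp only: sum_st_aut lw_aut)

text \<open>Transport turns the variance at one vertex into l2 norms over all vertices, one for each
  \<open>J\<close>; \<open>lazy_l2\<close> contracts them, and transport leads back.\<close>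

lemma VV_lazyf:
 assumes F: "eqv F" shows "VV (lazyf F) z \<le> ennreal lam * VV F z"
proof -
 let ?s = "\<lambda>J w. sqrt (nb F J w)"
 let ?w = "\<lambda>J. indicator (snd ` J) z / of_nat (card (snd ` J)) :: ennreal"
 have "VV (lazyf F) z \<le> (\<integral>\<^sup>+J. ennreal ((lazy (?s J) z)\<^sup>2) \<partial>count_space Fin)"
  unfolding VV_def by (intro nn_integral_mono ennreal_leI nb_lazyf F)
 also have "\<dots> = (\<integral>\<^sup>+J. ?w J * (\<integral>\<^sup>+v. ennreal ((lazy (?s J) v)\<^sup>2) \<partial>count_space UNIV) \<partial>count_space Fin)"
  using F by (intro Fin_transport) (simp add: lazy_aut nb_aut Fin_def)
 also have "\<dots> \<le> (\<integral>\<^sup>+J. ?w J * (ennreal lam * (\<integral>\<^sup>+v. ennreal ((?s J v)\<^sup>2) \<partial>count_space UNIV)) \<partial>count_space Fin)"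
  by (intro nn_integral_mono mult_left_mono lazy_l2) (auto simp: nb_nonneg)
 also have "\<dots> = ennreal lam * (\<integral>\<^sup>+J. ?w J * (\<integral>\<^sup>+v. ennreal (nb F J v) \<partial>count_space UNIV) \<partial>count_space Fin)"
  by (subst nn_integral_cmult[symmetric]) (auto simp: nb_nonneg mult_ac intro!: nn_integral_cong)
 also have "(\<integral>\<^sup>+J. ?w J * (\<integral>\<^sup>+v. ennreal (nb F J v) \<partial>count_space UNIV) \<partial>count_space Fin) = VV F z"
  unfolding VV_def using F by (intro Fin_transport[symmetric]) (simp add: nb_aut Fin_def)
 finally show ?thesis .
qed

lemma VV_total:
 assumes F: "eqv F" shows "ennreal (IP (F z) (F z)) = ennreal ((\<integral>x. F z x \<partial>mu)\<^sup>2) + VV F z"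
proof -
 have b: "bm (F z)" and a: "appr KK (F z)" using F by (auto simp: eqv_def)
 have "HJ {} (F z) = (\<lambda>_. \<integral>x. F z x \<partial>mu)"
  by (auto simp: HJ_def mobius_def EI_def mrg_def fun_eq_iff)
 then have 0: "nb F {} z = (\<integral>x. F z x \<partial>mu)\<^sup>2"
  by (simp add: nb_def IP_def power2_eq_square M.prob_space[simplified])
 have "ennreal (IP (F z) (F z)) = (\<integral>\<^sup>+J. ennreal (nb F J z) \<partial>count_space {J. finite J})"
  unfolding nb_def by (rule HJ_parseval[symmetric, OF b a KK(1,2,3)])
 also have "\<dots> = (\<integral>\<^sup>+J. ennreal (nb F J z) * indicator {{}} J + ennreal (nb F J z) * indicator Fin J \<partial>count_space UNIV)"
  by (subst nn_integral_count_space_indicator, simp) (auto intro!: nn_integral_cong simp: indicator_def Fin_def)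
 also have "\<dots> = ennreal (nb F {} z) + VV F z"
  unfolding VV_def by (subst nn_integral_add) (auto simp: nn_integral_count_space_indicator)
 finally show ?thesis by (simp add: 0)
qed

lemma lazyf_iter:
 assumes F: "eqv F"
 shows "eqv ((lazyf ^^ k) F)" "VV ((lazyf ^^ k) F) z \<le> ennreal (lam ^ k) * VV F z"
  "(\<integral>x. (lazyf ^^ k) F z x \<partial>mu) = (\<integral>x. F z x \<partial>mu)"
  "(\<And>u. u \<in> gball E z k \<Longrightarrow> F u x = 0) \<Longrightarrow> (lazyf ^^ k) F z x = 0"
proof -
 show e: "eqv ((lazyf ^^ k) F)" for k by (induction k) (auto intro: F eqv_lazyf)
 show "VV ((lazyf ^^ k) F) z \<le> ennreal (lam ^ k) * VV F z"
 proof (induction k)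
  case (Suc k)
  have "VV ((lazyf ^^ Suc k) F) z \<le> ennreal lam * VV ((lazyf ^^ k) F) z" using VV_lazyf[OF e] by simp
  also have "\<dots> \<le> ennreal lam * (ennreal (lam ^ k) * VV F z)" using Suc by (intro mult_left_mono) auto
  also have "\<dots> = ennreal (lam ^ Suc k) * VV F z"
   using lam_bounds by (simp add: ennreal_mult[symmetric] mult.assoc[symmetric])
  finally show ?case .
 qed simp
 show "(\<integral>x. (lazyf ^^ k) F z x \<partial>mu) = (\<integral>x. F z x \<partial>mu)"
 proof (induction k arbitrary: z)
  case (Suc k)
  have b: "bm ((lazyf ^^ k) F w)" for w using e[of k] by (auto simp: eqv_def)
  have lf: "(lazyf ^^ Suc k) F z = (\<lambda>x. \<Sum>w\<in>st z. lw z w * (lazyf ^^ k) F w x)" by (auto simp: lazyf_def lazy_lw fun_eq_iff)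
  have "(\<integral>x. (lazyf ^^ Suc k) F z x \<partial>mu) = (\<Sum>w\<in>st z. lw z w * (\<integral>x. (lazyf ^^ k) F w x \<partial>mu))"
   unfolding lf by (subst Bochner_Integration.integral_sum) (auto intro!: bm_integrable bm_cmult b)
  also have "\<dots> = (\<Sum>w\<in>st z. lw z w) * (\<integral>x. F z x \<partial>mu)"
  proof -
   have "(\<integral>x. (lazyf ^^ k) F w x \<partial>mu) = (\<integral>x. F z x \<partial>mu)" for w
    using Suc[of w] F by (metis eqv_def)
   then show ?thesis by (simp only: sum_distrib_right)
  qed
  finally show ?case by (simp only: lw_sum mult_1_left)
 qed simp
 show "(\<And>u. u \<in> gball E z k \<Longrightarrow> F u x = 0) \<Longrightarrow> (lazyf ^^ k) F z x = 0"
 proof (induction k arbitrary: z)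
  case (Suc k)
  have "(lazyf ^^ k) F w x = 0" if "w \<in> st z" for w
  proof (rule Suc.IH)
   fix u assume u: "u \<in> gball E w k"
   have "dd z w \<le> 1" using that dd_E by auto
   then show "F u x = 0" using Suc.prems[of u] u dd_triangle[of z u w] by auto
  qed
  moreover have "(lazyf ^^ Suc k) F z x = (\<Sum>w\<in>st z. lw z w * (lazyf ^^ k) F w x)"
   by (simp only: funpow.simps o_apply lazyf_def[of "(lazyf ^^ k) F"] lazy_lw)
  ultimately show ?case by (simp only: mult_zero_right sum.neutral_const cong: sum.cong)
 qed simp
qed

text \<open>After \<open>k\<close> averaging steps the indicator keeps its mean, has second moment
  above the squared mean by at most \<open>lam ^ k\<close> times the mean, and vanishes off the
  \<open>k\<close>-neighbourhood event. Cauchy-Schwarz then bounds the probability of that event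
  from below.\<close>

theorem spectral_gap:
 assumes S: "\<And>u. S u \<in> sets mu" and F: "eqv (\<lambda>u. indicator (S u))"
 shows "measure mu (S z) \<le> measure mu (\<Union>u\<in>gball E z k. S u) * (measure mu (S z) + lam ^ k)"
proof -
 define F where "F u = (indicator (S u) :: _ \<Rightarrow> real)" for u
 define G where "G = (lazyf ^^ k) F z"
 define N where "N = (\<Union>u\<in>gball E z k. S u)"
 define s where "s = measure mu (S z)"
 have eF: "eqv F" using F by (simp add: F_def[abs_def])
 note it = lazyf_iter[OF eF, where k = k]
 have bG: "bm G" using it(1) by (auto simp: G_def eqv_def)
 have Ns: "N \<in> sets mu" unfolding N_def using S by (intro sets.finite_UN) auto
 have s0: "s \<ge> 0" by (simp add: s_def)
 have mean: "(\<integral>x. F z x \<partial>mu) = s" using S by (simp add: F_def s_def)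
 have IPF: "IP (F z) (F z) = s"
  using S by (simp add: IP_def F_def s_def flip: indicator_inter_arith)
 have "VV F z \<le> ennreal s" using VV_total[OF eF, of z] unfolding IPF by (metis add_increasing zero_le order_refl)
 have "ennreal (IP G G) = ennreal (s\<^sup>2) + VV ((lazyf ^^ k) F) z"
  unfolding G_def using VV_total[OF it(1), of z] it(3)[of z] mean by simp
 also have "\<dots> \<le> ennreal (s\<^sup>2) + ennreal (lam ^ k) * ennreal s"
  using it(2)[of z] \<open>VV F z \<le> ennreal s\<close> by (intro add_left_mono) (meson mult_left_mono order_trans zero_le)
 also have "\<dots> = ennreal (s\<^sup>2 + lam ^ k * s)" using s0 lam_bounds by (simp add: ennreal_mult ennreal_plus)
 finally have GG: "IP G G \<le> s\<^sup>2 + lam ^ k * s" using s0 lam_bounds by (subst (asm) ennreal_le_iff) auto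
 have GN: "G x * indicator N x = G x" for x
  using it(4)[of z x] by (cases "x \<in> N") (auto simp: G_def N_def F_def)
 have "s = IP G (indicator N)" unfolding IP_def GN using it(3)[of z] mean by (simp add: G_def)
 also have "\<dots> \<le> sqrt (IP G G) * sqrt (IP (indicator N) (indicator N))"
  using bG Ns by (intro IP_CS bm_indicator)
 also have "IP (indicator N) (indicator N) = measure mu N"
  using Ns by (simp add: IP_def flip: indicator_inter_arith)
 finally have "s\<^sup>2 \<le> (sqrt (IP G G) * sqrt (measure mu N))\<^sup>2" using s0 by (intro power_mono)
 also have "\<dots> = IP G G * measure mu N" by (simp add: power_mult_distrib IP_nonneg)
 also have "\<dots> \<le> (s\<^sup>2 + lam ^ k * s) * measure mu N" using GG by (intro mult_right_mono) auto
 finally have "s * s \<le> s * (measure mu N * (s + lam ^ k))" by (simp add: power2_eq_square algebra_simps)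
 moreover have "0 \<le> measure mu N * (s + lam ^ k)" using s0 lam_bounds by simp
 ultimately have "s \<le> measure mu N * (s + lam ^ k)" using s0 by (cases "s = 0") (auto simp: mult_le_cancel_left_pos)
 then show ?thesis by (simp add: s_def N_def)
qed

end

lemma nn_integral_count_space_limit:
 fixes f :: "'a \<Rightarrow> ennreal"
 assumes "incseq K" "\<And>n. finite (K n)" "(\<Union>n. K n) = UNIV"
 shows "(\<lambda>n. \<Sum>v\<in>K n. f v) \<longlonglongrightarrow> (\<integral>\<^sup>+v. f v \<partial>count_space UNIV)"
proof -
 let ?g = "\<lambda>n v. f v * indicator (K n) v"
 have inc: "incseq ?g"
  using assms(1) by (auto simp: incseq_def le_fun_def indicator_def)
 have sup: "(SUP n. ?g n v) = f v" for v
 proof (rule antisym)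
  show "(SUP n. ?g n v) \<le> f v" by (auto intro!: SUP_least simp: indicator_def)
  obtain n where "v \<in> K n" using assms(3) by blast
  then show "f v \<le> (SUP n. ?g n v)" using SUP_upper[of n UNIV "\<lambda>n. ?g n v"] by simp
 qed
 have "(\<integral>\<^sup>+v. f v \<partial>count_space UNIV) = (\<integral>\<^sup>+v. (SUP n. ?g n v) \<partial>count_space UNIV)" by (simp add: sup)
 also have "\<dots> = (SUP n. \<integral>\<^sup>+v. ?g n v \<partial>count_space UNIV)"
  using inc by (intro nn_integral_monotone_convergence_SUP) auto
 also have "\<dots> = (SUP n. \<Sum>v\<in>K n. f v)"
  using assms(2) by (simp add: nn_integral_count_space_indicator[symmetric] nn_integral_count_space_finite)
 finally have eq: "(\<integral>\<^sup>+v. f v \<partial>count_space UNIV) = (SUP n. \<Sum>v\<in>K n. f v)" .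
 have "incseq (\<lambda>n. \<Sum>v\<in>K n. f v)"
  using assms(1,2) by (auto simp: incseq_def intro!: sum_mono2)
 then show ?thesis unfolding eq by (rule LIMSEQ_SUP)
qed

context nonamenable_graph begin

definition Kv :: "nat \<Rightarrow> 'v set" where "Kv n = from_nat_into UNIV ` {..<n}"

lemma Kv: "incseq Kv" "finite (Kv n)" "(\<Union>n. Kv n) = UNIV" "eventually (\<lambda>n. i \<in> Kv n) sequentially"
proof -
 show inc: "incseq Kv" by (auto simp: Kv_def incseq_def)
 show "finite (Kv n)" by (simp add: Kv_def)
 have mem: "i \<in> Kv (Suc (to_nat_on UNIV i))" for i
  using countable_V by (auto simp: Kv_def intro!: image_eqI[of _ _ "to_nat_on UNIV i"])
 then show "(\<Union>n. Kv n) = UNIV" by auto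
 show "eventually (\<lambda>n. i \<in> Kv n) sequentially"
  using mem[of i] inc unfolding eventually_sequentially incseq_def by blast
qed

end

section \<open>Emission fields\<close>

text \<open>Index \<open>(b, v)\<close> emits \<open>snd\<close> many points on side
  \<open>b\<close>, all placed at the location \<open>fst\<close>. A Poisson process has fixed
  locations and random numbers, a perturbed vertex set random locations and single points. The last
  assumption compares exponential moments with those of a Poisson variable of the same mean; the
  exponents 1 and -1 serve the two Chernoff tails.\<close>

locale emission = spectral_graph E q
 for E :: "'v \<Rightarrow> 'v \<Rightarrow> bool" and q :: "bool \<times> 'v \<Rightarrow> ('v \<times> nat) pmf" +
 assumes q_aut: "aut \<gamma> \<Longrightarrow> map_pmf (map_prod \<gamma> id) (q (b, v)) = q (b, \<gamma> v)"
  and q_mean: "(\<integral>\<^sup>+y. of_nat (snd y) \<partial>measure_pmf (q i)) = 1"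
  and q_mgf: "s \<in> {1, -1} \<Longrightarrow>
   (\<integral>\<^sup>+y. ennreal (exp (s * (if fst y \<in> W then real (snd y) else 0))) \<partial>measure_pmf (q i))
    \<le> ennreal (exp ((exp s - 1) * enn2real (\<integral>\<^sup>+y. of_nat (snd y) * indicator W (fst y) \<partial>measure_pmf (q i))))"
begin

text \<open>The number of points received at \<open>u\<close>. If infinitely many emitters hit
  \<open>u\<close>, the cardinality defaults to 0; by \<open>AE_fin\<close> this is a null
  event.\<close>

definition tot :: "(bool \<times> 'v \<Rightarrow> 'v \<times> nat) \<Rightarrow> bool \<Rightarrow> 'v \<Rightarrow> nat" where
 "tot x b u = card {(v, j). fst (x (b, v)) = u \<and> j < snd (x (b, v))}"

definition mm :: "bool \<Rightarrow> 'v set \<Rightarrow> 'v \<Rightarrow> ennreal" where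
 "mm b W v = (\<integral>\<^sup>+y. of_nat (snd y) * indicator W (fst y) \<partial>measure_pmf (q (b, v)))"

definition psum :: "'v set \<Rightarrow> (bool \<times> 'v \<Rightarrow> 'v \<times> nat) \<Rightarrow> bool \<Rightarrow> 'v set \<Rightarrow> nat" where
 "psum K x b W = (\<Sum>v\<in>K. if fst (x (b, v)) \<in> W then snd (x (b, v)) else 0)"

lemma mm_sum: "finite W \<Longrightarrow> mm b W v = (\<Sum>u\<in>W. mm b {u} v)"
proof -
 assume W: "finite W"
 have "of_nat (snd y) * indicator W (fst y) = (\<Sum>u\<in>W. of_nat (snd y) * indicator {u} (fst y) :: ennreal)" for y :: "'v \<times> nat"
  unfolding sum_distrib_left[symmetric] using W
  by (intro arg_cong2[where f=times] refl) (auto simp: indicator_def sum.delta')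
 then show ?thesis unfolding mm_def by (subst nn_integral_sum[symmetric]) simp_all
qed

text \<open>By mass transport a vertex receives on average as many points as it emits, and it emits
  one on average.\<close>

lemma mm_total1: "(\<integral>\<^sup>+v. mm b {u} v \<partial>count_space UNIV) = 1"
proof -
 have inv: "mm b {\<gamma> u} (\<gamma> v) = mm b {u} v" if "aut \<gamma>" for \<gamma> u v
 proof -
  have "mm b {\<gamma> u} (\<gamma> v) = (\<integral>\<^sup>+y. of_nat (snd y) * indicator {\<gamma> u} (fst y) \<partial>measure_pmf (map_pmf (map_prod \<gamma> id) (q (b, v))))"
   unfolding mm_def q_aut[OF that] ..
  also have "\<dots> = mm b {u} v"
   unfolding mm_def using that by (auto intro!: nn_integral_cong simp: indicator_def)
  finally show ?thesis .
 qed
 have "(\<integral>\<^sup>+v. mm b {u} v \<partial>count_space UNIV) = (\<integral>\<^sup>+v. mm b {v} u \<partial>count_space UNIV)"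
  using mass_transport[of "\<lambda>v w. mm b {w} v" u] inv by simp
 also have "\<dots> = (\<integral>\<^sup>+y. (\<integral>\<^sup>+v. of_nat (snd y) * indicator {v} (fst y) \<partial>count_space UNIV) \<partial>measure_pmf (q (b, u)))"
  unfolding mm_def using countable_V by (subst nn_integral_count_space_nn_integral) auto
 also have "\<dots> = (\<integral>\<^sup>+y. of_nat (snd y) \<partial>measure_pmf (q (b, u)))"
 proof (intro nn_integral_cong)
  fix y :: "'v \<times> nat"
  have "(\<integral>\<^sup>+v. of_nat (snd y) * indicator {v} (fst y) \<partial>count_space UNIV) = (\<integral>\<^sup>+v. of_nat (snd y) * indicator {fst y} v \<partial>count_space UNIV)"
   by (intro nn_integral_cong) (auto simp: indicator_def)
  then show "(\<integral>\<^sup>+v. of_nat (snd y) * indicator {v} (fst y) \<partial>count_space UNIV) = (of_nat (snd y) :: ennreal)"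
   by (simp add: nn_integral_cmult)
 qed
 finally show ?thesis by (simp add: q_mean)
qed

lemma mm_total: "finite W \<Longrightarrow> (\<integral>\<^sup>+v. mm b W v \<partial>count_space UNIV) = of_nat (card W)"
proof -
 assume W: "finite W"
 show ?thesis unfolding mm_sum[OF W] by (subst nn_integral_sum) (simp_all add: mm_total1)
qed

lemma mm_le1: "mm b W v \<le> 1"
 unfolding mm_def q_mean[of "(b, v)", symmetric] by (intro nn_integral_mono) (auto simp: indicator_def)

lemma measurable_coord_enn: "(\<lambda>x. f (x i) :: ennreal) \<in> borel_measurable mu"
 by (rule measurable_compose[OF measurable_coord[of i]]) simp

lemma nn_coord: "(\<integral>\<^sup>+x. f (x i) \<partial>mu) = (\<integral>\<^sup>+y. f y \<partial>measure_pmf (q i))"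
proof -
 have m: "(\<lambda>x. x i) \<in> mu \<rightarrow>\<^sub>M measure_pmf (q i)" unfolding mu_def by (rule measurable_component_singleton) simp
 have "(\<integral>\<^sup>+y. f y \<partial>distr mu (measure_pmf (q i)) (\<lambda>x. x i)) = (\<integral>\<^sup>+x. f (x i) \<partial>mu)"
  by (rule nn_integral_distr[OF m]) simp
 moreover have "distr mu (measure_pmf (q i)) (\<lambda>x. x i) = measure_pmf (q i)"
  unfolding mu_def by (rule distr_PiM_component) (auto intro: prob_space_measure_pmf)
 ultimately show ?thesis by simp
qed

text \<open>The expected number of points received is finite, and every emitter that contributes at
  all contributes at least one.\<close>

lemma AE_fin: "AE x in mu. \<forall>b u. finite {v. fst (x (b, v)) = u \<and> 0 < snd (x (b, v))}"
proof -
 have "AE x in mu. finite {v. fst (x (b, v)) = u \<and> 0 < snd (x (b, v))}" for b u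
 proof -
  let ?f = "\<lambda>x v. of_nat (snd (x (b, v))) * indicator {u} (fst (x (b, v))) :: ennreal"
  have m: "(\<lambda>x. ?f x v) \<in> borel_measurable mu" for v
   using measurable_coord_enn[of "\<lambda>y. of_nat (snd y) * indicator {u} (fst y)"] by simp
  have "(\<integral>\<^sup>+x. (\<integral>\<^sup>+v. ?f x v \<partial>count_space UNIV) \<partial>mu) = (\<integral>\<^sup>+v. (\<integral>\<^sup>+x. ?f x v \<partial>mu) \<partial>count_space UNIV)"
   using countable_V m by (rule nn_integral_count_space_nn_integral)
  also have "\<dots> = (\<integral>\<^sup>+v. mm b {u} v \<partial>count_space UNIV)"
   unfolding mm_def by (intro nn_integral_cong) (subst nn_coord[symmetric], simp)
  finally have int: "(\<integral>\<^sup>+x. (\<integral>\<^sup>+v. ?f x v \<partial>count_space UNIV) \<partial>mu) = 1" by (simp add: mm_total1)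
  have meas: "(\<lambda>x. \<integral>\<^sup>+v. ?f x v \<partial>count_space UNIV) \<in> borel_measurable mu"
  proof (rule borel_measurable_LIMSEQ_order)
   show "(\<lambda>n. \<Sum>v\<in>Kv n. ?f x v) \<longlonglongrightarrow> (\<integral>\<^sup>+v. ?f x v \<partial>count_space UNIV)" for x
    by (rule nn_integral_count_space_limit[OF Kv(1,2,3)])
   show "(\<lambda>x. \<Sum>v\<in>Kv n. ?f x v) \<in> borel_measurable mu" for n using m by simp
  qed
  have "AE x in mu. (\<integral>\<^sup>+v. ?f x v \<partial>count_space UNIV) \<noteq> \<infinity>"
   using meas int by (intro nn_integral_noteq_infinite) auto
  then show ?thesis
  proof eventually_elim
   case (elim x)
   show ?case
   proof (rule ccontr)
    assume inf: "infinite {v. fst (x (b, v)) = u \<and> 0 < snd (x (b, v))}"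
    have "emeasure (count_space UNIV) {v. fst (x (b, v)) = u \<and> 0 < snd (x (b, v))} \<le> (\<integral>\<^sup>+v. ?f x v \<partial>count_space UNIV)"
     by (subst nn_integral_indicator[symmetric], simp, intro nn_integral_mono)
      (auto simp: indicator_def Suc_le_eq[symmetric] simp del: of_nat_Suc)
    then show False using inf elim by (simp add: top_unique)
   qed
  qed
 qed
 then have "AE x in mu. \<forall>u\<in>UNIV. finite {v. fst (x (b, v)) = u \<and> 0 < snd (x (b, v))}" for b
  by (subst AE_ball_countable[OF countable_V]) simp
 from this[of True] this[of False] show ?thesis by eventually_elim (simp add: all_bool_eq)
qed

lemma tot_psum:
 assumes "finite W" "finite K" "{v. fst (x (b, v)) \<in> W \<and> 0 < snd (x (b, v))} \<subseteq> K"
 shows "(\<Sum>u\<in>W. tot x b u) = psum K x b W"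
proof -
 have "tot x b u = (\<Sum>v\<in>K. if fst (x (b, v)) = u then snd (x (b, v)) else 0)" if "u \<in> W" for u
 proof -
  have "{(v, j). fst (x (b, v)) = u \<and> j < snd (x (b, v))} = (SIGMA v:{v\<in>K. fst (x (b, v)) = u}. {..<snd (x (b, v))})"
   using assms(3) that by force
  then show ?thesis unfolding tot_def using assms(2) by (simp add: card_SigmaI sum.inter_filter)
 qed
 then have "(\<Sum>u\<in>W. tot x b u) = (\<Sum>u\<in>W. \<Sum>v\<in>K. if fst (x (b, v)) = u then snd (x (b, v)) else 0)" by simp
 also have "\<dots> = (\<Sum>v\<in>K. \<Sum>u\<in>W. if fst (x (b, v)) = u then snd (x (b, v)) else 0)" by (rule sum.swap)
 also have "\<dots> = psum K x b W" unfolding psum_def using assms(1) by (intro sum.cong refl) simp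
 finally show ?thesis .
qed

lemma AE_tot_eventually:
 assumes "finite W"
 shows "AE x in mu. eventually (\<lambda>n. (\<Sum>u\<in>W. tot x b u) = psum (Kv n) x b W) sequentially"
 using AE_fin
proof eventually_elim
 case (elim x)
 let ?S = "{v. fst (x (b, v)) \<in> W \<and> 0 < snd (x (b, v))}"
 have "?S = (\<Union>u\<in>W. {v. fst (x (b, v)) = u \<and> 0 < snd (x (b, v))})" by auto
 then have "finite ?S" using elim assms by auto
 then have "eventually (\<lambda>n. \<forall>v\<in>?S. v \<in> Kv n) sequentially"
  by (rule eventually_ball_finite) (use Kv(4) in blast)
 then show ?case
  by eventually_elim (rule tot_psum[OF assms Kv(2)], auto)
qed

lemma indep_coord: "M.indep_vars (\<lambda>i. measure_pmf (q i)) (\<lambda>i x. x i) UNIV"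
proof (subst M.indep_vars_iff_distr_eq_PiM)
 show m: "\<And>i. (\<lambda>x. x i) \<in> mu \<rightarrow>\<^sub>M measure_pmf (q i)" unfolding mu_def by (rule measurable_component_singleton) simp
 have c: "distr mu (measure_pmf (q i)) (\<lambda>x. x i) = measure_pmf (q i)" for i
  unfolding mu_def by (rule distr_PiM_component) (auto intro: prob_space_measure_pmf)
 show "distr mu (PiM UNIV (\<lambda>i. measure_pmf (q i))) (\<lambda>x. \<lambda>i\<in>UNIV. x i) = (\<Pi>\<^sub>M i\<in>UNIV. distr mu (measure_pmf (q i)) (\<lambda>x. x i))"
  unfolding c by (simp add: mu_def restrict_UNIV distr_id2)
qed simp

text \<open>Independence of the emitters multiplies the exponential moments, so the bounds from
  \<open>q_mgf\<close> add up in the exponent.\<close>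

lemma psum_mgf:
 assumes s: "s \<in> {1, -1 :: real}" and K: "finite K"
 shows "(\<integral>\<^sup>+x. ennreal (exp (s * real (psum K x b W))) \<partial>mu) \<le> ennreal (exp ((exp s - 1) * (\<Sum>v\<in>K. enn2real (mm b W v))))"
proof -
 let ?g = "\<lambda>y. ennreal (exp (s * (if fst y \<in> W then real (snd y) else 0)))"
 have "ennreal (exp (s * real (psum K x b W))) = (\<Prod>i\<in>Pair b ` K. ?g (x i))" for x
 proof -
  have "s * real (psum K x b W) = (\<Sum>v\<in>K. s * (if fst (x (b, v)) \<in> W then real (snd (x (b, v))) else 0))"
   unfolding psum_def of_nat_sum sum_distrib_left by (intro sum.cong refl) auto
  then show ?thesis using K
   by (subst prod.reindex) (auto simp: inj_on_def exp_sum prod_ennreal)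
 qed
 then have "(\<integral>\<^sup>+x. ennreal (exp (s * real (psum K x b W))) \<partial>mu) = (\<integral>\<^sup>+x. (\<Prod>i\<in>Pair b ` K. ?g (x i)) \<partial>mu)" by simp
 also have "\<dots> = (\<Prod>i\<in>Pair b ` K. \<integral>\<^sup>+x. ?g (x i) \<partial>mu)"
 proof (rule M.indep_vars_nn_integral)
  have "M.indep_vars (\<lambda>i. measure_pmf (q i)) (\<lambda>i x. x i) (Pair b ` K)"
   using indep_coord M.indep_vars_subset by blast
  then show "M.indep_vars (\<lambda>_. borel) (\<lambda>i x. ?g (x i)) (Pair b ` K)"
   by (rule M.indep_vars_compose2) simp
 qed (use K in auto)
 also have "\<dots> = (\<Prod>v\<in>K. \<integral>\<^sup>+y. ?g y \<partial>measure_pmf (q (b, v)))"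
  by (subst prod.reindex) (auto simp: inj_on_def nn_coord[of ?g])
 also have "\<dots> \<le> (\<Prod>v\<in>K. ennreal (exp ((exp s - 1) * enn2real (mm b W v))))"
  unfolding mm_def by (intro prod_mono_ennreal q_mgf s)
 also have "\<dots> = ennreal (exp ((exp s - 1) * (\<Sum>v\<in>K. enn2real (mm b W v))))"
  using K by (simp add: prod_ennreal exp_sum sum_distrib_left)
 finally show ?thesis .
qed

lemma psum_measurable: "(\<lambda>x. psum K x b W) \<in> mu \<rightarrow>\<^sub>M count_space UNIV"
proof -
 have "(\<lambda>x. (\<lambda>y. if fst y \<in> W then snd y else 0) (x (b, v))) \<in> mu \<rightarrow>\<^sub>M count_space UNIV" for v
  by (rule measurable_compose[OF measurable_coord]) simp
 then show ?thesis unfolding psum_def by simp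
qed

lemma mm_sum_lim:
 assumes "finite W" shows "(\<lambda>n. \<Sum>v\<in>Kv n. enn2real (mm b W v)) \<longlonglongrightarrow> real (card W)"
proof -
 have "(\<lambda>n. \<Sum>v\<in>Kv n. mm b W v) \<longlonglongrightarrow> of_nat (card W)"
  using nn_integral_count_space_limit[OF Kv(1,2,3), of "mm b W"] mm_total[OF assms] by simp
 then have "(\<lambda>n. enn2real (\<Sum>v\<in>Kv n. mm b W v)) \<longlonglongrightarrow> real (card W)"
  unfolding ennreal_of_nat_eq_real_of_nat by (rule tendsto_enn2real) simp
 moreover have "enn2real (\<Sum>v\<in>Kv n. mm b W v) = (\<Sum>v\<in>Kv n. enn2real (mm b W v))" for n
 proof -
  have "mm b W v = ennreal (enn2real (mm b W v))" for v
   using mm_le1[of b W v] by (metis ennreal_enn2real ennreal_one_less_top le_less_trans)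
  then have "(\<Sum>v\<in>Kv n. mm b W v) = (\<Sum>v\<in>Kv n. ennreal (enn2real (mm b W v)))" by metis
  also have "\<dots> = ennreal (\<Sum>v\<in>Kv n. enn2real (mm b W v))" by (rule sum_ennreal) simp
  finally show ?thesis by (simp add: sum_nonneg)
 qed
 ultimately show ?thesis by simp
qed

text \<open>Fatou passes from finitely many emitters to all of them; the means in the exponent sum
  to \<open>card W\<close> by \<open>mm_total\<close>.\<close>

lemma tot_mgf:
 assumes s: "s \<in> {1, -1 :: real}" and W: "finite W"
 shows "(\<integral>\<^sup>+x. ennreal (exp (s * real (\<Sum>u\<in>W. tot x b u))) \<partial>mu) \<le> ennreal (exp ((exp s - 1) * real (card W)))"
proof -
 let ?f = "\<lambda>n x. ennreal (exp (s * real (psum (Kv n) x b W)))"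
 have "(\<integral>\<^sup>+x. ennreal (exp (s * real (\<Sum>u\<in>W. tot x b u))) \<partial>mu) \<le> (\<integral>\<^sup>+x. liminf (\<lambda>n. ?f n x) \<partial>mu)"
 proof (intro nn_integral_mono_AE)
  show "AE x in mu. ennreal (exp (s * real (\<Sum>u\<in>W. tot x b u))) \<le> liminf (\<lambda>n. ?f n x)"
   using AE_tot_eventually[OF W, of b]
  proof eventually_elim
   case (elim x)
   then have "eventually (\<lambda>n. ennreal (exp (s * real (\<Sum>u\<in>W. tot x b u))) \<le> ?f n x) sequentially"
    by eventually_elim simp
   then show ?case by (rule Liminf_bounded)
  qed
 qed
 also have "\<dots> \<le> liminf (\<lambda>n. \<integral>\<^sup>+x. ?f n x \<partial>mu)"
  using psum_measurable by (intro nn_integral_liminf) (auto intro!: measurable_compose[OF psum_measurable])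
 also have "\<dots> \<le> liminf (\<lambda>n. ennreal (exp ((exp s - 1) * (\<Sum>v\<in>Kv n. enn2real (mm b W v)))))"
  by (intro Liminf_mono always_eventually allI psum_mgf s Kv)
 also have "\<dots> = ennreal (exp ((exp s - 1) * real (card W)))"
  by (intro lim_imp_Liminf tendsto_ennrealI tendsto_exp tendsto_mult tendsto_const mm_sum_lim W) simp
 finally show ?thesis .
qed

lemma AE_tot_eq: "AE x in mu. of_nat (tot x b u) = (\<integral>\<^sup>+v. of_nat (snd (x (b, v))) * indicator {u} (fst (x (b, v))) \<partial>count_space UNIV)"
 using AE_tot_eventually[of "{u}" b, simplified]
proof eventually_elim
 case (elim x)
 let ?f = "\<lambda>v. of_nat (snd (x (b, v))) * indicator {u} (fst (x (b, v))) :: ennreal"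
 have "(\<lambda>n. \<Sum>v\<in>Kv n. ?f v) \<longlonglongrightarrow> (\<integral>\<^sup>+v. ?f v \<partial>count_space UNIV)"
  by (rule nn_integral_count_space_limit[OF Kv(1,2,3)])
 moreover have "(\<Sum>v\<in>Kv n. ?f v) = of_nat (psum (Kv n) x b {u})" for n
  unfolding psum_def of_nat_sum by (intro sum.cong refl) (auto simp: indicator_def)
 ultimately have "(\<lambda>n. of_nat (psum (Kv n) x b {u})) \<longlonglongrightarrow> (\<integral>\<^sup>+v. ?f v \<partial>count_space UNIV)" by simp
 moreover have "(\<lambda>n. of_nat (psum (Kv n) x b {u}) :: ennreal) \<longlonglongrightarrow> of_nat (tot x b u)"
  using elim by (intro tendsto_eventually) (auto elim: eventually_mono)
 ultimately show ?case using LIMSEQ_unique by blast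
qed

lemma tot_mean: "(\<integral>\<^sup>+x. of_nat (tot x b u) \<partial>mu) = 1"
proof -
 let ?f = "\<lambda>x v. of_nat (snd (x (b, v))) * indicator {u} (fst (x (b, v))) :: ennreal"
 have m: "(\<lambda>x. ?f x v) \<in> borel_measurable mu" for v
  using measurable_coord_enn[of "\<lambda>y. of_nat (snd y) * indicator {u} (fst y)"] by simp
 have "(\<integral>\<^sup>+x. of_nat (tot x b u) \<partial>mu) = (\<integral>\<^sup>+x. (\<integral>\<^sup>+v. ?f x v \<partial>count_space UNIV) \<partial>mu)"
  by (rule nn_integral_cong_AE[OF AE_tot_eq])
 also have "\<dots> = (\<integral>\<^sup>+v. (\<integral>\<^sup>+x. ?f x v \<partial>mu) \<partial>count_space UNIV)"
  using countable_V m by (rule nn_integral_count_space_nn_integral)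
 also have "\<dots> = (\<integral>\<^sup>+v. mm b {u} v \<partial>count_space UNIV)"
  unfolding mm_def by (intro nn_integral_cong) (subst nn_coord[symmetric], simp)
 finally show ?thesis by (simp add: mm_total1)
qed

text \<open>Finiteness of the set of emitters means containment in some \<open>Kv n\<close>, where
  \<open>tot\<close> is a finite sum; off this event the default value 0 has to be accounted
  for.\<close>

lemma tot_measurable: "(\<lambda>x. tot x b u) \<in> mu \<rightarrow>\<^sub>M count_space UNIV"
proof -
 let ?fin = "\<lambda>x. finite {v. fst (x (b, v)) = u \<and> 0 < snd (x (b, v))}"
 define PP where "PP x n \<longleftrightarrow> (\<forall>m. \<forall>v\<in>Kv m - Kv n. \<not> (fst (x (b, v)) = u \<and> 0 < snd (x (b, v))))" for x :: "bool \<times> 'v \<Rightarrow> 'v \<times> nat" and n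
 have Pn: "PP x n \<longleftrightarrow> {v. fst (x (b, v)) = u \<and> 0 < snd (x (b, v))} \<subseteq> Kv n" for x n
  unfolding PP_def using Kv(3) by blast
 have fin: "?fin x \<longleftrightarrow> (\<exists>n. PP x n)" for x
 proof
  assume "?fin x"
  then have "eventually (\<lambda>n. \<forall>v\<in>{v. fst (x (b, v)) = u \<and> 0 < snd (x (b, v))}. v \<in> Kv n) sequentially"
   by (rule eventually_ball_finite) (use Kv(4) in blast)
  then show "\<exists>n. PP x n" unfolding Pn eventually_sequentially by blast
 next
  assume "\<exists>n. PP x n" then show "?fin x" unfolding Pn using Kv(2) finite_subset by blast
 qed
 have eq: "{x. tot x b u = k} = {x. \<exists>n. PP x n \<and> psum (Kv n) x b {u} = k} \<union> (if k = 0 then {x. \<not> (\<exists>n. PP x n)} else {})" for k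
 proof -
  have t1: "tot x b u = psum (Kv n) x b {u}" if "PP x n" for x n
   using tot_psum[of "{u}" "Kv n" x b] that Kv(2) unfolding Pn by simp
  have t2: "tot x b u = 0" if "\<not> (\<exists>n. PP x n)" for x
  proof -
   have "infinite {v. fst (x (b, v)) = u \<and> 0 < snd (x (b, v))}" using that fin by blast
   moreover have "{v. fst (x (b, v)) = u \<and> 0 < snd (x (b, v))} \<subseteq> fst ` {(v, j). fst (x (b, v)) = u \<and> j < snd (x (b, v))}"
    by force
   ultimately show ?thesis unfolding tot_def by (metis (no_types, lifting) card.infinite finite_imageI finite_subset)
  qed
  have "tot x b u = k \<longleftrightarrow> (\<exists>n. PP x n \<and> psum (Kv n) x b {u} = k) \<or> (k = 0 \<and> \<not> (\<exists>n. PP x n))" for x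
   using t1[of x] t2[of x] by metis
  then show ?thesis by auto
 qed
 have mp: "Measurable.pred mu (\<lambda>x. \<not> (fst (x (b, v)) = u \<and> 0 < snd (x (b, v))))" for v
  using measurable_compose[OF measurable_coord[of "(b,v)"], of "\<lambda>y. \<not> (fst y = u \<and> 0 < snd y)"] by simp
 have "Measurable.pred mu (\<lambda>x. \<forall>v\<in>Kv m - Kv n. \<not> (fst (x (b, v)) = u \<and> 0 < snd (x (b, v))))" for m n
  using Kv(2) mp by (intro pred_intros_finite) auto
 then have mP: "Measurable.pred mu (\<lambda>x. PP x n)" for n
  unfolding PP_def by (intro pred_intros_countable)
 have mS: "Measurable.pred mu (\<lambda>x. psum (Kv n) x b {u} = k)" for n k
  using measurable_compose[OF psum_measurable, of "\<lambda>j. j = k"] by simp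
 have "Measurable.pred mu (\<lambda>x. \<exists>n. PP x n \<and> psum (Kv n) x b {u} = k)" for k
  using mP mS by (intro pred_intros_countable pred_intros_logic)
 moreover have "Measurable.pred mu (\<lambda>x. \<not> (\<exists>n. PP x n))"
  using mP by (intro pred_intros_countable pred_intros_logic)
 ultimately have "{x. tot x b u = k} \<in> sets mu" for k
  unfolding eq pred_def by auto
 then show ?thesis by (subst measurable_count_space_eq2_countable) (auto simp: vimage_def)
qed

end

section \<open>Environments: multiplicities together with labels\<close>

lemma pred_Bex_countable:
 assumes "countable I" "\<And>i. i \<in> I \<Longrightarrow> Measurable.pred M (\<lambda>x. P x i)"
 shows "Measurable.pred M (\<lambda>x. \<exists>i\<in>I. P x i)"
proof -
 have "{x \<in> space M. \<exists>i\<in>I. P x i} = (\<Union>i\<in>I. {x \<in> space M. P x i})" by auto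
 also have "\<dots> \<in> sets M" using assms by (intro sets.countable_UN') (auto simp: pred_def)
 finally show ?thesis by (simp add: pred_def)
qed

lemma pred_Ball_countable:
 assumes "countable I" "\<And>i. i \<in> I \<Longrightarrow> Measurable.pred M (\<lambda>x. P x i)"
 shows "Measurable.pred M (\<lambda>x. \<forall>i\<in>I. P x i)"
proof -
 have "Measurable.pred M (\<lambda>x. \<not> (\<exists>i\<in>I. \<not> P x i))"
  using assms by (intro pred_intros_logic pred_Bex_countable) auto
 then show ?thesis by simp
qed

text \<open>The two multiplicity functions and the labels. The flag \<open>b\<close> below selects the side:
  \<^const>\<open>True\<close> for the points to be matched, \<^const>\<open>False\<close> for their targets.\<close>

type_synonym 'v env = "('v \<Rightarrow> nat) \<times> ('v \<Rightarrow> nat) \<times> ('v \<Rightarrow> real)"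

definition envM :: "'v env measure" where
 "envM = config_space \<Otimes>\<^sub>M (config_space \<Otimes>\<^sub>M (\<Pi>\<^sub>M v\<in>UNIV. borel))"

definition cnt :: "'v env \<Rightarrow> bool \<Rightarrow> 'v \<Rightarrow> nat" where
 "cnt Y b = (if b then fst Y else fst (snd Y))"

definition lab :: "'v env \<Rightarrow> 'v \<Rightarrow> real" where
 "lab Y = snd (snd Y)"

definition actz :: "('v \<Rightarrow> 'v) \<Rightarrow> 'v env \<Rightarrow> 'v env" where
 "actz \<gamma> Y = (act_field \<gamma> (fst Y), act_field \<gamma> (fst (snd Y)), act_field \<gamma> (snd (snd Y)))"

lemma space_envM [simp]: "space envM = UNIV"
 by (simp add: envM_def config_space_def space_pair_measure space_PiM)

lemma space_config [simp]: "space config_space = UNIV"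
 by (simp add: config_space_def space_PiM)

lemma config_component [measurable]: "(\<lambda>\<phi>. \<phi> v) \<in> config_space \<rightarrow>\<^sub>M count_space UNIV"
 unfolding config_space_def by (rule measurable_component_singleton) simp

lemma measurable_into_config:
 assumes "\<And>v. (\<lambda>x. f x v) \<in> N \<rightarrow>\<^sub>M count_space UNIV" shows "f \<in> N \<rightarrow>\<^sub>M config_space"
 unfolding config_space_def using assms by (intro measurable_PiM_single') auto

lemma act_field_config [measurable]: "act_field \<gamma> \<in> config_space \<rightarrow>\<^sub>M config_space"
 unfolding act_field_def by (rule measurable_into_config) simp

lemma act_field_borel [measurable]: "act_field \<gamma> \<in> (\<Pi>\<^sub>M v\<in>UNIV. borel) \<rightarrow>\<^sub>M (\<Pi>\<^sub>M v\<in>UNIV. borel)"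
 unfolding act_field_def by (rule measurable_PiM_single') auto

lemma actz_measurable [measurable]: "actz \<gamma> \<in> envM \<rightarrow>\<^sub>M envM"
 unfolding actz_def envM_def by measurable

lemma cnt_measurable [measurable]: "(\<lambda>Y. cnt Y b v) \<in> envM \<rightarrow>\<^sub>M count_space UNIV"
 unfolding cnt_def envM_def by (cases b) simp_all

lemma lab_measurable [measurable]: "(\<lambda>Y. lab Y v) \<in> borel_measurable envM"
 unfolding lab_def envM_def by measurable

lemma cnt_actz: "cnt (actz \<gamma> Y) b = act_field \<gamma> (cnt Y b)"
 by (simp add: cnt_def actz_def)

lemma lab_actz: "lab (actz \<gamma> Y) = act_field \<gamma> (lab Y)"
 by (simp add: lab_def actz_def)

text \<open>What the construction of the matching uses of the law of multiplicities and labels. The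
  gap is demanded for exactly equivariant predicates. As functions of the points the labels are
  equivariant only almost surely, so they are carried along as part of the environment, on which the
  automorphisms act exactly.\<close>

locale env = nonamenable_graph E + prob_space D
 for E :: "'v \<Rightarrow> 'v \<Rightarrow> bool" and D :: "'v env measure" +
 assumes sets_D: "sets D = sets envM"
  and D_inv: "aut \<gamma> \<Longrightarrow> distr D D (actz \<gamma>) = D"
  and D_mgf: "s \<in> {1, -1} \<Longrightarrow> finite W \<Longrightarrow>
   (\<integral>\<^sup>+Y. ennreal (exp (s * real (\<Sum>u\<in>W. cnt Y b u))) \<partial>D) \<le> ennreal (exp ((exp s - 1) * real (card W)))"
  and D_mean: "(\<integral>\<^sup>+Y. of_nat (cnt Y b u) \<partial>D) = 1"
  and D_gap: "(\<And>u. Measurable.pred D (\<lambda>Y. S Y u)) \<Longrightarrow>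
   (\<And>\<gamma> Y u. aut \<gamma> \<Longrightarrow> S (actz \<gamma> Y) (\<gamma> u) = S Y u) \<Longrightarrow>
   measure D {Y. S Y z} \<le> measure D {Y. \<exists>u\<in>gball E z k. S Y u} * (measure D {Y. S Y z} + lam ^ k)"
  and D_inj: "AE Y in D. inj (lab Y)"

context emission begin

definition gx :: "('v \<Rightarrow> 'v) \<Rightarrow> (bool \<times> 'v \<Rightarrow> 'v \<times> nat) \<Rightarrow> bool \<times> 'v \<Rightarrow> 'v \<times> nat" where
 "gx \<gamma> x = (\<lambda>(b, v). map_prod \<gamma> id (x (b, inv \<gamma> v)))"

lemma gx_measurable [measurable]: "gx \<gamma> \<in> mu \<rightarrow>\<^sub>M mu"
proof (rule measurable_into_mu)
 fix i :: "bool \<times> 'v"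
 have "(\<lambda>x. map_prod \<gamma> id (x (fst i, inv \<gamma> (snd i)))) \<in> mu \<rightarrow>\<^sub>M count_space UNIV"
  by (rule measurable_compose[OF measurable_coord]) simp
 then show "(\<lambda>x. gx \<gamma> x i) \<in> mu \<rightarrow>\<^sub>M count_space UNIV" by (cases i) (simp add: gx_def)
qed

lemma distr_gx: assumes g: "aut \<gamma>" shows "distr mu mu (gx \<gamma>) = mu"
proof (rule mu_eqI)
 interpret G: prob_space "distr mu mu (gx \<gamma>)" by (rule M.prob_space_distr) simp
 show "finite_measure (distr mu mu (gx \<gamma>))" by unfold_locales
 fix J :: "(bool \<times> 'v) set" and A :: "bool \<times> 'v \<Rightarrow> ('v \<times> nat) set" assume J: "finite J"
 let ?J = "gi (inv \<gamma>) ` J"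
 let ?A = "\<lambda>i. map_prod \<gamma> id -` A (gi \<gamma> i)"
 have gg: "gi \<gamma> (gi (inv \<gamma>) i) = i" for i using g by (cases i) (simp add: gi_def)
 have "gx \<gamma> -` {x. \<forall>i\<in>J. x i \<in> A i} = {x. \<forall>i\<in>?J. x i \<in> ?A i}"
  by (auto simp: gx_def gi_def g)
 then have "emeasure (distr mu mu (gx \<gamma>)) {x. \<forall>i\<in>J. x i \<in> A i} = emeasure mu {x. \<forall>i\<in>?J. x i \<in> ?A i}"
  using J by (subst emeasure_distr) simp_all
 also have "\<dots> = (\<Prod>i\<in>?J. emeasure (measure_pmf (q i)) (?A i))" using J by (intro emeasure_cylinder) simp
 also have "\<dots> = (\<Prod>i\<in>J. emeasure (measure_pmf (q (gi (inv \<gamma>) i))) (?A (gi (inv \<gamma>) i)))"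
  using gi_inj[OF aut_inv[OF g]] by (subst prod.reindex) (auto intro: inj_on_subset)
 also have "\<dots> = (\<Prod>i\<in>J. emeasure (measure_pmf (q i)) (A i))"
 proof (intro prod.cong refl)
  fix i :: "bool \<times> 'v"
  obtain b v where i: "i = (b, v)" by (cases i)
  have "emeasure (measure_pmf (q (gi (inv \<gamma>) i))) (?A (gi (inv \<gamma>) i)) = emeasure (measure_pmf (map_pmf (map_prod \<gamma> id) (q (b, inv \<gamma> v)))) (A i)"
   unfolding gg i gi_def using g by simp
  also have "map_pmf (map_prod \<gamma> id) (q (b, inv \<gamma> v)) = q i" using q_aut[OF g, of b "inv \<gamma> v"] g i by simp
  finally show "emeasure (measure_pmf (q (gi (inv \<gamma>) i))) (?A (gi (inv \<gamma>) i)) = emeasure (measure_pmf (q i)) (A i)" .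
 qed
 finally show "emeasure (distr mu mu (gx \<gamma>)) {x. \<forall>i\<in>J. x i \<in> A i} = (\<Prod>i\<in>J. emeasure (measure_pmf (q i)) (A i))" .
qed simp

lemma tot_gx: assumes g: "aut \<gamma>" shows "tot (gx \<gamma> x) b = act_field \<gamma> (tot x b)"
proof
 fix u
 let ?X = "{(v, j). fst (x (b, v)) = inv \<gamma> u \<and> j < snd (x (b, v))}"
 have u: "\<gamma> a = u \<longleftrightarrow> a = inv \<gamma> u" for a using g by (metis aut_apply_inv)
 have "{(v, j). fst (gx \<gamma> x (b, v)) = u \<and> j < snd (gx \<gamma> x (b, v))} = map_prod \<gamma> id ` ?X"
 proof (intro set_eqI iffI)
  fix p assume "p \<in> {(v, j). fst (gx \<gamma> x (b, v)) = u \<and> j < snd (gx \<gamma> x (b, v))}"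
  then have "(inv \<gamma> (fst p), snd p) \<in> ?X" by (auto simp: gx_def u)
  then have "map_prod \<gamma> id (inv \<gamma> (fst p), snd p) \<in> map_prod \<gamma> id ` ?X" by (rule imageI)
  then show "p \<in> map_prod \<gamma> id ` ?X" using g by simp
 next
  fix p assume "p \<in> map_prod \<gamma> id ` ?X"
  then show "p \<in> {(v, j). fst (gx \<gamma> x (b, v)) = u \<and> j < snd (gx \<gamma> x (b, v))}"
   using g by (auto simp: gx_def)
 qed
 moreover have "inj_on (map_prod \<gamma> id) ?X"
  using prod.inj_map[OF aut_inj[OF g] inj_on_id] by (rule inj_on_subset) simp
 ultimately show "tot (gx \<gamma> x) b u = act_field \<gamma> (tot x b) u"
  unfolding tot_def act_field_def by (simp add: card_image)
qed

lemma mrg_gx: assumes g: "aut \<gamma>" shows "mrg (gi \<gamma> ` I) (gx \<gamma> x) (gx \<gamma> y) = gx \<gamma> (mrg I x y)"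
proof
 fix i :: "bool \<times> 'v"
 obtain b v where i: "i = (b, v)" by (cases i)
 have "i \<in> gi \<gamma> ` I \<longleftrightarrow> (b, inv \<gamma> v) \<in> I"
 proof
  assume "i \<in> gi \<gamma> ` I"
  then show "(b, inv \<gamma> v) \<in> I" using g i by (auto simp: gi_def)
 next
  assume "(b, inv \<gamma> v) \<in> I"
  then have "gi \<gamma> (b, inv \<gamma> v) \<in> gi \<gamma> ` I" by (rule imageI)
  then show "i \<in> gi \<gamma> ` I" using g i by (simp add: gi_def)
 qed
 then show "mrg (gi \<gamma> ` I) (gx \<gamma> x) (gx \<gamma> y) i = gx \<gamma> (mrg I x y) i"
  by (simp add: mrg_def gx_def i)
qed

lemma IP_AE: assumes "AE x in mu. F x = F' x" "bm F" "bm F'" "bm H" shows "IP F H = IP F' H"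
 unfolding IP_def
proof (rule integral_cong_AE)
 show "AE x in mu. F x * H x = F' x * H x" using assms(1) by eventually_elim simp
qed (use assms in \<open>auto simp: bm_def\<close>)

text \<open>Change of variables by \<open>gx\<close>, which preserves \<open>mu\<close> and commutes
  with resampling. Equivariance enters only inside integrals, so it may fail on null sets.\<close>

lemma IP_cross:
 assumes g: "aut \<gamma>" and b: "bm F" "bm G" "bm F'" "bm G'"
  and F: "AE x in mu. F' (gx \<gamma> x) = F x" and G: "AE x in mu. G' (gx \<gamma> x) = G x"
 shows "IP F' (EI (gi \<gamma> ` I) G') = IP F (EI I G)"
proof -
 have int: "(\<integral>x. H x \<partial>mu) = (\<integral>x. H (gx \<gamma> x) \<partial>mu)" if "bm H" for H
 proof -
  have "(\<integral>x. H x \<partial>mu) = (\<integral>x. H x \<partial>distr mu mu (gx \<gamma>))" by (simp add: distr_gx[OF g])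
  also have "\<dots> = (\<integral>x. H (gx \<gamma> x) \<partial>mu)" using that by (intro integral_distr) (auto simp: bm_def)
  finally show ?thesis .
 qed
 have bg: "bm (\<lambda>x. H (gx \<gamma> x))" if "bm H" for H using that by (auto simp: bm_def)
 have E: "EI (gi \<gamma> ` I) G' (gx \<gamma> x) = EI I (\<lambda>x. G' (gx \<gamma> x)) x" for x
  unfolding EI_def using int[OF bm_mrg[OF b(4)], of "gi \<gamma> ` I" "gx \<gamma> x"] by (simp add: mrg_gx[OF g])
 have "IP F' (EI (gi \<gamma> ` I) G') = IP (\<lambda>x. F' (gx \<gamma> x)) (EI I (\<lambda>x. G' (gx \<gamma> x)))"
  unfolding IP_def using int[OF bm_mult[OF b(3) bm_EI[OF b(4)]]] by (simp add: E)
 also have "\<dots> = IP F (EI I (\<lambda>x. G' (gx \<gamma> x)))"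
  by (rule IP_AE[OF F bg[OF b(3)] b(1) bm_EI[OF bg[OF b(4)]]])
 also have "\<dots> = IP (\<lambda>x. G' (gx \<gamma> x)) (EI I F)"
  using IP_EI_adj[OF b(1) bg[OF b(4)]] IP_sym by metis
 also have "\<dots> = IP G (EI I F)" by (rule IP_AE[OF G bg[OF b(4)] b(2) bm_EI[OF b(1)]])
 also have "\<dots> = IP F (EI I G)" using IP_EI_adj[OF b(1) b(2)] IP_sym by metis
 finally show ?thesis .
qed

text \<open>For the gap, the event pulled back along \<open>e\<close> is equivariant only up to null
  sets, since \<open>f\<close> is; \<open>IP_cross\<close> shows that this suffices for
  \<open>eqv\<close>.\<close>

lemma env_emission:
 assumes f: "f \<in> config_space \<Otimes>\<^sub>M config_space \<rightarrow>\<^sub>M (\<Pi>\<^sub>M v\<in>UNIV. borel :: real measure)"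
  and f_eqv: "\<And>\<gamma>. aut \<gamma> \<Longrightarrow> AE x in mu. f (act_field \<gamma> (tot x True), act_field \<gamma> (tot x False)) = act_field \<gamma> (f (tot x True, tot x False))"
  and f_inj: "AE x in mu. inj (f (tot x True, tot x False))"
 defines "e \<equiv> \<lambda>x. (tot x True, tot x False, f (tot x True, tot x False))"
 shows "env E (distr mu envM e)"
proof -
 have t [measurable]: "(\<lambda>x. tot x b) \<in> mu \<rightarrow>\<^sub>M config_space" for b by (rule measurable_into_config[OF tot_measurable])
 note f[measurable]
 have e [measurable]: "e \<in> mu \<rightarrow>\<^sub>M envM" unfolding e_def envM_def by measurable
 let ?D = "distr mu envM e"
 have ce: "cnt (e x) b = tot x b" for x b by (simp add: e_def cnt_def)
 have eg: "AE x in mu. e (gx \<gamma> x) = actz \<gamma> (e x)" if "aut \<gamma>" for \<gamma>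
  using f_eqv[OF that] by eventually_elim (simp add: e_def actz_def tot_gx[OF that])
 have mD: "measure ?D {Y. Q Y} = measure mu {x. Q (e x)}" if "Measurable.pred envM Q" for Q
  using that by (subst measure_distr) (auto simp: vimage_def pred_def)
 show ?thesis
 proof (intro env.intro env_axioms.intro)
  show "nonamenable_graph E" by unfold_locales
  show "prob_space ?D" by (rule M.prob_space_distr) simp
  show "sets ?D = sets envM" by simp
  fix \<gamma> assume g: "aut \<gamma>"
  have "distr ?D ?D (actz \<gamma>) = distr ?D envM (actz \<gamma>)" by (rule distr_cong) simp_all
  also have "\<dots> = distr mu envM (\<lambda>x. actz \<gamma> (e x))" by (subst distr_distr) (simp_all add: o_def)
  also have "\<dots> = distr mu envM (\<lambda>x. e (gx \<gamma> x))"
   using eg[OF g] by (intro distr_cong_AE) (auto elim!: eventually_mono)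
  also have "\<dots> = distr (distr mu mu (gx \<gamma>)) envM e" by (subst distr_distr) (simp_all add: o_def)
  finally show "distr ?D ?D (actz \<gamma>) = ?D" by (simp add: distr_gx[OF g])
 next
  fix s :: real and W :: "'v set" and b assume s: "s \<in> {1, -1}" and W: "finite W"
  have "(\<integral>\<^sup>+Y. ennreal (exp (s * real (\<Sum>u\<in>W. cnt Y b u))) \<partial>?D) = (\<integral>\<^sup>+x. ennreal (exp (s * real (\<Sum>u\<in>W. tot x b u))) \<partial>mu)"
   by (subst nn_integral_distr) (simp_all add: ce)
  then show "(\<integral>\<^sup>+Y. ennreal (exp (s * real (\<Sum>u\<in>W. cnt Y b u))) \<partial>?D) \<le> ennreal (exp ((exp s - 1) * real (card W)))"
   using tot_mgf[OF s W] by simp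
 next
  fix b u
  have "(\<integral>\<^sup>+Y. of_nat (cnt Y b u) \<partial>?D) = (\<integral>\<^sup>+x. of_nat (tot x b u) \<partial>mu)"
   by (subst nn_integral_distr) (simp_all add: ce)
  then show "(\<integral>\<^sup>+Y. of_nat (cnt Y b u) \<partial>?D) = 1" by (simp add: tot_mean)
 next
  fix S :: "'v env \<Rightarrow> 'v \<Rightarrow> bool" and z k
  assume S: "\<And>u. Measurable.pred ?D (\<lambda>Y. S Y u)"
   and Si: "\<And>\<gamma> Y u. aut \<gamma> \<Longrightarrow> S (actz \<gamma> Y) (\<gamma> u) = S Y u"
  have S' [measurable]: "Measurable.pred envM (\<lambda>Y. S Y u)" for u using S[of u] by simp
  define T where "T u = {x. S (e x) u}" for u
  have "{x \<in> space mu. S (e x) u} \<in> sets mu" for u by measurable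
  then have T: "T u \<in> sets mu" for u by (simp add: T_def)
  have Tg: "AE x in mu. indicator (T (\<gamma> u)) (gx \<gamma> x) = (indicator (T u) x :: real)" if "aut \<gamma>" for \<gamma> u
   using eg[OF that] by eventually_elim (simp add: T_def indicator_def Si[OF that])
  have eq: "eqv (\<lambda>u. indicator (T u))"
   unfolding eqv_def
  proof (intro conjI allI impI)
   show "bm (indicator (T u))" for u by (rule bm_indicator[OF T])
   show "appr KK (indicator (T u))" for u by (rule appr_indicator[OF KK(4) T])
   show "(\<integral>x. (indicator (T u) x :: real) \<partial>mu) = (\<integral>x. indicator (T w) x \<partial>mu)" for u w
   proof -
    obtain \<gamma> where g: "aut \<gamma>" "\<gamma> w = u" using ex_aut by blast
    have "(\<integral>x. (indicator (T u) x :: real) \<partial>mu) = (\<integral>x. indicator (T u) x \<partial>distr mu mu (gx \<gamma>))" by (simp add: distr_gx[OF g(1)])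
    also have "\<dots> = (\<integral>x. indicator (T u) (gx \<gamma> x) \<partial>mu)" using T by (intro integral_distr) auto
    also have "\<dots> = (\<integral>x. indicator (T w) x \<partial>mu)"
     using Tg[OF g(1), of w] T g(2) by (intro integral_cong_AE) auto
    finally show ?thesis .
   qed
   show "IP (indicator (T (\<gamma> u))) (EI (gi \<gamma> ` I) (indicator (T (\<gamma> w)))) = IP (indicator (T u)) (EI I (indicator (T w)))"
    if "aut \<gamma>" "finite I" for \<gamma> u w I
    by (rule IP_cross[OF that(1) bm_indicator[OF T] bm_indicator[OF T] bm_indicator[OF T] bm_indicator[OF T] Tg[OF that(1)] Tg[OF that(1)]])
  qed
  have m2: "Measurable.pred envM (\<lambda>Y. \<exists>u\<in>gball E z k. S Y u)" by (intro pred_intros_finite S') simp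
  have "(\<Union>u\<in>gball E z k. T u) = {x. \<exists>u\<in>gball E z k. S (e x) u}" by (auto simp: T_def)
  then show "measure ?D {Y. S Y z} \<le> measure ?D {Y. \<exists>u\<in>gball E z k. S Y u} * (measure ?D {Y. S Y z} + lam ^ k)"
   using spectral_gap[OF T eq, of z k] by (simp add: mD[OF S'] mD[OF m2] T_def)
 next
  have eq: "inj (lab Y) \<longleftrightarrow> (\<forall>p\<in>UNIV \<times> UNIV. lab Y (fst p) = lab Y (snd p) \<longrightarrow> fst p = snd p)" for Y :: "'v env"
   by (auto simp: inj_def)
  have cU: "countable (UNIV \<times> UNIV :: ('v \<times> 'v) set)" by (intro countable_SIGMA countable_V)
  have "Measurable.pred envM (\<lambda>Y :: 'v env. \<forall>p\<in>UNIV \<times> UNIV. lab Y (fst p) = lab Y (snd p) \<longrightarrow> fst p = snd p)"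
   by (intro pred_Ball_countable[OF cU]) measurable
  then have "{Y \<in> space envM. \<forall>p\<in>UNIV \<times> UNIV. lab Y (fst p) = lab Y (snd p) \<longrightarrow> fst p = snd p} \<in> sets (envM :: 'v env measure)"
   unfolding pred_def .
  then have "{Y \<in> space envM. inj (lab Y)} \<in> sets (envM :: 'v env measure)" unfolding eq .
  then show "AE Y in ?D. inj (lab Y)"
   using f_inj by (subst AE_distr_iff[OF e]) (simp_all add: lab_def e_def)
 qed
qed

end

context env begin

lemma space_D [simp]: "space D = UNIV"
 using sets_eq_imp_space_eq[OF sets_D] by simp

lemma cnt_D [measurable]: "(\<lambda>Y. cnt Y b v) \<in> D \<rightarrow>\<^sub>M count_space UNIV"
 using cnt_measurable by (subst measurable_cong_sets[OF sets_D refl])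

lemma lab_D [measurable]: "(\<lambda>Y. lab Y v) \<in> borel_measurable D"
 using lab_measurable by (subst measurable_cong_sets[OF sets_D refl])

lemma actz_D [measurable]: "actz \<gamma> \<in> D \<rightarrow>\<^sub>M D"
 using actz_measurable by (subst measurable_cong_sets[OF sets_D sets_D])

lemma pred_sets: "Measurable.pred D Q \<Longrightarrow> {Y. Q Y} \<in> events"
 by (simp add: pred_def)

definition csum :: "'v env \<Rightarrow> bool \<Rightarrow> 'v set \<Rightarrow> nat" where
 "csum Y b W = (\<Sum>u\<in>W. cnt Y b u)"

lemma csum_D [measurable]: "(\<lambda>Y. csum Y b W) \<in> D \<rightarrow>\<^sub>M count_space UNIV"
 unfolding csum_def by measurable

lemma csum_mono: "finite B \<Longrightarrow> A \<subseteq> B \<Longrightarrow> csum Y b A \<le> csum Y b B"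
 unfolding csum_def by (rule sum_mono2) auto

lemma csum_actz: assumes "aut \<gamma>" shows "csum (actz \<gamma> Y) b (\<gamma> ` W) = csum Y b W"
 unfolding csum_def cnt_actz act_field_def using assms
 by (subst sum.reindex) (auto intro: inj_on_subset[OF aut_inj])

text \<open>Chernoff bound: \<open>s = 1\<close> gives the upper tail, \<open>s = -1\<close> the
  lower one.\<close>

lemma markov_exp:
 assumes s: "s \<in> {1, -1}" and W: "finite W"
 shows "prob {Y. s * real (csum Y b W) \<ge> t} \<le> exp ((exp s - 1) * real (card W) - t)"
proof -
 let ?X = "\<lambda>Y. ennreal (exp (s * real (csum Y b W)))"
 have m: "(\<lambda>Y. ?X Y * indicator (space D) Y) \<in> borel_measurable D" by measurable
 have "emeasure D {Y. s * real (csum Y b W) \<ge> t} \<le> emeasure D {Y \<in> space D. 1 \<le> ennreal (exp (- t)) * ?X Y}"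
 proof (intro emeasure_mono)
  show "{Y \<in> space D. 1 \<le> ennreal (exp (- t)) * ?X Y} \<in> events" by measurable
  show "{Y. s * real (csum Y b W) \<ge> t} \<subseteq> {Y \<in> space D. 1 \<le> ennreal (exp (- t)) * ?X Y}"
   by (auto simp: ennreal_mult[symmetric] exp_add[symmetric] simp flip: ennreal_1 intro!: ennreal_leI)
 qed
 also have "\<dots> \<le> ennreal (exp (- t)) * (\<integral>\<^sup>+Y. ?X Y \<partial>D)"
  using nn_integral_Markov_inequality[OF m sets.top, of "ennreal (exp (- t))"] by simp
 also have "\<dots> \<le> ennreal (exp (- t)) * ennreal (exp ((exp s - 1) * real (card W)))"
  using D_mgf[OF s W, of b] unfolding csum_def by (intro mult_left_mono) auto
 also have "\<dots> = ennreal (exp ((exp s - 1) * real (card W) - t))"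
  by (simp add: ennreal_mult[symmetric] exp_add[symmetric])
 finally show ?thesis by (simp add: emeasure_eq_measure)
qed

end

lemma exp1_bounds: "exp 1 - 1 \<le> (2::real)" "exp (- 1) - 1 \<le> (- 1 / 2 :: real)"
proof -
 show "exp 1 - 1 \<le> (2::real)" using exp_le by simp
 have "exp 1 \<ge> (2::real)" using exp_ge_add_one_self[of 1] by simp
 then have "exp (- 1) \<le> (1 / 2 :: real)" by (simp add: exp_minus divide_simps)
 then show "exp (- 1) - 1 \<le> (- 1 / 2 :: real)" by simp
qed

section \<open>Bad sets\<close>

text \<open>\<open>Lc_large\<close> makes badness rare enough to beat the entropy of connected sets
  at scale \<open>DD\<close>, which is linear in \<open>rho\<close>; it is tuned to give
  \<open>aa / 4 - c1 - c2 \<ge> 2\<close>. By \<open>rho_large\<close> at least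
  \<open>14 * Lc\<close> points per vertex of a set are expected in its
  \<open>rho\<close>-neighbourhood, so that finding fewer than \<open>6 * Lc\<close> is a deviation
  costing \<open>Lc\<close> in the exponent.\<close>

locale env1 = env E D for E :: "'v \<Rightarrow> 'v \<Rightarrow> bool" and D +
 fixes rho Lc :: nat and \<kappa> :: real
 assumes kappa: "\<kappa> = ln (real (bsize 1))"
  and rho_large: "(1 + hh) ^ rho \<ge> 14 * real Lc"
  and Lc_large: "real Lc \<ge> 14 + 28 * \<kappa> + 24 * \<kappa> * real rho"
begin

text \<open>Sets whose \<open>rho\<close>-neighbourhoods meet are within \<open>2 * rho\<close> of
  each other; the extra one fits the form of \<open>conn_gball\<close>.\<close>

definition DD :: nat where "DD = 2 * rho + 1"

text \<open>Common rate per vertex of the two Chernoff bounds: the upper tail gives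
  \<open>Lc - (exp 1 - 1)\<close>, which is at least \<open>Lc - 2\<close>, and the lower tail gives
  \<open>Lc\<close>.\<close>

definition aa :: real where "aa = real Lc - 2"

definition bad1 :: "'v env \<Rightarrow> bool \<Rightarrow> 'v set \<Rightarrow> bool" where
 "bad1 Y b W \<longleftrightarrow> csum Y (\<not> b) (nbhd W rho) < 6 * Lc * card W"

definition bad2 :: "'v env \<Rightarrow> bool \<Rightarrow> 'v set \<Rightarrow> bool" where
 "bad2 Y b W \<longleftrightarrow> csum Y b W > Lc * card W"

definition bad :: "'v env \<Rightarrow> bool \<Rightarrow> 'v set \<Rightarrow> bool" where
 "bad Y b W \<longleftrightarrow> bad1 Y b W \<or> bad2 Y b W"

lemma bad_measurable [measurable]:
 "Measurable.pred D (\<lambda>Y. bad1 Y b W)" "Measurable.pred D (\<lambda>Y. bad2 Y b W)"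
 "Measurable.pred D (\<lambda>Y. bad Y b W)"
 unfolding bad_def bad1_def bad2_def by measurable

lemma bad_actz: assumes "aut \<gamma>" shows "bad (actz \<gamma> Y) b (\<gamma> ` W) = bad Y b W"
proof -
 have "card (\<gamma> ` W) = card W" using aut_inj[OF assms] by (metis card_image inj_on_subset subset_UNIV)
 then show ?thesis unfolding bad_def bad1_def bad2_def aut_nbhd[OF assms] csum_actz[OF assms] by simp
qed

lemma kappa_pos: "\<kappa> > 0"
 unfolding kappa using bsize_ge[of 1] by simp

lemma bsize_exp: "real (bsize r) \<le> exp (\<kappa> * real r)"
proof -
 have "real (bsize r) \<le> real (bsize 1) ^ r" using bsize_le_power[of r] by (metis of_nat_le_iff of_nat_power)
 also have "\<dots> = exp (\<kappa> * real r)"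
  unfolding kappa using bsize_ge[of 1] by (simp add: exp_of_nat2_mult)
 finally show ?thesis .
qed

text \<open>The threshold is non-strict, so that the bound applies to unions of bad sets, for which
  the defining inequality survives summation even over an empty family.\<close>

lemma prob_weak1:
 assumes "finite W"
 shows "prob {Y. csum Y (\<not> b) (nbhd W rho) \<le> 6 * Lc * card W} \<le> exp (- aa * real (card W))"
proof -
 have eq: "csum Y (\<not> b) (nbhd W rho) \<le> 6 * Lc * card W \<longleftrightarrow>
  (- 1) * real (csum Y (\<not> b) (nbhd W rho)) \<ge> - (6 * real Lc * real (card W))" for Y
 proof -
  have "csum Y (\<not> b) (nbhd W rho) \<le> 6 * Lc * card W \<longleftrightarrow> real (csum Y (\<not> b) (nbhd W rho)) \<le> real (6 * Lc * card W)"
   by (simp only: of_nat_le_iff)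
  then show ?thesis by simp
 qed
 have "prob {Y. (- 1) * real (csum Y (\<not> b) (nbhd W rho)) \<ge> - (6 * real Lc * real (card W))}
  \<le> exp ((exp (- 1) - 1) * real (card (nbhd W rho)) - (- (6 * real Lc * real (card W))))"
  using assms by (intro markov_exp) auto
 also have "\<dots> \<le> exp (- aa * real (card W))"
 proof -
  have "14 * real Lc * real (card W) \<le> (1 + hh) ^ rho * real (card W)"
   using rho_large by (intro mult_right_mono) auto
  also have "\<dots> \<le> real (card (nbhd W rho))" by (rule card_nbhd_ge[OF assms])
  finally have "(exp (- 1) - 1) * real (card (nbhd W rho)) \<le> (- 1 / 2) * (14 * real Lc * real (card W))"
   using exp1_bounds(2) by (intro order_trans[OF mult_right_mono[OF exp1_bounds(2)]]) auto
  then show ?thesis by (simp add: aa_def algebra_simps)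
 qed
 finally show ?thesis unfolding eq .
qed

lemma prob_weak2:
 assumes "finite W"
 shows "prob {Y. csum Y b W \<ge> Lc * card W} \<le> exp (- aa * real (card W))"
proof -
 have eq: "csum Y b W \<ge> Lc * card W \<longleftrightarrow> 1 * real (csum Y b W) \<ge> real Lc * real (card W)" for Y
  by (simp flip: of_nat_mult)
 have "prob {Y. 1 * real (csum Y b W) \<ge> real Lc * real (card W)}
  \<le> exp ((exp 1 - 1) * real (card W) - real Lc * real (card W))"
  using assms by (intro markov_exp) auto
 also have "\<dots> \<le> exp (- aa * real (card W))"
  using mult_right_mono[OF exp1_bounds(1), of "real (card W)"] by (simp add: aa_def algebra_simps)
 finally show ?thesis unfolding eq .
qed

lemma aa_pos: "aa \<ge> 12 + 28 * \<kappa> + 24 * \<kappa> * real rho"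
 using Lc_large by (simp add: aa_def)

lemma aa_ge0: "aa \<ge> 0"
proof -
 have "\<kappa> * real rho \<ge> 0" using kappa_pos by simp
 then show ?thesis using aa_pos kappa_pos by linarith
qed

lemma csum_UN_le:
 assumes "finite J" "\<And>i. i \<in> J \<Longrightarrow> finite (A i)"
 shows "csum Y b (\<Union>i\<in>J. A i) \<le> (\<Sum>i\<in>J. csum Y b (A i))"
 using assms
proof (induction J rule: finite_induct)
 case empty then show ?case by (simp add: csum_def)
next
 case (insert i J)
 have "csum Y b (A i \<union> (\<Union>i\<in>J. A i)) \<le> csum Y b (A i) + csum Y b (\<Union>i\<in>J. A i)"
  unfolding csum_def using insert sum.union_inter[of "A i" "\<Union>i\<in>J. A i" "cnt Y b"] by auto
 then show ?case using insert by simp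
qed

text \<open>The bound comes without independence of the events: shortages in the
  \<open>rho\<close>-neighbourhoods are preserved under unions, and surpluses on disjoint sets add
  up, so the union of all sets of one type is itself deviant. One of the two types carries half of
  the total size, which halves the rate; \<open>2 ^ card I\<close> counts the ways to divide the
  family.\<close>

lemma prob_disjoint_bad:
 assumes I: "finite I" and fin: "\<And>i. i \<in> I \<Longrightarrow> finite (W i)" and disj: "disjoint_family_on W I"
 shows "prob {Y. \<forall>i\<in>I. bad Y b (W i)} \<le> 2 ^ card I * exp (- aa / 2 * real (\<Sum>i\<in>I. card (W i)))"
proof -
 let ?N = "\<lambda>J. \<Sum>i\<in>J. card (W i)"
 let ?U = "\<lambda>J. \<Union>i\<in>J. W i"
 have card: "card (?U J) = ?N J" if "J \<subseteq> I" for J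
  using that I fin by (intro card_UN_disjoint' disjoint_family_on_mono[OF that disj]) (auto intro: finite_subset)
 have fU: "finite (?U J)" if "J \<subseteq> I" for J using that I fin by (auto intro: finite_subset)
 \<comment> \<open>\<open>J\<close> stands for the members with too few points of the other side
   nearby. Whichever of the two unions has at least half of the vertices is used.\<close>
 let ?A = "\<lambda>J. {Y. if ?N I \<le> 2 * ?N J then csum Y (\<not> b) (nbhd (?U J) rho) \<le> 6 * Lc * card (?U J)
   else csum Y b (?U (I - J)) \<ge> Lc * card (?U (I - J))}"
 have half: "exp (- aa * real n) \<le> exp (- aa / 2 * real (?N I))" if "?N I \<le> 2 * n" for n
 proof -
  have "real (?N I) \<le> 2 * real n" using that by (metis of_nat_le_iff of_nat_mult of_nat_numeral)
  then show ?thesis using aa_ge0 mult_left_mono[of "real (?N I)" "2 * real n" aa] by simp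
 qed
 have bound: "prob (?A J) \<le> exp (- aa / 2 * real (?N I))" if J: "J \<subseteq> I" for J
 proof (cases "?N I \<le> 2 * ?N J")
  case True
  have "prob (?A J) \<le> exp (- aa * real (?N J))" using prob_weak1[OF fU[OF J], of b] card[OF J] True by simp
  also have "\<dots> \<le> exp (- aa / 2 * real (?N I))" by (rule half[OF True])
  finally show ?thesis .
 next
  case False
  have "?N I = ?N (I - J) + ?N J" using I J by (simp add: sum.subset_diff)
  then have le: "?N I \<le> 2 * ?N (I - J)" using False by linarith
  have "prob (?A J) \<le> exp (- aa * real (?N (I - J)))"
   using prob_weak2[OF fU[of "I - J"], of b] card[of "I - J"] False by auto
  also have "\<dots> \<le> exp (- aa / 2 * real (?N I))" by (rule half[OF le])
  finally show ?thesis .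
 qed
 have sub: "{Y. \<forall>i\<in>I. bad Y b (W i)} \<subseteq> (\<Union>J\<in>Pow I. ?A J)"
 proof
  fix Y assume "Y \<in> {Y. \<forall>i\<in>I. bad Y b (W i)}"
  then have al: "\<forall>i\<in>I. bad Y b (W i)" by simp
  define J where "J = {i\<in>I. bad1 Y b (W i)}"
  have JI: "J \<subseteq> I" and fJ: "finite J" using I by (auto simp: J_def)
  have "csum Y (\<not> b) (nbhd (?U J) rho) \<le> (\<Sum>i\<in>J. csum Y (\<not> b) (nbhd (W i) rho))"
  proof -
   have "nbhd (?U J) rho = (\<Union>i\<in>J. nbhd (W i) rho)" by (auto simp: nbhd_def)
   then show ?thesis using fJ JI fin by (simp only:) (intro csum_UN_le; auto)
  qed
  also have "\<dots> \<le> (\<Sum>i\<in>J. 6 * Lc * card (W i))"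
   by (intro sum_mono) (auto simp: J_def bad1_def)
  also have "\<dots> = 6 * Lc * card (?U J)" using card[OF JI] by (simp add: sum_distrib_left)
  finally have 1: "csum Y (\<not> b) (nbhd (?U J) rho) \<le> 6 * Lc * card (?U J)" .
  have "Lc * card (?U (I - J)) = (\<Sum>i\<in>I - J. Lc * card (W i))" using card[of "I - J"] by (simp add: sum_distrib_left)
  also have "\<dots> \<le> (\<Sum>i\<in>I - J. csum Y b (W i))"
   using al by (intro sum_mono) (auto simp: J_def bad_def bad2_def)
  also have "\<dots> = csum Y b (?U (I - J))"
   unfolding csum_def using I fin disj by (subst sum.UNION_disjoint) (auto simp: disjoint_family_on_def)
  finally have 2: "Lc * card (?U (I - J)) \<le> csum Y b (?U (I - J))" .
  show "Y \<in> (\<Union>J\<in>Pow I. ?A J)" using 1 2 JI by (intro UN_I[of J]) auto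
 qed
 have mA: "?A J \<in> events" for J by (cases "?N I \<le> 2 * ?N J") (simp_all add: pred_sets)
 have "prob {Y. \<forall>i\<in>I. bad Y b (W i)} \<le> prob (\<Union>J\<in>Pow I. ?A J)"
  by (rule finite_measure_mono[OF sub], rule sets.finite_UN) (use I mA in blast)+
 also have "\<dots> \<le> (\<Sum>J\<in>Pow I. prob (?A J))"
  by (rule finite_measure_subadditive_finite) (use I mA in blast)+
 also have "\<dots> \<le> (\<Sum>J\<in>Pow I. exp (- aa / 2 * real (?N I)))" by (intro sum_mono bound) auto
 also have "\<dots> = 2 ^ card I * exp (- aa / 2 * real (?N I))" using I by (simp add: card_Pow)
 finally show ?thesis .
qed

lemma prob_bad: assumes "finite W" shows "prob {Y. bad Y b W} \<le> 2 * exp (- aa / 2 * real (card W))"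
 using prob_disjoint_bad[of "{()}" "\<lambda>_. W" b] assms by (simp add: disjoint_family_on_def)

end

lemma exp2_ge: "exp (2::real) \<ge> 16 / 3"
proof -
 have "exp 1 \<ge> (5/2::real)" using exp_lower_Taylor_quadratic[of 1] by simp
 then have "exp 1 * exp 1 \<ge> (5/2 * (5/2) :: real)" by (intro mult_mono) auto
 then show ?thesis by (simp add: exp_add[symmetric])
qed

text \<open>Geometric series of ratio at most 1/4. Giving up 2 in the rate buys the prefactor 1/4,
  which in \<open>prob_ext\<close> absorbs the factor 2 per chain step and leaves a further
  1/2.\<close>

lemma (in prob_space) prob_UN_exp:
 assumes B: "\<And>n. n \<ge> m \<Longrightarrow> B n \<in> events" "\<And>n. n \<ge> m \<Longrightarrow> prob (B n) \<le> C * exp (- t * real n)"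
  and t: "t \<ge> 2" and m: "m \<ge> 1" and C: "C \<ge> 0"
 shows "prob (\<Union>n\<in>{m..}. B n) \<le> C / 4 * exp (- (t - 2) * real m)"
proof -
 let ?x = "exp (- t)"
 have x: "0 < ?x" "?x \<le> 1 / 4"
 proof -
  have "?x \<le> exp (- 2)" using t by simp
  also have "\<dots> \<le> 1 / 4" using exp2_ge by (simp add: exp_minus divide_simps)
  finally show "?x \<le> 1 / 4" .
 qed simp
 have "{m..} = range (\<lambda>k. m + k)" by (auto simp: le_iff_add)
 then have "(\<Union>n\<in>{m..}. B n) = (\<Union>k. B (m + k))" by simp
 moreover have s: "summable (\<lambda>k. C * exp (- t * real m) * ?x ^ k)"
  using x t by (intro summable_mult summable_geometric) auto
 moreover have le: "prob (B (m + k)) \<le> C * exp (- t * real m) * ?x ^ k" for k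
  using B(2)[of "m + k"] by (simp add: exp_of_nat_mult[symmetric] exp_add[symmetric] algebra_simps)
 moreover have s2: "summable (\<lambda>k. prob (B (m + k)))"
  using le by (intro summable_comparison_test[OF _ s]) (auto simp: measure_nonneg)
 moreover have "prob (\<Union>k. B (m + k)) \<le> (\<Sum>k. prob (B (m + k)))"
  using B s2 by (intro finite_measure_subadditive_countably) auto
 moreover have "(\<Sum>k. prob (B (m + k))) \<le> (\<Sum>k. C * exp (- t * real m) * ?x ^ k)"
  using le s s2 by (intro suminf_le) auto
 moreover have "(\<Sum>k. C * exp (- t * real m) * ?x ^ k) = C * exp (- t * real m) * (1 / (1 - ?x))"
  using x t by (subst suminf_mult) (auto simp: suminf_geometric intro!: summable_geometric)
 moreover have "C * exp (- t * real m) * (1 / (1 - ?x)) \<le> C * exp (- t * real m) * (4 / 3)"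
  using x C t by (intro mult_left_mono) (auto simp: divide_simps)
 moreover have "C * exp (- t * real m) * (4 / 3) \<le> C / 4 * exp (- (t - 2) * real m)"
 proof -
  have "exp (- 2 * real m) \<le> exp (- 2)" using m by simp
  also have "\<dots> \<le> 3 / 16" using exp2_ge by (simp add: exp_minus divide_simps)
  finally have "exp (- (t - 2) * real m) * exp (- 2 * real m) \<le> exp (- (t - 2) * real m) * (3 / 16)"
   by (rule mult_left_mono) simp
  moreover have "exp (- (t - 2) * real m) * exp (- 2 * real m) = exp (- t * real m)"
   by (simp add: exp_add[symmetric] algebra_simps)
  ultimately have "exp (- t * real m) \<le> exp (- (t - 2) * real m) * (3 / 16)" by argo
  then show ?thesis using C mult_left_mono[of "exp (- t * real m)" "exp (- (t - 2) * real m) * (3 / 16)" C] by simp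
 qed
 ultimately show ?thesis by simp
qed

section \<open>Bad sets through a vertex, and expansion at the radius beyond them\<close>

context env1 begin

lemma countable_finsets: "countable {W :: 'v set. finite W}"
 using countable_Collect_finite_subset[OF countable_V] by simp

definition hasbad :: "'v env \<Rightarrow> bool \<Rightarrow> 'v \<Rightarrow> nat \<Rightarrow> bool" where
 "hasbad Y b v n \<longleftrightarrow> (\<exists>W. conn DD W \<and> v \<in> W \<and> bad Y b W \<and> n \<le> card W)"

lemma hasbad_alt: "hasbad Y b v n \<longleftrightarrow> (\<exists>W\<in>{W. finite W}. bad Y b W \<and> conn DD W \<and> v \<in> W \<and> n \<le> card W)"
 by (auto simp: hasbad_def conn_def)

lemma hasbad_measurable [measurable]: "Measurable.pred D (\<lambda>Y. hasbad Y b v n)"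
 unfolding hasbad_alt by (intro pred_Bex_countable countable_finsets pred_intros_logic bad_measurable) auto

lemma hasbad_mono: "n \<le> m \<Longrightarrow> hasbad Y b v m \<Longrightarrow> hasbad Y b v n"
 by (auto simp: hasbad_def intro: le_trans)

lemma hasbad_actz: assumes g: "aut \<gamma>" shows "hasbad (actz \<gamma> Y) b (\<gamma> v) n = hasbad Y b v n"
proof
 assume "hasbad (actz \<gamma> Y) b (\<gamma> v) n"
 then obtain W where W: "conn DD W" "\<gamma> v \<in> W" "bad (actz \<gamma> Y) b W" "n \<le> card W" by (auto simp: hasbad_def)
 let ?W = "inv \<gamma> ` W"
 have e: "W = \<gamma> ` ?W" using g by (simp add: image_image)
 have "card ?W = card W" using aut_inj[OF aut_inv[OF g]] by (metis card_image inj_on_subset subset_UNIV)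
 moreover have "bad Y b ?W" using W(3) bad_actz[OF g, of Y b ?W] e by simp
 moreover have "v \<in> ?W" using W(2) g by (metis aut_apply_inv(2) image_eqI)
 ultimately show "hasbad Y b v n" using conn_aut[OF aut_inv[OF g] W(1)] W(4) by (auto simp: hasbad_def)
next
 assume "hasbad Y b v n"
 then obtain W where W: "conn DD W" "v \<in> W" "bad Y b W" "n \<le> card W" by (auto simp: hasbad_def)
 have "card (\<gamma> ` W) = card W" using aut_inj[OF g] by (metis card_image inj_on_subset subset_UNIV)
 then show "hasbad (actz \<gamma> Y) b (\<gamma> v) n"
  using conn_aut[OF g W(1)] W bad_actz[OF g, of Y b W] by (auto simp: hasbad_def intro!: exI[of _ "\<gamma> ` W"])
qed

lemma kr: "\<kappa> * real rho \<ge> 0" using kappa_pos by simp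

lemma prob_UN_bad:
 assumes X: "finite X" "\<And>W. W \<in> X \<Longrightarrow> finite W \<and> card W = n"
 shows "prob (\<Union>W\<in>X. {Y. bad Y b W}) \<le> real (card X) * (2 * exp (- aa / 2 * real n))"
proof -
 have "prob (\<Union>W\<in>X. {Y. bad Y b W}) \<le> (\<Sum>W\<in>X. prob {Y. bad Y b W})"
  using X by (intro finite_measure_subadditive_finite) (auto intro: pred_sets)
 also have "\<dots> \<le> (\<Sum>W\<in>X. 2 * exp (- aa / 2 * real n))"
  using X by (intro sum_mono) (metis prob_bad)
 finally show ?thesis by simp
qed

lemma UN_bad_sets: "finite X \<Longrightarrow> (\<Union>W\<in>X. {Y. bad Y b W}) \<in> events"
 by (intro sets.finite_UN) (auto intro: pred_sets)

lemma bsize_DD_pow: "real (bsize DD ^ (2 * n)) \<le> exp (2 * \<kappa> * real DD * real n)"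
proof -
 have "real (bsize DD ^ (2 * n)) \<le> exp (\<kappa> * real DD) ^ (2 * n)"
  unfolding of_nat_power by (intro power_mono bsize_exp) simp
 also have "\<dots> = exp (2 * \<kappa> * real DD * real n)"
  by (simp add: exp_of_nat_mult[symmetric] mult_ac)
 finally show ?thesis .
qed

text \<open>Union bound over connected sets through \<open>v\<close>: the entropy
  \<open>2 * \<kappa> * real DD\<close> is set against the rate \<open>aa / 2\<close>, with a
  surplus of at least 3 per vertex.\<close>

lemma prob_hasbad: assumes n: "n \<ge> 1" shows "prob {Y. hasbad Y b v n} \<le> exp (- real n)"
proof -
 define X where "X j = {W. conn DD W \<and> v \<in> W \<and> card W = j}" for j
 define t where "t = aa / 2 - 2 * \<kappa> * real DD"
 have DDk: "2 * \<kappa> * real DD = 4 * (\<kappa> * real rho) + 2 * \<kappa>" by (simp add: DD_def algebra_simps)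
 have t: "t \<ge> 3" using aa_pos kr kappa_pos unfolding t_def DDk by linarith
 have X: "finite (X j)" "real (card (X j)) \<le> exp (2 * \<kappa> * real DD * real j)"
  "W \<in> X j \<Longrightarrow> finite W \<and> card W = j" for j W
  using count_conn[of DD v j] order_trans[OF _ bsize_DD_pow[of j]] by (auto simp: X_def conn_def of_nat_le_iff simp del: of_nat_power)
 have bnd: "prob (\<Union>j\<in>{n..}. \<Union>W\<in>X j. {Y. bad Y b W}) \<le> 2 / 4 * exp (- (t - 2) * real n)"
 proof (rule prob_UN_exp)
  show "(\<Union>W\<in>X j. {Y. bad Y b W}) \<in> events" for j by (rule UN_bad_sets[OF X(1)])
  show "prob (\<Union>W\<in>X j. {Y. bad Y b W}) \<le> 2 * exp (- t * real j)" for j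
  proof -
   have "prob (\<Union>W\<in>X j. {Y. bad Y b W}) \<le> real (card (X j)) * (2 * exp (- aa / 2 * real j))"
    using X by (intro prob_UN_bad) auto
   also have "\<dots> \<le> exp (2 * \<kappa> * real DD * real j) * (2 * exp (- aa / 2 * real j))"
    by (intro mult_right_mono X) auto
   also have "\<dots> = 2 * exp (- t * real j)" by (simp add: t_def exp_add[symmetric] algebra_simps)
   finally show ?thesis .
  qed
 qed (use t n in auto)
 have eq: "{Y. hasbad Y b v n} = (\<Union>j\<in>{n..}. \<Union>W\<in>X j. {Y. bad Y b W})"
  by (auto simp: hasbad_def X_def)
 have ex: "exp (- (t - 2) * real n) \<le> exp (- real n)"
 proof -
  have "1 * real n \<le> (t - 2) * real n" using t by (intro mult_right_mono) auto
  then show ?thesis by (subst exp_le_cancel_iff) (simp add: algebra_simps)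
 qed
 have "0 \<le> exp (- (t - 2) * real n)" by simp
 with bnd ex show ?thesis unfolding eq by linarith
qed

lemma AE_wf: "AE Y in D. \<forall>b v. \<exists>n. \<not> hasbad Y b v n"
proof -
 have "AE Y in D. \<exists>n. \<not> hasbad Y b v n" for b v
 proof -
  have m: "Measurable.pred D (\<lambda>Y. \<forall>n. hasbad Y b v n)" by measurable
  have "prob {Y. \<forall>n. hasbad Y b v n} \<le> exp (- real n)" if "n \<ge> 1" for n
   using that prob_hasbad[of n b v] by (intro order_trans[OF finite_measure_mono prob_hasbad]) (auto intro!: pred_sets)
  then have "prob {Y. \<forall>n. hasbad Y b v n} \<le> 0"
  proof (intro LIMSEQ_le_const)
   show "(\<lambda>n. exp (- real n)) \<longlonglongrightarrow> 0"
    using filterlim_compose[OF exp_at_bot filterlim_compose[OF filterlim_uminus_at_bot_at_top filterlim_real_sequentially]] by simp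
  qed blast
  then have "prob {Y. \<forall>n. hasbad Y b v n} = 0" using measure_nonneg[of D] by (meson antisym)
  then have "AE Y in D. \<not> (\<forall>n. hasbad Y b v n)"
   using m prob_eq_0[OF pred_sets[OF m]] by simp
  then show ?thesis by simp
 qed
 then have "AE Y in D. \<forall>v\<in>UNIV. \<exists>n. \<not> hasbad Y b v n" for b
  by (subst AE_ball_countable[OF countable_V]) simp
 from this[of True] this[of False] show ?thesis by eventually_elim (simp add: all_bool_eq)
qed

text \<open>A connected set that contains the ball of this radius around \<open>v\<close> is too
  large to be bad. Almost surely \<open>AE_wf\<close> guarantees that such a radius exists.\<close>

definition rad :: "'v env \<Rightarrow> bool \<Rightarrow> 'v \<Rightarrow> nat" where
 "rad Y b v = (LEAST r. \<not> hasbad Y b v (bsize r))"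

lemma rad:
 assumes "\<exists>n. \<not> hasbad Y b v n"
 shows "\<not> hasbad Y b v (bsize (rad Y b v))" "r < rad Y b v \<Longrightarrow> hasbad Y b v (bsize r)"
proof -
 obtain n where "\<not> hasbad Y b v n" using assms by blast
 then have "\<not> hasbad Y b v (bsize n)" using hasbad_mono bsize_ge[of n] by (meson Suc_leD)
 then show "\<not> hasbad Y b v (bsize (rad Y b v))" unfolding rad_def by (rule LeastI)
 show "r < rad Y b v \<Longrightarrow> hasbad Y b v (bsize r)" unfolding rad_def using not_less_Least by blast
qed

definition vadj :: "'v env \<Rightarrow> bool \<Rightarrow> 'v \<Rightarrow> 'v \<Rightarrow> bool" where
 "vadj Y b v w \<longleftrightarrow> (\<exists>x\<in>gball E v (rad Y b v). \<exists>y\<in>gball E w (rad Y b w). dd x y \<le> DD)"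

text \<open>The balls of radius \<open>rad\<close> around a maximal linked cluster unite to a
  connected set too large to be bad, and the two inequalities of non-badness give the factor 6. The
  remaining vertices are not linked to the cluster, hence their enlarged balls are disjoint from
  those of the cluster and induction adds the contributions.\<close>

lemma expansion:
 assumes wf: "\<forall>v. \<exists>n. \<not> hasbad Y b v n" and S: "finite S"
 shows "6 * csum Y b S \<le> csum Y (\<not> b) (\<Union>v\<in>S. gball E v (rad Y b v + rho))"
 using S
proof (induction "card S" arbitrary: S rule: less_induct)
 case less
 let ?B = "\<lambda>C. \<Union>v\<in>C. gball E v (rad Y b v)"
 let ?B' = "\<lambda>C. \<Union>v\<in>C. gball E v (rad Y b v + rho)"
 show ?case
 proof (cases "S = {}")
  case True then show ?thesis by (simp add: csum_def)
 next
  case False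
  then obtain v where v: "v \<in> S" by blast
  define P where "P C \<longleftrightarrow> C \<subseteq> S \<and> v \<in> C \<and> conn DD (?B C)" for C
  have cb: "conn DD (gball E w r)" for w r unfolding DD_def using conn_gball[of "2 * rho"] by simp
  have "P {v}" using v cb by (simp add: P_def)
  moreover have "\<forall>C. P C \<longrightarrow> card C < Suc (card S)" using less.prems by (auto intro: card_mono simp: P_def less_Suc_eq_le)
  ultimately have "\<exists>C. P C \<and> (\<forall>C'. P C' \<longrightarrow> card C' \<le> card C)" by (rule ex_has_greatest_nat)
  then obtain C where PC: "P C" and mx: "\<And>C'. P C' \<Longrightarrow> card C' \<le> card C" by blast
  have C: "C \<subseteq> S" "v \<in> C" "conn DD (?B C)" using PC by (auto simp: P_def)
  have fC: "finite C" using C less.prems finite_subset by blast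
  have na: "\<not> vadj Y b c w" if cw: "c \<in> C" "w \<in> S - C" for c w
  proof
   assume "vadj Y b c w"
   then obtain x y where xy: "x \<in> gball E c (rad Y b c)" "y \<in> gball E w (rad Y b w)" "dd x y \<le> DD" by (auto simp: vadj_def)
   have "conn DD (?B C \<union> gball E w (rad Y b w))"
    by (rule conn_Un[OF _ cb _ xy(2,3)]) (use C cw xy in auto)
   then have "P (insert w C)" using C cw by (auto simp: Un_commute P_def)
   then show False using mx[of "insert w C"] fC cw by simp
  qed
  let ?W = "?B C"
  have W: "finite ?W" "conn DD ?W" using C by (auto simp: conn_def)
  have "gball E v (rad Y b v) \<subseteq> ?W" using C by auto
  then have "bsize (rad Y b v) \<le> card ?W" using card_mono[OF W(1)] by (metis card_gball)
  moreover have vW: "v \<in> ?W" using C by (auto intro!: bexI[of _ v])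
  ultimately have nb: "\<not> bad Y b ?W" using rad(1)[OF wf[rule_format, of v]] W(2) unfolding hasbad_def by blast
  have nW: "nbhd ?W rho = ?B' C"
  proof -
   have "nbhd ?W rho = (\<Union>c\<in>C. nbhd (gball E c (rad Y b c)) rho)" by (auto simp: nbhd_def)
   then show ?thesis by (simp add: gball_eq_nbhd nbhd_add)
  qed
  have CW: "C \<subseteq> ?W" by (auto intro!: bexI[of _ _ C])
  have "6 * csum Y b C \<le> 6 * csum Y b ?W" using csum_mono[OF W(1) CW] by simp
  also have "\<dots> \<le> 6 * (Lc * card ?W)" using nb by (simp add: bad_def bad2_def)
  also have "\<dots> \<le> csum Y (\<not> b) (nbhd ?W rho)" using nb by (simp add: bad_def bad1_def)
  finally have 1: "6 * csum Y b C \<le> csum Y (\<not> b) (?B' C)" unfolding nW .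
  have lt: "card (S - C) < card S" using C v less.prems by (intro psubset_card_mono) auto
  have 2: "6 * csum Y b (S - C) \<le> csum Y (\<not> b) (?B' (S - C))" using less.hyps[OF lt] less.prems by simp
  have disj: "?B' C \<inter> ?B' (S - C) = {}"
  proof (rule ccontr)
   assume "?B' C \<inter> ?B' (S - C) \<noteq> {}"
   then obtain y c w where y: "c \<in> C" "w \<in> S - C" "dd c y \<le> rad Y b c + rho" "dd w y \<le> rad Y b w + rho"
    unfolding disjoint_iff by (auto simp only: UN_iff mem_gball)
   have "\<exists>x. dd c x \<le> r \<and> dd x y \<le> s" if "dd c y \<le> r + s" for c r s
   proof -
    have "y \<in> nbhd {c} (r + s)" using that by (simp add: nbhd_def)
    then have "y \<in> nbhd (nbhd {c} r) s" by (simp only: nbhd_add)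
    then show ?thesis by (auto simp: nbhd_def)
   qed
   then obtain x x' where "dd c x \<le> rad Y b c" "dd x y \<le> rho" "dd w x' \<le> rad Y b w" "dd x' y \<le> rho" using y by metis
   moreover then have "dd x x' \<le> DD" using dd_triangle[of x x' y] dd_sym[of x' y] by (simp add: DD_def)
   ultimately show False using na[OF y(1,2)] by (auto simp: vadj_def)
  qed
  have "csum Y b S = csum Y b C + csum Y b (S - C)"
   unfolding csum_def using C less.prems by (metis add.commute sum.subset_diff)
  moreover have "csum Y (\<not> b) (?B' S) = csum Y (\<not> b) (?B' C) + csum Y (\<not> b) (?B' (S - C))"
  proof -
   have "?B' S = ?B' C \<union> ?B' (S - C)" using C by auto
   then show ?thesis unfolding csum_def using disj fC less.prems by (simp only:) (subst sum.union_disjoint; auto)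
  qed
  ultimately show ?thesis using 1 2 by simp
 qed
qed

end

section \<open>Finiteness of clusters of bad sets\<close>

context env1 begin

text \<open>A class of overlapping balls is infinite only if there is an infinite chain of bad sets with gaps
  controlled by their sizes; along a geodesic chain every second set is disjoint from the others, so
  that their badness probabilities multiply.\<close>

definition nadj :: "'v set \<Rightarrow> 'v set \<Rightarrow> bool" where
 "nadj W W' \<longleftrightarrow> (\<exists>w\<in>W. \<exists>w'\<in>W'. dd w w' \<le> 2 * card W + 2 * card W' + DD)"

definition nset :: "'v set \<Rightarrow> nat \<Rightarrow> 'v set set" where
 "nset W n = {W'. conn DD W' \<and> card W' = n \<and> nadj W W'}"

text \<open>Entropy rates for choosing a neighbour of size \<open>n\<close> of a given set
  \<open>W\<close>. \<open>c1\<close> is the price per vertex of \<open>W\<close>: a starting vertex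
  and the radius \<open>2 * card W\<close>. \<open>c2\<close> is the price per vertex of the
  neighbour: the radius \<open>2 * n\<close>, its shape, and one \<open>DD\<close> absorbed by
  \<open>n \<ge> 1\<close>.\<close>

definition c1 :: real where "c1 = 1 + 2 * \<kappa>"
definition c2 :: real where "c2 = 2 * \<kappa> + 3 * \<kappa> * real DD"

lemma c12: "aa / 4 - c1 - c2 \<ge> 2" "c1 \<ge> 0" "c2 \<ge> 0"
proof -
 have DDk: "c2 = 5 * \<kappa> + 6 * (\<kappa> * real rho)" by (simp add: c2_def DD_def algebra_simps)
 show "aa / 4 - c1 - c2 \<ge> 2" unfolding DDk c1_def using aa_pos by linarith
 show "c1 \<ge> 0" "c2 \<ge> 0" unfolding DDk c1_def using kr kappa_pos by linarith+
qed

lemma nset: assumes W: "finite W" and n: "n \<ge> 1"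
 shows "finite (nset W n)" "real (card (nset W n)) \<le> exp (c1 * real (card W) + c2 * real n)"
proof -
 let ?r = "2 * card W + 2 * n + DD"
 let ?X = "\<lambda>u. {W'. conn DD W' \<and> u \<in> W' \<and> card W' = n}"
 let ?U = "\<Union>w\<in>W. \<Union>u\<in>gball E w ?r. ?X u"
 have sub: "nset W n \<subseteq> ?U"
 proof
  fix W' assume "W' \<in> nset W n"
  then obtain w w' where w: "conn DD W'" "card W' = n" "w \<in> W" "w' \<in> W'" "dd w w' \<le> ?r" by (auto simp: nset_def nadj_def)
  show "W' \<in> ?U" by (rule UN_I[OF w(3)], rule UN_I[of w']) (use w in auto)
 qed
 have fU: "finite ?U" using W count_conn(1) by auto
 show "finite (nset W n)" using sub fU finite_subset by blast
 have "card (nset W n) \<le> card ?U" using sub fU by (intro card_mono)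
 also have "\<dots> \<le> (\<Sum>w\<in>W. card (\<Union>u\<in>gball E w ?r. ?X u))" using W by (rule card_UN_le)
 also have "\<dots> \<le> (\<Sum>w\<in>W. bsize ?r * bsize DD ^ (2 * n))"
 proof (intro sum_mono)
  fix w
  have "card (\<Union>u\<in>gball E w ?r. ?X u) \<le> (\<Sum>u\<in>gball E w ?r. card (?X u))" by (rule card_UN_le) simp
  also have "\<dots> \<le> (\<Sum>u\<in>gball E w ?r. bsize DD ^ (2 * n))" by (intro sum_mono count_conn)
  finally show "card (\<Union>u\<in>gball E w ?r. ?X u) \<le> bsize ?r * bsize DD ^ (2 * n)" by (simp add: card_gball)
 qed
 finally have "card (nset W n) \<le> card W * (bsize ?r * bsize DD ^ (2 * n))" by simp
 then have "real (card (nset W n)) \<le> real (card W) * (real (bsize ?r) * real (bsize DD ^ (2 * n)))"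
  by (simp only: of_nat_mult[symmetric] of_nat_le_iff)
 also have "\<dots> \<le> exp (real (card W)) * (exp (\<kappa> * real ?r) * exp (2 * \<kappa> * real DD * real n))"
 proof (intro mult_mono bsize_exp bsize_DD_pow)
  show "real (card W) \<le> exp (real (card W))" using exp_ge_add_one_self[of "real (card W)"] by linarith
 qed auto
 also have "\<dots> = exp (real (card W) + \<kappa> * real ?r + 2 * \<kappa> * real DD * real n)" by (simp add: exp_add)
 also have "\<dots> \<le> exp (c1 * real (card W) + c2 * real n)"
 proof -
  have "\<kappa> * real DD * 1 \<le> \<kappa> * real DD * real n" using n kappa_pos by (intro mult_left_mono) auto
  then show ?thesis by (simp add: c1_def c2_def algebra_simps)
 qed
 finally show "real (card (nset W n)) \<le> exp (c1 * real (card W) + c2 * real n)" .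
qed

text \<open>Only consecutive sets may meet, so the sets in even positions are pairwise disjoint, and
  so are those in odd positions.\<close>

definition chain :: "'v set list \<Rightarrow> bool" where
 "chain ps \<longleftrightarrow> (\<forall>W\<in>set ps. conn DD W) \<and> successively nadj ps \<and>
  (\<forall>i j. i + 2 \<le> j \<longrightarrow> j < length ps \<longrightarrow> ps ! i \<inter> ps ! j = {})"

definition csize :: "'v set list \<Rightarrow> nat" where
 "csize ps = sum_list (map card ps)"

text \<open>One parity class carries half of the total size, whence the rate drops from
  \<open>aa / 2\<close> to \<open>aa / 4\<close>.\<close>

lemma prob_chain:
 assumes "chain ps"
 shows "prob {Y. \<forall>W\<in>set ps. bad Y b W} \<le> 2 ^ length ps * exp (- aa / 4 * real (csize ps))"
proof -
 define I where "I e = {i. i < length ps \<and> (even i \<longleftrightarrow> e)}" for e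
 have fI: "finite (I e)" for e by (simp add: I_def)
 have disj: "disjoint_family_on (\<lambda>i. ps ! i) (I e)" for e
  unfolding disjoint_family_on_def
 proof (intro ballI impI)
  fix i j assume ij: "i \<in> I e" "j \<in> I e" "i \<noteq> j"
  then have "even i = even j" by (simp add: I_def)
  then have "i + 2 \<le> j \<or> j + 2 \<le> i" using ij(3) by presburger
  then show "ps ! i \<inter> ps ! j = {}" using assms ij unfolding chain_def I_def by (metis (no_types, lifting) Int_commute mem_Collect_eq)
 qed
 have fin: "finite (ps ! i)" if "i \<in> I e" for i e using assms that by (auto simp: chain_def I_def conn_def)
 have "csize ps = (\<Sum>i<length ps. card (ps ! i))"
  by (simp add: csize_def sum_list_sum_nth atLeast0LessThan)
 also have "{..<length ps} = I True \<union> I False" by (auto simp: I_def)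
 also have "(\<Sum>i\<in>I True \<union> I False. card (ps ! i)) = (\<Sum>i\<in>I True. card (ps ! i)) + (\<Sum>i\<in>I False. card (ps ! i))"
  by (intro sum.union_disjoint fI) (auto simp: I_def)
 finally have "csize ps \<le> 2 * (\<Sum>i\<in>I True. card (ps ! i)) \<or> csize ps \<le> 2 * (\<Sum>i\<in>I False. card (ps ! i))" by linarith
 then obtain e where e: "csize ps \<le> 2 * (\<Sum>i\<in>I e. card (ps ! i))" by blast
 have "prob {Y. \<forall>W\<in>set ps. bad Y b W} \<le> prob {Y. \<forall>i\<in>I e. bad Y b (ps ! i)}"
 proof (intro finite_measure_mono)
  show "{Y. \<forall>i\<in>I e. bad Y b (ps ! i)} \<in> events" using fI by (intro pred_sets pred_intros_finite) auto
 qed (auto simp: I_def)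
 also have "\<dots> \<le> 2 ^ card (I e) * exp (- aa / 2 * real (\<Sum>i\<in>I e. card (ps ! i)))"
  by (intro prob_disjoint_bad fI fin disj)
 also have "\<dots> \<le> 2 ^ length ps * exp (- aa / 4 * real (csize ps))"
 proof (intro mult_mono)
  have "card (I e) \<le> card {..<length ps}" by (intro card_mono) (auto simp: I_def)
  then show "(2::real) ^ card (I e) \<le> 2 ^ length ps" by (intro power_increasing) auto
  have "real (csize ps) \<le> 2 * real (\<Sum>i\<in>I e. card (ps ! i))" using e by (metis of_nat_le_iff of_nat_mult of_nat_numeral)
  then show "exp (- aa / 2 * real (\<Sum>i\<in>I e. card (ps ! i))) \<le> exp (- aa / 4 * real (csize ps))"
   using aa_ge0 mult_left_mono[of "real (csize ps)" "2 * real (\<Sum>i\<in>I e. card (ps ! i))" "aa / 4"] by simp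
 qed auto
 finally show ?thesis .
qed

definition ext :: "'v env \<Rightarrow> bool \<Rightarrow> 'v set list \<Rightarrow> nat \<Rightarrow> bool" where
 "ext Y b p m \<longleftrightarrow> (\<exists>qs. length qs = m \<and> chain (p @ qs) \<and> (\<forall>W\<in>set (p @ qs). bad Y b W))"

lemma ext_measurable: "Measurable.pred D (\<lambda>Y. ext Y b p m)"
proof -
 have "ext Y b p m \<longleftrightarrow> (\<exists>qs\<in>lists {W. finite W}. (\<forall>W\<in>set (p @ qs). bad Y b W) \<and> length qs = m \<and> chain (p @ qs))" for Y
 proof
  assume "ext Y b p m"
  then obtain qs where qs: "length qs = m" "chain (p @ qs)" "\<forall>W\<in>set (p @ qs). bad Y b W" unfolding ext_def by blast
  moreover have "qs \<in> lists {W. finite W}" using qs(2) by (auto simp: chain_def conn_def)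
  ultimately show "\<exists>qs\<in>lists {W. finite W}. (\<forall>W\<in>set (p @ qs). bad Y b W) \<and> length qs = m \<and> chain (p @ qs)" by blast
 qed (auto simp: ext_def)
 moreover have "Measurable.pred D (\<lambda>Y. \<exists>qs\<in>lists {W. finite W}. (\<forall>W\<in>set (p @ qs). bad Y b W) \<and> length qs = m \<and> chain (p @ qs))"
 proof (rule pred_Bex_countable[OF countable_lists[OF countable_finsets]])
  fix qs :: "'v set list"
  have "Measurable.pred D (\<lambda>Y. \<forall>W\<in>set (p @ qs). bad Y b W)" by (intro pred_intros_finite bad_measurable) simp
  then show "Measurable.pred D (\<lambda>Y. (\<forall>W\<in>set (p @ qs). bad Y b W) \<and> length qs = m \<and> chain (p @ qs))"
   by (cases "length qs = m \<and> chain (p @ qs)") simp_all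
 qed
 ultimately show ?thesis by (simp only:)
qed

text \<open>Induction on the number of further sets. The factor
  \<open>exp (c1 * real (card (last p)))\<close> prepays the choices of a successor of the last set;
  the sum over the size of that successor then yields a factor 1/2 per step.\<close>

lemma prob_ext:
 assumes "p \<noteq> []"
 shows "prob {Y. ext Y b p m} \<le> 2 ^ length p * exp (- aa / 4 * real (csize p)) * exp (c1 * real (card (last p))) * (1 / 2) ^ m"
 using assms
proof (induction m arbitrary: p)
 case 0
 show ?case
 proof (cases "chain p")
  case True
  have "{Y. ext Y b p 0} = {Y. \<forall>W\<in>set p. bad Y b W}" using True by (auto simp: ext_def)
  then have "prob {Y. ext Y b p 0} \<le> 2 ^ length p * exp (- aa / 4 * real (csize p)) * 1" using prob_chain[OF True] by simp
  also have "\<dots> \<le> 2 ^ length p * exp (- aa / 4 * real (csize p)) * exp (c1 * real (card (last p)))"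
   using c12 by (intro mult_left_mono) auto
  finally show ?thesis by simp
 next
  case False
  then have e: "{Y. ext Y b p 0} = {}" by (auto simp: ext_def)
  show ?thesis unfolding e by simp
 qed
next
 case (Suc m)
 let ?l = "last p"
 show ?case
 proof (cases "conn DD ?l")
  case False
  then have e: "{Y. ext Y b p (Suc m)} = {}" using Suc.prems by (auto simp: ext_def chain_def)
  show ?thesis unfolding e by simp
 next
  case True
  then have fl: "finite ?l" by (simp add: conn_def)
  let ?B = "\<lambda>n. \<Union>W\<in>nset ?l n. {Y. ext Y b (p @ [W]) m}"
  \<comment> \<open>\<open>C\<close> collects what does not depend on the size \<open>n\<close> of
    the next set; \<open>t\<close> below is the rate left per vertex of it after paying
    \<open>c2\<close> for its choice and \<open>c1\<close> for that of its successor.\<close>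
  define C where "C = 2 ^ (length p + 1) * exp (- aa / 4 * real (csize p)) * exp (c1 * real (card ?l)) * (1 / 2) ^ m"
  define t where "t = aa / 4 - c1 - c2"
  have t: "t \<ge> 2" using c12 by (simp add: t_def)
  have sub: "{Y. ext Y b p (Suc m)} \<subseteq> (\<Union>n\<in>{1..}. ?B n)"
  proof
   fix Y assume "Y \<in> {Y. ext Y b p (Suc m)}"
   then obtain qs where qs: "length qs = Suc m" "chain (p @ qs)" "\<forall>W\<in>set (p @ qs). bad Y b W" by (auto simp: ext_def)
   then obtain W qs' where q: "qs = W # qs'" by (cases qs) auto
   have "nadj ?l W" "conn DD W" using qs(2) Suc.prems unfolding q chain_def by (auto simp: successively_append_iff)
   then have "W \<in> nset ?l (card W)" "card W \<ge> 1" by (auto simp: nset_def conn_def Suc_le_eq card_gt_0_iff)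
   moreover have "ext Y b (p @ [W]) m" using qs unfolding q ext_def by (intro exI[of _ qs']) simp
   ultimately show "Y \<in> (\<Union>n\<in>{1..}. ?B n)" by blast
  qed
  have Bm: "?B n \<in> events" if "n \<ge> 1" for n
   using nset(1)[OF fl that] by (intro sets.finite_UN) (auto intro: pred_sets ext_measurable)
  have Bp: "prob (?B n) \<le> C * exp (- t * real n)" if n: "n \<ge> 1" for n
  proof -
   have "prob (?B n) \<le> (\<Sum>W\<in>nset ?l n. prob {Y. ext Y b (p @ [W]) m})"
    using nset(1)[OF fl n] by (intro finite_measure_subadditive_finite) (auto intro: pred_sets ext_measurable)
   also have "\<dots> \<le> (\<Sum>W\<in>nset ?l n. 2 ^ (length p + 1) * exp (- aa / 4 * (real (csize p) + real n)) * exp (c1 * real n) * (1 / 2) ^ m)"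
   proof (intro sum_mono)
    fix W assume "W \<in> nset ?l n"
    then have e: "real (csize (p @ [W])) = real (csize p) + real n" "card (last (p @ [W])) = n" "length (p @ [W]) = length p + 1"
     by (auto simp: nset_def csize_def)
    show "prob {Y. ext Y b (p @ [W]) m} \<le> 2 ^ (length p + 1) * exp (- aa / 4 * (real (csize p) + real n)) * exp (c1 * real n) * (1 / 2) ^ m"
     using Suc.IH[of "p @ [W]"] unfolding e by simp
   qed
   also have "\<dots> = real (card (nset ?l n)) * (2 ^ (length p + 1) * exp (- aa / 4 * (real (csize p) + real n)) * exp (c1 * real n) * (1 / 2) ^ m)"
    by simp
   also have "\<dots> \<le> exp (c1 * real (card ?l) + c2 * real n) * (2 ^ (length p + 1) * exp (- aa / 4 * (real (csize p) + real n)) * exp (c1 * real n) * (1 / 2) ^ m)"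
    using nset(2)[OF fl n] by (intro mult_right_mono) auto
   also have "\<dots> = C * (exp (c2 * real n) * exp (- aa / 4 * real n) * exp (c1 * real n))"
    unfolding C_def distrib_left exp_add by (simp only: mult_ac)
   also have "exp (c2 * real n) * exp (- aa / 4 * real n) * exp (c1 * real n) = exp (- t * real n)"
    unfolding exp_add[symmetric] t_def by (simp add: algebra_simps)
   finally show ?thesis .
  qed
  have Un: "(\<Union>n\<in>{1..}. ?B n) \<in> events" using Bm by (intro sets.countable_UN') auto
  have "prob {Y. ext Y b p (Suc m)} \<le> prob (\<Union>n\<in>{1..}. ?B n)" by (rule finite_measure_mono[OF sub Un])
  also have "\<dots> \<le> C / 4 * exp (- (t - 2) * real 1)"
   by (rule prob_UN_exp[OF Bm Bp t]) (auto simp: C_def)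
  also have "\<dots> \<le> C / 4 * 1" using t by (intro mult_left_mono) (auto simp: C_def)
  also have "\<dots> = 2 ^ length p * exp (- aa / 4 * real (csize p)) * exp (c1 * real (card ?l)) * (1 / 2) ^ Suc m"
   by (simp add: C_def)
  finally show ?thesis .
 qed
qed

lemma AE_ext: "AE Y in D. \<forall>W\<in>{W. finite W}. \<exists>m. \<not> ext Y b [W] m"
proof (subst AE_ball_countable[OF countable_finsets], intro ballI)
 fix W :: "'v set"
 have m: "Measurable.pred D (\<lambda>Y. \<forall>m. ext Y b [W] m)" by (intro pred_intros_countable ext_measurable)
 let ?C = "2 ^ length [W] * exp (- aa / 4 * real (csize [W])) * exp (c1 * real (card (last [W])))"
 have "prob {Y. \<forall>m. ext Y b [W] m} \<le> ?C * (1 / 2) ^ m" for m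
  by (intro order_trans[OF finite_measure_mono prob_ext]) (auto intro!: pred_sets ext_measurable)
 moreover have "(\<lambda>m. ?C * (1 / 2) ^ m) \<longlonglongrightarrow> 0"
  by (intro tendsto_mult_right_zero LIMSEQ_power_zero) simp
 ultimately have "prob {Y. \<forall>m. ext Y b [W] m} \<le> 0" by (intro LIMSEQ_le_const[of "\<lambda>m. ?C * (1 / 2) ^ m"]) auto
 then have "prob {Y. \<forall>m. ext Y b [W] m} = 0" using measure_nonneg[of D] by (meson antisym)
 then have "AE Y in D. \<not> (\<forall>m. ext Y b [W] m)" using prob_eq_0[OF pred_sets[OF m]] by simp
 then show "AE Y in D. \<exists>m. \<not> ext Y b [W] m" by simp
qed

text \<open>Borel-Cantelli over the size of the neighbour: the rate of badness beats the number of
  neighbours of each size.\<close>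

lemma AE_locfin: "AE Y in D. \<forall>W\<in>{W. finite W}. finite {W'. conn DD W' \<and> bad Y b W' \<and> nadj W W'}"
proof (subst AE_ball_countable[OF countable_finsets], intro ballI)
 fix W :: "'v set" assume "W \<in> {W. finite W}"
 then have W: "finite W" by simp
 let ?B = "\<lambda>n. \<Union>W'\<in>nset W (Suc n). {Y. bad Y b W'}"
 let ?f = "\<lambda>n. 2 * exp (c1 * real (card W) + c2) * exp (- (aa / 4)) * exp (- 2) ^ n"
 have m: "?B n \<in> events" for n using nset(1)[OF W, of "Suc n"] by (intro UN_bad_sets) simp
 have le: "prob (?B n) \<le> ?f n" for n
 proof -
  have "prob (?B n) \<le> real (card (nset W (Suc n))) * (2 * exp (- aa / 2 * real (Suc n)))"
   using nset(1)[OF W, of "Suc n"] by (intro prob_UN_bad) (auto simp: nset_def conn_def)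
  also have "\<dots> \<le> exp (c1 * real (card W) + c2 * real (Suc n)) * (2 * exp (- aa / 2 * real (Suc n)))"
   using nset(2)[OF W, of "Suc n"] by (intro mult_right_mono) auto
  also have "\<dots> \<le> exp (c1 * real (card W) + c2 * real (Suc n)) * (2 * exp (- aa / 4 * real (Suc n)))"
   using aa_ge0 by (intro mult_left_mono) (auto intro!: mult_right_mono)
  also have "\<dots> = 2 * exp (c1 * real (card W) + c2) * exp (- (aa / 4)) * exp (- (aa / 4 - c2) * real n)"
   by (simp add: exp_add[symmetric] algebra_simps)
  also have "\<dots> \<le> 2 * exp (c1 * real (card W) + c2) * exp (- (aa / 4)) * exp (- 2 * real n)"
  proof (rule mult_left_mono)
   have "2 * real n \<le> (aa / 4 - c2) * real n" using c12 by (intro mult_right_mono) auto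
   then show "exp (- (aa / 4 - c2) * real n) \<le> exp (- 2 * real n)"
    by (subst exp_le_cancel_iff) (simp add: algebra_simps)
  qed simp
  also have "exp (- 2 * real n) = exp (- 2) ^ n" by (simp add: exp_of_nat2_mult[symmetric] mult.commute)
  finally show ?thesis .
 qed
 have "summable ?f" by (intro summable_mult summable_geometric) simp
 then have "summable (\<lambda>n. prob (?B n))"
  by (rule summable_comparison_test[rotated]) (use le in \<open>auto simp: measure_nonneg\<close>)
 then have "AE Y in D. eventually (\<lambda>n. Y \<in> space D - ?B n) sequentially"
  using m by (intro borel_cantelli_AE1) (auto simp: emeasure_eq_measure)
 then show "AE Y in D. finite {W'. conn DD W' \<and> bad Y b W' \<and> nadj W W'}"
 proof eventually_elim
  case (elim Y)
  then obtain N where N: "\<And>n. n \<ge> N \<Longrightarrow> Y \<notin> ?B n" unfolding eventually_sequentially by auto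
  have "{W'. conn DD W' \<and> bad Y b W' \<and> nadj W W'} \<subseteq> (\<Union>n<N. nset W (Suc n))"
  proof
   fix W' assume "W' \<in> {W'. conn DD W' \<and> bad Y b W' \<and> nadj W W'}"
   then have W': "W' \<in> nset W (card W')" "bad Y b W'" "card W' \<ge> 1" by (auto simp: nset_def conn_def Suc_le_eq card_gt_0_iff)
   then have e: "card W' = Suc (card W' - 1)" by simp
   have "\<not> card W' - 1 \<ge> N"
   proof
    assume "card W' - 1 \<ge> N"
    from N[OF this] show False using W' e by auto
   qed
   then show "W' \<in> (\<Union>n<N. nset W (Suc n))" using W'(1) e by (intro UN_I[of "card W' - 1"]) auto
  qed
  then show ?case using nset(1)[OF W] finite_subset by (metis (no_types, lifting) finite_UN_I finite_lessThan le_add1 plus_1_eq_Suc)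
 qed
qed

definition BR :: "'v env \<Rightarrow> bool \<Rightarrow> ('v set \<times> 'v set) set" where
 "BR Y b = {(W, W'). conn DD W \<and> bad Y b W \<and> conn DD W' \<and> bad Y b W' \<and> nadj W W'}"

text \<open>A member at distance at least \<open>m\<close> from \<open>W0\<close> would yield a
  geodesic of bad sets whose initial part is a chain: two sets meeting two or more positions apart
  are adjacent and would give a shortcut. Hence the component consists of fewer than
  \<open>m + 1\<close> spheres, each finite by local finiteness.\<close>

lemma finite_component:
 assumes ext: "\<forall>W\<in>{W. finite W}. \<exists>m. \<not> ext Y b [W] m"
  and lf: "\<forall>W\<in>{W. finite W}. finite {W'. conn DD W' \<and> bad Y b W' \<and> nadj W W'}"
  and W0: "conn DD W0" "bad Y b W0"
 shows "finite ((BR Y b)\<^sup>* `` {W0})"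
proof -
 let ?R = "BR Y b"
 have fin: "finite ((?R ^^ i) `` {W0})" for i
 proof (induction i)
  case (Suc i)
  have "(?R ^^ Suc i) `` {W0} = (\<Union>W\<in>(?R ^^ i) `` {W0}. ?R `` {W})" by (auto simp: relcomp.simps)
  moreover have "finite (?R `` {W})" for W
  proof (cases "finite W")
   case True
   then show ?thesis using lf by (auto simp: BR_def Image_def intro: finite_subset[rotated])
  next
   case False
   then have "?R `` {W} = {}" by (auto simp: BR_def conn_def)
   then show ?thesis by simp
  qed
  ultimately show ?case using Suc by simp
 qed simp
 obtain m where m: "\<not> ext Y b [W0] m" using ext W0 by (auto simp: conn_def)
 have "\<exists>i<m. (W0, U) \<in> ?R ^^ i" if U: "(W0, U) \<in> ?R\<^sup>*" for U
 proof (rule ccontr)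
  assume no: "\<not> (\<exists>i<m. (W0, U) \<in> ?R ^^ i)"
  obtain k where k: "(W0, U) \<in> ?R ^^ k" and kmin: "\<And>i. i < k \<Longrightarrow> (W0, U) \<notin> ?R ^^ i"
   using U rtrancl_power exists_least_iff[of "\<lambda>i. (W0, U) \<in> ?R ^^ i"] by metis
  have mk: "m \<le> k" using no k by (meson not_le)
  obtain f where f: "f 0 = W0" "f k = U" "\<And>i. i < k \<Longrightarrow> (f i, f (Suc i)) \<in> ?R"
   using k by (auto simp: relpow_fun_conv)
  have path: "(f i, f j) \<in> ?R ^^ (j - i)" if "i \<le> j" "j \<le> k" for i j
   using that
  proof (induction j)
   case (Suc j)
   show ?case
   proof (cases "i = Suc j")
    case False
    then have "(f i, f j) \<in> ?R ^^ (j - i)" "(f j, f (Suc j)) \<in> ?R" "Suc j - i = Suc (j - i)"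
     using Suc f(3)[of j] by (auto simp: le_Suc_eq)
    then show ?thesis by (metis relpow_Suc_I)
   qed simp
  qed simp
  have bc: "conn DD (f i) \<and> bad Y b (f i)" if "i \<le> k" for i
   using that f(1) W0 f(3)[of "i - 1"] by (cases i) (auto simp: BR_def)
  let ?ps = "map f [0..<Suc m]"
  have nth: "?ps ! i = f i" if "i \<le> m" for i using that by (metis diff_zero length_upt less_Suc_eq_le nth_map nth_upt add_0)
  have "chain ?ps"
   unfolding chain_def
  proof (intro conjI ballI allI impI)
   fix W assume "W \<in> set ?ps"
   then obtain i where "W = f i" "i \<le> m" by auto
   then show "conn DD W" using bc[of i] mk by auto
  next
   show "successively nadj ?ps"
    unfolding successively_conv_nth using f(3) mk nth by (auto simp: BR_def less_Suc_eq_le)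
  next
   fix i j assume ij: "i + 2 \<le> j" "j < length ?ps"
   then have jk: "j \<le> m" "j \<le> k" "i \<le> m" "i \<le> k" using mk by auto
   show "?ps ! i \<inter> ?ps ! j = {}"
   proof (rule ccontr)
    assume "?ps ! i \<inter> ?ps ! j \<noteq> {}"
    then obtain w where "w \<in> f i" "w \<in> f j" using jk nth by auto
    then have "nadj (f i) (f j)" unfolding nadj_def by (intro bexI[of _ w]) auto
    then have "(f i, f j) \<in> ?R" using bc jk by (auto simp: BR_def)
    then have "(W0, f j) \<in> ?R ^^ Suc i" using path[of 0 i] jk f(1) by (auto intro: relpow_Suc_I)
    moreover have "(f j, U) \<in> ?R ^^ (k - j)" using path[of j k] jk f(2) by simp
    ultimately have "(W0, U) \<in> ?R ^^ (Suc i + (k - j))" by (simp only: relpow_add) (rule relcompI)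
    moreover have "Suc i + (k - j) < k" using ij jk by linarith
    ultimately show False using kmin by blast
   qed
  qed
  moreover have "?ps = [W0] @ map f [1..<Suc m]" using f(1) by (simp add: upt_rec)
  moreover have "\<forall>W\<in>set ?ps. bad Y b W" using bc mk by (auto simp: less_Suc_eq_le)
  ultimately have "ext Y b [W0] m" unfolding ext_def by (intro exI[of _ "map f [1..<Suc m]"]) simp
  then show False using m by simp
 qed
 then have "?R\<^sup>* `` {W0} \<subseteq> (\<Union>i<m. (?R ^^ i) `` {W0})" by blast
 then show ?thesis using fin by (meson finite_UN_I finite_lessThan finite_subset)
qed

definition good :: "'v env \<Rightarrow> bool \<Rightarrow> nat \<Rightarrow> 'v \<Rightarrow> bool" where
 "good Y b k v \<longleftrightarrow> \<not> hasbad Y b v k"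

text \<open>Goodness is required on a ball of radius \<open>k\<close>, because the spectral gap
  enlarges sets by \<open>k\<close> and the enlarged set should still consist of good
  vertices.\<close>

definition vgood :: "'v env \<Rightarrow> bool \<Rightarrow> nat \<Rightarrow> 'v \<Rightarrow> bool" where
 "vgood Y b k v \<longleftrightarrow> (\<forall>u\<in>gball E v k. good Y b k u)"

text \<open>If \<open>v\<close> itself is not good, minimality of \<open>rad\<close> gives a bad set
  through \<open>v\<close> of size at least \<open>rad\<close>. Otherwise \<open>rad\<close> is at
  most \<open>k\<close>, and a bad set of size at least \<open>k\<close> comes within distance
  \<open>k\<close>. Either way twice its size bounds the distances, which is the origin of the
  factor 2 in \<open>nadj\<close>.\<close>

lemma not_vgood_cover:
 assumes wf: "\<forall>v. \<exists>n. \<not> hasbad Y b v n" and v: "\<not> vgood Y b k v" and k: "k \<ge> 1"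
 shows "\<exists>W. conn DD W \<and> bad Y b W \<and> gball E v (rad Y b v) \<subseteq> nbhd W (2 * card W)"
proof (cases "good Y b k v")
 case False
 then have "hasbad Y b v k" by (simp add: good_def)
 then obtain W1 where W1: "conn DD W1" "v \<in> W1" "bad Y b W1" by (auto simp: hasbad_def)
 have "\<exists>W. conn DD W \<and> v \<in> W \<and> bad Y b W \<and> rad Y b v \<le> card W"
 proof (cases "rad Y b v")
  case 0 then show ?thesis using W1 by auto
 next
  case (Suc r)
  then have "hasbad Y b v (bsize r)" using rad(2)[OF wf[rule_format]] by simp
  then have "hasbad Y b v (Suc r)" using hasbad_mono bsize_ge by blast
  then show ?thesis using Suc by (auto simp: hasbad_def)
 qed
 then obtain W where W: "conn DD W" "v \<in> W" "bad Y b W" "rad Y b v \<le> card W" by blast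
 then have "gball E v (rad Y b v) \<subseteq> nbhd W (2 * card W)" by (force simp: nbhd_def)
 then show ?thesis using W by blast
next
 case True
 have "k \<le> bsize k" using bsize_ge[of k] by simp
 then have "\<not> hasbad Y b v (bsize k)" using True hasbad_mono unfolding good_def by blast
 then have rk: "rad Y b v \<le> k" unfolding rad_def by (rule Least_le)
 obtain u where u: "dd v u \<le> k" "hasbad Y b u k" using v by (auto simp: vgood_def good_def)
 then obtain W where W: "conn DD W" "u \<in> W" "bad Y b W" "k \<le> card W" by (auto simp: hasbad_def)
 have "dd u x \<le> 2 * card W" if "dd v x \<le> rad Y b v" for x
  using that rk u(1) W(4) dd_triangle[of u x v] dd_sym[of u v] by linarith
 then have "gball E v (rad Y b v) \<subseteq> nbhd W (2 * card W)" using W(2) unfolding nbhd_def by (auto intro!: bexI[of _ u])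
 then show ?thesis using W by blast
qed

definition VR :: "'v env \<Rightarrow> bool \<Rightarrow> nat \<Rightarrow> ('v \<times> 'v) set" where
 "VR Y b k = {(v, w). \<not> vgood Y b k v \<and> \<not> vgood Y b k w \<and> vadj Y b v w}"

text \<open>Replacing each vertex by a covering bad set maps linked vertices to adjacent bad sets,
  so a class lies in a neighbourhood of a finite component.\<close>

lemma finite_class:
 assumes wf: "\<forall>v. \<exists>n. \<not> hasbad Y b v n"
  and ext: "\<forall>W\<in>{W. finite W}. \<exists>m. \<not> ext Y b [W] m"
  and lf: "\<forall>W\<in>{W. finite W}. finite {W'. conn DD W' \<and> bad Y b W' \<and> nadj W W'}"
  and k: "k \<ge> 1" and v: "\<not> vgood Y b k v"
 shows "finite ((VR Y b k)\<^sup>* `` {v})"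
proof -
 define Wf where "Wf v = (SOME W. conn DD W \<and> bad Y b W \<and> gball E v (rad Y b v) \<subseteq> nbhd W (2 * card W))" for v
 have Wf: "conn DD (Wf v)" "bad Y b (Wf v)" "gball E v (rad Y b v) \<subseteq> nbhd (Wf v) (2 * card (Wf v))" if "\<not> vgood Y b k v" for v
  using someI_ex[OF not_vgood_cover[OF wf that k]] unfolding Wf_def by auto
 have step: "(Wf a, Wf c) \<in> BR Y b" if "(a, c) \<in> VR Y b k" for a c
 proof -
  have a: "\<not> vgood Y b k a" and c: "\<not> vgood Y b k c" and "vadj Y b a c" using that by (auto simp: VR_def)
  then obtain x y where "x \<in> gball E a (rad Y b a)" "y \<in> gball E c (rad Y b c)" "dd x y \<le> DD" by (auto simp: vadj_def)
  moreover then obtain w w' where w: "w \<in> Wf a" "dd w x \<le> 2 * card (Wf a)" "w' \<in> Wf c" "dd w' y \<le> 2 * card (Wf c)"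
   using Wf(3)[OF a] Wf(3)[OF c] unfolding nbhd_def by blast
  ultimately have "dd w w' \<le> 2 * card (Wf a) + 2 * card (Wf c) + DD"
   using dd_triangle[of w w' x] dd_triangle[of x w' y] dd_sym[of w' y] by linarith
  then show ?thesis using Wf(1,2)[OF a] Wf(1,2)[OF c] w by (auto simp: BR_def nadj_def)
 qed
 have reach: "\<not> vgood Y b k w \<and> (Wf v, Wf w) \<in> (BR Y b)\<^sup>*" if "(v, w) \<in> (VR Y b k)\<^sup>*" for w
  using that
 proof (induction rule: rtrancl_induct)
  case (step y z)
  then show ?case using \<open>\<And>a c. (a, c) \<in> VR Y b k \<Longrightarrow> (Wf a, Wf c) \<in> BR Y b\<close>[of y z]
   by (auto simp: VR_def intro: rtrancl_into_rtrancl)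
 qed (simp add: v)
 let ?C = "(BR Y b)\<^sup>* `` {Wf v}"
 have fin: "finite ?C" using finite_component[OF ext lf Wf(1,2)[OF v]] .
 have "(VR Y b k)\<^sup>* `` {v} \<subseteq> (\<Union>W\<in>{W\<in>?C. finite W}. nbhd W (2 * card W))"
 proof
  fix w assume "w \<in> (VR Y b k)\<^sup>* `` {v}"
  then have w: "\<not> vgood Y b k w" "Wf w \<in> ?C" using reach by auto
  have "w \<in> gball E w (rad Y b w)" by simp
  then have "w \<in> nbhd (Wf w) (2 * card (Wf w))" using Wf(3)[OF w(1)] by blast
  moreover have "finite (Wf w)" using Wf(1)[OF w(1)] by (simp add: conn_def)
  ultimately show "w \<in> (\<Union>W\<in>{W\<in>?C. finite W}. nbhd W (2 * card W))" using w by blast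
 qed
 moreover have "finite (\<Union>W\<in>{W\<in>?C. finite W}. nbhd W (2 * card W))"
  by (rule finite_UN_I) (use finite_subset[OF _ fin, of "{W\<in>?C. finite W}"] in auto)
 ultimately show ?thesis by (rule finite_subset)
qed

end

lemma borel_measurable_nn_integral_count:
 fixes f :: "'i \<Rightarrow> 'a \<Rightarrow> ennreal"
 assumes "countable (UNIV :: 'i set)" "\<And>i. f i \<in> borel_measurable M"
 shows "(\<lambda>x. \<integral>\<^sup>+i. f i x \<partial>count_space UNIV) \<in> borel_measurable M"
proof (cases "finite (UNIV :: 'i set)")
 case True
 then show ?thesis using assms by (simp add: nn_integral_count_space_finite)
next
 case False
 note * = bij_betw_from_nat_into[OF assms(1) False]
 have "(\<integral>\<^sup>+i. f i x \<partial>count_space UNIV) = (\<Sum>n. f (from_nat_into UNIV n) x)" for x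
  by (simp add: nn_integral_bij_count_space[symmetric, OF *] nn_integral_count_space_nat)
 then show ?thesis using assms(2) by simp
qed

lemma nn_integral_of_bool_finite:
 "finite A \<Longrightarrow> (\<integral>\<^sup>+x. of_bool (x \<in> A) * c \<partial>count_space UNIV) = of_nat (card A) * (c :: ennreal)"
proof -
 assume "finite A"
 have "(\<integral>\<^sup>+x. of_bool (x \<in> A) * c \<partial>count_space UNIV) = (\<integral>\<^sup>+x. c * indicator A x \<partial>count_space UNIV)"
  by (intro nn_integral_cong) (auto simp: indicator_def)
 also have "\<dots> = of_nat (card A) * c" using \<open>finite A\<close> by (simp add: nn_integral_cmult mult.commute)
 finally show ?thesis .
qed

section \<open>Mass transport for random sets of points\<close>

context env begin

definition gp :: "('v \<Rightarrow> 'v) \<Rightarrow> 'v \<times> nat \<Rightarrow> 'v \<times> nat" where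
 "gp \<gamma> p = (\<gamma> (fst p), snd p)"

lemma gp_simps [simp]: "gp \<gamma> (v, i) = (\<gamma> v, i)" "fst (gp \<gamma> p) = \<gamma> (fst p)" "snd (gp \<gamma> p) = snd p"
 by (simp_all add: gp_def)

lemma gp_inv: "aut \<gamma> \<Longrightarrow> gp \<gamma> (gp (inv \<gamma>) p) = p" "aut \<gamma> \<Longrightarrow> gp (inv \<gamma>) (gp \<gamma> p) = p"
 by (simp_all add: gp_def)

lemma ex_aut_iff: "aut \<gamma> \<Longrightarrow> (\<exists>v. Q v) \<longleftrightarrow> (\<exists>v. Q (\<gamma> v))"
 by (metis aut_apply_inv(1))

lemma ex_gp_iff: "aut \<gamma> \<Longrightarrow> (\<exists>p. Q p) \<longleftrightarrow> (\<exists>p. Q (gp \<gamma> p))"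
 by (metis gp_inv(1))

lemma gp_inj: "aut \<gamma> \<Longrightarrow> gp \<gamma> p = gp \<gamma> q \<longleftrightarrow> p = q"
 by (metis gp_inv(2))

lemma countable_pts: "countable (UNIV :: ('v \<times> nat) set)"
proof -
 have "countable (UNIV \<times> UNIV :: ('v \<times> nat) set)" by (intro countable_SIGMA countable_V) simp
 then show ?thesis by simp
qed

lemma gp_bij: "aut \<gamma> \<Longrightarrow> bij_betw (gp \<gamma>) UNIV UNIV"
 by (rule bij_betwI[of _ _ _ "gp (inv \<gamma>)"]) (auto simp: gp_inv)

lemma D_inv_nn: assumes "aut \<gamma>" "g \<in> borel_measurable D"
 shows "(\<integral>\<^sup>+Y. g Y \<partial>D) = (\<integral>\<^sup>+Y. g (actz \<gamma> Y) \<partial>D)"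
proof -
 have "(\<integral>\<^sup>+Y. g Y \<partial>distr D D (actz \<gamma>)) = (\<integral>\<^sup>+Y. g (actz \<gamma> Y) \<partial>D)"
  using assms by (intro nn_integral_distr) auto
 then show ?thesis by (simp add: D_inv[OF assms(1)])
qed

text \<open>A single realisation is not invariant, but the expected mass between two vertices is,
  because the law is; the indices of the points are summed out.\<close>

lemma pmtp:
 fixes F :: "'v env \<Rightarrow> 'v \<times> nat \<Rightarrow> 'v \<times> nat \<Rightarrow> ennreal"
 assumes m: "\<And>p q. (\<lambda>Y. F Y p q) \<in> borel_measurable D"
  and e: "\<And>\<gamma> Y p q. aut \<gamma> \<Longrightarrow> F (actz \<gamma> Y) (gp \<gamma> p) (gp \<gamma> q) = F Y p q"
 shows "(\<integral>\<^sup>+Y. \<integral>\<^sup>+i. \<integral>\<^sup>+q. F Y (z, i) q \<partial>count_space UNIV \<partial>count_space UNIV \<partial>D)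
   = (\<integral>\<^sup>+Y. \<integral>\<^sup>+j. \<integral>\<^sup>+p. F Y p (z, j) \<partial>count_space UNIV \<partial>count_space UNIV \<partial>D)"
proof -
 define f where "f u v = (\<integral>\<^sup>+Y. \<integral>\<^sup>+i. \<integral>\<^sup>+j. F Y (u, i) (v, j) \<partial>count_space UNIV \<partial>count_space UNIV \<partial>D)" for u v
 have m2: "(\<lambda>Y. \<integral>\<^sup>+i. \<integral>\<^sup>+j. F Y (u, i) (v, j) \<partial>count_space UNIV \<partial>count_space UNIV) \<in> borel_measurable D" for u v
  using m by (intro borel_measurable_nn_integral_count) auto
 have inv: "f (\<gamma> u) (\<gamma> v) = f u v" if g: "aut \<gamma>" for \<gamma> u v
 proof -
  have "F (actz \<gamma> Y) (\<gamma> u, i) (\<gamma> v, j) = F Y (u, i) (v, j)" for Y i j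
   using e[OF g, of Y "(u, i)" "(v, j)"] by simp
  then show ?thesis unfolding f_def D_inv_nn[OF g m2[of "\<gamma> u" "\<gamma> v"]] by simp
 qed
 have 1: "(\<integral>\<^sup>+v. f z v \<partial>count_space UNIV) = (\<integral>\<^sup>+Y. \<integral>\<^sup>+i. \<integral>\<^sup>+q. F Y (z, i) q \<partial>count_space UNIV \<partial>count_space UNIV \<partial>D)"
 proof -
  have "(\<integral>\<^sup>+v. f z v \<partial>count_space UNIV) = (\<integral>\<^sup>+Y. \<integral>\<^sup>+v. \<integral>\<^sup>+i. \<integral>\<^sup>+j. F Y (z, i) (v, j) \<partial>count_space UNIV \<partial>count_space UNIV \<partial>count_space UNIV \<partial>D)"
   unfolding f_def by (rule nn_integral_count_space_nn_integral[OF countable_V m2, symmetric])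
  also have "\<dots> = (\<integral>\<^sup>+Y. \<integral>\<^sup>+i. \<integral>\<^sup>+v. \<integral>\<^sup>+j. F Y (z, i) (v, j) \<partial>count_space UNIV \<partial>count_space UNIV \<partial>count_space UNIV \<partial>D)"
   by (intro nn_integral_cong nn_integral_count_space_nn_integral) auto
  also have "\<dots> = (\<integral>\<^sup>+Y. \<integral>\<^sup>+i. \<integral>\<^sup>+q. F Y (z, i) q \<partial>count_space UNIV \<partial>count_space UNIV \<partial>D)"
   by (intro nn_integral_cong nn_integral_fst_count_space[of "\<lambda>q. F _ _ q"])
  finally show ?thesis .
 qed
 have 2: "(\<integral>\<^sup>+v. f v z \<partial>count_space UNIV) = (\<integral>\<^sup>+Y. \<integral>\<^sup>+j. \<integral>\<^sup>+p. F Y p (z, j) \<partial>count_space UNIV \<partial>count_space UNIV \<partial>D)"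
 proof -
  have "(\<integral>\<^sup>+v. f v z \<partial>count_space UNIV) = (\<integral>\<^sup>+Y. \<integral>\<^sup>+v. \<integral>\<^sup>+i. \<integral>\<^sup>+j. F Y (v, i) (z, j) \<partial>count_space UNIV \<partial>count_space UNIV \<partial>count_space UNIV \<partial>D)"
   unfolding f_def by (rule nn_integral_count_space_nn_integral[OF countable_V m2, symmetric])
  also have "\<dots> = (\<integral>\<^sup>+Y. \<integral>\<^sup>+p. \<integral>\<^sup>+j. F Y p (z, j) \<partial>count_space UNIV \<partial>count_space UNIV \<partial>D)"
   by (intro nn_integral_cong nn_integral_fst_count_space[of "\<lambda>p. \<integral>\<^sup>+j. F _ p (z, j) \<partial>count_space UNIV"])
  also have "\<dots> = (\<integral>\<^sup>+Y. \<integral>\<^sup>+j. \<integral>\<^sup>+p. F Y p (z, j) \<partial>count_space UNIV \<partial>count_space UNIV \<partial>D)"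
   by (intro nn_integral_cong nn_integral_count_space_nn_integral) auto
  finally show ?thesis .
 qed
 show ?thesis using mass_transport[of f z, OF inv] unfolding 1 2 by simp
qed

definition rset :: "('v env \<Rightarrow> 'v \<times> nat \<Rightarrow> bool) \<Rightarrow> bool" where
 "rset A \<longleftrightarrow> (\<forall>p. Measurable.pred D (\<lambda>Y. A Y p)) \<and>
  (\<forall>\<gamma> Y p. aut \<gamma> \<longrightarrow> A (actz \<gamma> Y) (gp \<gamma> p) = A Y p)"

lemma rsetD: "rset A \<Longrightarrow> Measurable.pred D (\<lambda>Y. A Y p)" "rset A \<Longrightarrow> aut \<gamma> \<Longrightarrow> A (actz \<gamma> Y) (gp \<gamma> p) = A Y p"
 unfolding rset_def by blast+

lemma rset_conj: "rset A \<Longrightarrow> rset B \<Longrightarrow> rset (\<lambda>Y p. A Y p \<and> B Y p)"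
 unfolding rset_def by (auto intro!: pred_intros_logic)

lemma rset_not: "rset A \<Longrightarrow> rset (\<lambda>Y p. \<not> A Y p)"
 unfolding rset_def by (auto intro!: pred_intros_logic)

text \<open>Intensity of a random set of points, with values in \<^typ>\<open>ennreal\<close>; \<open>io\<close> is its real version.\<close>

definition iot :: "('v env \<Rightarrow> 'v \<times> nat \<Rightarrow> bool) \<Rightarrow> 'v \<Rightarrow> ennreal" where
 "iot A z = (\<integral>\<^sup>+Y. \<integral>\<^sup>+i. of_bool (A Y (z, i)) \<partial>count_space UNIV \<partial>D)"

lemma of_bool_measurable: "Measurable.pred D Q \<Longrightarrow> (\<lambda>Y. of_bool (Q Y) :: ennreal) \<in> borel_measurable D"
 unfolding of_bool_def by measurable

lemma iot_meas: "rset A \<Longrightarrow> (\<lambda>Y. \<integral>\<^sup>+i. of_bool (A Y (z, i)) \<partial>count_space UNIV) \<in> borel_measurable D"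
 by (intro borel_measurable_nn_integral_count of_bool_measurable rsetD) auto

lemma iot_mono: "(AE Y in D. \<forall>i. A Y (z, i) \<longrightarrow> B Y (z, i)) \<Longrightarrow> iot A z \<le> iot B z"
 unfolding iot_def by (intro nn_integral_mono_AE) (auto elim!: eventually_mono intro!: nn_integral_mono)

lemma iot_split:
 assumes "rset A" "rset B"
 shows "iot A z = iot (\<lambda>Y p. A Y p \<and> B Y p) z + iot (\<lambda>Y p. A Y p \<and> \<not> B Y p) z"
proof -
 have "iot A z = (\<integral>\<^sup>+Y. (\<integral>\<^sup>+i. of_bool (A Y (z, i) \<and> B Y (z, i)) \<partial>count_space UNIV) + (\<integral>\<^sup>+i. of_bool (A Y (z, i) \<and> \<not> B Y (z, i)) \<partial>count_space UNIV) \<partial>D)"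
  unfolding iot_def by (subst nn_integral_add[symmetric]) (auto intro!: nn_integral_cong)
 also have "\<dots> = iot (\<lambda>Y p. A Y p \<and> B Y p) z + iot (\<lambda>Y p. A Y p \<and> \<not> B Y p) z"
  unfolding iot_def using rset_conj[OF assms] rset_conj[OF assms(1) rset_not[OF assms(2)]]
  by (intro nn_integral_add iot_meas) auto
 finally show ?thesis .
qed

lemma iot_const: assumes "rset A" shows "iot A z = iot A w"
proof -
 obtain \<gamma> where g: "aut \<gamma>" "\<gamma> w = z" using ex_aut by blast
 have "A (actz \<gamma> Y) (z, i) = A Y (w, i)" for Y i using rsetD(2)[OF assms g(1), of Y "(w, i)"] g(2) by simp
 then show ?thesis unfolding iot_def D_inv_nn[OF g(1) iot_meas[OF assms, of z]] by simp
qed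

text \<open>Expected mass sent equals expected mass received; the former is bounded below through
  \<open>A\<close>, the latter above through \<open>B\<close>.\<close>

lemma transport_le:
 fixes F :: "'v env \<Rightarrow> 'v \<times> nat \<Rightarrow> 'v \<times> nat \<Rightarrow> ennreal"
 assumes m: "\<And>p q. (\<lambda>Y. F Y p q) \<in> borel_measurable D"
  and e: "\<And>\<gamma> Y p q. aut \<gamma> \<Longrightarrow> F (actz \<gamma> Y) (gp \<gamma> p) (gp \<gamma> q) = F Y p q"
  and A: "AE Y in D. \<forall>p. A Y p \<longrightarrow> 1 \<le> (\<integral>\<^sup>+q. F Y p q \<partial>count_space UNIV)"
  and B: "AE Y in D. \<forall>q. (\<integral>\<^sup>+p. F Y p q \<partial>count_space UNIV) \<le> d * of_bool (B Y q)" "rset B"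
 shows "iot A z \<le> d * iot B z"
proof -
 have "iot A z \<le> (\<integral>\<^sup>+Y. \<integral>\<^sup>+i. \<integral>\<^sup>+q. F Y (z, i) q \<partial>count_space UNIV \<partial>count_space UNIV \<partial>D)"
  unfolding iot_def using A by (intro nn_integral_mono_AE) (auto elim!: eventually_mono intro!: nn_integral_mono)
 also have "\<dots> = (\<integral>\<^sup>+Y. \<integral>\<^sup>+j. \<integral>\<^sup>+p. F Y p (z, j) \<partial>count_space UNIV \<partial>count_space UNIV \<partial>D)"
  by (rule pmtp[where F = F, OF m e])
 also have "\<dots> \<le> (\<integral>\<^sup>+Y. \<integral>\<^sup>+j. d * of_bool (B Y (z, j)) \<partial>count_space UNIV \<partial>D)"
  using B(1) by (intro nn_integral_mono_AE) (auto elim!: eventually_mono intro!: nn_integral_mono)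
 also have "\<dots> = d * iot B z"
  unfolding iot_def by (simp add: nn_integral_cmult iot_meas[OF B(2)])
 finally show ?thesis .
qed

lemma inject_le:
 assumes A: "rset A" and B: "rset B"
  and m: "\<And>p q. Measurable.pred D (\<lambda>Y. m Y p q)" "\<And>\<gamma> Y p q. aut \<gamma> \<Longrightarrow> m (actz \<gamma> Y) (gp \<gamma> p) (gp \<gamma> q) = m Y p q"
  and ex: "AE Y in D. \<forall>p. A Y p \<longrightarrow> (\<exists>q. B Y q \<and> m Y p q)"
  and inj: "AE Y in D. \<forall>p p' q. m Y p q \<longrightarrow> m Y p' q \<longrightarrow> A Y p \<longrightarrow> A Y p' \<longrightarrow> p = p'"
 shows "iot A z \<le> iot B z"
proof -
 let ?F = "\<lambda>Y p q. of_bool (A Y p \<and> B Y q \<and> m Y p q) :: ennreal"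
 have "iot A z \<le> 1 * iot B z"
 proof (rule transport_le[where F = ?F])
  show "(\<lambda>Y. ?F Y p q) \<in> borel_measurable D" for p q
   by (intro of_bool_measurable pred_intros_logic rsetD(1)[OF A] rsetD(1)[OF B] m(1))
  show "?F (actz \<gamma> Y) (gp \<gamma> p) (gp \<gamma> q) = ?F Y p q" if "aut \<gamma>" for \<gamma> Y p q
   using A B m(2) that by (simp add: rsetD)
  show "AE Y in D. \<forall>p. A Y p \<longrightarrow> 1 \<le> (\<integral>\<^sup>+q. ?F Y p q \<partial>count_space UNIV)"
   using ex
  proof eventually_elim
   case (elim Y)
   show ?case
   proof (intro allI impI)
    fix p assume p: "A Y p"
    then obtain q where q: "B Y q" "m Y p q" using elim by blast
    have "1 = (\<integral>\<^sup>+q'. of_bool (q' \<in> {q}) * 1 \<partial>count_space UNIV)" by (subst nn_integral_of_bool_finite) auto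
    also have "\<dots> \<le> (\<integral>\<^sup>+q. ?F Y p q \<partial>count_space UNIV)" using p q by (intro nn_integral_mono) auto
    finally show "1 \<le> (\<integral>\<^sup>+q. ?F Y p q \<partial>count_space UNIV)" .
   qed
  qed
  show "AE Y in D. \<forall>q. (\<integral>\<^sup>+p. ?F Y p q \<partial>count_space UNIV) \<le> 1 * of_bool (B Y q)"
   using inj
  proof eventually_elim
   case (elim Y)
   show ?case
   proof
    fix q
    show "(\<integral>\<^sup>+p. ?F Y p q \<partial>count_space UNIV) \<le> 1 * of_bool (B Y q)"
    proof (cases "\<exists>p. A Y p \<and> B Y q \<and> m Y p q")
     case True
     then obtain p where p: "A Y p" "B Y q" "m Y p q" by blast
     have "(\<integral>\<^sup>+p. ?F Y p q \<partial>count_space UNIV) \<le> (\<integral>\<^sup>+p'. of_bool (p' \<in> {p}) * 1 \<partial>count_space UNIV)"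
     proof (intro nn_integral_mono)
      fix p'
      have "A Y p' \<and> B Y q \<and> m Y p' q \<Longrightarrow> p' = p" using elim p by blast
      then show "?F Y p' q \<le> of_bool (p' \<in> {p}) * 1"
       by (cases "A Y p' \<and> B Y q \<and> m Y p' q") auto
     qed
     also have "\<dots> = 1" by (subst nn_integral_of_bool_finite) auto
     finally show ?thesis using p by simp
    next
     case False
     then have no: "\<not> (A Y p \<and> B Y q \<and> m Y p q)" for p by blast
     show ?thesis by (simp only: no) simp
    qed
   qed
  qed
 qed (rule B)
 then show ?thesis by simp
qed

definition pt :: "'v env \<Rightarrow> bool \<Rightarrow> 'v \<times> nat \<Rightarrow> bool" where
 "pt Y b p \<longleftrightarrow> 1 \<le> snd p \<and> snd p \<le> cnt Y b (fst p)"

lemma pt_actz: "aut \<gamma> \<Longrightarrow> pt (actz \<gamma> Y) b (gp \<gamma> p) = pt Y b p"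
 by (simp add: pt_def cnt_actz act_field_def)

lemma pt_measurable [measurable]: "Measurable.pred D (\<lambda>Y. pt Y b p)"
 unfolding pt_def by measurable

lemma rset_pt: "rset (\<lambda>Y. pt Y b)"
 by (simp add: rset_def pt_actz)

lemma pt_count: "(\<integral>\<^sup>+i. of_bool (pt Y b (z, i)) \<partial>count_space UNIV) = of_nat (cnt Y b z)"
proof -
 have "(\<integral>\<^sup>+i. of_bool (pt Y b (z, i)) \<partial>count_space UNIV) = (\<integral>\<^sup>+i. of_bool (i \<in> {1..cnt Y b z}) * 1 \<partial>count_space UNIV)"
  by (intro nn_integral_cong) (simp add: pt_def)
 then show ?thesis by (subst (asm) nn_integral_of_bool_finite) auto
qed

lemma iot_pt: "iot (\<lambda>Y. pt Y b) z = 1"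
 unfolding iot_def pt_count by (rule D_mean)

lemma iot_le1: "(\<And>Y p. A Y p \<Longrightarrow> pt Y b p) \<Longrightarrow> iot A z \<le> 1"
 unfolding iot_pt[of b z, symmetric] by (intro iot_mono) auto

text \<open>A square is at most twice the exponential, whose expectation at one vertex is at most
  \<open>exp 2\<close>, hence below 8.\<close>

lemma second_moment: "(\<integral>\<^sup>+Y. (of_nat (cnt Y b z))\<^sup>2 \<partial>D) \<le> 16"
proof -
 have "(of_nat n)\<^sup>2 \<le> 2 * ennreal (exp (1 * real n))" for n
 proof -
  have "(real n)\<^sup>2 \<le> 2 * exp (real n)" using exp_lower_Taylor_quadratic[of "real n"] by (simp add: power2_eq_square)
  then have "ennreal ((real n)\<^sup>2) \<le> ennreal (2 * exp (real n))" by (rule ennreal_leI)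
  then show ?thesis by (simp add: ennreal_of_nat_eq_real_of_nat ennreal_power ennreal_mult)
 qed
 then have "(\<integral>\<^sup>+Y. (of_nat (cnt Y b z))\<^sup>2 \<partial>D) \<le> (\<integral>\<^sup>+Y. 2 * ennreal (exp (1 * real (\<Sum>u\<in>{z}. cnt Y b u))) \<partial>D)"
  by (intro nn_integral_mono) simp
 also have "\<dots> = 2 * (\<integral>\<^sup>+Y. ennreal (exp (1 * real (\<Sum>u\<in>{z}. cnt Y b u))) \<partial>D)"
  by (rule nn_integral_cmult) measurable
 also have "\<dots> \<le> 2 * ennreal (exp ((exp 1 - 1) * real (card {z})))"
  by (intro mult_left_mono D_mgf) auto
 also have "\<dots> \<le> 2 * ennreal 8"
 proof (intro mult_left_mono ennreal_leI)
  have "exp ((exp 1 - 1) * real (card {z})) \<le> exp (2::real)" using exp1_bounds(1) by simp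
  also have "\<dots> = exp 1 * exp 1" by (simp add: exp_add[symmetric])
  also have "\<dots> \<le> 2.8 * 2.8"
  proof -
   have "exp 1 \<le> (2.8::real)" using e_less_272 by simp
   then show ?thesis by (intro mult_mono) auto
  qed
  finally show "exp ((exp 1 - 1) * real (card {z})) \<le> 8" by simp
 qed auto
 finally show ?thesis by (simp flip: ennreal_numeral add: ennreal_mult[symmetric])
qed

text \<open>Turns a small probability into a small density of points although multiplicities are
  unbounded.\<close>

lemma CS_cnt:
 assumes "Measurable.pred D Q"
 shows "(\<integral>\<^sup>+Y. of_nat (cnt Y b z) * of_bool (Q Y) \<partial>D)\<^sup>2 \<le> 16 * ennreal (prob {Y. Q Y})"
proof -
 have m: "(\<lambda>Y. of_nat (cnt Y b z) :: ennreal) \<in> borel_measurable D" by measurable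
 have "(\<integral>\<^sup>+Y. of_nat (cnt Y b z) * of_bool (Q Y) \<partial>D)\<^sup>2 \<le> (\<integral>\<^sup>+Y. (of_nat (cnt Y b z))\<^sup>2 \<partial>D) * (\<integral>\<^sup>+Y. (of_bool (Q Y))\<^sup>2 \<partial>D)"
  by (rule Cauchy_Schwarz_nn_integral[OF m of_bool_measurable[OF assms]])
 also have "(\<integral>\<^sup>+Y. (of_bool (Q Y))\<^sup>2 \<partial>D) = (\<integral>\<^sup>+Y. indicator {Y. Q Y} Y \<partial>D)"
  by (intro nn_integral_cong) (auto simp: indicator_def)
 also have "\<dots> = ennreal (prob {Y. Q Y})" using pred_sets[OF assms] by (simp add: emeasure_eq_measure)
 finally show ?thesis using second_moment[of b z] by (meson mult_right_mono order_trans zero_le)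
qed

end

section \<open>Long edges, linked classes and good vertices\<close>

context env1 begin

text \<open>By \<open>reach_rad\<close> this permits every distance above \<open>rho\<close> up to
  \<open>rad + rho\<close>; subtracting \<open>rho + 1\<close> encodes the strict comparison with
  \<open>rad\<close>. In terms of \<open>hasbad\<close>, the condition is monotone in
  \<open>d\<close> and has an explicit probability bound.\<close>

definition reach :: "'v env \<Rightarrow> bool \<Rightarrow> 'v \<Rightarrow> nat \<Rightarrow> bool" where
 "reach Y b v d \<longleftrightarrow> hasbad Y b v (bsize (d - rho - 1))"

lemma reach_rad:
 assumes "\<exists>n. \<not> hasbad Y b v n" "d \<le> rad Y b v + rho" "\<not> d \<le> rho"
 shows "reach Y b v d"
 unfolding reach_def using assms by (intro rad(2)) auto

lemma rad_measurable [measurable]: "(\<lambda>Y. rad Y b v) \<in> D \<rightarrow>\<^sub>M count_space UNIV"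
 unfolding rad_def by measurable

lemma rad_actz: "aut \<gamma> \<Longrightarrow> rad (actz \<gamma> Y) b (\<gamma> v) = rad Y b v"
 by (simp add: rad_def hasbad_actz)

lemma good_actz: "aut \<gamma> \<Longrightarrow> good (actz \<gamma> Y) b k (\<gamma> v) = good Y b k v"
 by (simp add: good_def hasbad_actz)

lemma vgood_actz: "aut \<gamma> \<Longrightarrow> vgood (actz \<gamma> Y) b k (\<gamma> v) = vgood Y b k v"
 unfolding vgood_def by (simp add: aut_gball good_actz)

lemma vgood_measurable [measurable]: "Measurable.pred D (\<lambda>Y. vgood Y b k v)"
 unfolding vgood_def good_def by (intro pred_intros_finite pred_intros_logic hasbad_measurable) simp

lemma vadj_actz: assumes g: "aut \<gamma>" shows "vadj (actz \<gamma> Y) b (\<gamma> v) (\<gamma> w) = vadj Y b v w"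
 unfolding vadj_def rad_actz[OF g] aut_gball[OF g] by (simp add: g)

lemma vadj_measurable [measurable]: "Measurable.pred D (\<lambda>Y. vadj Y b v w)"
proof -
 have eq: "vadj Y b v w \<longleftrightarrow> (\<exists>x\<in>UNIV. \<exists>y\<in>UNIV. dd x y \<le> DD \<and> dd v x \<le> rad Y b v \<and> dd w y \<le> rad Y b w)" for Y
  unfolding vadj_def Bex_def mem_gball by blast
 show ?thesis unfolding eq
  by (intro pred_Bex_countable[OF countable_V] pred_intros_logic) measurable
qed

definition cl :: "'v env \<Rightarrow> bool \<Rightarrow> nat \<Rightarrow> 'v \<Rightarrow> 'v \<Rightarrow> bool" where
 "cl Y b k v w \<longleftrightarrow> (v, w) \<in> (VR Y b k)\<^sup>*"

lemma relpow_measurable: "Measurable.pred D (\<lambda>Y. (v, w) \<in> VR Y b k ^^ n)"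
proof (induction n arbitrary: w)
 case 0 then show ?case by simp
next
 case (Suc n)
 have eq: "(v, w) \<in> VR Y b k ^^ Suc n \<longleftrightarrow> (\<exists>y\<in>UNIV. (v, y) \<in> VR Y b k ^^ n \<and> \<not> vgood Y b k y \<and> \<not> vgood Y b k w \<and> vadj Y b y w)" for Y
  by (auto simp: VR_def)
 show ?case unfolding eq
  by (intro pred_Bex_countable[OF countable_V] pred_intros_logic Suc vgood_measurable vadj_measurable)
qed

lemma cl_measurable [measurable]: "Measurable.pred D (\<lambda>Y. cl Y b k v w)"
 unfolding cl_def rtrancl_power by (intro pred_intros_countable relpow_measurable)

lemma cl_actz: assumes g: "aut \<gamma>" shows "cl (actz \<gamma> Y) b k (\<gamma> v) (\<gamma> w) = cl Y b k v w"
proof -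
 have "(\<gamma> v, \<gamma> w) \<in> VR (actz \<gamma> Y) b k ^^ n \<longleftrightarrow> (v, w) \<in> VR Y b k ^^ n" for n
 proof (induction n arbitrary: w)
  case 0 then show ?case by (simp add: g)
 next
  case (Suc n)
  have "(\<gamma> v, \<gamma> w) \<in> VR (actz \<gamma> Y) b k ^^ Suc n \<longleftrightarrow> (\<exists>y. (\<gamma> v, y) \<in> VR (actz \<gamma> Y) b k ^^ n \<and> (y, \<gamma> w) \<in> VR (actz \<gamma> Y) b k)"
   by (auto intro: relcompI)
  also have "\<dots> \<longleftrightarrow> (\<exists>y. (\<gamma> v, \<gamma> y) \<in> VR (actz \<gamma> Y) b k ^^ n \<and> (\<gamma> y, \<gamma> w) \<in> VR (actz \<gamma> Y) b k)"
   by (rule ex_aut_iff[OF g])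
  also have "\<dots> \<longleftrightarrow> (\<exists>y. (v, y) \<in> VR Y b k ^^ n \<and> (y, w) \<in> VR Y b k)"
  proof -
   have "(\<gamma> y, \<gamma> w) \<in> VR (actz \<gamma> Y) b k \<longleftrightarrow> (y, w) \<in> VR Y b k" for y
    by (simp add: VR_def vgood_actz[OF g] vadj_actz[OF g])
   then show ?thesis by (simp only: Suc)
  qed
  also have "\<dots> \<longleftrightarrow> (v, w) \<in> VR Y b k ^^ Suc n" by (auto intro: relcompI)
  finally show ?case .
 qed
 then show ?thesis by (simp add: cl_def rtrancl_power)
qed

lemma vadj_sym: "vadj Y b v w \<Longrightarrow> vadj Y b w v"
 unfolding vadj_def using dd_sym by metis

lemma cl_sym: "cl Y b k v w \<Longrightarrow> cl Y b k w v"
proof -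
 have "sym (VR Y b k)" by (auto simp: sym_def VR_def intro: vadj_sym)
 then show "cl Y b k v w \<Longrightarrow> cl Y b k w v" unfolding cl_def using sym_rtrancl symD by metis
qed

lemma cl_trans: "cl Y b k u v \<Longrightarrow> cl Y b k v w \<Longrightarrow> cl Y b k u w"
 unfolding cl_def by (rule rtrancl_trans)

text \<open>Minimality keeps the ball of radius \<open>rr n\<close> below \<open>n * bsize 1\<close>
  vertices, so the constants attached to scale \<open>k\<close> stay linear in
  \<open>k\<close>.\<close>

definition rr :: "nat \<Rightarrow> nat" where "rr n = (LEAST r. n \<le> bsize r)"

lemma rr: "n \<le> bsize (rr n)" "n \<ge> 1 \<Longrightarrow> bsize (rr n) \<le> n * bsize 1"
proof -
 have "n \<le> bsize n" using bsize_ge[of n] by simp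
 then show "n \<le> bsize (rr n)" unfolding rr_def by (rule LeastI)
 assume n: "n \<ge> 1"
 show "bsize (rr n) \<le> n * bsize 1"
 proof (cases "rr n")
  case 0
  then show ?thesis using n bsize_ge[of 1] by simp
 next
  case (Suc r)
  then have "\<not> n \<le> bsize r" using not_less_Least[of r "\<lambda>r. n \<le> bsize r"] by (simp add: rr_def)
  then have "bsize r * bsize 1 \<le> n * bsize 1" by simp
  then show ?thesis using bsize_add[of r 1] Suc by (metis Suc_eq_plus1 le_trans)
 qed
qed

text \<open>The ball of radius \<open>rr k\<close> around \<open>u\<close> is a connected set of
  size at least \<open>k\<close>, hence not bad; both claims are read off its two
  inequalities.\<close>

lemma good_facts:
 assumes g: "good Y b k u" and k: "k \<ge> 1"
 shows "cnt Y b u \<le> Lc * bsize (rr k)" "\<exists>q. dd u q \<le> rr k + rho \<and> 0 < cnt Y (\<not> b) q"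
proof -
 let ?W = "gball E u (rr k)"
 have c: "conn DD ?W" unfolding DD_def using conn_gball[of "2 * rho"] by simp
 have "k \<le> card ?W" using rr(1) by (simp add: card_gball)
 moreover have "u \<in> ?W" by simp
 ultimately have nb: "\<not> bad Y b ?W" using g c unfolding good_def hasbad_def by blast
 have "cnt Y b u = csum Y b {u}" by (simp add: csum_def)
 also have "\<dots> \<le> csum Y b ?W" by (rule csum_mono) auto
 also have "\<dots> \<le> Lc * bsize (rr k)" using nb by (simp add: bad_def bad2_def card_gball)
 finally show "cnt Y b u \<le> Lc * bsize (rr k)" .
 have "nbhd ?W rho = gball E u (rr k + rho)" by (simp add: gball_eq_nbhd nbhd_add)
 then have le: "6 * Lc * bsize (rr k) \<le> csum Y (\<not> b) (gball E u (rr k + rho))"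
  using nb by (simp add: bad_def bad1_def card_gball)
 have "Lc > 0" using Lc_large kappa_pos kr by (cases Lc) auto
 moreover have "bsize (rr k) > 0" using rr(1)[of k] k by simp
 ultimately have "6 * Lc * bsize (rr k) > 0" by simp
 with le have pos: "csum Y (\<not> b) (gball E u (rr k + rho)) > 0" by linarith
 show "\<exists>q. dd u q \<le> rr k + rho \<and> 0 < cnt Y (\<not> b) q"
 proof (rule ccontr)
  assume "\<nexists>q. dd u q \<le> rr k + rho \<and> 0 < cnt Y (\<not> b) q"
  then have "csum Y (\<not> b) (gball E u (rr k + rho)) = 0" unfolding csum_def by (intro sum.neutral) auto
  then show False using pos by simp
 qed
qed

end

text \<open>The constants are chosen in the order \<open>k\<close>, \<open>e0\<close>,
  \<open>kp\<close>. At scale \<open>k\<close> the decay \<open>lam ^ k\<close> beats multiplicities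
  and ball sizes; up to density \<open>e0\<close> all sets expand; and edges up to length
  \<open>kp\<close> are always allowed, with \<open>kp\<close> so large that a set of density
  \<open>e0\<close> misses at most density \<open>e0\<close> of the other side.\<close>

locale env2 = env1 E D rho Lc \<kappa> for E :: "'v \<Rightarrow> 'v \<Rightarrow> bool" and D rho Lc \<kappa> +
 fixes k kp :: nat and e0 :: real
 assumes k2: "k \<ge> 2" and kp_ge: "kp \<ge> k + (rr k + rho)"
  and k_small: "12 * real (Lc * bsize (rr k)) * real (bsize (rr k + rho)) * lam ^ k \<le> 1"
  and e0: "0 < e0" "e0 \<le> 1 / 4" "e0 \<le> 1 / (6 * real (bsize (rr k + rho)))"
  and kp_small: "lam ^ kp \<le> e0 ^ 4 / 256"
begin

text \<open>The edges of the bipartite graph in which the matching is sought, as a relation on locations.\<close>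

definition Hd :: "'v env \<Rightarrow> bool \<Rightarrow> 'v \<Rightarrow> 'v \<Rightarrow> bool" where
 "Hd Y b v u \<longleftrightarrow> dd v u \<le> kp \<or> reach Y b v (dd v u) \<or> reach Y (\<not> b) u (dd v u)"

lemma Hd_sym: "Hd Y (\<not> b) u v = Hd Y b v u"
 by (auto simp: Hd_def dd_sym)

lemma Hd_measurable [measurable]: "Measurable.pred D (\<lambda>Y. Hd Y b v u)"
 unfolding Hd_def reach_def by measurable

lemma Hd_actz: "aut \<gamma> \<Longrightarrow> Hd (actz \<gamma> Y) b (\<gamma> v) (\<gamma> u) = Hd Y b v u"
 by (simp add: Hd_def reach_def hasbad_actz)

definition NN :: "bool \<Rightarrow> ('v env \<Rightarrow> 'v \<times> nat \<Rightarrow> bool) \<Rightarrow> 'v env \<Rightarrow> 'v \<times> nat \<Rightarrow> bool" where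
 "NN b A Y q \<longleftrightarrow> pt Y (\<not> b) q \<and> (\<exists>p. A Y p \<and> Hd Y b (fst p) (fst q))"

lemma rset_NN: assumes A: "rset A" shows "rset (NN b A)"
 unfolding rset_def
proof (intro conjI allI impI)
 fix q
 have eq: "NN b A Y q \<longleftrightarrow> pt Y (\<not> b) q \<and> (\<exists>p\<in>UNIV. A Y p \<and> Hd Y b (fst p) (fst q))" for Y by (simp add: NN_def)
 show "Measurable.pred D (\<lambda>Y. NN b A Y q)" unfolding eq
  by (intro pred_intros_logic pred_Bex_countable[OF countable_pts] rsetD(1)[OF A] pt_measurable Hd_measurable)
next
 fix \<gamma> Y q assume g: "aut \<gamma>"
 show "NN b A (actz \<gamma> Y) (gp \<gamma> q) = NN b A Y q"
  unfolding NN_def pt_actz[OF g] ex_gp_iff[OF g, of "\<lambda>p. A (actz \<gamma> Y) p \<and> Hd (actz \<gamma> Y) b (fst p) (fst (gp \<gamma> q))"]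
  by (simp add: rsetD(2)[OF A g] Hd_actz[OF g])
qed

text \<open>Every point of \<open>A\<close> distributes one unit evenly over the targets
  \<open>Ns\<close> of its class. By \<open>expansion\<close> the points of \<open>A\<close> in a
  class are at most a sixth as many as its targets, and targets of different classes are
  disjoint.\<close>

lemma expand_bad:
 assumes A: "rset A" and sub: "\<And>Y p. A Y p \<Longrightarrow> pt Y b p \<and> \<not> vgood Y b k (fst p)"
 shows "iot A z \<le> ennreal (1 / 6) * iot (NN b A) z"
proof -
 define Ns where "Ns Y v q \<longleftrightarrow> pt Y (\<not> b) q \<and> (\<exists>p. A Y p \<and> cl Y b k v (fst p) \<and> dd (fst p) (fst q) \<le> rad Y b (fst p) + rho)" for Y v q
 define N where "N Y v = (\<integral>\<^sup>+q. of_bool (Ns Y v q) \<partial>count_space UNIV :: ennreal)" for Y v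
 define F where "F Y p q = (of_bool (A Y p \<and> Ns Y (fst p) q) / N Y (fst p) :: ennreal)" for Y p q
 have Ns_meas: "Measurable.pred D (\<lambda>Y. Ns Y v q)" for v q
 proof -
  have eq: "Ns Y v q \<longleftrightarrow> pt Y (\<not> b) q \<and> (\<exists>p\<in>UNIV. A Y p \<and> cl Y b k v (fst p) \<and> dd (fst p) (fst q) \<le> rad Y b (fst p) + rho)" for Y
   by (simp add: Ns_def)
  show ?thesis unfolding eq
   by (intro pred_intros_logic pred_Bex_countable[OF countable_pts] rsetD(1)[OF A] pt_measurable cl_measurable) measurable
 qed
 have N_meas: "(\<lambda>Y. N Y v) \<in> borel_measurable D" for v
  unfolding N_def by (intro borel_measurable_nn_integral_count countable_pts of_bool_measurable Ns_meas)
 have Ns_act: "Ns (actz \<gamma> Y) (\<gamma> v) (gp \<gamma> q) = Ns Y v q" if g: "aut \<gamma>" for \<gamma> Y v q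
  unfolding Ns_def pt_actz[OF g] ex_gp_iff[OF g, of "\<lambda>p. A (actz \<gamma> Y) p \<and> _ p \<and> _ p"]
  by (simp add: rsetD(2)[OF A g] cl_actz[OF g] rad_actz[OF g] g)
 have N_act: "N (actz \<gamma> Y) (\<gamma> v) = N Y v" if g: "aut \<gamma>" for \<gamma> Y v
 proof -
  have "N (actz \<gamma> Y) (\<gamma> v) = (\<integral>\<^sup>+q. of_bool (Ns (actz \<gamma> Y) (\<gamma> v) (gp \<gamma> q)) \<partial>count_space UNIV)"
   unfolding N_def by (rule nn_integral_bij_count_space[OF gp_bij[OF g], symmetric])
  then show ?thesis by (simp add: Ns_act[OF g] N_def)
 qed
 have AE: "AE Y in D. \<forall>v. \<not> vgood Y b k v \<longrightarrow> finite {w. cl Y b k v w} \<and>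
  finite {q. Ns Y v q} \<and> 6 * card {p. A Y p \<and> cl Y b k v (fst p)} \<le> card {q. Ns Y v q} \<and> finite {p. A Y p \<and> cl Y b k v (fst p)}"
  using AE_wf AE_ext[of b] AE_locfin[of b]
 proof eventually_elim
  case (elim Y)
  show ?case
  proof (intro allI impI)
   fix v assume v: "\<not> vgood Y b k v"
   have wf: "\<forall>v. \<exists>n. \<not> hasbad Y b v n" using elim(1) by blast
   have fc: "finite {w. cl Y b k v w}"
    using finite_class[OF wf elim(2,3) _ v] k2 by (simp add: cl_def Image_def)
   define S where "S = {w. cl Y b k v w \<and> (\<exists>i. A Y (w, i))}"
   have fS: "finite S" by (rule finite_subset[OF _ fc]) (auto simp: S_def)
   let ?U = "\<Union>w\<in>S. gball E w (rad Y b w + rho)"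
   have fU: "finite ?U" using fS by simp
   have pts: "finite {p. pt Y b' p \<and> fst p \<in> X} \<and> card {p. pt Y b' p \<and> fst p \<in> X} = csum Y b' X" if "finite X" for b' X
   proof -
    have "{p. pt Y b' p \<and> fst p \<in> X} = (SIGMA v:X. {1..cnt Y b' v})" by (auto simp: pt_def)
    then show ?thesis using that by (simp add: csum_def)
   qed
   have 1: "{q. Ns Y v q} = {q. pt Y (\<not> b) q \<and> fst q \<in> ?U}"
    by (auto simp: Ns_def S_def)
   have 2: "{p. A Y p \<and> cl Y b k v (fst p)} \<subseteq> {p. pt Y b p \<and> fst p \<in> S}"
   proof
    fix p assume "p \<in> {p. A Y p \<and> cl Y b k v (fst p)}"
    then have p: "A Y p" "cl Y b k v (fst p)" by auto
    have "A Y (fst p, snd p)" using p by simp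
    then show "p \<in> {p. pt Y b p \<and> fst p \<in> S}" using sub[OF p(1)] p(2) unfolding S_def by blast
   qed
   have "6 * card {p. A Y p \<and> cl Y b k v (fst p)} \<le> 6 * csum Y b S"
    using card_mono[OF _ 2] pts[OF fS, of b] by simp
   also have "\<dots> \<le> csum Y (\<not> b) ?U" by (rule expansion[OF wf fS])
   also have "\<dots> = card {q. Ns Y v q}" using pts[OF fU, of "\<not> b"] unfolding 1 by simp
   finally show "finite {w. cl Y b k v w} \<and> finite {q. Ns Y v q} \<and>
     6 * card {p. A Y p \<and> cl Y b k v (fst p)} \<le> card {q. Ns Y v q} \<and> finite {p. A Y p \<and> cl Y b k v (fst p)}"
    using fc pts[OF fU, of "\<not> b"] pts[OF fS, of b] finite_subset[OF 2] unfolding 1 by simp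
  qed
 qed
 have NsN: "(\<integral>\<^sup>+q. of_bool (Ns Y v q) \<partial>count_space UNIV) = (of_nat (card {q. Ns Y v q}) :: ennreal)" if "finite {q. Ns Y v q}" for Y v
  using nn_integral_of_bool_finite[OF that, of 1] by simp
 show ?thesis
 proof (rule transport_le[where F = F])
  show "(\<lambda>Y. F Y p q) \<in> borel_measurable D" for p q
   unfolding F_def using N_meas Ns_meas rsetD(1)[OF A]
   by (intro borel_measurable_divide_ennreal of_bool_measurable pred_intros_logic) auto
  show "F (actz \<gamma> Y) (gp \<gamma> p) (gp \<gamma> q) = F Y p q" if "aut \<gamma>" for \<gamma> Y p q
   unfolding F_def using that by (simp add: N_act Ns_act rsetD(2)[OF A])
  show "AE Y in D. \<forall>p. A Y p \<longrightarrow> 1 \<le> (\<integral>\<^sup>+q. F Y p q \<partial>count_space UNIV)"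
   using AE
  proof eventually_elim
   case (elim Y)
   show ?case
   proof (intro allI impI)
    fix p assume p: "A Y p"
    let ?v = "fst p"
    have v: "\<not> vgood Y b k ?v" using sub p by blast
    have f: "finite {q. Ns Y ?v q}" and f2: "finite {p. A Y p \<and> cl Y b k ?v (fst p)}"
     and le: "6 * card {p. A Y p \<and> cl Y b k ?v (fst p)} \<le> card {q. Ns Y ?v q}" using elim v by blast+
    have "p \<in> {p. A Y p \<and> cl Y b k ?v (fst p)}" using p by (simp add: cl_def)
    then have "card {p. A Y p \<and> cl Y b k ?v (fst p)} > 0" using f2 by (metis card_gt_0_iff empty_iff)
    then have c: "card {q. Ns Y ?v q} > 0" using le by linarith
    have "(\<integral>\<^sup>+q. F Y p q \<partial>count_space UNIV) = (\<integral>\<^sup>+q. of_bool (Ns Y ?v q) \<partial>count_space UNIV) / N Y ?v"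
     unfolding F_def using p by (simp add: divide_ennreal_def nn_integral_multc)
    also have "\<dots> = 1" unfolding N_def NsN[OF f] using c by (subst ennreal_divide_self) (auto simp: of_nat_less_top)
    finally show "1 \<le> (\<integral>\<^sup>+q. F Y p q \<partial>count_space UNIV)" by simp
   qed
  qed
  show "AE Y in D. \<forall>q. (\<integral>\<^sup>+p. F Y p q \<partial>count_space UNIV) \<le> ennreal (1 / 6) * of_bool (NN b A Y q)"
   using AE AE_wf
  proof eventually_elim
   case (elim Y)
   have wf: "\<exists>n. \<not> hasbad Y b v n" for v using elim(2) by blast
   show ?case
   proof
    fix q
    show "(\<integral>\<^sup>+p. F Y p q \<partial>count_space UNIV) \<le> ennreal (1 / 6) * of_bool (NN b A Y q)"
    proof (cases "\<exists>p. A Y p \<and> Ns Y (fst p) q")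
     case False
     then have "\<not> (A Y p \<and> Ns Y (fst p) q)" for p by blast
     then have "F Y p q = 0" for p by (simp add: F_def)
     then show ?thesis by simp
    next
     case True
     then obtain p where p: "A Y p" "Ns Y (fst p) q" by blast
     let ?v = "fst p"
     have v: "\<not> vgood Y b k ?v" using sub p by blast
     obtain p0 where p0: "pt Y (\<not> b) q" "A Y p0" "cl Y b k ?v (fst p0)" "dd (fst p0) (fst q) \<le> rad Y b (fst p0) + rho"
      using p(2) unfolding Ns_def by blast
     have NNq: "NN b A Y q"
     proof -
      have "Hd Y b (fst p0) (fst q)"
       using reach_rad[OF wf p0(4)] kp_ge unfolding Hd_def by fastforce
      then show ?thesis using p0 unfolding NN_def by blast
     qed
     \<comment> \<open>A target shared by two enlarged balls puts the balls themselves within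
       \<open>2 * rho\<close> of each other, so their centres are linked and belong to one
       class.\<close>
     have same: "cl Y b k ?v (fst p')" if p': "A Y p'" "Ns Y (fst p') q" for p'
     proof -
      obtain p1 where p1: "A Y p1" "cl Y b k (fst p') (fst p1)" "dd (fst p1) (fst q) \<le> rad Y b (fst p1) + rho"
       using p'(2) unfolding Ns_def by blast
      have mid: "\<exists>x. dd c x \<le> r \<and> dd x y \<le> s" if "dd c y \<le> r + s" for c r s y
      proof -
       have "y \<in> nbhd {c} (r + s)" using that by (simp add: nbhd_def)
       then have "y \<in> nbhd (nbhd {c} r) s" by (simp only: nbhd_add)
       then show ?thesis by (auto simp: nbhd_def)
      qed
      obtain x where x: "dd (fst p0) x \<le> rad Y b (fst p0)" "dd x (fst q) \<le> rho" using mid[OF p0(4)] by blast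
      obtain y where y: "dd (fst p1) y \<le> rad Y b (fst p1)" "dd y (fst q) \<le> rho" using mid[OF p1(3)] by blast
      have "dd x y \<le> DD" using x(2) y(2) dd_triangle[of x y "fst q"] dd_sym[of y "fst q"] by (simp add: DD_def)
      then have "vadj Y b (fst p0) (fst p1)" using x y unfolding vadj_def by (intro bexI[of _ x] bexI[of _ y]) auto
      moreover have "\<not> vgood Y b k (fst p0)" "\<not> vgood Y b k (fst p1)" using sub p0 p1 by blast+
      ultimately have "cl Y b k (fst p0) (fst p1)" unfolding cl_def VR_def by auto
      then show ?thesis using p0(3) cl_sym[OF p1(2)] cl_trans by blast
     qed
     have eqN: "Ns Y (fst p') = Ns Y ?v" if "cl Y b k ?v (fst p')" for p'
      unfolding Ns_def using that cl_sym cl_trans by (intro ext) blast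
     have f: "finite {q. Ns Y ?v q}" and f2: "finite {p. A Y p \<and> cl Y b k ?v (fst p)}"
      and le: "6 * card {p. A Y p \<and> cl Y b k ?v (fst p)} \<le> card {q. Ns Y ?v q}" using elim v by blast+
     let ?P = "{p. A Y p \<and> cl Y b k ?v (fst p)}"
     have "F Y p' q \<le> of_bool (p' \<in> ?P) * (1 / N Y ?v)" for p'
      using same[of p'] eqN[of p'] unfolding F_def N_def by (cases "A Y p' \<and> Ns Y (fst p') q") auto
     then have "(\<integral>\<^sup>+p. F Y p q \<partial>count_space UNIV) \<le> (\<integral>\<^sup>+p'. of_bool (p' \<in> ?P) * (1 / N Y ?v) \<partial>count_space UNIV)"
      by (intro nn_integral_mono)
     also have "\<dots> = of_nat (card ?P) * (1 / of_nat (card {q. Ns Y ?v q}))"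
      unfolding N_def NsN[OF f] by (rule nn_integral_of_bool_finite[OF f2])
     also have "\<dots> = ennreal (real (card ?P) * (1 / real (card {q. Ns Y ?v q})))"
     proof -
      have "card {q. Ns Y ?v q} > 0" using p(2) f by (metis card_gt_0_iff empty_iff mem_Collect_eq)
      then have "(1 / of_nat (card {q. Ns Y ?v q}) :: ennreal) = ennreal (1 / real (card {q. Ns Y ?v q}))"
       by (simp add: ennreal_of_nat_eq_real_of_nat divide_ennreal flip: ennreal_1)
      then show ?thesis by (simp only: ennreal_of_nat_eq_real_of_nat) (rule ennreal_mult[symmetric], simp_all)
     qed
     also have "\<dots> \<le> ennreal (1 / 6)"
     proof (intro ennreal_leI)
      have "6 * real (card ?P) \<le> real (card {q. Ns Y ?v q})" using le by (metis of_nat_le_iff of_nat_mult of_nat_numeral)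
      moreover have "card {q. Ns Y ?v q} > 0" using p(2) f by (metis card_gt_0_iff empty_iff mem_Collect_eq)
      ultimately show "real (card ?P) * (1 / real (card {q. Ns Y ?v q})) \<le> 1 / 6" by (simp add: field_simps)
     qed
     finally show ?thesis using NNq by simp
    qed
   qed
  qed
 qed (rule rset_NN[OF A])
qed

definition io :: "('v env \<Rightarrow> 'v \<times> nat \<Rightarrow> bool) \<Rightarrow> real" where
 "io A = enn2real (iot A (SOME z. True))"

lemma io: assumes "rset A" "\<And>Y p. A Y p \<Longrightarrow> pt Y b p"
 shows "iot A z = ennreal (io A)" "0 \<le> io A" "io A \<le> 1"
proof -
 have 1: "iot A (SOME z. True) \<le> 1" using assms(2) by (rule iot_le1)
 then have "iot A (SOME z. True) < top" using ennreal_one_less_top le_less_trans by blast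
 then show "iot A z = ennreal (io A)" using iot_const[OF assms(1), of z "SOME z. True"] by (simp add: io_def)
 show "0 \<le> io A" by (simp add: io_def)
 show "io A \<le> 1" unfolding io_def using enn2real_mono[OF 1] by simp
qed

lemma NN_pt: "NN b A Y p \<Longrightarrow> pt Y (\<not> b) p"
 by (simp add: NN_def)

lemma io_NN:
 assumes "rset A"
 shows "iot (NN b A) z = ennreal (io (NN b A))" "0 \<le> io (NN b A)" "io (NN b A) \<le> 1"
 using io[OF rset_NN[OF assms] NN_pt] by auto

lemma supp_gap:
 assumes A: "rset A"
 shows "prob {Y. \<exists>i. A Y (z, i)} \<le> prob {Y. \<exists>u\<in>gball E z r. \<exists>i. A Y (u, i)} * (prob {Y. \<exists>i. A Y (z, i)} + lam ^ r)"
proof (rule D_gap)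
 show "Measurable.pred D (\<lambda>Y. \<exists>i. A Y (u, i))" for u
  by (intro pred_intros_countable rsetD(1)[OF A])
 show "(\<exists>i. A (actz \<gamma> Y) (\<gamma> u, i)) = (\<exists>i. A Y (u, i))" if "aut \<gamma>" for \<gamma> Y u
  using rsetD(2)[OF A that, of Y "(u, _)"] by simp
qed

lemma supp_measurable: "rset A \<Longrightarrow> Measurable.pred D (\<lambda>Y. \<exists>i. A Y (u, i))"
 by (intro pred_intros_countable rsetD(1))

text \<open>Good vertices have bounded multiplicity, so density is controlled by the probability of
  occupation. The spectral gap spreads the occupied set, and every vertex within \<open>k\<close> of
  it is still good and hence sees a point of the other side nearby. That point is a neighbour of
  \<open>A\<close> because \<open>kp\<close> covers the sum of both distances.\<close>

lemma expand_good:
 fixes z :: 'v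
 assumes A: "rset A" and sub: "\<And>Y p. A Y p \<Longrightarrow> pt Y b p \<and> vgood Y b k (fst p)"
 defines "\<sigma> \<equiv> prob {Y. \<exists>i. A Y (z, i)}" and "Q \<equiv> prob {Y. \<exists>u\<in>gball E z k. \<exists>i. A Y (u, i)}"
 shows "io A \<le> real (Lc * bsize (rr k)) * \<sigma>" "\<sigma> \<le> Q * (\<sigma> + lam ^ k)" "Q \<le> real (bsize (rr k + rho)) * io (NN b A)"
proof -
 show "\<sigma> \<le> Q * (\<sigma> + lam ^ k)" unfolding \<sigma>_def Q_def by (rule supp_gap[OF A])
 let ?K = "Lc * bsize (rr k)" and ?s = "rr k + rho"
 have vg: "vgood Y b k v \<Longrightarrow> good Y b k v" for Y v by (simp add: vgood_def)
 have "iot A z \<le> (\<integral>\<^sup>+Y. of_nat ?K * indicator {Y. \<exists>i. A Y (z, i)} Y \<partial>D)"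
  unfolding iot_def
 proof (intro nn_integral_mono)
  fix Y
  show "(\<integral>\<^sup>+i. of_bool (A Y (z, i)) \<partial>count_space UNIV) \<le> of_nat ?K * indicator {Y. \<exists>i. A Y (z, i)} Y"
  proof (cases "\<exists>i. A Y (z, i)")
   case True
   then obtain i where i: "A Y (z, i)" ..
   then have "vgood Y b k z" using sub[OF i] by simp
   then have c: "cnt Y b z \<le> ?K" using good_facts(1)[OF vg] k2 by simp
   have "(\<integral>\<^sup>+i. of_bool (A Y (z, i)) \<partial>count_space UNIV) \<le> (\<integral>\<^sup>+i. of_bool (pt Y b (z, i)) \<partial>count_space UNIV)"
    using sub by (intro nn_integral_mono) (simp add: of_bool_def)
   also have "\<dots> \<le> of_nat ?K" unfolding pt_count using c by (simp only: of_nat_le_iff)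
   finally show ?thesis using True by simp
  next
   case False
   then have "\<not> A Y (z, i)" for i by blast
   then show ?thesis by simp
  qed
 qed
 also have "\<dots> = of_nat ?K * ennreal \<sigma>"
  unfolding \<sigma>_def using pred_sets[OF supp_measurable[OF A, of z]] by (simp add: nn_integral_cmult emeasure_eq_measure)
 also have "\<dots> = ennreal (real ?K * \<sigma>)" by (simp add: ennreal_of_nat_eq_real_of_nat ennreal_mult \<sigma>_def)
 finally have "ennreal (io A) \<le> ennreal (real ?K * \<sigma>)" using io(1)[OF A, of b z] sub by metis
 then show "io A \<le> real ?K * \<sigma>" by (subst (asm) ennreal_le_iff) (simp_all add: \<sigma>_def)
 \<comment> \<open>Actual points have index at least 1, so \<open>(v, 0)\<close> is free to stand
   for the vertex \<open>v\<close> itself in a transport between points.\<close>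
 define A' where "A' Y p \<longleftrightarrow> snd p = 0 \<and> (\<exists>u\<in>gball E (fst p) k. \<exists>i. A Y (u, i))" for Y and p :: "'v \<times> nat"
 let ?F = "\<lambda>Y (p :: 'v \<times> nat) (q :: 'v \<times> nat). of_bool (A' Y p \<and> NN b A Y q \<and> dd (fst p) (fst q) \<le> ?s) :: ennreal"
 have mQ: "Measurable.pred D (\<lambda>Y. \<exists>u\<in>gball E v k. \<exists>i. A Y (u, i))" for v
  by (intro pred_intros_finite supp_measurable A) simp
 have A'r: "rset A'"
  unfolding rset_def
 proof (intro conjI allI impI)
  show "Measurable.pred D (\<lambda>Y. A' Y p)" for p
   unfolding A'_def using mQ[of "fst p"] by (cases "snd p = 0") simp_all
  fix \<gamma> Y p assume g: "aut \<gamma>"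
  have "A (actz \<gamma> Y) (\<gamma> u, i) = A Y (u, i)" for u i using rsetD(2)[OF A g, of Y "(u, i)"] by simp
  then show "A' (actz \<gamma> Y) (gp \<gamma> p) = A' Y p"
   unfolding A'_def by (simp add: aut_gball[OF g])
 qed
 have N: "rset (NN b A)" by (rule rset_NN[OF A])
 have "iot A' z \<le> of_nat (bsize ?s) * iot (NN b A) z"
 proof (rule transport_le[where F = ?F])
  show "(\<lambda>Y. ?F Y p q) \<in> borel_measurable D" for p q
   by (intro of_bool_measurable pred_intros_logic rsetD(1)[OF A'r] rsetD(1)[OF N]) simp
  show "?F (actz \<gamma> Y) (gp \<gamma> p) (gp \<gamma> q) = ?F Y p q" if "aut \<gamma>" for \<gamma> Y p q
   using that by (simp add: rsetD(2)[OF A'r] rsetD(2)[OF N])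
  show "AE Y in D. \<forall>p. A' Y p \<longrightarrow> 1 \<le> (\<integral>\<^sup>+q. ?F Y p q \<partial>count_space UNIV)"
  proof (intro AE_I2 allI impI)
   fix Y p assume p: "A' Y p"
   then obtain u i where u: "dd (fst p) u \<le> k" "A Y (u, i)" by (auto simp: A'_def)
   have "vgood Y b k u" using sub[OF u(2)] by simp
   then have "good Y b k (fst p)" using u(1) dd_sym by (auto simp: vgood_def)
   then obtain w where w: "dd (fst p) w \<le> ?s" "0 < cnt Y (\<not> b) w" using good_facts(2)[of Y b k "fst p"] k2 by auto
   have "pt Y (\<not> b) (w, 1)" using w by (simp add: pt_def)
   moreover have "Hd Y b u w" unfolding Hd_def using dd_triangle[of u w "fst p"] dd_sym[of u "fst p"] u(1) w(1) kp_ge by simp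
   ultimately have q: "NN b A Y (w, 1)" unfolding NN_def using u(2) by force
   have "1 = (\<integral>\<^sup>+q'. of_bool (q' \<in> {(w, 1 :: nat)}) * 1 \<partial>count_space UNIV)" by (subst nn_integral_of_bool_finite) auto
   also have "\<dots> \<le> (\<integral>\<^sup>+q. ?F Y p q \<partial>count_space UNIV)" using p q w by (intro nn_integral_mono) auto
   finally show "1 \<le> (\<integral>\<^sup>+q. ?F Y p q \<partial>count_space UNIV)" .
  qed
  show "AE Y in D. \<forall>q. (\<integral>\<^sup>+p. ?F Y p q \<partial>count_space UNIV) \<le> of_nat (bsize ?s) * of_bool (NN b A Y q)"
  proof (intro AE_I2 allI)
   fix Y and q :: "'v \<times> nat"
   let ?P = "(\<lambda>v. (v, 0 :: nat)) ` gball E (fst q) ?s"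
   have "(\<integral>\<^sup>+p. ?F Y p q \<partial>count_space UNIV) \<le> (\<integral>\<^sup>+p. of_bool (p \<in> ?P) * of_bool (NN b A Y q) \<partial>count_space UNIV)"
   proof (intro nn_integral_mono)
    fix p
    have "p \<in> ?P" if "A' Y p" "dd (fst p) (fst q) \<le> ?s"
     using that by (intro image_eqI[of _ _ "fst p"]) (auto simp: A'_def dd_sym prod_eq_iff)
    then show "?F Y p q \<le> of_bool (p \<in> ?P) * of_bool (NN b A Y q)"
     by (cases "A' Y p \<and> NN b A Y q \<and> dd (fst p) (fst q) \<le> ?s") auto
   qed
   also have "\<dots> = of_nat (card ?P) * of_bool (NN b A Y q)" by (rule nn_integral_of_bool_finite) simp
   also have "card ?P = bsize ?s" by (subst card_image) (auto simp: inj_on_def card_gball)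
   finally show "(\<integral>\<^sup>+p. ?F Y p q \<partial>count_space UNIV) \<le> of_nat (bsize ?s) * of_bool (NN b A Y q)" .
  qed
 qed (rule N)
 moreover have "iot A' z = ennreal Q"
 proof -
  have "(\<integral>\<^sup>+i. of_bool (A' Y (z, i)) \<partial>count_space UNIV) = indicator {Y. \<exists>u\<in>gball E z k. \<exists>i. A Y (u, i)} Y" for Y
  proof -
   have "(\<integral>\<^sup>+i. of_bool (A' Y (z, i)) \<partial>count_space UNIV)
    = (\<integral>\<^sup>+i. of_bool (i \<in> {0 :: nat}) * indicator {Y. \<exists>u\<in>gball E z k. \<exists>i. A Y (u, i)} Y \<partial>count_space UNIV)"
    by (intro nn_integral_cong) (simp add: A'_def indicator_def)
   then show ?thesis by (subst (asm) nn_integral_of_bool_finite) auto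
  qed
  then show ?thesis unfolding iot_def Q_def using pred_sets[OF mQ[of z]] by (simp add: emeasure_eq_measure)
 qed
 ultimately have "ennreal Q \<le> of_nat (bsize ?s) * ennreal (io (NN b A))"
  using io_NN(1)[OF A, of b z] by simp
 also have "\<dots> = ennreal (real (bsize ?s) * io (NN b A))"
  using io_NN(2)[OF A, of b] by (simp add: ennreal_of_nat_eq_real_of_nat ennreal_mult)
 finally show "Q \<le> real (bsize ?s) * io (NN b A)"
  using io_NN(2)[OF A, of b] by (subst (asm) ennreal_le_iff) simp_all
qed

lemma io_mono:
 assumes "rset A" "rset B" "\<And>Y p. A Y p \<Longrightarrow> B Y p" "\<And>Y p. B Y p \<Longrightarrow> pt Y b p"
 shows "io A \<le> io B"
proof -
 have "iot A z \<le> iot B z" for z using assms(3) by (intro iot_mono) auto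
 then have "ennreal (io A) \<le> ennreal (io B)"
  using io(1)[OF assms(1), of b] io(1)[OF assms(2,4)] assms(3,4) by metis
 then show ?thesis using io(2)[OF assms(2,4)] by (subst (asm) ennreal_le_iff) auto
qed

lemma io_split:
 assumes "rset A" "rset B" "\<And>Y p. A Y p \<Longrightarrow> pt Y b p"
 shows "io A = io (\<lambda>Y p. A Y p \<and> B Y p) + io (\<lambda>Y p. A Y p \<and> \<not> B Y p)"
proof -
 let ?A1 = "\<lambda>Y p. A Y p \<and> B Y p" and ?A2 = "\<lambda>Y p. A Y p \<and> \<not> B Y p"
 have r: "rset ?A1" "rset ?A2" using assms by (auto intro: rset_conj rset_not)
 have p: "\<And>Y p. ?A1 Y p \<Longrightarrow> pt Y b p" "\<And>Y p. ?A2 Y p \<Longrightarrow> pt Y b p" using assms(3) by blast+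
 have "ennreal (io A) = ennreal (io ?A1) + ennreal (io ?A2)"
  using iot_split[OF assms(1,2), of "SOME z. True"] io(1)[OF assms(1,3)] io(1)[OF r(1) p(1)] io(1)[OF r(2) p(2)] by simp
 also have "\<dots> = ennreal (io ?A1 + io ?A2)"
  using io(2)[OF r(1) p(1)] io(2)[OF r(2) p(2)] by simp
 finally show ?thesis
  using io(2)[OF assms(1,3)] io(2)[OF r(1) p(1)] io(2)[OF r(2) p(2)] by (subst (asm) ennreal_inj) auto
qed

lemma rset_vgood: "rset (\<lambda>Y p. vgood Y b k (fst p))"
 by (simp add: rset_def vgood_actz)

lemma NN_mono: "(\<And>p. A Y p \<Longrightarrow> B Y p) \<Longrightarrow> NN b A Y q \<Longrightarrow> NN b B Y q"
 by (auto simp: NN_def)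

text \<open>One of the two parts carries half of \<open>A\<close>. On the bad part the factor 6
  loses one half. On the good part, a support less likely than \<open>lam ^ k\<close> gains from the
  smallness of \<open>lam ^ k\<close>, and a likelier one already has a
  \<open>k\<close>-neighbourhood of probability at least one half, which the bounds on
  \<open>e0\<close> convert.\<close>

theorem small_set_expands:
 assumes A: "rset A" and sub: "\<And>Y p. A Y p \<Longrightarrow> pt Y b p" and small: "io A \<le> e0"
 shows "3 * io A \<le> io (NN b A)"
proof -
 let ?G = "\<lambda>Y p. A Y p \<and> vgood Y b k (fst p)" and ?B = "\<lambda>Y p. A Y p \<and> \<not> vgood Y b k (fst p)"
 have r: "rset ?G" "rset ?B" by (rule rset_conj[OF A rset_vgood], rule rset_conj[OF A rset_not[OF rset_vgood]])
 have pB: "\<And>Y p. ?B Y p \<Longrightarrow> pt Y b p" and pG: "\<And>Y p. ?G Y p \<Longrightarrow> pt Y b p" using sub by blast+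
 have sp: "io A = io ?G + io ?B" by (rule io_split[OF A rset_vgood sub])
 have nG: "io (NN b ?G) \<le> io (NN b A)"
  by (rule io_mono[OF rset_NN[OF r(1)] rset_NN[OF A] _ NN_pt], erule NN_mono[rotated], blast)
 have nB: "io (NN b ?B) \<le> io (NN b A)"
  by (rule io_mono[OF rset_NN[OF r(2)] rset_NN[OF A] _ NN_pt], erule NN_mono[rotated], blast)
 show ?thesis
 proof (cases "io ?B \<ge> io A / 2")
  case True
  have ioB: "iot ?B z = ennreal (io ?B)" for z by (rule io(1)[OF r(2)]) (erule pB)
  have "iot ?B (SOME z. True) \<le> ennreal (1 / 6) * iot (NN b ?B) (SOME z. True)"
   using sub by (intro expand_bad[OF r(2)]) blast
  then have "ennreal (io ?B) \<le> ennreal (1 / 6 * io (NN b ?B))"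
   unfolding io_NN(1)[OF r(2)] ioB by (simp only: ennreal_mult[OF _ io_NN(2)[OF r(2)]])
  then have "io ?B \<le> 1 / 6 * io (NN b ?B)"
   using io_NN(2)[OF r(2)] by (subst (asm) ennreal_le_iff) auto
  then show ?thesis using True nB by linarith
 next
  case False
  then have half: "io ?G \<ge> io A / 2" using sp by linarith
  have A0: "0 \<le> io A" by (rule io(2)[OF A sub])
  fix z :: 'v
  define \<sigma> where "\<sigma> = prob {Y. \<exists>i. ?G Y (z, i)}"
  define Q where "Q = prob {Y. \<exists>u\<in>gball E z k. \<exists>i. ?G Y (u, i)}"
  define K where "K = real (Lc * bsize (rr k))"
  define bs where "bs = real (bsize (rr k + rho))"
  have eg: "io ?G \<le> K * \<sigma>" "\<sigma> \<le> Q * (\<sigma> + lam ^ k)" "Q \<le> bs * io (NN b ?G)"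
   unfolding \<sigma>_def Q_def K_def bs_def using sub by (intro expand_good[OF r(1)]; blast)+
  have pos: "\<sigma> \<ge> 0" "Q \<ge> 0" "K \<ge> 0" "bs > 0" "lam ^ k > 0"
   using bsize_ge[of "rr k + rho"] lam_bounds by (auto simp: \<sigma>_def Q_def K_def bs_def)
  have ks: "12 * K * bs * lam ^ k \<le> 1" using k_small by (simp add: K_def bs_def)
  have x: "Q \<le> bs * io (NN b A)" using eg(3) nG pos by (meson mult_left_mono less_imp_le order_trans)
  show ?thesis
  proof (cases "\<sigma> \<le> lam ^ k")
   case True
   have "\<sigma> \<le> Q * (2 * lam ^ k)" using eg(2) True pos mult_left_mono[of "\<sigma> + lam ^ k" "2 * lam ^ k" Q] by linarith
   also have "\<dots> \<le> (bs * io (NN b A)) * (2 * lam ^ k)" using x pos by (intro mult_right_mono) auto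
   finally have s1: "\<sigma> \<le> 2 * bs * lam ^ k * io (NN b A)" by (simp add: mult_ac)
   have "io A \<le> 2 * (K * \<sigma>)" using half eg(1) by linarith
   also have "\<dots> \<le> 2 * (K * (2 * bs * lam ^ k * io (NN b A)))" using s1 pos by (intro mult_left_mono) auto
   finally have "3 * io A \<le> (12 * K * bs * lam ^ k) * io (NN b A)" by (simp add: mult_ac)
   also have "\<dots> \<le> 1 * io (NN b A)" using ks io_NN(2)[OF A] by (intro mult_right_mono)
   finally show ?thesis by simp
  next
   case False
   then have "\<sigma> > 0" using pos by linarith
   have "\<sigma> \<le> Q * (2 * \<sigma>)" using eg(2) False pos mult_left_mono[of "\<sigma> + lam ^ k" "2 * \<sigma>" Q] by linarith
   then have "1 \<le> 2 * Q" using \<open>\<sigma> > 0\<close> by (simp add: mult.left_commute)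
   then have "1 \<le> 2 * (bs * io (NN b A))" using x by linarith
   moreover have "e0 * (6 * bs) \<le> 1" using e0(3) pos by (simp add: bs_def field_simps)
   ultimately have "e0 * (6 * bs) \<le> 2 * (bs * io (NN b A))" by linarith
   then have "3 * e0 \<le> io (NN b A)" using pos by (simp add: mult_ac)
   then show ?thesis using small by linarith
  qed
 qed
qed

text \<open>\<open>A\<close> occupies a vertex with probability at least
  \<open>e0\<^sup>2 / 16\<close>, so the gap at distance \<open>kp\<close> leaves at most
  \<open>e0\<^sup>2 / 16\<close> for seeing no point of \<open>A\<close> within \<open>kp\<close>.
  Cauchy-Schwarz converts this into a density of at most \<open>e0\<close>.\<close>

theorem large_set_dominates:
 assumes A: "rset A" and sub: "\<And>Y p. A Y p \<Longrightarrow> pt Y b p" and large: "e0 \<le> io A"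
 shows "io (\<lambda>Y p. pt Y (\<not> b) p \<and> \<not> NN b A Y p) \<le> e0"
proof -
 fix z :: 'v
 let ?C = "\<lambda>Y p. pt Y (\<not> b) p \<and> \<not> NN b A Y p"
 have C: "rset ?C" by (intro rset_conj rset_pt rset_not rset_NN A)
 have Cp: "\<And>Y p. ?C Y p \<Longrightarrow> pt Y (\<not> b) p" by blast
 let ?S = "\<lambda>Y u. \<exists>i. A Y (u, i)"
 let ?N = "\<lambda>Y. \<exists>u\<in>gball E z kp. ?S Y u"
 define \<sigma> where "\<sigma> = prob {Y. ?S Y z}"
 define Q where "Q = prob {Y. ?N Y}"
 have mS: "Measurable.pred D (\<lambda>Y. ?S Y z)" by (rule supp_measurable[OF A])
 have mN: "Measurable.pred D ?N" by (intro pred_intros_finite supp_measurable A) simp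
 have gap: "\<sigma> \<le> Q * (\<sigma> + lam ^ kp)" unfolding \<sigma>_def Q_def by (rule supp_gap[OF A])
 have bound: "iot B z \<le> (\<integral>\<^sup>+Y. of_nat (cnt Y b' z) * of_bool (R Y) \<partial>D)"
  if "\<And>Y p. B Y p \<Longrightarrow> pt Y b' p" "\<And>Y i. B Y (z, i) \<Longrightarrow> R Y" for B b' R
  unfolding iot_def
 proof (intro nn_integral_mono)
  fix Y
  show "(\<integral>\<^sup>+i. of_bool (B Y (z, i)) \<partial>count_space UNIV) \<le> of_nat (cnt Y b' z) * of_bool (R Y)"
  proof (cases "R Y")
   case True
   have "(\<integral>\<^sup>+i. of_bool (B Y (z, i)) \<partial>count_space UNIV) \<le> (\<integral>\<^sup>+i. of_bool (pt Y b' (z, i)) \<partial>count_space UNIV)"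
    using that(1) by (intro nn_integral_mono) (simp add: of_bool_def)
   then show ?thesis using True unfolding pt_count by simp
  next
   case False
   then have "\<not> B Y (z, i)" for i using that(2) by blast
   then show ?thesis by simp
  qed
 qed
 have sq: "(io B)\<^sup>2 \<le> 16 * prob {Y. R Y}"
  if "rset B" "\<And>Y p. B Y p \<Longrightarrow> pt Y b' p" "\<And>Y i. B Y (z, i) \<Longrightarrow> R Y" "Measurable.pred D R" for B b' R
 proof -
  have "(iot B z)\<^sup>2 \<le> (\<integral>\<^sup>+Y. of_nat (cnt Y b' z) * of_bool (R Y) \<partial>D)\<^sup>2"
   by (rule power_mono[OF bound[OF that(2,3)]]) auto
  also have "\<dots> \<le> 16 * ennreal (prob {Y. R Y})" by (rule CS_cnt[OF that(4)])
  finally have "(iot B z)\<^sup>2 \<le> 16 * ennreal (prob {Y. R Y})" .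
  then have "ennreal ((io B)\<^sup>2) \<le> ennreal (16 * prob {Y. R Y})"
   using io(1)[OF that(1,2)] io(2)[OF that(1,2)] by (simp add: ennreal_power ennreal_mult)
  then show ?thesis by (subst (asm) ennreal_le_iff) auto
 qed
 have 1: "(io A)\<^sup>2 \<le> 16 * \<sigma>" unfolding \<sigma>_def by (rule sq[OF A sub _ mS]) (auto intro: exI)
 have "(io ?C)\<^sup>2 \<le> 16 * prob {Y. \<not> ?N Y}"
 proof (rule sq[OF C Cp])
  fix Y i assume c: "?C Y (z, i)"
  show "\<not> ?N Y"
  proof
   assume "?N Y"
   then obtain u j where u: "dd z u \<le> kp" "A Y (u, j)" by auto
   then have "Hd Y b u z" by (simp add: Hd_def dd_sym)
   then have "NN b A Y (z, i)" using c u(2) unfolding NN_def by force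
   then show False using c by blast
  qed
 qed (assumption, intro pred_intros_logic mN)
 also have "prob {Y. \<not> ?N Y} = 1 - Q"
  using prob_compl[OF pred_sets[OF mN]] unfolding Q_def space_D Compl_eq_Diff_UNIV[symmetric] Collect_neg_eq .
 finally have 2: "(io ?C)\<^sup>2 \<le> 16 * (1 - Q)" by simp
 have lp: "lam ^ kp > 0" using lam_bounds by simp
 have s0: "\<sigma> > 0"
 proof -
  have "e0\<^sup>2 \<le> 16 * \<sigma>" using 1 power_mono[OF large, where n = 2] e0(1) by linarith
  moreover have "e0\<^sup>2 > 0" using e0(1) by simp
  ultimately show ?thesis by linarith
 qed
 have "e0\<^sup>2 \<le> 16 * \<sigma>" using 1 power_mono[OF large, where n = 2] e0(1) by linarith
 have Q1: "Q \<le> 1" by (simp add: Q_def)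
 have "(1 - Q) * \<sigma> \<le> Q * lam ^ kp" using gap by (simp add: algebra_simps)
 also have "\<dots> \<le> 1 * lam ^ kp" using Q1 lp by (intro mult_right_mono) auto
 finally have "(1 - Q) * \<sigma> \<le> e0 ^ 4 / 256" using kp_small by linarith
 have "(1 - Q) * e0\<^sup>2 \<le> (1 - Q) * (16 * \<sigma>)" using Q1 \<open>e0\<^sup>2 \<le> 16 * \<sigma>\<close> by (intro mult_left_mono) auto
 also have "\<dots> \<le> 16 * (e0 ^ 4 / 256)" using \<open>(1 - Q) * \<sigma> \<le> e0 ^ 4 / 256\<close> by simp
 finally have "(1 - Q) * e0\<^sup>2 \<le> e0 ^ 4 / 16" by simp
 moreover have "e0 ^ 4 = e0\<^sup>2 * e0\<^sup>2" by (simp flip: power_add)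
 ultimately have "16 * (1 - Q) * e0\<^sup>2 \<le> e0\<^sup>2 * e0\<^sup>2" by linarith
 then have "16 * (1 - Q) \<le> e0\<^sup>2" by (rule mult_right_le_imp_le) (use e0(1) in simp)
 then have "(io ?C)\<^sup>2 \<le> e0\<^sup>2" using 2 by linarith
 then show ?thesis by (rule power2_le_imp_le) (use e0(1) in simp)
qed

end

section \<open>Augmenting paths\<close>

text \<open>Greedy choice of a maximal conflict-free set. The code of step \<open>t\<close> is a pair of a precision and a
  label; a candidate enters if it has this label and no conflicting candidate shares it.\<close>

primrec mis_step :: "('i \<Rightarrow> bool) \<Rightarrow> ('i \<Rightarrow> 'i \<Rightarrow> bool) \<Rightarrow> (nat \<Rightarrow> 'i \<Rightarrow> 'c :: countable) \<Rightarrow> nat \<Rightarrow> 'i \<Rightarrow> bool" where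
 "mis_step cand cf lb 0 p = False"
| "mis_step cand cf lb (Suc t) p \<longleftrightarrow> mis_step cand cf lb t p \<or>
  (cand p \<and> lb (fst (from_nat t :: nat \<times> 'c)) p = snd (from_nat t :: nat \<times> 'c) \<and>
   \<not> (\<exists>q\<in>UNIV. cand q \<and> q \<noteq> p \<and> cf p q \<and> lb (fst (from_nat t :: nat \<times> 'c)) q = snd (from_nat t :: nat \<times> 'c)) \<and>
   \<not> (\<exists>q\<in>UNIV. mis_step cand cf lb t q \<and> cf p q))"

definition mis :: "('i \<Rightarrow> bool) \<Rightarrow> ('i \<Rightarrow> 'i \<Rightarrow> bool) \<Rightarrow> (nat \<Rightarrow> 'i \<Rightarrow> 'c :: countable) \<Rightarrow> 'i \<Rightarrow> bool" where
 "mis cand cf lb p \<longleftrightarrow> (\<exists>t. mis_step cand cf lb t p)"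

lemma mis_cand: "mis cand cf lb p \<Longrightarrow> cand p"
proof -
 have "mis_step cand cf lb t p \<Longrightarrow> cand p" for t by (induction t) auto
 then show "mis cand cf lb p \<Longrightarrow> cand p" by (auto simp: mis_def)
qed

lemma mis_step_mono: "mis_step cand cf lb t p \<Longrightarrow> t \<le> t' \<Longrightarrow> mis_step cand cf lb t' p"
 by (induction t' rule: nat_induct) (auto simp: le_Suc_eq)

lemma mis_independent:
 assumes sym: "\<And>p q. cf p q \<Longrightarrow> cf q p"
 shows "mis cand cf lb p \<Longrightarrow> mis cand cf lb q \<Longrightarrow> cf p q \<Longrightarrow> p = q"
proof -
 have *: "mis_step cand cf lb t p \<Longrightarrow> mis_step cand cf lb t q \<Longrightarrow> cf p q \<Longrightarrow> p = q" for t
 proof (induction t arbitrary: p q)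
  case (Suc t)
  have cc: "mis_step cand cf lb t r \<Longrightarrow> cand r" for r using mis_cand[of cand cf lb r] by (auto simp: mis_def)
  from Suc show ?case
   by (cases "mis_step cand cf lb t p"; cases "mis_step cand cf lb t q") (auto dest: sym)
 qed simp
 show "mis cand cf lb p \<Longrightarrow> mis cand cf lb q \<Longrightarrow> cf p q \<Longrightarrow> p = q"
 proof -
  assume "mis cand cf lb p" "mis cand cf lb q" and c: "cf p q"
  then obtain t t' where "mis_step cand cf lb t p" "mis_step cand cf lb t' q" by (auto simp: mis_def)
  then have "mis_step cand cf lb (max t t') p" "mis_step cand cf lb (max t t') q" by (auto intro: mis_step_mono)
  then show "p = q" using * c by blast
 qed
qed

text \<open>At a precision separating \<open>p\<close> from its finitely many rivals, the step
  coding this precision and the label of \<open>p\<close> admits \<open>p\<close> unless a rival is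
  already in. As \<open>cf p p\<close> holds, the admission of \<open>p\<close> also counts.\<close>

lemma mis_maximal:
 fixes lb :: "nat \<Rightarrow> 'i \<Rightarrow> 'c :: countable"
 assumes p: "cand p" "cf p p" and fin: "finite {q. cand q \<and> cf p q}"
  and sep: "\<And>q. cand q \<Longrightarrow> cf p q \<Longrightarrow> q \<noteq> p \<Longrightarrow> \<exists>e0. \<forall>e\<ge>e0. lb e q \<noteq> lb e p"
 shows "\<exists>q. mis cand cf lb q \<and> cf p q"
proof (rule ccontr)
 assume neg: "\<nexists>q. mis cand cf lb q \<and> cf p q"
 let ?Q = "{q. cand q \<and> cf p q \<and> q \<noteq> p}"
 have fQ: "finite ?Q" by (rule finite_subset[OF _ fin]) auto
 obtain e0 where e0: "q \<in> ?Q \<Longrightarrow> \<forall>e\<ge>e0 q. lb e q \<noteq> lb e p" for q using sep by (simp add: Bex_def) metis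
 define e where "e = Max (insert 0 (e0 ` ?Q))"
 have e: "lb e q \<noteq> lb e p" if "q \<in> ?Q" for q
  using e0[OF that] that fQ unfolding e_def by (meson Max_ge finite_imageI finite_insert image_eqI insertCI)
 define t where "t = to_nat (e, lb e p)"
 have t: "(from_nat t :: nat \<times> 'c) = (e, lb e p)" by (simp add: t_def)
 have "mis_step cand cf lb (Suc t) p"
  using neg p(1) e by (auto simp: t mis_def)
 then have "mis cand cf lb p" unfolding mis_def by blast
 then show False using neg p(2) by blast
qed

text \<open>Only the new edges are listed; the old ones join each target to the source of the next
  entry. Thus \<open>l\<close> bounds the number of new edges, and flipping inserts the listed
  pairs. The quantifiers over \<open>UNIV\<close> match the lemmas on countable unions.\<close>

definition augp :: "('a \<Rightarrow> 'b \<Rightarrow> bool) \<Rightarrow> ('a \<Rightarrow> 'b \<Rightarrow> bool) \<Rightarrow> nat \<Rightarrow> ('a \<times> 'b) list \<Rightarrow> bool" where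
 "augp H m l ps \<longleftrightarrow> ps \<noteq> [] \<and> length ps \<le> l \<and> distinct (map fst ps) \<and> distinct (map snd ps) \<and>
  (\<forall>p\<in>set ps. H (fst p) (snd p)) \<and> \<not> (\<exists>y\<in>UNIV. m (fst (hd ps)) y) \<and> \<not> (\<exists>x\<in>UNIV. m x (snd (last ps))) \<and>
  (\<forall>i. Suc i < length ps \<longrightarrow> m (fst (ps ! Suc i)) (snd (ps ! i)))"

definition conf :: "('a \<times> 'b) list \<Rightarrow> ('a \<times> 'b) list \<Rightarrow> bool" where
 "conf ps qs \<longleftrightarrow> fst ` set ps \<inter> fst ` set qs \<noteq> {} \<or> snd ` set ps \<inter> snd ` set qs \<noteq> {}"

definition cov :: "('i list \<Rightarrow> bool) \<Rightarrow> ('i \<Rightarrow> 'x) \<Rightarrow> 'x \<Rightarrow> bool" where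
 "cov S f x \<longleftrightarrow> (\<exists>ps\<in>UNIV. S ps \<and> x \<in> f ` set ps)"

text \<open>An old edge is dropped when its first end lies on a chosen path; by
  \<open>cov_fst_snd\<close> and \<open>cov_snd_fst\<close> the two ends of an old edge are covered
  together.\<close>

definition flip :: "('a \<Rightarrow> 'b \<Rightarrow> bool) \<Rightarrow> (('a \<times> 'b) list \<Rightarrow> bool) \<Rightarrow> 'a \<Rightarrow> 'b \<Rightarrow> bool" where
 "flip m S x y \<longleftrightarrow> (\<exists>ps\<in>UNIV. S ps \<and> (x, y) \<in> set ps) \<or> (m x y \<and> \<not> cov S fst x)"

text \<open>The alternating paths starting at \<open>U\<close> and avoiding the flipped family \<open>S\<close>, after \<open>i\<close> rounds.\<close>

primrec lev :: "('a \<Rightarrow> 'b \<Rightarrow> bool) \<Rightarrow> ('a \<Rightarrow> 'b \<Rightarrow> bool) \<Rightarrow> (('a \<times> 'b) list \<Rightarrow> bool) \<Rightarrow> ('a \<Rightarrow> bool) \<Rightarrow> nat \<Rightarrow> 'a \<Rightarrow> bool" where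
 "lev H m S U 0 x \<longleftrightarrow> U x \<and> \<not> cov S fst x"
| "lev H m S U (Suc i) x \<longleftrightarrow> (\<exists>y\<in>UNIV. m x y \<and> \<not> cov S snd y \<and> (\<exists>x'\<in>UNIV. lev H m S U i x' \<and> H x' y))"

locale augmentation =
 fixes H m :: "'a \<Rightarrow> 'b \<Rightarrow> bool" and S :: "('a \<times> 'b) list \<Rightarrow> bool" and l :: nat
 assumes mH: "m x y \<Longrightarrow> H x y"
  and mfun: "m x y \<Longrightarrow> m x y' \<Longrightarrow> y = y'" and minj: "m x y \<Longrightarrow> m x' y \<Longrightarrow> x = x'"
  and SA: "S ps \<Longrightarrow> augp H m l ps"
  and SC: "S ps \<Longrightarrow> S qs \<Longrightarrow> conf ps qs \<Longrightarrow> ps = qs"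
begin

text \<open>The old partner of a covered target is the next source on the path, because the final
  target is unmatched.\<close>

lemma cov_snd_fst: assumes "m x y" "cov S snd y" shows "cov S fst x"
proof -
 obtain ps i where ps: "S ps" "i < length ps" "y = snd (ps ! i)"
  using assms(2) unfolding cov_def by (auto simp: in_set_conv_nth)
 note A = SA[OF ps(1), unfolded augp_def]
 show ?thesis
 proof (cases "Suc i < length ps")
  case True
  then have "m (fst (ps ! Suc i)) y" using A ps by blast
  then have "x = fst (ps ! Suc i)" using assms(1) minj by blast
  moreover have "ps ! Suc i \<in> set ps" using True by simp
  ultimately show ?thesis using ps(1) unfolding cov_def by blast
 next
  case False
  then have "i = length ps - 1" using ps(2) by linarith
  moreover have "ps \<noteq> []" using ps(2) by auto
  ultimately have "y = snd (last ps)" using ps(3) by (simp add: last_conv_nth)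
  then show ?thesis using A assms(1) by blast
 qed
qed

lemma cov_fst_snd: assumes "m x y" "cov S fst x" shows "cov S snd y"
proof -
 obtain ps i where ps: "S ps" "i < length ps" "x = fst (ps ! i)"
  using assms(2) unfolding cov_def by (auto simp: in_set_conv_nth)
 note A = SA[OF ps(1), unfolded augp_def]
 show ?thesis
 proof (cases i)
  case 0
  moreover have "ps \<noteq> []" using ps(2) by auto
  ultimately have "x = fst (hd ps)" using ps(3) by (simp add: hd_conv_nth)
  then show ?thesis using A assms(1) by blast
 next
  case (Suc j)
  then have "m x (snd (ps ! j))" using A ps by blast
  then have "y = snd (ps ! j)" using assms(1) mfun by blast
  moreover have "ps ! j \<in> set ps" using ps(2) Suc by simp
  ultimately show ?thesis using ps(1) unfolding cov_def by blast
 qed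
qed

lemma flip_H: "flip m S x y \<Longrightarrow> H x y"
proof -
 have "S ps \<Longrightarrow> p \<in> set ps \<Longrightarrow> H (fst p) (snd p)" for ps p using SA[of ps] unfolding augp_def by blast
 then show "flip m S x y \<Longrightarrow> H x y" unfolding flip_def using mH by force
qed

lemma flip_uncov: "\<not> cov S fst x \<Longrightarrow> flip m S x y = m x y"
 unfolding flip_def cov_def by (metis UNIV_I fst_conv imageI)

lemma flip_uncov2: "\<not> cov S snd y \<Longrightarrow> flip m S x y = m x y"
proof -
 assume y: "\<not> cov S snd y"
 have "\<not> (\<exists>ps\<in>UNIV. S ps \<and> (x, y) \<in> set ps)" using y unfolding cov_def by force
 then show "flip m S x y = m x y" unfolding flip_def using cov_fst_snd y by blast
qed

lemma cov_flip: "cov S fst x \<Longrightarrow> \<exists>y. flip m S x y"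
 unfolding flip_def cov_def by force

lemma flip_fun: assumes "flip m S x y" "flip m S x y'" shows "y = y'"
proof (cases "cov S fst x")
 case True
 then obtain ps ps' where p: "S ps" "S ps'" "(x, y) \<in> set ps" "(x, y') \<in> set ps'" using assms unfolding flip_def by blast
 then have "conf ps ps'" unfolding conf_def by force
 then have "(x, y') \<in> set ps" using p SC by blast
 moreover have "inj_on fst (set ps)" using SA[OF p(1)] by (simp add: augp_def distinct_map)
 ultimately show ?thesis using p(3) by (metis fst_conv inj_onD prod.inject)
qed (use assms flip_uncov mfun in blast)

lemma flip_inj: assumes "flip m S x y" "flip m S x' y" shows "x = x'"
proof (cases "cov S snd y")
 case True
 then have "m x y \<Longrightarrow> cov S fst x" "m x' y \<Longrightarrow> cov S fst x'" using cov_snd_fst by blast+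
 then obtain ps ps' where p: "S ps" "S ps'" "(x, y) \<in> set ps" "(x', y) \<in> set ps'" using assms unfolding flip_def by blast
 then have "conf ps ps'" unfolding conf_def by force
 then have "(x', y) \<in> set ps" using p SC by blast
 moreover have "inj_on snd (set ps)" using SA[OF p(1)] by (simp add: augp_def distinct_map)
 ultimately show ?thesis using p(3) by (metis snd_conv inj_onD prod.inject)
qed (use assms flip_uncov2 minj in blast)

lemma unmatched_flip: "(\<forall>y. \<not> flip m S x y) \<longleftrightarrow> (\<forall>y. \<not> m x y) \<and> \<not> cov S fst x"
 using cov_flip flip_uncov by blast

lemma lev_uncov: "lev H m S U i x \<Longrightarrow> \<not> cov S fst x"
 using cov_fst_snd by (cases i) auto

text \<open>Tracing back through the first rounds in which points are reached yields sources on
  distinct levels, hence distinct; the targets are then distinct because the old matching is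
  injective. The path avoids the family since all levels do.\<close>

lemma aug_exists:
 assumes U: "\<And>x y. U x \<Longrightarrow> \<not> m x y"
  and x: "lev H m S U i x" and y: "H x y" "\<And>x'. \<not> m x' y" "\<not> cov S snd y"
 shows "\<exists>ps. augp H m (Suc i) ps \<and> (\<forall>qs. S qs \<longrightarrow> \<not> conf ps qs)"
proof -
 define L where "L j x \<longleftrightarrow> lev H m S U j x \<and> (\<forall>k<j. \<not> lev H m S U k x)" for j x
 have Linj: "L j x \<Longrightarrow> L k x \<Longrightarrow> j = k" for j k x unfolding L_def using linorder_neqE_nat by blast
 have path: "\<exists>ps. length ps = Suc i \<and> (\<forall>j\<le>i. L j (fst (ps ! j))) \<and> last ps = (x, y) \<and>
   (\<forall>p\<in>set ps. H (fst p) (snd p) \<and> \<not> cov S snd (snd p)) \<and>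
   (\<forall>j. Suc j < length ps \<longrightarrow> m (fst (ps ! Suc j)) (snd (ps ! j)))"
  if "L i x" "H x y" "\<not> cov S snd y" for i x y
  using that
 proof (induction i arbitrary: x y)
  case 0
  then show ?case by (intro exI[of _ "[(x, y)]"]) auto
 next
  case (Suc i)
  then obtain y' x' where y': "m x y'" "\<not> cov S snd y'" "lev H m S U i x'" "H x' y'" by (auto simp: L_def)
  have "L i x'"
  proof -
   have "\<not> lev H m S U k x'" if "k < i" for k
   proof
    assume "lev H m S U k x'"
    then have "lev H m S U (Suc k) x" using y' by auto
    moreover have "Suc k < Suc i" using that by simp
    ultimately show False using Suc.prems(1) unfolding L_def by blast
   qed
   then show ?thesis using y'(3) by (simp add: L_def)
  qed
  from Suc.IH[OF this y'(4,2)] obtain ps where ps: "length ps = Suc i" "\<forall>j\<le>i. L j (fst (ps ! j))" "last ps = (x', y')"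
   "\<forall>p\<in>set ps. H (fst p) (snd p) \<and> \<not> cov S snd (snd p)" "\<forall>j. Suc j < length ps \<longrightarrow> m (fst (ps ! Suc j)) (snd (ps ! j))" by blast
  have li: "ps ! i = (x', y')" using ps(1,3) by (metis Zero_not_Suc diff_Suc_1 last_conv_nth length_0_conv)
  have "m (fst ((ps @ [(x, y)]) ! Suc j)) (snd ((ps @ [(x, y)]) ! j))" if "Suc j < length (ps @ [(x, y)])" for j
  proof (cases "j = i")
   case True then show ?thesis using ps(1) li y'(1) by (simp add: nth_append)
  next
   case False then show ?thesis using ps that by (simp add: nth_append)
  qed
  moreover have "L j (fst ((ps @ [(x, y)]) ! j))" if "j \<le> Suc i" for j
   using ps(1,2) that Suc.prems(1) by (cases "j = Suc i") (auto simp: nth_append)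
  ultimately show ?case using ps(1,4) Suc.prems by (intro exI[of _ "ps @ [(x, y)]"]) auto
 qed
 obtain j where j: "j \<le> i" "L j x"
 proof -
  let ?j = "LEAST j. lev H m S U j x"
  have "lev H m S U ?j x" using x by (rule LeastI)
  moreover have "?j \<le> i" using x by (rule Least_le)
  ultimately show ?thesis using that[of ?j] not_less_Least unfolding L_def by blast
 qed
 from path[OF j(2) y(1,3)] obtain ps where ps: "length ps = Suc j" "\<And>k. k \<le> j \<Longrightarrow> L k (fst (ps ! k))" "last ps = (x, y)"
   "\<And>p. p \<in> set ps \<Longrightarrow> H (fst p) (snd p) \<and> \<not> cov S snd (snd p)" "\<And>k. Suc k < length ps \<Longrightarrow> m (fst (ps ! Suc k)) (snd (ps ! k))" by blast
 have ne: "ps \<noteq> []" using ps(1) by auto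
 have d1: "distinct (map fst ps)"
  unfolding distinct_conv_nth using ps(1,2) Linj by (simp add: less_Suc_eq_le) metis
 have lastj: "ps ! j = (x, y)" using ps(1,3) ne by (simp add: last_conv_nth)
 have neq: "snd (ps ! k) \<noteq> snd (ps ! k')" if "k < k'" "k' \<le> j" for k k'
 proof
  assume eq: "snd (ps ! k) = snd (ps ! k')"
  have 1: "m (fst (ps ! Suc k)) (snd (ps ! k))" using ps(1,5) that by simp
  show False
  proof (cases "k' = j")
   case True then show False using 1 eq lastj y(2) by simp
  next
   case False
   then have "m (fst (ps ! Suc k')) (snd (ps ! k'))" using ps(1,5) that by simp
   then have "fst (ps ! Suc k) = fst (ps ! Suc k')" using 1 eq minj by simp
   moreover have "L (Suc k) (fst (ps ! Suc k))" "L (Suc k') (fst (ps ! Suc k'))" using ps(2) that False by auto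
   ultimately have "Suc k = Suc k'" using Linj by metis
   then show False using that by simp
  qed
 qed
 have d2: "distinct (map snd ps)"
  unfolding distinct_conv_nth
 proof (intro allI impI)
  fix k k' assume "k < length (map snd ps)" "k' < length (map snd ps)" "k \<noteq> k'"
  then show "map snd ps ! k \<noteq> map snd ps ! k'" using neq[of k k'] neq[of k' k] ps(1) by (cases "k < k'") auto
 qed
 have hd: "\<not> m (fst (hd ps)) y'" for y'
  using ps(2)[of 0] U ne by (simp add: L_def hd_conv_nth)
 have "augp H m (Suc i) ps"
  unfolding augp_def using ne ps d1 d2 hd j(1) y(2) by simp
 moreover have "\<not> conf ps qs" if "S qs" for qs
 proof -
  have "\<not> cov S fst (fst p)" if p: "p \<in> set ps" for p
  proof -
   obtain k where "k < length ps" "p = ps ! k" using p by (metis in_set_conv_nth)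
   then show ?thesis using ps(1) ps(2)[of k] lev_uncov by (auto simp: L_def)
  qed
  moreover have "\<not> cov S snd (snd p)" if "p \<in> set ps" for p using ps(4) that by blast
  ultimately show ?thesis using that unfolding conf_def cov_def by blast
 qed
 ultimately show ?thesis by blast
qed

end

section \<open>Labels of paths and finiteness of conflicts\<close>

lemma floor_scaled_neq:
 fixes a b :: real
 assumes "a \<noteq> b"
 shows "\<exists>e0. \<forall>e\<ge>e0. \<lfloor>a * 2 ^ e\<rfloor> \<noteq> \<lfloor>b * 2 ^ e\<rfloor>"
proof -
 obtain e0 where e0: "1 / \<bar>a - b\<bar> < 2 ^ e0" using real_arch_pow[of 2 "1 / \<bar>a - b\<bar>"] by auto
 have "\<lfloor>a * 2 ^ e\<rfloor> \<noteq> \<lfloor>b * 2 ^ e\<rfloor>" if "e \<ge> e0" for e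
 proof
  assume eq: "\<lfloor>a * 2 ^ e\<rfloor> = \<lfloor>b * 2 ^ e\<rfloor>"
  have "1 < \<bar>a - b\<bar> * 2 ^ e0" using e0 assms by (simp add: field_simps)
  also have "\<dots> \<le> \<bar>a - b\<bar> * 2 ^ e" using that by (intro mult_left_mono power_increasing) auto
  also have "\<dots> = \<bar>a * 2 ^ e - b * 2 ^ e\<bar>" by (simp add: abs_mult left_diff_distrib[symmetric])
  finally show False using eq by linarith
 qed
 then show ?thesis by blast
qed

text \<open>The greedy choice takes codes from a countable type, so the real labels of the locations
  are cut after \<open>e\<close> binary digits; increasing \<open>e\<close> separates any two
  paths.\<close>

definition plab :: "('v \<Rightarrow> real) \<Rightarrow> nat \<Rightarrow> (('v \<times> nat) \<times> ('v \<times> nat)) list \<Rightarrow> (int \<times> nat \<times> int \<times> nat) list" where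
 "plab o' e = map (\<lambda>p. (\<lfloor>o' (fst (fst p)) * 2 ^ e\<rfloor>, snd (fst p), \<lfloor>o' (fst (snd p)) * 2 ^ e\<rfloor>, snd (snd p)))"

lemma plab_separates:
 assumes inj: "inj o'" and ne: "ps \<noteq> qs"
 shows "\<exists>e0. \<forall>e\<ge>e0. plab o' e ps \<noteq> plab o' e qs"
proof (cases "length ps = length qs")
 case False
 have "plab o' e ps \<noteq> plab o' e qs" for e
 proof
  assume "plab o' e ps = plab o' e qs"
  then have "length (plab o' e ps) = length (plab o' e qs)" by simp
  then show False using False unfolding plab_def length_map by blast
 qed
 then show ?thesis by blast
next
 case True
 then obtain i where i: "i < length ps" "ps ! i \<noteq> qs ! i" using ne nth_equalityI by blast
 have c: "plab o' e ps \<noteq> plab o' e qs" if "plab o' e ps ! i \<noteq> plab o' e qs ! i" for e using that by auto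
 obtain v a u c' where p: "ps ! i = ((v, a), (u, c'))" by (metis surj_pair)
 obtain v' a' u' d where q: "qs ! i = ((v', a'), (u', d))" by (metis surj_pair)
 have nth: "plab o' e ps ! i = (\<lfloor>o' v * 2 ^ e\<rfloor>, a, \<lfloor>o' u * 2 ^ e\<rfloor>, c')" "plab o' e qs ! i = (\<lfloor>o' v' * 2 ^ e\<rfloor>, a', \<lfloor>o' u' * 2 ^ e\<rfloor>, d)" for e
  using i True by (auto simp: plab_def p q)
 show ?thesis
 proof (cases "v = v'")
  case False
  then obtain e0 where "\<forall>e\<ge>e0. \<lfloor>o' v * 2 ^ e\<rfloor> \<noteq> \<lfloor>o' v' * 2 ^ e\<rfloor>" using floor_scaled_neq inj by (metis injD)
  then show ?thesis by (intro exI[of _ e0] allI impI c) (simp add: nth)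
 next
  case v: True
  show ?thesis
  proof (cases "u = u'")
   case False
   then obtain e0 where "\<forall>e\<ge>e0. \<lfloor>o' u * 2 ^ e\<rfloor> \<noteq> \<lfloor>o' u' * 2 ^ e\<rfloor>" using floor_scaled_neq inj by (metis injD)
   then show ?thesis by (intro exI[of _ e0] allI impI c) (simp add: nth)
  next
   case True
   then have "a \<noteq> a' \<or> c' \<noteq> d" using i(2) v by (auto simp: p q)
   then show ?thesis by (intro exI[of _ 0] allI impI c) (auto simp: nth)
  qed
 qed
qed

lemma conf_sym: "conf p q \<Longrightarrow> conf q p"
 by (auto simp: conf_def)

lemma conf_refl: "p \<noteq> [] \<Longrightarrow> conf p p"
 by (cases p) (auto simp: conf_def)

lemma finite_relpowp:
 fixes R :: "'a \<Rightarrow> 'a \<Rightarrow> bool"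
 assumes "\<And>v. finite {u. R v u}"
 shows "finite {u. (R ^^ n) v u}"
proof (induction n arbitrary: v)
 case (Suc n)
 have "{u. (R ^^ Suc n) v u} \<subseteq> (\<Union>w\<in>{w. (R ^^ n) v w}. {u. R w u})" by auto
 then show ?case using Suc assms by (meson finite_UN_I finite_subset)
qed simp

lemma relpowp_refl_mono:
 fixes R :: "'a \<Rightarrow> 'a \<Rightarrow> bool"
 assumes "\<And>v. R v v" "(R ^^ n) v u" "n \<le> n'"
 shows "(R ^^ n') v u"
proof -
 have "(R ^^ k) u u" for k by (induction k) (auto simp: assms(1) intro!: relcomppI)
 moreover have "(R ^^ n') = (R ^^ n) OO (R ^^ (n' - n))" using assms(3) by (metis le_add_diff_inverse relpowp_add)
 ultimately show ?thesis using assms(2) by auto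
qed

text \<open>New and old edges both follow the locally finite relation \<open>K\<close>, so a path of
  at most \<open>l\<close> pairs that meets \<open>ps\<close> stays within \<open>2 * l + 2\<close>
  steps of it; the bounds on the indices leave finitely many paths.\<close>

lemma finite_augp:
 fixes H m :: "'v \<times> nat \<Rightarrow> 'v \<times> nat \<Rightarrow> bool"
 assumes H: "\<And>x y. H x y \<Longrightarrow> K (fst x) (fst y) \<and> snd x \<le> c1 (fst x) \<and> snd y \<le> c2 (fst y)"
  and m: "\<And>x y. m x y \<Longrightarrow> H x y"
  and f: "\<And>v. finite {u. K v u}" "\<And>u. finite {v. K v u}"
 shows "finite {qs. augp H m l qs \<and> conf ps qs}"
proof -
 define R where "R v u \<longleftrightarrow> v = u \<or> K v u \<or> K u v" for v u
 have "{u. R v u} = insert v ({u. K v u} \<union> {u. K u v})" for v by (auto simp: R_def)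
 then have fR: "finite {u. R v u}" for v using f by simp
 have Rr: "R v v" for v by (simp add: R_def)
 have Rs: "R v u \<Longrightarrow> R u v" for v u by (auto simp: R_def)
 have Rsn: "(R ^^ n) v u \<Longrightarrow> (R ^^ n) u v" for n v u
 proof (induction n arbitrary: u)
  case (Suc n)
  then obtain w where "(R ^^ n) v w" "R w u" by auto
  then show ?case using Suc.IH[of w] Rs relpowp_Suc_I2 by metis
 qed simp
 define V0 where "V0 = fst ` fst ` set ps \<union> fst ` snd ` set ps"
 define W where "W = (\<Union>v\<in>V0. {u. (R ^^ (2 * l + 2)) v u})"
 have fW: "finite W" unfolding W_def V0_def by (intro finite_UN_I finite_relpowp fR finite_UnI finite_imageI finite_set)
 define Z where "Z = ((SIGMA v:W. {..c1 v}) \<times> (SIGMA v:W. {..c2 v}))"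
 have "finite Z" unfolding Z_def using fW by auto
 then have fin: "finite {qs. set qs \<subseteq> Z \<and> length qs \<le> l}" by (rule finite_lists_length_le)
 have "qs \<in> {qs. set qs \<subseteq> Z \<and> length qs \<le> l}" if q: "augp H m l qs" "conf ps qs" for qs
 proof -
  have AH: "\<And>p. p \<in> set qs \<Longrightarrow> H (fst p) (snd p)" and Al: "length qs \<le> l"
   and Am: "\<And>i. Suc i < length qs \<Longrightarrow> m (fst (qs ! Suc i)) (snd (qs ! i))" using q(1) unfolding augp_def by blast+
  let ?x = "\<lambda>i. fst (fst (qs ! i))" and ?y = "\<lambda>i. fst (snd (qs ! i))"
  have Hi: "H (fst (qs ! i)) (snd (qs ! i))" if "i < length qs" for i using AH that by simp
  have xy: "R (?x i) (?y i)" if "i < length qs" for i using H[OF Hi[OF that]] by (simp add: R_def)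
  have step: "R (?y i) (?x (Suc i))" if "Suc i < length qs" for i
   using H[OF m[OF Am[OF that]]] by (simp add: R_def)
  have up: "(R ^^ (2 * n)) (?x i) (?x (i + n))" if "i + n < length qs" for i n
   using that
  proof (induction n)
   case (Suc n)
   have "(R ^^ Suc (Suc (2 * n))) (?x i) (?x (i + Suc n))"
    using Suc xy[of "i + n"] step[of "i + n"] by (intro relpowp_Suc_I) auto
   then show ?case by simp
  qed simp
  have any: "(R ^^ (2 * l)) (?x i) (?x j)" if "i < length qs" "j < length qs" for i j
  proof (cases "i \<le> j")
   case True
   then have "i + (j - i) = j" by simp
   then have "(R ^^ (2 * (j - i))) (?x i) (?x j)" using up[of i "j - i"] that by metis
   then show ?thesis by (rule relpowp_refl_mono[OF Rr]) (use that Al in linarith)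
  next
   case False
   then have "j + (i - j) = i" by simp
   then have "(R ^^ (2 * (i - j))) (?x j) (?x i)" using up[of j "i - j"] that by metis
   then have "(R ^^ (2 * (i - j))) (?x i) (?x j)" by (rule Rsn)
   then show ?thesis by (rule relpowp_refl_mono[OF Rr]) (use that Al in linarith)
  qed
  obtain i where i: "i < length qs" "\<exists>v\<in>V0. R v (?x i)"
  proof -
   have "(\<exists>p\<in>set qs. fst p \<in> fst ` set ps) \<or> (\<exists>p\<in>set qs. snd p \<in> snd ` set ps)"
    using q(2) unfolding conf_def by (simp add: disjoint_iff Bex_def image_iff) metis
   then consider p where "p \<in> set qs" "fst p \<in> fst ` set ps" | p where "p \<in> set qs" "snd p \<in> snd ` set ps"
    by (elim disjE bexE) simp_all
   then show ?thesis
   proof cases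
    case 1
    then obtain i where "i < length qs" "p = qs ! i" by (metis in_set_conv_nth)
    then show ?thesis using that[of i] 1 Rr unfolding V0_def by blast
   next
    case 2
    then obtain i where "i < length qs" "p = qs ! i" by (metis in_set_conv_nth)
    then show ?thesis using that[of i] 2 Rs[OF xy[of i]] unfolding V0_def by blast
   qed
  qed
  then obtain v where v: "v \<in> V0" "R v (?x i)" by blast
  have "qs ! j \<in> Z" if j: "j < length qs" for j
  proof -
   have 1: "(R ^^ Suc (2 * l)) v (?x j)" using v(2) any[OF i(1) j] by (rule relpowp_Suc_I2)
   have "(R ^^ Suc (Suc (2 * l))) v (?y j)" using 1 xy[OF j] by (rule relpowp_Suc_I)
   then have "?y j \<in> W" using v(1) unfolding W_def by auto
   moreover have "(R ^^ (2 * l + 2)) v (?x j)" by (rule relpowp_refl_mono[OF Rr 1]) simp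
   then have "?x j \<in> W" using v(1) unfolding W_def by auto
   moreover have "z \<in> (SIGMA v:W. {..c v})" if "fst z \<in> W" "snd z \<le> c (fst z)" for z :: "'v \<times> nat" and c
    using that by (cases z) auto
   ultimately show ?thesis using H[OF Hi[OF j]] unfolding Z_def by (simp add: mem_Times_iff)
  qed
  then have "set qs \<subseteq> Z" by (metis in_set_conv_nth subsetI)
  then show ?thesis using Al by blast
 qed
 then show ?thesis by (intro finite_subset[OF _ fin]) blast
qed

lemma plab_measurable:
 assumes "\<And>v. (\<lambda>x. L x v) \<in> borel_measurable M"
 shows "Measurable.pred M (\<lambda>x. plab (L x) e ps = c)"
proof (induction ps arbitrary: c)
 case Nil
 then show ?case by (simp add: plab_def)
next
 case (Cons p ps)
 have [measurable]: "(\<lambda>x. L x v) \<in> borel_measurable M" for v by fact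
 show ?case
 proof (cases c)
  case Nil
  then show ?thesis by (simp add: plab_def)
 next
  case (Cons d c')
  have eq: "plab (L x) e (p # ps) = c \<longleftrightarrow> (\<lfloor>L x (fst (fst p)) * 2 ^ e\<rfloor> = fst d \<and> \<lfloor>L x (fst (snd p)) * 2 ^ e\<rfloor> = fst (snd (snd d))) \<and>
    (snd (fst p) = fst (snd d) \<and> snd (snd p) = snd (snd (snd d))) \<and> plab (L x) e ps = c'" for x
   by (cases d) (auto simp: plab_def Cons)
  show ?thesis unfolding eq by (intro pred_intros_logic Cons.IH) measurable
 qed
qed

section \<open>Measurability and equivariance of augmentation\<close>

context env begin

lemma rsetI:
 assumes "\<And>p. Measurable.pred D (\<lambda>Y. A Y p)" "\<And>\<gamma> Y p. aut \<gamma> \<Longrightarrow> A (actz \<gamma> Y) (gp \<gamma> p) = A Y p"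
 shows "rset A"
 unfolding rset_def using assms by blast

definition rrel :: "('v env \<Rightarrow> 'v \<times> nat \<Rightarrow> 'v \<times> nat \<Rightarrow> bool) \<Rightarrow> bool" where
 "rrel m \<longleftrightarrow> (\<forall>p q. Measurable.pred D (\<lambda>Y. m Y p q)) \<and>
  (\<forall>\<gamma> Y p q. aut \<gamma> \<longrightarrow> m (actz \<gamma> Y) (gp \<gamma> p) (gp \<gamma> q) = m Y p q)"

lemma rrelD: "rrel m \<Longrightarrow> Measurable.pred D (\<lambda>Y. m Y p q)"
 "rrel m \<Longrightarrow> aut \<gamma> \<Longrightarrow> m (actz \<gamma> Y) (gp \<gamma> p) (gp \<gamma> q) = m Y p q"
 unfolding rrel_def by blast+

definition gl :: "('v \<Rightarrow> 'v) \<Rightarrow> (('v \<times> nat) \<times> ('v \<times> nat)) list \<Rightarrow> (('v \<times> nat) \<times> ('v \<times> nat)) list" where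
 "gl \<gamma> = map (\<lambda>p. (gp \<gamma> (fst p), gp \<gamma> (snd p)))"

definition rpath :: "('v env \<Rightarrow> (('v \<times> nat) \<times> ('v \<times> nat)) list \<Rightarrow> bool) \<Rightarrow> bool" where
 "rpath S \<longleftrightarrow> (\<forall>ps. Measurable.pred D (\<lambda>Y. S Y ps)) \<and>
  (\<forall>\<gamma> Y ps. aut \<gamma> \<longrightarrow> S (actz \<gamma> Y) (gl \<gamma> ps) = S Y ps)"

lemma rpathD: "rpath S \<Longrightarrow> Measurable.pred D (\<lambda>Y. S Y ps)"
 "rpath S \<Longrightarrow> aut \<gamma> \<Longrightarrow> S (actz \<gamma> Y) (gl \<gamma> ps) = S Y ps"
 unfolding rpath_def by blast+

lemma countable_paths: "countable (UNIV :: (('v \<times> nat) \<times> ('v \<times> nat)) list set)"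
proof -
 have "countable (lists (UNIV \<times> UNIV :: (('v \<times> nat) \<times> ('v \<times> nat)) set))"
  by (intro countable_lists countable_SIGMA countable_pts)
 then show ?thesis by simp
qed

lemma gl_inv: "aut \<gamma> \<Longrightarrow> gl \<gamma> (gl (inv \<gamma>) ps) = ps" "aut \<gamma> \<Longrightarrow> gl (inv \<gamma>) (gl \<gamma> ps) = ps"
 by (simp_all add: gl_def map_idI gp_inv)

lemma ex_gl_iff: "aut \<gamma> \<Longrightarrow> (\<exists>ps\<in>UNIV. Q ps) \<longleftrightarrow> (\<exists>ps\<in>UNIV. Q (gl \<gamma> ps))"
 unfolding bex_UNIV by (metis gl_inv(1))

lemma bex_gp_iff: "aut \<gamma> \<Longrightarrow> (\<exists>p\<in>UNIV. Q p) \<longleftrightarrow> (\<exists>p\<in>UNIV. Q (gp \<gamma> p))"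
 unfolding bex_UNIV by (rule ex_gp_iff)

lemma gl_eq_iff: "aut \<gamma> \<Longrightarrow> gl \<gamma> ps = gl \<gamma> qs \<longleftrightarrow> ps = qs"
 by (metis gl_inv(2))

lemma fst_gl: "fst ` set (gl \<gamma> ps) = gp \<gamma> ` fst ` set ps" and snd_gl: "snd ` set (gl \<gamma> ps) = gp \<gamma> ` snd ` set ps"
 by (force simp: gl_def)+

lemma gp_mem_image: "aut \<gamma> \<Longrightarrow> gp \<gamma> p \<in> gp \<gamma> ` X \<longleftrightarrow> p \<in> X"
 using gp_inj by (auto simp: image_iff)

lemma conf_gl: assumes "aut \<gamma>" shows "conf (gl \<gamma> ps) (gl \<gamma> qs) = conf ps qs"
proof -
 have "inj (gp \<gamma>)" using gp_inj[OF assms] by (auto intro: injI)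
 then show ?thesis unfolding conf_def fst_gl snd_gl by (simp add: image_Int[symmetric])
qed

lemma plab_gl: "aut \<gamma> \<Longrightarrow> plab (lab (actz \<gamma> Y)) e (gl \<gamma> ps) = plab (lab Y) e ps"
 by (simp add: plab_def gl_def lab_actz act_field_def)

lemma rpath_augp:
 assumes H: "rrel H" and m: "rrel m"
 shows "rpath (\<lambda>Y. augp (H Y) (m Y) l)"
 unfolding rpath_def
proof (intro conjI allI impI)
 fix ps
 show "Measurable.pred D (\<lambda>Y. augp (H Y) (m Y) l ps)"
  unfolding augp_def
  by (intro pred_intros_logic pred_intros_finite pred_intros_countable pred_Bex_countable[OF countable_pts] rrelD(1)[OF H] rrelD(1)[OF m])
   simp_all
next
 fix \<gamma> Y ps assume g: "aut \<gamma>"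
 have i: "inj_on (gp \<gamma>) X" for X using gp_inj[OF g] by (auto intro: inj_onI)
 have mf: "map fst (gl \<gamma> ps) = map (gp \<gamma>) (map fst ps)" "map snd (gl \<gamma> ps) = map (gp \<gamma>) (map snd ps)"
  by (simp_all add: gl_def)
 have d: "distinct (map fst (gl \<gamma> ps)) = distinct (map fst ps)" "distinct (map snd (gl \<gamma> ps)) = distinct (map snd ps)"
  unfolding mf by (simp_all only: distinct_map[of "gp \<gamma>"] i simp_thms)
 have len: "length (gl \<gamma> ps) = length ps" "gl \<gamma> ps = [] \<longleftrightarrow> ps = []" by (simp_all add: gl_def)
 have nth: "i < length ps \<Longrightarrow> gl \<gamma> ps ! i = (gp \<gamma> (fst (ps ! i)), gp \<gamma> (snd (ps ! i)))" for i by (simp add: gl_def)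
 have HH: "(\<forall>p\<in>set (gl \<gamma> ps). H (actz \<gamma> Y) (fst p) (snd p)) \<longleftrightarrow> (\<forall>p\<in>set ps. H Y (fst p) (snd p))"
  by (simp add: gl_def rrelD(2)[OF H g])
 have hd: "(\<exists>y\<in>UNIV. m (actz \<gamma> Y) (fst (hd (gl \<gamma> ps))) y) \<longleftrightarrow> (\<exists>y\<in>UNIV. m Y (fst (hd ps)) y)" if "ps \<noteq> []"
  using that by (subst bex_gp_iff[OF g]) (simp add: gl_def hd_map rrelD(2)[OF m g])
 have last: "(\<exists>x\<in>UNIV. m (actz \<gamma> Y) x (snd (last (gl \<gamma> ps)))) \<longleftrightarrow> (\<exists>x\<in>UNIV. m Y x (snd (last ps)))" if "ps \<noteq> []"
  using that by (subst bex_gp_iff[OF g]) (simp add: gl_def last_map rrelD(2)[OF m g])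
 have step: "(\<forall>i. Suc i < length ps \<longrightarrow> m (actz \<gamma> Y) (fst (gl \<gamma> ps ! Suc i)) (snd (gl \<gamma> ps ! i))) \<longleftrightarrow>
   (\<forall>i. Suc i < length ps \<longrightarrow> m Y (fst (ps ! Suc i)) (snd (ps ! i)))"
  by (simp add: len nth rrelD(2)[OF m g])
 show "augp (H (actz \<gamma> Y)) (m (actz \<gamma> Y)) l (gl \<gamma> ps) = augp (H Y) (m Y) l ps"
  unfolding augp_def d HH len step using hd last by (cases "ps = []") simp_all
qed

text \<open>The selection consults only candidacy, conflicts, equality and truncated labels, all
  compatible with the action on paths and environments; hence exact equivariance.\<close>

lemma rpath_mis:
 assumes c: "rpath cand"
 shows "rpath (\<lambda>Y. mis (cand Y) conf (plab (lab Y)))"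
proof -
 have m: "Measurable.pred D (\<lambda>Y. mis_step (cand Y) conf (plab (lab Y)) t ps)" for t ps
 proof (induction t arbitrary: ps)
  case (Suc t)
  show ?case unfolding mis_step.simps
   by (intro pred_intros_logic pred_Bex_countable[OF countable_paths] rpathD(1)[OF c] Suc plab_measurable lab_D) simp_all
 qed simp
 have e: "mis_step (cand (actz \<gamma> Y)) conf (plab (lab (actz \<gamma> Y))) t (gl \<gamma> ps) = mis_step (cand Y) conf (plab (lab Y)) t ps"
  if g: "aut \<gamma>" for \<gamma> Y t ps
 proof (induction t arbitrary: ps)
  case (Suc t)
  show ?case unfolding mis_step.simps Suc
   by (subst (1 2) ex_gl_iff[OF g]) (simp only: Suc rpathD(2)[OF c g] conf_gl[OF g] plab_gl[OF g] gl_eq_iff[OF g])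
 qed simp
 show ?thesis unfolding rpath_def mis_def
  using m e by (auto intro!: pred_intros_countable)
qed

lemma rset_cov: assumes S: "rpath S" shows "rset (\<lambda>Y. cov (S Y) fst)" "rset (\<lambda>Y. cov (S Y) snd)"
proof -
 show "rset (\<lambda>Y. cov (S Y) fst)"
 proof (rule rsetI)
  show "Measurable.pred D (\<lambda>Y. cov (S Y) fst p)" for p
   unfolding cov_def by (intro pred_intros_logic pred_Bex_countable[OF countable_paths] rpathD(1)[OF S]) simp
  show "cov (S (actz \<gamma> Y)) fst (gp \<gamma> p) = cov (S Y) fst p" if g: "aut \<gamma>" for \<gamma> Y p
   unfolding cov_def by (subst ex_gl_iff[OF g]) (simp only: rpathD(2)[OF S g] fst_gl gp_mem_image[OF g])
 qed
 show "rset (\<lambda>Y. cov (S Y) snd)"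
 proof (rule rsetI)
  show "Measurable.pred D (\<lambda>Y. cov (S Y) snd p)" for p
   unfolding cov_def by (intro pred_intros_logic pred_Bex_countable[OF countable_paths] rpathD(1)[OF S]) simp
  show "cov (S (actz \<gamma> Y)) snd (gp \<gamma> p) = cov (S Y) snd p" if g: "aut \<gamma>" for \<gamma> Y p
   unfolding cov_def by (subst ex_gl_iff[OF g]) (simp only: rpathD(2)[OF S g] snd_gl gp_mem_image[OF g])
 qed
qed

lemma rrel_flip: assumes m: "rrel m" and S: "rpath S" shows "rrel (\<lambda>Y. flip (m Y) (S Y))"
 unfolding rrel_def
proof (intro conjI allI impI)
 fix p q
 show "Measurable.pred D (\<lambda>Y. flip (m Y) (S Y) p q)"
  unfolding flip_def by (intro pred_intros_logic pred_Bex_countable[OF countable_paths] rpathD(1)[OF S] rrelD(1)[OF m] rsetD(1)[OF rset_cov(1)[OF S]]) simp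
next
 fix \<gamma> Y p q assume g: "aut \<gamma>"
 let ?f = "\<lambda>p. (gp \<gamma> (fst p), gp \<gamma> (snd p))"
 have "inj ?f"
 proof (rule injI)
  fix a b assume "?f a = ?f b"
  then have "gp \<gamma> (fst a) = gp \<gamma> (fst b)" "gp \<gamma> (snd a) = gp \<gamma> (snd b)" by blast+
  then show "a = b" using gp_inj[OF g] by (metis prod.collapse)
 qed
 then have "?f (p, q) \<in> ?f ` set ps \<longleftrightarrow> (p, q) \<in> set ps" for ps by (rule inj_image_mem_iff)
 then have "(gp \<gamma> p, gp \<gamma> q) \<in> set (gl \<gamma> ps) \<longleftrightarrow> (p, q) \<in> set ps" for ps unfolding gl_def set_map fst_conv snd_conv .
 then show "flip (m (actz \<gamma> Y)) (S (actz \<gamma> Y)) (gp \<gamma> p) (gp \<gamma> q) = flip (m Y) (S Y) p q"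
  unfolding flip_def by (subst ex_gl_iff[OF g]) (simp add: rpathD(2)[OF S g] rrelD(2)[OF m g] rsetD(2)[OF rset_cov(1)[OF S] g])
qed

lemma rset_unm: assumes m: "rrel m"
 shows "rset (\<lambda>Y x. pt Y b x \<and> \<not> (\<exists>y\<in>UNIV. m Y x y))" "rset (\<lambda>Y y. pt Y b y \<and> \<not> (\<exists>x\<in>UNIV. m Y x y))"
proof -
 show "rset (\<lambda>Y x. pt Y b x \<and> \<not> (\<exists>y\<in>UNIV. m Y x y))"
 proof (rule rsetI)
  show "(pt (actz \<gamma> Y) b (gp \<gamma> p) \<and> \<not> (\<exists>y\<in>UNIV. m (actz \<gamma> Y) (gp \<gamma> p) y)) = (pt Y b p \<and> \<not> (\<exists>y\<in>UNIV. m Y p y))"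
   if g: "aut \<gamma>" for \<gamma> Y p
   by (subst bex_gp_iff[OF g]) (simp only: rrelD(2)[OF m g] pt_actz[OF g])
 qed (intro pred_intros_logic pred_Bex_countable[OF countable_pts] rrelD(1)[OF m] pt_measurable)
 show "rset (\<lambda>Y y. pt Y b y \<and> \<not> (\<exists>x\<in>UNIV. m Y x y))"
 proof (rule rsetI)
  show "(pt (actz \<gamma> Y) b (gp \<gamma> p) \<and> \<not> (\<exists>x\<in>UNIV. m (actz \<gamma> Y) x (gp \<gamma> p))) = (pt Y b p \<and> \<not> (\<exists>x\<in>UNIV. m Y x p))"
   if g: "aut \<gamma>" for \<gamma> Y p
   by (subst bex_gp_iff[OF g]) (simp only: rrelD(2)[OF m g] pt_actz[OF g])
 qed (intro pred_intros_logic pred_Bex_countable[OF countable_pts] rrelD(1)[OF m] pt_measurable)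
qed

end

section \<open>Range of the edges arriving at a vertex\<close>

context env1 begin

definition far :: "'v env \<Rightarrow> bool \<Rightarrow> 'v \<Rightarrow> nat \<Rightarrow> bool" where
 "far Y b v r \<longleftrightarrow> (\<exists>u\<in>UNIV. r \<le> dd v u \<and> reach Y b u (dd v u))"

lemma far_measurable [measurable]: "Measurable.pred D (\<lambda>Y. far Y b v r)"
 unfolding far_def reach_def by (intro pred_Bex_countable[OF countable_V] pred_intros_logic hasbad_measurable) simp

text \<open>Union over spheres. The sphere of radius \<open>r + s\<close> has at most
  \<open>bsize (rho + 1) * x s\<close> vertices, where \<open>x s\<close> is the size of the bad set
  required there. Half of the rate absorbs the factor \<open>x s\<close>, and
  \<open>x s \<ge> x 0 + s\<close> makes the rest a geometric series.\<close>

lemma prob_far: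
 assumes r: "r \<ge> rho + 1"
 shows "prob {Y. far Y b v r} \<le> 6 * real (bsize (rho + 1)) * exp (- real (bsize (r - rho - 1)) / 2)"
proof -
 define B where "B = real (bsize (rho + 1))"
 define x where "x s = bsize (r + s - rho - 1)" for s
 let ?A = "\<lambda>s. \<Union>u\<in>{u. dd v u = r + s}. {Y. reach Y b u (r + s)}"
 have fin: "finite {u. dd v u = t}" and card: "card {u. dd v u = t} \<le> bsize t" for t
 proof -
  have s: "{u. dd v u = t} \<subseteq> gball E v t" by auto
  show "finite {u. dd v u = t}" by (rule finite_subset[OF s]) simp
  show "card {u. dd v u = t} \<le> bsize t" using card_mono[OF _ s] by (simp add: card_gball)
 qed
 have mr: "{Y. reach Y b u t} \<in> events" for u t by (rule pred_sets) (simp add: reach_def hasbad_measurable)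
 have eq: "{Y. far Y b v r} = (\<Union>s. ?A s)"
 proof (intro set_eqI iffI)
  fix Y assume "Y \<in> {Y. far Y b v r}"
  then obtain u where u: "r \<le> dd v u" "reach Y b u (dd v u)" by (auto simp: far_def)
  then have "Y \<in> ?A (dd v u - r)" by (intro UN_I[of u]) auto
  then show "Y \<in> (\<Union>s. ?A s)" by blast
 next
  fix Y assume "Y \<in> (\<Union>s. ?A s)"
  then obtain s u where "dd v u = r + s" "reach Y b u (r + s)" by blast
  then have "r \<le> dd v u \<and> reach Y b u (dd v u)" by simp
  then show "Y \<in> {Y. far Y b v r}" unfolding far_def by blast
 qed
 have ps: "prob (?A s) \<le> B * 2 * (exp (- real (x 0) / 2) * exp (- 1 / 2) ^ s)" for s
 proof -
  have x1: "x s \<ge> 1" using bsize_ge[of "r + s - rho - 1"] by (simp add: x_def)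
  have x0: "x s \<ge> x 0 + s"
  proof (induction s)
   case (Suc s)
   have "r + Suc s - rho - 1 = Suc (r + s - rho - 1)" using r by simp
   then have "x (Suc s) > x s" unfolding x_def using bsize_Suc_gt by simp
   then show ?case using Suc by simp
  qed simp
  have "prob (?A s) \<le> (\<Sum>u\<in>{u. dd v u = r + s}. prob {Y. reach Y b u (r + s)})"
   by (intro finite_measure_subadditive_finite fin) (use mr in auto)
  also have "\<dots> \<le> (\<Sum>u\<in>{u. dd v u = r + s}. exp (- real (x s)))"
   by (intro sum_mono) (use prob_hasbad[OF x1] in \<open>simp add: reach_def x_def\<close>)
  also have "\<dots> \<le> real (bsize (r + s)) * exp (- real (x s))" using card[of "r + s"] by (simp add: mult_right_mono)
  also have "\<dots> \<le> (B * real (x s)) * exp (- real (x s))"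
  proof -
   have "bsize (r + s) \<le> bsize (rho + 1) * x s"
    using bsize_add[of "rho + 1" "r + s - rho - 1"] r by (simp add: x_def)
   then have "real (bsize (r + s)) \<le> B * real (x s)" unfolding B_def by (metis of_nat_le_iff of_nat_mult)
   then show ?thesis by (intro mult_right_mono) auto
  qed
  also have "\<dots> \<le> B * (2 * exp (- real (x s) / 2))"
  proof -
   have "real (x s) / 2 \<le> exp (real (x s) / 2)" using exp_ge_add_one_self[of "real (x s) / 2"] by linarith
   then have "real (x s) * exp (- real (x s)) \<le> 2 * exp (real (x s) / 2) * exp (- real (x s))" by (intro mult_right_mono) auto
   also have "\<dots> = 2 * exp (- real (x s) / 2)" by (simp add: exp_add[symmetric])
   finally show ?thesis by (simp add: B_def mult.assoc mult_left_mono)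
  qed
  also have "\<dots> \<le> B * (2 * exp (- real (x 0 + s) / 2))" using x0 by (intro mult_left_mono) (auto simp: B_def)
  also have "exp (- real (x 0 + s) / 2) = exp (- real (x 0) / 2) * exp (- 1 / 2) ^ s"
   by (simp add: exp_add[symmetric] exp_of_nat_mult[symmetric] add_divide_distrib)
  finally show ?thesis by (simp add: mult_ac)
 qed
 have e: "exp (- 1 / 2 :: real) \<le> 2 / 3" "exp (- 1 / 2 :: real) > 0"
 proof -
  have "exp (1 / 2 :: real) \<ge> 3 / 2" using exp_ge_add_one_self[of "1 / 2 :: real"] by simp
  then show "exp (- 1 / 2 :: real) \<le> 2 / 3" by (simp add: exp_minus field_simps)
 qed simp
 let ?g = "\<lambda>s. B * 2 * (exp (- real (x 0) / 2) * exp (- 1 / 2) ^ s)"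
 have sg: "?g sums (B * 2 * (exp (- real (x 0) / 2) * (1 / (1 - exp (- 1 / 2)))))"
  using e by (intro sums_mult geometric_sums) auto
 have Am: "?A s \<in> events" for s using mr fin by (intro sets.finite_UN) auto
 have sA: "summable (\<lambda>s. prob (?A s))"
  by (rule summable_comparison_test[OF _ sums_summable[OF sg]]) (use ps in auto)
 have "prob {Y. far Y b v r} \<le> (\<Sum>s. prob (?A s))" unfolding eq
  by (rule finite_measure_subadditive_countably[OF _ sA]) (use Am in auto)
 also have "\<dots> \<le> (\<Sum>s. ?g s)" by (intro suminf_le ps sA sums_summable[OF sg])
 also have "\<dots> = B * 2 * (exp (- real (x 0) / 2) * (1 / (1 - exp (- 1 / 2))))" by (rule sums_unique[OF sg, symmetric])
 also have "\<dots> \<le> B * 2 * (exp (- real (x 0) / 2) * 3)"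
  using e by (intro mult_left_mono) (auto simp: B_def field_simps)
 finally show ?thesis by (simp add: B_def x_def mult_ac)
qed

lemma AE_not_far: "AE Y in D. \<forall>v\<in>UNIV. \<exists>r. \<not> far Y b v r"
proof (rule AE_ball_countable')
 fix v
 let ?N = "{Y. \<forall>r. far Y b v r}"
 have m: "Measurable.pred D (\<lambda>Y. \<forall>r. far Y b v r)" by measurable
 have "prob ?N \<le> 6 * real (bsize (rho + 1)) * exp (- real n / 2)" for n
 proof -
  have "prob ?N \<le> prob {Y. far Y b v (rho + 1 + n)}" by (intro finite_measure_mono pred_sets far_measurable) auto
  also have "\<dots> \<le> 6 * real (bsize (rho + 1)) * exp (- real (bsize (rho + 1 + n - rho - 1)) / 2)" by (rule prob_far) simp
  also have "\<dots> \<le> 6 * real (bsize (rho + 1)) * exp (- real n / 2)"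
  proof (intro mult_left_mono)
   have "n \<le> bsize (rho + 1 + n - rho - 1)" using bsize_ge[of n] by simp
   then show "exp (- real (bsize (rho + 1 + n - rho - 1)) / 2) \<le> exp (- real n / 2)" by simp
  qed simp
  finally show ?thesis .
 qed
 moreover have "(\<lambda>n. 6 * real (bsize (rho + 1)) * exp (- real n / 2)) \<longlonglongrightarrow> 0" by (intro tendsto_mult_right_zero) real_asymp
 ultimately have "prob ?N \<le> 0" by (intro LIMSEQ_le_const) auto
 then have "prob ?N = 0" using measure_nonneg[of D ?N] by linarith
 then have "AE Y in D. Y \<notin> ?N" using pred_sets[OF m] by (intro AE_not_in) (simp add: null_sets_def emeasure_eq_measure)
 then show "AE Y in D. \<exists>r. \<not> far Y b v r" by eventually_elim simp
qed (rule countable_V)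

end

section \<open>The random augmentation step\<close>

context env2 begin

text \<open>An edge longer than \<open>kp\<close> needs a large bad set at \<open>v\<close>, which
  \<open>AE_wf\<close> limits, or one at the other end, which \<open>AE_not_far\<close>
  limits.\<close>

lemma AE_finite_Hd: "AE Y in D. \<forall>b v. finite {u. Hd Y b v u}"
proof -
 have "AE Y in D. \<forall>v. finite {u. Hd Y b v u}" for b
  using AE_wf AE_not_far[of "\<not> b"]
 proof eventually_elim
  case (elim Y)
  show ?case
  proof
   fix v
   obtain n where n: "\<not> hasbad Y b v n" using elim(1) by blast
   obtain r where r: "\<not> far Y (\<not> b) v r" using elim(2) by blast
   have "{u. Hd Y b v u} \<subseteq> gball E v (Max {kp, r, n + rho + 1})"
   proof
    fix u assume "u \<in> {u. Hd Y b v u}"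
    then consider "dd v u \<le> kp" | "reach Y b v (dd v u)" | "reach Y (\<not> b) u (dd v u)" unfolding Hd_def by blast
    then have "dd v u \<le> kp \<or> dd v u \<le> r \<or> dd v u \<le> n + rho + 1"
    proof cases
     case 2
     then have "\<not> n \<le> bsize (dd v u - rho - 1)" using n hasbad_mono unfolding reach_def by blast
     then have "\<not> n \<le> dd v u - rho - 1" using bsize_ge[of "dd v u - rho - 1"] by linarith
     then show ?thesis by linarith
    next
     case 3
     then have "\<not> r \<le> dd v u" using r unfolding far_def by blast
     then show ?thesis by linarith
    qed simp
    then show "u \<in> gball E v (Max {kp, r, n + rho + 1})" by auto
   qed
   then show "finite {u. Hd Y b v u}" using finite_gball finite_subset by blast
  qed
 qed
 from this[of True] this[of False] show ?thesis
  by eventually_elim (simp add: all_bool_eq)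
qed

definition HH :: "'v env \<Rightarrow> 'v \<times> nat \<Rightarrow> 'v \<times> nat \<Rightarrow> bool" where
 "HH Y x y \<longleftrightarrow> pt Y True x \<and> pt Y False y \<and> Hd Y True (fst x) (fst y)"

lemma rrel_HH: "rrel HH"
 unfolding rrel_def HH_def
 by (intro conjI allI impI pred_intros_logic pt_measurable Hd_measurable) (simp add: pt_actz Hd_actz)

text \<open>The conditions are imposed on every environment and not merely almost every one, so the
  iteration stays inside this class exactly.\<close>

definition ok :: "('v env \<Rightarrow> 'v \<times> nat \<Rightarrow> 'v \<times> nat \<Rightarrow> bool) \<Rightarrow> bool" where
 "ok m \<longleftrightarrow> rrel m \<and> (\<forall>Y x y. m Y x y \<longrightarrow> HH Y x y) \<and>
  (\<forall>Y x y y'. m Y x y \<longrightarrow> m Y x y' \<longrightarrow> y = y') \<and> (\<forall>Y x x' y. m Y x y \<longrightarrow> m Y x' y \<longrightarrow> x = x')"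

definition sel :: "('v env \<Rightarrow> 'v \<times> nat \<Rightarrow> 'v \<times> nat \<Rightarrow> bool) \<Rightarrow> nat \<Rightarrow> 'v env \<Rightarrow> (('v \<times> nat) \<times> ('v \<times> nat)) list \<Rightarrow> bool" where
 "sel m l Y = mis (augp (HH Y) (m Y) l) conf (plab (lab Y))"

definition nxt :: "('v env \<Rightarrow> 'v \<times> nat \<Rightarrow> 'v \<times> nat \<Rightarrow> bool) \<Rightarrow> nat \<Rightarrow> 'v env \<Rightarrow> 'v \<times> nat \<Rightarrow> 'v \<times> nat \<Rightarrow> bool" where
 "nxt m l Y = flip (m Y) (sel m l Y)"

lemma ok_augmentation: assumes "ok m" shows "augmentation (HH Y) (m Y) (sel m l Y) l"
proof
 show "sel m l Y ps \<Longrightarrow> augp (HH Y) (m Y) l ps" for ps unfolding sel_def by (rule mis_cand)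
 show "sel m l Y ps \<Longrightarrow> sel m l Y qs \<Longrightarrow> conf ps qs \<Longrightarrow> ps = qs" for ps qs
  unfolding sel_def by (rule mis_independent[OF conf_sym])
qed (use assms in \<open>unfold ok_def, blast+\<close>)

lemma rpath_sel: "ok m \<Longrightarrow> rpath (sel m l)"
 unfolding sel_def by (intro rpath_mis rpath_augp rrel_HH) (simp add: ok_def)

lemma ok_nxt: assumes m: "ok m" shows "ok (nxt m l)"
proof -
 have "rrel (nxt m l)" unfolding nxt_def by (intro rrel_flip rpath_sel m) (use m in \<open>simp add: ok_def\<close>)
 then show ?thesis unfolding ok_def nxt_def
  using augmentation.flip_H[OF ok_augmentation[OF m]] augmentation.flip_fun[OF ok_augmentation[OF m]]
   augmentation.flip_inj[OF ok_augmentation[OF m]] by blast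
qed

text \<open>The exceptional set comes from \<open>D_inj\<close> and \<open>AE_finite_Hd\<close>
  alone, so it serves all matchings and all lengths at once.\<close>

lemma AE_maximal: "AE Y in D. \<forall>m l ps. ok m \<longrightarrow> augp (HH Y) (m Y) l ps \<longrightarrow> (\<exists>qs. sel m l Y qs \<and> conf ps qs)"
 using D_inj AE_finite_Hd
proof eventually_elim
 case (elim Y)
 show ?case
 proof (intro allI impI)
  fix m l ps assume m: "ok m" and ps: "augp (HH Y) (m Y) l ps"
  show "\<exists>qs. sel m l Y qs \<and> conf ps qs"
   unfolding sel_def
  proof (rule mis_maximal[where cand = "augp (HH Y) (m Y) l", OF ps])
   show "conf ps ps" using ps by (intro conf_refl) (simp add: augp_def)
   show "finite {q. augp (HH Y) (m Y) l q \<and> conf ps q}"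
   proof (rule finite_augp)
    show "Hd Y True (fst x) (fst y) \<and> snd x \<le> cnt Y True (fst x) \<and> snd y \<le> cnt Y False (fst y)" if "HH Y x y" for x y
     using that by (simp add: HH_def pt_def)
    show "HH Y x y" if "m Y x y" for x y using m that unfolding ok_def by blast
    show "finite {u. Hd Y True v u}" for v using elim(2) by blast
    have "{v. Hd Y True v u} = {v. Hd Y False u v}" for u using Hd_sym[of Y True] by auto
    then show "finite {v. Hd Y True v u}" for u using elim(2) by simp
   qed
   show "\<exists>e0. \<forall>e\<ge>e0. plab (lab Y) e q \<noteq> plab (lab Y) e ps" if "q \<noteq> ps" for q
    by (rule plab_separates[OF elim(1) that])
  qed
 qed
qed

end

section \<open>Convergence of the matchings\<close>

text \<open>Here \<open>a i\<close> is the density reached by alternating paths after \<open>i\<close> rounds, \<open>c i\<close> the density not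
  adjacent to it, \<open>\<alpha>\<close> the density of unmatched points and \<open>q\<close> that of the points lost to the flipped family.
  First \<open>a\<close> doubles until it exceeds \<open>e\<close>, then \<open>1 - a\<close> halves until it drops below \<open>\<alpha>\<close>.\<close>

lemma no_stall:
 fixes a c :: "nat \<Rightarrow> real" and q \<alpha> e :: real
 assumes start: "\<alpha> - q \<le> a 0" and q: "8 * q < \<alpha>" and e: "0 < e" "e \<le> 1 / 4"
  and n: "2 \<le> 2 ^ n * \<alpha>" and l: "2 * n + 2 \<le> l"
  and grow: "\<And>i. i < l \<Longrightarrow> a i \<le> e \<Longrightarrow> 3 * a i \<le> 1 - c i"
  and step: "\<And>i. i < l \<Longrightarrow> 1 - c i \<le> a (Suc i) + q"
  and mix: "\<And>i. i < l \<Longrightarrow> e \<le> a i \<Longrightarrow> c i \<le> e"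
  and free: "\<And>i. i < l \<Longrightarrow> \<alpha> \<le> c i + q"
  and grow': "\<And>i. i < l \<Longrightarrow> c i \<le> e \<Longrightarrow> 3 * c i \<le> 1 - a i"
 shows False
proof -
 have apos: "\<alpha> > 0"
 proof (rule ccontr)
  assume "\<not> \<alpha> > 0"
  then have "2 ^ n * \<alpha> \<le> 0" by (simp add: mult_nonneg_nonpos)
  then show False using n by linarith
 qed
 \<comment> \<open>Tripling minus the loss still doubles, because \<open>q\<close> stays below
   \<open>a i\<close>; \<open>n\<close> doublings starting from \<open>7 / 8 * \<alpha>\<close>
   would exceed 1.\<close>
 have "\<exists>i\<le>n. e \<le> a i"
 proof (rule ccontr)
  assume "\<not> (\<exists>i\<le>n. e \<le> a i)"
  then have small: "a i \<le> e" if "i \<le> n" for i using that by force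
  have "2 ^ i * (7 / 8 * \<alpha>) \<le> a i" if "i \<le> n" for i
   using that
  proof (induction i)
   case 0
   then show ?case using start q by simp
  next
   case (Suc i)
   have "7 / 8 * \<alpha> \<le> 2 ^ i * (7 / 8 * \<alpha>)" using apos by simp
   also have "\<dots> \<le> a i" using Suc by simp
   finally have "q \<le> a i" using q apos by linarith
   moreover have "3 * a i \<le> a (Suc i) + q" using grow[of i] step[of i] small[of i] Suc.prems l by fastforce
   moreover have "2 ^ i * (7 / 8 * \<alpha>) \<le> a i" using Suc by simp
   ultimately have "2 * (2 ^ i * (7 / 8 * \<alpha>)) \<le> a (Suc i)" by linarith
   then show ?case by simp
  qed
  from this[of n] small[of n] n e show False by (simp add: mult.left_commute)
 qed
 then obtain i0 where i0: "i0 \<le> n" "e \<le> a i0" by blast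
 \<comment> \<open>The loss \<open>q\<close> is at most half of \<open>c\<close>, since
   \<open>c\<close> is at least \<open>\<alpha> - q\<close>. So \<open>1 - a\<close> at the next
   index is at most \<open>c + q\<close>, which is at most one and a half times a third of the
   present value.\<close>
 have *: "e \<le> a (i0 + j) \<and> 2 ^ j * (1 - a (i0 + j)) \<le> 1 \<and> 1 - a (i0 + j) \<le> 1" if "j \<le> n" for j
  using that
 proof (induction j)
  case 0
  then show ?case using i0 e by simp
 next
  case (Suc j)
  let ?i = "i0 + j"
  have il: "?i < l" using Suc.prems i0(1) l by simp
  have ih: "e \<le> a ?i" "2 ^ j * (1 - a ?i) \<le> 1" "1 - a ?i \<le> 1" using Suc by auto
  have c: "3 * c ?i \<le> 1 - a ?i" using grow'[OF il mix[OF il ih(1)]] .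
  have "1 - x' \<le> (1 - x) / 2" if "3 * y \<le> 1 - x" "1 - y \<le> x' + q" "\<alpha> \<le> y + q" for x x' y
  proof -
   have "2 * q \<le> y" using that(3) q apos by linarith
   then show ?thesis using that(1,2) by argo
  qed
  then have h: "1 - a (Suc ?i) \<le> (1 - a ?i) / 2" using c step[OF il] free[OF il] by blast
  have "2 ^ Suc j * (1 - a (Suc ?i)) \<le> 2 ^ Suc j * ((1 - a ?i) / 2)" using h by (intro mult_left_mono) auto
  also have "\<dots> \<le> 1" using ih(2) by simp
  finally show ?case using h ih(3) e by simp
 qed
 let ?i = "i0 + n"
 have il: "?i < l" using i0(1) l by simp
 have c: "3 * c ?i \<le> 1 - a ?i" using grow'[OF il mix[OF il]] *[of n] by simp
 have "2 ^ n * (1 - a ?i) \<le> 1" using *[of n] by blast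
 also have "1 \<le> 2 ^ n * (\<alpha> / 2)" using n by simp
 finally have "1 - a ?i \<le> \<alpha> / 2" by (rule mult_left_le_imp_le) simp
 then show False using c free[OF il] q apos by linarith
qed

section \<open>Densities of matched, covered and reachable points\<close>

context env2 begin

abbreviation sub :: "('v env \<Rightarrow> 'v \<times> nat \<Rightarrow> bool) \<Rightarrow> bool \<Rightarrow> bool" where
 "sub A b \<equiv> (\<forall>Y p. A Y p \<longrightarrow> pt Y b p)"

lemma iot_io: assumes "rset A" "sub A b" shows "iot A z = ennreal (io A)"
 by (rule io(1)[OF assms(1), of b]) (use assms(2) in blast)

lemma io_nonneg: "0 \<le> io A"
 by (simp add: io_def)

lemma io_le1: assumes "rset A" "sub A b" shows "io A \<le> 1"
 by (rule io(3)[OF assms(1), of b]) (use assms(2) in blast)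

lemma io_leI:
 assumes "rset A" "sub A b" "rset B" "sub B b'" "iot A (SOME z. True) \<le> ennreal c * iot B (SOME z. True)" "0 \<le> c"
 shows "io A \<le> c * io B"
proof -
 have "ennreal (io A) \<le> ennreal (c * io B)"
  using assms(5,6) unfolding iot_io[OF assms(1,2)] iot_io[OF assms(3,4)] by (simp add: ennreal_mult io_nonneg)
 then show ?thesis using assms(6) by (subst (asm) ennreal_le_iff) (auto simp: io_nonneg)
qed

lemma io_AE_mono:
 assumes "rset A" "sub A b" "rset B" "sub B b'" "AE Y in D. \<forall>p. A Y p \<longrightarrow> B Y p"
 shows "io A \<le> io B"
proof -
 have "iot A z \<le> iot B z" for z by (rule iot_mono) (use assms(5) in \<open>eventually_elim, blast\<close>)
 then show ?thesis using io_leI[OF assms(1-4), of 1] by simp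
qed

lemma io_splits:
 assumes "rset A" "sub A b" "rset B"
 shows "io A = io (\<lambda>Y p. A Y p \<and> B Y p) + io (\<lambda>Y p. A Y p \<and> \<not> B Y p)"
 by (rule io_split[OF assms(1,3), of b]) (use assms(2) in blast)

lemma io_AE_cover:
 assumes A: "rset A" "sub A b" and B: "rset B" "sub B b'" and C: "rset C" "sub C b''"
  and AE: "AE Y in D. \<forall>p. A Y p \<longrightarrow> B Y p \<or> C Y p"
 shows "io A \<le> io B + io C"
proof -
 have "io (\<lambda>Y p. A Y p \<and> B Y p) \<le> io B"
  by (rule io_AE_mono[OF rset_conj[OF A(1) B(1)] _ B, of b]) (use A(2) in auto)
 moreover have "io (\<lambda>Y p. A Y p \<and> \<not> B Y p) \<le> io C"
 proof (rule io_AE_mono[OF rset_conj[OF A(1) rset_not[OF B(1)]] _ C, of b])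
  show "AE Y in D. \<forall>p. A Y p \<and> \<not> B Y p \<longrightarrow> C Y p" using AE by eventually_elim blast
 qed (use A(2) in blast)
 ultimately show ?thesis using io_splits[OF A B(1)] by linarith
qed

lemma io_pt: "io (\<lambda>Y. pt Y b) = 1"
 by (simp add: io_def iot_pt)

lemma io_compl:
 assumes "rset A" "sub A b"
 shows "io (\<lambda>Y p. pt Y b p \<and> \<not> A Y p) = 1 - io A"
proof -
 have "(\<lambda>Y p. pt Y b p \<and> A Y p) = A" using assms(2) by (intro ext) blast
 then show ?thesis using io_splits[OF rset_pt _ assms(1), of b b] io_pt[of b] by simp
qed

lemma io_inject:
 assumes A: "rset A" "sub A b" and B: "rset B" "sub B b'" and m: "rrel m"
  and ex: "AE Y in D. \<forall>p. A Y p \<longrightarrow> (\<exists>q. B Y q \<and> m Y p q)"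
  and inj: "\<And>Y p p' q. m Y p q \<Longrightarrow> m Y p' q \<Longrightarrow> p = p'"
 shows "io A \<le> io B"
proof -
 have "iot A z \<le> iot B z" for z
 proof (rule inject_le[OF A(1) B(1), where m = m])
  show "AE Y in D. \<forall>p p' q. m Y p q \<longrightarrow> m Y p' q \<longrightarrow> A Y p \<longrightarrow> A Y p' \<longrightarrow> p = p'"
   using inj by (intro AE_I2) blast
 qed (use m ex in \<open>unfold rrel_def, blast+\<close>)
 then show ?thesis using io_leI[OF A B, of 1] by simp
qed

lemma prob_le_io:
 assumes "rset A" "sub A b"
 shows "prob {Y. A Y p} \<le> io A"
proof -
 obtain v i where p: "p = (v, i)" by (cases p)
 have "ennreal (prob {Y. A Y p}) = (\<integral>\<^sup>+Y. indicator {Y. A Y p} Y \<partial>D)"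
  using pred_sets[OF rsetD(1)[OF assms(1)], of p] by (simp add: emeasure_eq_measure)
 also have "\<dots> \<le> iot A v"
  unfolding iot_def
 proof (intro nn_integral_mono)
  fix Y
  have "of_bool (A Y (v, i)) = (\<integral>\<^sup>+j. of_bool (j \<in> {i}) * of_bool (A Y (v, i)) \<partial>count_space UNIV :: ennreal)"
   by (subst nn_integral_of_bool_finite) auto
  also have "\<dots> \<le> (\<integral>\<^sup>+j. of_bool (A Y (v, j)) \<partial>count_space UNIV)" by (intro nn_integral_mono) auto
  finally show "indicator {Y. A Y p} Y \<le> (\<integral>\<^sup>+j. of_bool (A Y (v, j)) \<partial>count_space UNIV)"
   by (simp add: indicator_def p)
 qed
 also have "\<dots> = ennreal (io A)" by (rule iot_io[OF assms])
 finally show ?thesis using io_nonneg by (simp add: ennreal_le_iff)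
qed

definition unA where "unA m Y x \<longleftrightarrow> pt Y True x \<and> \<not> (\<exists>y\<in>UNIV. m Y x y)" for m :: "'v env \<Rightarrow> 'v \<times> nat \<Rightarrow> 'v \<times> nat \<Rightarrow> bool"
definition unB where "unB m Y y \<longleftrightarrow> pt Y False y \<and> \<not> (\<exists>x\<in>UNIV. m Y x y)" for m :: "'v env \<Rightarrow> 'v \<times> nat \<Rightarrow> 'v \<times> nat \<Rightarrow> bool"

lemma okD: assumes "ok m"
 shows "rrel m" "\<And>Y x y. m Y x y \<Longrightarrow> HH Y x y" "\<And>Y x y y'. m Y x y \<Longrightarrow> m Y x y' \<Longrightarrow> y = y'"
  "\<And>Y x x' y. m Y x y \<Longrightarrow> m Y x' y \<Longrightarrow> x = x'"
 using assms unfolding ok_def by blast+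

lemma rset_unA: "ok m \<Longrightarrow> rset (unA m)" and rset_unB: "ok m \<Longrightarrow> rset (unB m)"
 unfolding unA_def[abs_def] unB_def[abs_def] by (intro rset_unm okD(1); assumption)+

lemma sub_un: "sub (unA m) True" "sub (unB m) False"
 by (simp_all add: unA_def unB_def)

lemma rrel_flip_args: "rrel m \<Longrightarrow> rrel (\<lambda>Y y x. m Y x y)"
 by (simp add: rrel_def)

text \<open>The matching injects the matched points of each side into those of the other, and both
  sides have density one.\<close>

lemma io_unB: assumes m: "ok m" shows "io (unB m) = io (unA m)"
proof -
 let ?A = "\<lambda>Y p. pt Y True p \<and> \<not> unA m Y p" and ?B = "\<lambda>Y p. pt Y False p \<and> \<not> unB m Y p"
 have r: "rset ?A" "rset ?B" using m by (intro rset_conj rset_pt rset_not rset_unA rset_unB; assumption)+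
 have s: "sub ?A True" "sub ?B False" by blast+
 have HHp: "m Y x y \<Longrightarrow> pt Y True x \<and> pt Y False y" for Y x y using okD(2)[OF m] by (simp add: HH_def)
 have "io ?A \<le> io ?B"
 proof (rule io_inject[OF r(1) s(1) r(2) s(2) okD(1)[OF m]])
  show "AE Y in D. \<forall>p. ?A Y p \<longrightarrow> (\<exists>q. ?B Y q \<and> m Y p q)"
   unfolding unA_def unB_def using HHp by (intro AE_I2) blast
 qed (use okD(4)[OF m] in blast)
 moreover have "io ?B \<le> io ?A"
 proof (rule io_inject[OF r(2) s(2) r(1) s(1) rrel_flip_args[OF okD(1)[OF m]]])
  show "AE Y in D. \<forall>p. ?B Y p \<longrightarrow> (\<exists>q. ?A Y q \<and> m Y q p)"
   unfolding unA_def unB_def using HHp by (intro AE_I2) blast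
 qed (use okD(3)[OF m] in blast)
 ultimately show ?thesis using io_compl[OF rset_unA[OF m] sub_un(1)] io_compl[OF rset_unB[OF m] sub_un(2)] by linarith
qed

definition hds where "hds m l Y x \<longleftrightarrow> unA m Y x \<and> cov (sel m l Y) fst x"

lemma rset_covs: "ok m \<Longrightarrow> rset (\<lambda>Y. cov (sel m l Y) fst)" "ok m \<Longrightarrow> rset (\<lambda>Y. cov (sel m l Y) snd)"
 by (intro rset_cov rpath_sel; assumption)+

lemma sel_augp: "ok m \<Longrightarrow> sel m l Y ps \<Longrightarrow> augp (HH Y) (m Y) l ps"
 by (rule augmentation.SA[OF ok_augmentation])

lemma sub_cov: assumes "ok m" shows "sub (\<lambda>Y. cov (sel m l Y) fst) True" "sub (\<lambda>Y. cov (sel m l Y) snd) False"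
proof -
 have "sel m l Y ps \<Longrightarrow> p \<in> set ps \<Longrightarrow> HH Y (fst p) (snd p)" for Y ps p
  using sel_augp[OF assms] unfolding augp_def by blast
 then show "sub (\<lambda>Y. cov (sel m l Y) fst) True" "sub (\<lambda>Y. cov (sel m l Y) snd) False"
  unfolding cov_def HH_def by blast+
qed

lemma rset_hds: "ok m \<Longrightarrow> rset (hds m l)"
 unfolding hds_def[abs_def] by (intro rset_conj rset_unA rset_covs)

lemma sub_hds: "sub (hds m l) True"
 by (simp add: hds_def unA_def)

lemma unA_nxt: assumes "ok m" shows "unA (nxt m l) Y x \<longleftrightarrow> unA m Y x \<and> \<not> cov (sel m l Y) fst x"
 using augmentation.unmatched_flip[OF ok_augmentation[OF assms]] unfolding unA_def nxt_def by blast

lemma io_hds: assumes m: "ok m" shows "io (unA m) = io (hds m l) + io (unA (nxt m l))"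
proof -
 have "unA (nxt m l) = (\<lambda>Y x. unA m Y x \<and> \<not> cov (sel m l Y) fst x)" by (intro ext) (rule unA_nxt[OF m])
 then show ?thesis
  using io_splits[OF rset_unA[OF m] sub_un(1) rset_covs(1)[OF m]] by (simp add: hds_def[abs_def])
qed

text \<open>Each covered point sends a unit to the start of its path; the paths are disjoint and
  short, so a start receives at most \<open>l\<close>.\<close>

lemma io_cov:
 assumes m: "ok m" and f: "f = fst \<and> b = True \<or> f = snd \<and> b = False"
 shows "io (\<lambda>Y. cov (sel m l Y) f) \<le> real l * io (hds m l)"
proof -
 interpret a: augmentation "HH Y" "m Y" "sel m l Y" l for Y by (rule ok_augmentation[OF m])
 let ?C = "\<lambda>Y. cov (sel m l Y) f"
 have r: "rset ?C" and s: "sub ?C b" using f rset_covs[OF m] sub_cov[OF m] by blast+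
 have S: "rpath (sel m l)" by (rule rpath_sel[OF m])
 let ?G = "\<lambda>Y p q. \<exists>ps\<in>UNIV. sel m l Y ps \<and> p \<in> f ` set ps \<and> ps \<noteq> [] \<and> q = fst (hd ps)"
 let ?F = "\<lambda>Y p q. of_bool (?G Y p q) :: ennreal"
 have "iot ?C (SOME z. True) \<le> of_nat l * iot (hds m l) (SOME z. True)"
 proof (rule transport_le[where F = ?F])
  fix p q
  show "(\<lambda>Y. ?F Y p q) \<in> borel_measurable D"
   by (intro of_bool_measurable pred_Bex_countable[OF countable_paths] pred_intros_logic rpathD(1)[OF S]) simp_all
 next
  fix \<gamma> Y p q assume g: "aut \<gamma>"
  have 1: "f ` set (gl \<gamma> ps) = gp \<gamma> ` f ` set ps" for ps
   using f by (elim disjE conjE) (simp_all only: fst_gl snd_gl)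
  have 2: "gl \<gamma> ps \<noteq> [] \<and> gp \<gamma> q = fst (hd (gl \<gamma> ps)) \<longleftrightarrow> ps \<noteq> [] \<and> q = fst (hd ps)" for ps
   by (cases ps) (simp_all add: gl_def gp_inj[OF g])
  have "?G (actz \<gamma> Y) (gp \<gamma> p) (gp \<gamma> q) = ?G Y p q"
   by (subst ex_gl_iff[OF g]) (simp only: rpathD(2)[OF S g] 1 2 gp_mem_image[OF g])
  then show "?F (actz \<gamma> Y) (gp \<gamma> p) (gp \<gamma> q) = ?F Y p q" by (simp only:)
 next
  show "AE Y in D. \<forall>p. ?C Y p \<longrightarrow> 1 \<le> (\<integral>\<^sup>+q. ?F Y p q \<partial>count_space UNIV)"
  proof (intro AE_I2 allI impI)
   fix Y p assume "?C Y p"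
   then obtain ps where ps: "sel m l Y ps" "p \<in> f ` set ps" unfolding cov_def by blast
   have "ps \<noteq> []" using ps(2) by auto
   then have G: "?G Y p (fst (hd ps))" using ps by blast
   have "1 = (\<integral>\<^sup>+q. of_bool (q \<in> {fst (hd ps)}) * 1 \<partial>count_space UNIV)" by (subst nn_integral_of_bool_finite) auto
   also have "\<dots> \<le> (\<integral>\<^sup>+q. ?F Y p q \<partial>count_space UNIV)"
   proof (intro nn_integral_mono)
    fix q
    show "of_bool (q \<in> {fst (hd ps)}) * 1 \<le> ?F Y p q"
    proof (cases "q = fst (hd ps)")
     case True
     then have "?G Y p q" using G by blast
     then show ?thesis by (simp only: of_bool_eq) simp
    qed simp
   qed
   finally show "1 \<le> (\<integral>\<^sup>+q. ?F Y p q \<partial>count_space UNIV)" .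
  qed
 next
  show "AE Y in D. \<forall>q. (\<integral>\<^sup>+p. ?F Y p q \<partial>count_space UNIV) \<le> of_nat l * of_bool (hds m l Y q)"
  proof (intro AE_I2 allI)
   fix Y q
   show "(\<integral>\<^sup>+p. ?F Y p q \<partial>count_space UNIV) \<le> of_nat l * of_bool (hds m l Y q)"
   proof (cases "\<exists>ps. sel m l Y ps \<and> q = fst (hd ps)")
    case False
    then have "\<not> ?G Y p q" for p by blast
    then have Z: "?F Y p q = 0" for p by (simp only: of_bool_eq)
    have X: "(\<integral>\<^sup>+p. ?F Y p q \<partial>count_space UNIV) = 0" unfolding Z by simp
    show ?thesis unfolding X by simp
   next
    case True
    then obtain ps where ps: "sel m l Y ps" "q = fst (hd ps)" by blast
    have A: "ps \<noteq> []" "length ps \<le> l" "HH Y (fst (hd ps)) (snd (hd ps))" "\<not> (\<exists>y\<in>UNIV. m Y (fst (hd ps)) y)"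
     using sel_augp[OF m ps(1)] unfolding augp_def by auto
    have "q \<in> fst ` set ps" using ps(2) A(1) by simp
    then have "cov (sel m l Y) fst q" using ps(1) unfolding cov_def by blast
    moreover have "unA m Y q" using A(3,4) unfolding unA_def HH_def ps(2) by blast
    ultimately have h: "hds m l Y q" unfolding hds_def by blast
    have qs: "q \<in> fst ` set ps" using ps(2) A(1) by simp
    have uniq: "p \<in> f ` set ps" if "?G Y p q" for p
    proof -
     obtain ps' where ps': "sel m l Y ps'" "p \<in> f ` set ps'" "ps' \<noteq> []" "q = fst (hd ps')" using \<open>?G Y p q\<close> by blast
     have "q \<in> fst ` set ps'" using ps'(3,4) by simp
     then have "conf ps ps'" using qs unfolding conf_def by blast
     then show ?thesis using a.SC[OF ps(1) ps'(1)] ps'(2) by blast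
    qed
    have "(\<integral>\<^sup>+p. ?F Y p q \<partial>count_space UNIV) \<le> (\<integral>\<^sup>+p. of_bool (p \<in> f ` set ps) * 1 \<partial>count_space UNIV)"
    proof (intro nn_integral_mono)
     fix p
     show "?F Y p q \<le> of_bool (p \<in> f ` set ps) * 1"
     proof (cases "?G Y p q")
      case True
      then show ?thesis using uniq[OF True] by (simp only: of_bool_eq) simp
     next
      case False
      then show ?thesis by (simp only: of_bool_eq) simp
     qed
    qed
    also have "\<dots> = of_nat (card (f ` set ps))" by (subst nn_integral_of_bool_finite) auto
    also have "\<dots> \<le> of_nat l"
    proof -
     have "card (f ` set ps) \<le> l" using card_image_le[of "set ps" f] card_length[of ps] A(2) by simp
     then show ?thesis by (rule of_nat_mono)
    qed
    finally show ?thesis using h by simp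
   qed
  qed
 qed (rule rset_hds[OF m])
 then have "iot ?C (SOME z. True) \<le> ennreal (real l) * iot (hds m l) (SOME z. True)" by (simp add: ennreal_of_nat_eq_real_of_nat)
 then show ?thesis by (intro io_leI[OF r s rset_hds[OF m] sub_hds]) simp_all
qed

definition AA where "AA m l i Y = lev (HH Y) (m Y) (sel m l Y) (unA m Y) i"

lemma AA_props: assumes m: "ok m" shows "sub (AA m l i) True"
  "AA m l (Suc i) Y x \<longleftrightarrow> (\<exists>y\<in>UNIV. m Y x y \<and> \<not> cov (sel m l Y) snd y \<and> NN True (AA m l i) Y y)"
  "rset (AA m l i)"
proof -
 have HHp: "m Y x y \<Longrightarrow> pt Y True x \<and> pt Y False y" for Y x y using okD(2)[OF m] by (simp add: HH_def)
 show s: "sub (AA m l i) True" for i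
  by (cases i) (use HHp in \<open>auto simp: AA_def unA_def\<close>)
 show e: "AA m l (Suc i) Y x \<longleftrightarrow> (\<exists>y\<in>UNIV. m Y x y \<and> \<not> cov (sel m l Y) snd y \<and> NN True (AA m l i) Y y)" for i Y x
 proof -
  have "(\<exists>x'\<in>UNIV. AA m l i Y x' \<and> HH Y x' y) \<longleftrightarrow> NN True (AA m l i) Y y" for y
   using s[of i] unfolding NN_def HH_def by (simp only: bex_UNIV simp_thms) blast
  then show ?thesis unfolding AA_def lev.simps by (simp only:)
 qed
 show "rset (AA m l i)"
 proof (induction i)
  case 0
  have "AA m l 0 = (\<lambda>Y x. unA m Y x \<and> \<not> cov (sel m l Y) fst x)" by (simp add: AA_def fun_eq_iff)
  then show ?case using rset_conj[OF rset_unA[OF m] rset_not[OF rset_covs(1)[OF m]]] by simp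
 next
  case (Suc i)
  note N = rset_NN[OF Suc, of True]
  show ?case
  proof (rule rsetI)
   show "Measurable.pred D (\<lambda>Y. AA m l (Suc i) Y p)" for p
    unfolding e by (intro pred_Bex_countable[OF countable_pts] pred_intros_logic rrelD(1)[OF okD(1)[OF m]] rsetD(1)[OF N] rsetD(1)[OF rset_covs(2)[OF m]])
   show "AA m l (Suc i) (actz \<gamma> Y) (gp \<gamma> p) = AA m l (Suc i) Y p" if g: "aut \<gamma>" for \<gamma> Y p
    unfolding e by (subst bex_gp_iff[OF g]) (simp only: rrelD(2)[OF okD(1)[OF m] g] rsetD(2)[OF N g] rsetD(2)[OF rset_covs(2)[OF m] g])
  qed
 qed
qed

text \<open>Otherwise the loss through covered points is below an eighth of the unmatched density,
  and the alternating levels meet the hypotheses of \<open>no_stall\<close>: both growth conditions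
  are \<open>small_set_expands\<close>, applied once to each side, and the passage between them is
  \<open>large_set_dominates\<close>.\<close>

theorem augment_progress:
 assumes m: "ok m" and n: "2 \<le> 2 ^ n * io (unA m)" and l: "2 * n + 2 \<le> l"
 shows "io (unA m) \<le> 8 * (real l * io (hds m l))"
proof (rule ccontr)
 assume "\<not> io (unA m) \<le> 8 * (real l * io (hds m l))"
 define \<alpha> where "\<alpha> = io (unA m)"
 define q where "q = real l * io (hds m l)"
 have q: "8 * q < \<alpha>" using \<open>\<not> _\<close> by (simp add: \<alpha>_def q_def)
 interpret a: augmentation "HH Y" "m Y" "sel m l Y" l for Y by (rule ok_augmentation[OF m])
 let ?A = "AA m l"
 let ?Q = "\<lambda>Y. cov (sel m l Y) snd"
 let ?C = "\<lambda>i Y p. pt Y False p \<and> \<not> NN True (?A i) Y p"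
 note A = AA_props(3)[OF m, of l] and As = AA_props(1)[OF m, of l]
 have As': "\<And>Y p. ?A i Y p \<Longrightarrow> pt Y True p" for i using As by blast
 note N = rset_NN[OF A, of True]
 have Ns: "sub (NN True (?A i)) False" for i using NN_pt by force
 note Q = rset_covs(2)[OF m, of l] and Qs = sub_cov(2)[OF m, of l]
 have Qq: "io ?Q \<le> q" unfolding q_def by (rule io_cov[OF m, of snd False]) simp
 have C: "rset (?C i)" for i by (intro rset_conj rset_pt rset_not N)
 have Cs: "sub (?C i) False" for i by blast
 have Cs': "\<And>Y p. ?C i Y p \<Longrightarrow> pt Y False p" for i by blast
 have Cio: "io (?C i) = 1 - io (NN True (?A i))" for i by (rule io_compl[OF N Ns])
 \<comment> \<open>A reached target that is unmatched and uncovered would complete an augmenting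
   path disjoint from the chosen family, against maximality.\<close>
 have nofree: "AE Y in D. \<forall>y. NN True (?A i) Y y \<longrightarrow> unB m Y y \<longrightarrow> ?Q Y y" if i: "i < l" for i
  using AE_maximal
 proof eventually_elim
  case (elim Y)
  show ?case
  proof (intro allI impI, rule ccontr)
   fix y assume y: "NN True (?A i) Y y" "unB m Y y" "\<not> ?Q Y y"
   obtain x where x: "?A i Y x" "Hd Y True (fst x) (fst y)" using y(1) unfolding NN_def by blast
   have xy: "HH Y x y" using x As'[OF x(1)] y(2) unfolding HH_def unB_def by blast
   have "\<exists>ps. augp (HH Y) (m Y) (Suc i) ps \<and> (\<forall>qs. sel m l Y qs \<longrightarrow> \<not> conf ps qs)"
   proof (rule a.aug_exists[OF _ x(1)[unfolded AA_def] xy])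
    show "\<And>x' y'. unA m Y x' \<Longrightarrow> \<not> m Y x' y'" unfolding unA_def by blast
    show "\<And>x'. \<not> m Y x' y" using y(2) unfolding unB_def by blast
   qed (rule y(3))
   then obtain ps where ps: "augp (HH Y) (m Y) (Suc i) ps" "\<forall>qs. sel m l Y qs \<longrightarrow> \<not> conf ps qs" by blast
   have "augp (HH Y) (m Y) l ps" using ps(1) i unfolding augp_def by auto
   then show False using elim m ps(2) by blast
  qed
 qed
 have u0: "io (unA m) = io (hds m l) + io (?A 0)"
 proof -
  have "?A 0 = unA (nxt m l)" by (intro ext) (simp add: AA_def unA_nxt[OF m])
  then show ?thesis using io_hds[OF m, of l] by simp
 qed
 have hq: "io (hds m l) \<le> q" using l io_nonneg[of "hds m l"] unfolding q_def by (simp add: mult_le_cancel_right1)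
 show False
 proof (rule no_stall[where a = "\<lambda>i. io (?A i)" and c = "\<lambda>i. io (?C i)" and e = e0, OF _ q e0(1,2) n[folded \<alpha>_def] l])
  show "\<alpha> - q \<le> io (?A 0)" using u0 hq by (simp add: \<alpha>_def)
 next
  fix i assume "io (?A i) \<le> e0"
  then show "3 * io (?A i) \<le> 1 - io (?C i)" using small_set_expands[OF A As'] unfolding Cio by simp
 next
  fix i assume i: "i < l"
  have "io (\<lambda>Y y. NN True (?A i) Y y \<and> \<not> ?Q Y y) \<le> io (?A (Suc i))"
  proof (rule io_inject[OF rset_conj[OF N rset_not[OF Q]] _ A As rrel_flip_args[OF okD(1)[OF m]], of _ False])
   show "AE Y in D. \<forall>p. NN True (?A i) Y p \<and> \<not> ?Q Y p \<longrightarrow> (\<exists>q. ?A (Suc i) Y q \<and> m Y q p)"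
    using nofree[OF i]
   proof eventually_elim
    case (elim Y)
    show ?case
    proof (intro allI impI)
     fix p assume p: "NN True (?A i) Y p \<and> \<not> ?Q Y p"
     then have "\<not> unB m Y p" using elim by blast
     then obtain x where x: "m Y x p" using p NN_pt[of True "?A i" Y p] unfolding unB_def by auto
     then have "?A (Suc i) Y x" unfolding AA_props(2)[OF m] using p by blast
     then show "\<exists>q. ?A (Suc i) Y q \<and> m Y q p" using x by blast
    qed
   qed
  qed (use Ns okD(3)[OF m] in blast)+
  moreover have "io (\<lambda>Y y. NN True (?A i) Y y \<and> ?Q Y y) \<le> io ?Q"
   by (rule io_AE_mono[OF rset_conj[OF N Q] _ Q Qs, of _ False]) (use Ns in blast)+
  ultimately show "1 - io (?C i) \<le> io (?A (Suc i)) + q"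
   using io_splits[OF N Ns Q] Qq unfolding Cio by simp
 next
  fix i assume "e0 \<le> io (?A i)"
  then show "io (?C i) \<le> e0" using large_set_dominates[OF A As'] by simp
 next
  fix i assume i: "i < l"
  have "io (unB m) \<le> io (?C i) + io ?Q"
  proof (rule io_AE_cover[OF rset_unB[OF m] sub_un(2) C Cs Q Qs])
   show "AE Y in D. \<forall>p. unB m Y p \<longrightarrow> ?C i Y p \<or> ?Q Y p"
    using nofree[OF i] by eventually_elim (auto simp: unB_def)
  qed
  then show "\<alpha> \<le> io (?C i) + q" using Qq by (simp add: io_unB[OF m] \<alpha>_def)
 next
  fix i assume c: "io (?C i) \<le> e0"
  \<comment> \<open>Expansion in the reverse direction: by symmetry of the edges, the neighbours of
    unreached targets are sources outside the current level.\<close>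
  have "3 * io (?C i) \<le> io (NN False (?C i))" by (rule small_set_expands[OF C Cs' c])
  also have "\<dots> \<le> io (\<lambda>Y p. pt Y True p \<and> \<not> ?A i Y p)"
  proof (rule io_AE_mono[where b = True and b' = True, OF rset_NN[OF C] _ rset_conj[OF rset_pt rset_not[OF A]]])
   show "sub (NN False (?C i)) True" using NN_pt by force
   have "\<not> ?A i Y p" if Np: "NN False (?C i) Y p" for Y p
   proof
    assume Ap: "?A i Y p"
    obtain y where y: "?C i Y y" "Hd Y False (fst y) (fst p)" using Np unfolding NN_def by blast
    have "Hd Y True (fst p) (fst y)" using y(2) Hd_sym[of Y True "fst y" "fst p"] by simp
    moreover have "pt Y (\<not> True) y" using y(1) by simp
    ultimately have "NN True (?A i) Y y" using Ap unfolding NN_def by blast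
    then show False using y(1) by blast
   qed
   then show "AE Y in D. \<forall>p. NN False (?C i) Y p \<longrightarrow> pt Y True p \<and> \<not> ?A i Y p"
    using NN_pt by (intro AE_I2) force
  qed blast
  also have "\<dots> = 1 - io (?A i)" by (rule io_compl[OF A As])
  finally show "3 * io (?C i) \<le> 1 - io (?A i)" .
 qed
qed

section \<open>The sequence of matchings and its limit\<close>

primrec mm :: "nat \<Rightarrow> 'v env \<Rightarrow> 'v \<times> nat \<Rightarrow> 'v \<times> nat \<Rightarrow> bool" where
 "mm 0 = (\<lambda>_ _ _. False)"
| "mm (Suc j) = nxt (mm j) (2 * nat \<lceil>2 / sqrt (io (unA (mm j)))\<rceil> + 2)"

definition al :: "nat \<Rightarrow> real" where "al j = io (unA (mm j))"
text \<open>The order \<open>1 / sqrt (al j)\<close> is chosen so that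
  \<open>ll j * sqrt (al j)\<close> is bounded. For \<open>al j = 0\<close> the division yields 0
  and the length is 2.\<close>

definition ll :: "nat \<Rightarrow> nat" where "ll j = 2 * nat \<lceil>2 / sqrt (al j)\<rceil> + 2"

lemma mm_Suc: "mm (Suc j) = nxt (mm j) (ll j)"
 by (simp add: ll_def al_def)

lemma ok_mm: "ok (mm j)"
proof (induction j)
 case 0
 then show ?case by (simp add: ok_def rrel_def)
next
 case (Suc j)
 then show ?case unfolding mm_Suc by (rule ok_nxt)
qed

lemma al_bounds: "0 \<le> al j" "al j \<le> 1"
 using io_nonneg io_le1[OF rset_unA[OF ok_mm] sub_un(1)] by (auto simp: al_def)

lemma al_Suc: "al j = io (hds (mm j) (ll j)) + al (Suc j)"
 unfolding al_def mm_Suc by (rule io_hds[OF ok_mm])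

lemma ll_bound: assumes "al j > 0" shows "real (ll j) * sqrt (al j) \<le> 8"
proof -
 let ?s = "sqrt (al j)"
 have s: "0 < ?s" "?s \<le> 1" using assms al_bounds[of j] by auto
 have "real (nat \<lceil>2 / ?s\<rceil>) \<le> 2 / ?s + 1" using s by (simp add: of_nat_nat)
 then have "real (ll j) \<le> 2 * (2 / ?s + 1) + 2" by (simp add: ll_def)
 then have "real (ll j) * ?s \<le> (2 * (2 / ?s + 1) + 2) * ?s" using s by (intro mult_right_mono) auto
 also have "\<dots> = 4 + 4 * ?s" using s by (simp add: algebra_simps)
 finally show ?thesis using s by linarith
qed

text \<open>With n rounds of order \<open>2 / sqrt (al j)\<close>, the inequality n^2 <= 2 * 2^n
  supplies the doublings that \<open>augment_progress\<close> asks for; its conclusion is multiplied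
  by \<open>sqrt (al j)\<close> to eliminate the length.\<close>

lemma al_step: "al j * sqrt (al j) \<le> 64 * (al j - al (Suc j))"
proof (cases "al j = 0")
 case True
 then show ?thesis using al_Suc[of j] io_nonneg[of "hds (mm j) (ll j)"] by simp
next
 case False
 then have pos: "al j > 0" using al_bounds[of j] by linarith
 let ?n = "nat \<lceil>2 / sqrt (al j)\<rceil>"
 have s: "sqrt (al j) > 0" using pos by simp
 have n: "2 / sqrt (al j) \<le> real ?n" by linarith
 have "2 \<le> 2 ^ ?n * al j"
 proof -
  have "2 = 2 / sqrt (al j) * sqrt (al j)" using s by simp
  also have "\<dots> \<le> real ?n * sqrt (al j)" using n s by (intro mult_right_mono) auto
  finally have "2 \<le> real ?n * sqrt (al j)" .
  then have "2\<^sup>2 \<le> (real ?n * sqrt (al j))\<^sup>2" by (intro power_mono) auto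
  then have 4: "4 \<le> (real ?n)\<^sup>2 * al j" using pos by (simp add: power_mult_distrib)
  have sq: "n\<^sup>2 \<le> 2 * 2 ^ n" for n :: nat
  proof (induction n rule: nat_induct)
   case (Suc n)
   have "3 * n \<le> n * n" if "3 \<le> n" using that by (rule mult_le_mono1)
   then have "n < 3 \<or> 2 * n + 1 \<le> n\<^sup>2" unfolding power2_eq_square by linarith
   then show ?case
   proof
    assume "n < 3"
    then have "n = 0 \<or> n = 1 \<or> n = 2" by linarith
    then show ?thesis by (elim disjE) (simp_all add: power2_eq_square)
   next
    assume "2 * n + 1 \<le> n\<^sup>2"
    then show ?thesis using Suc by (simp add: power2_eq_square)
   qed
  qed simp
  have "real (?n\<^sup>2) \<le> real (2 * 2 ^ ?n)" using sq[of ?n] by (simp only: of_nat_le_iff)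
  then have "(real ?n)\<^sup>2 \<le> 2 * 2 ^ ?n" by (simp only: of_nat_mult of_nat_power of_nat_numeral)
  then have "(real ?n)\<^sup>2 * al j \<le> 2 * 2 ^ ?n * al j" using pos by (intro mult_right_mono) auto
  then show ?thesis using 4 by simp
 qed
 then have "al j \<le> 8 * (real (ll j) * io (hds (mm j) (ll j)))"
  unfolding al_def by (rule augment_progress[OF ok_mm]) (simp add: ll_def al_def)
 also have "io (hds (mm j) (ll j)) = al j - al (Suc j)" using al_Suc[of j] by simp
 finally have "al j * sqrt (al j) \<le> 8 * (real (ll j) * (al j - al (Suc j))) * sqrt (al j)" using s by (intro mult_right_mono) auto
 also have "\<dots> = 8 * (al j - al (Suc j)) * (real (ll j) * sqrt (al j))" by (simp add: mult_ac)
 also have "\<dots> \<le> 8 * (al j - al (Suc j)) * 8"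
  using al_Suc[of j] io_nonneg[of "hds (mm j) (ll j)"] by (intro mult_left_mono ll_bound pos) auto
 finally show ?thesis by simp
qed

text \<open>The terms \<open>al j * sqrt (al j)\<close> are summable by telescoping; the cube root
  of their squares recovers \<open>al j\<close>.\<close>

lemma al_tendsto: "al \<longlonglongrightarrow> 0"
proof -
 have "summable (\<lambda>j. al j * sqrt (al j))"
 proof (rule summableI_nonneg_bounded)
  fix n
  have "(\<Sum>j<n. al j * sqrt (al j)) \<le> (\<Sum>j<n. 64 * (al j - al (Suc j)))" by (intro sum_mono al_step)
  also have "\<dots> = 64 * (al 0 - al n)" by (simp only: sum_distrib_left[symmetric] sum_lessThan_telescope')
  also have "\<dots> \<le> 64" using al_bounds[of 0] al_bounds[of n] by simp
  finally show "(\<Sum>j<n. al j * sqrt (al j)) \<le> 64" .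
 qed (simp add: al_bounds)
 then have "(\<lambda>j. al j * sqrt (al j)) \<longlonglongrightarrow> 0" by (rule summable_LIMSEQ_zero)
 then have "(\<lambda>j. root 3 ((al j * sqrt (al j))\<^sup>2)) \<longlonglongrightarrow> root 3 (0\<^sup>2)" by (intro tendsto_intros)
 moreover have "root 3 ((al j * sqrt (al j))\<^sup>2) = al j" for j
 proof -
  have "(al j * sqrt (al j))\<^sup>2 = al j ^ 3" using al_bounds[of j] by (simp add: power_mult_distrib power3_eq_cube power2_eq_square)
  then show ?thesis using al_bounds[of j] by (simp add: real_root_pos2)
 qed
 ultimately show ?thesis by simp
qed

text \<open>With \<open>s\<close> and \<open>t\<close> the square roots of successive densities, the
  drop is \<open>(s - t) * (s + t)\<close> and \<open>ll j * s\<close> is bounded, so the covered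
  density is at most a multiple of \<open>s - t\<close> and telescopes.\<close>

lemma summable_cov:
 assumes f: "f = fst \<and> b = True \<or> f = snd \<and> b = False"
 shows "summable (\<lambda>j. io (\<lambda>Y. cov (sel (mm j) (ll j) Y) f))"
proof (rule summableI_nonneg_bounded)
 have le: "io (\<lambda>Y. cov (sel (mm j) (ll j) Y) f) \<le> 16 * (sqrt (al j) - sqrt (al (Suc j)))" for j
 proof -
  let ?h = "io (hds (mm j) (ll j))"
  have h: "?h = al j - al (Suc j)" "0 \<le> ?h" using al_Suc[of j] io_nonneg by auto
  have c: "io (\<lambda>Y. cov (sel (mm j) (ll j) Y) f) \<le> real (ll j) * ?h" by (rule io_cov[OF ok_mm f])
  show ?thesis
  proof (cases "al j = 0")
   case True
   then have "al (Suc j) = 0" "?h = 0" using h al_bounds[of "Suc j"] by linarith+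
   then show ?thesis using c True by simp
  next
   case False
   define s t where "s = sqrt (al j)" and "t = sqrt (al (Suc j))"
   have s: "0 < s" "0 \<le> t" "t \<le> s" using False al_bounds[of j] al_bounds[of "Suc j"] h by (auto simp: s_def t_def)
   have hs: "?h = (s - t) * (s + t)" using h(1) al_bounds by (simp add: s_def t_def algebra_simps)
   have ls: "real (ll j) * s \<le> 8" using ll_bound[of j] False al_bounds[of j] by (simp add: s_def)
   have "real (ll j) * ?h = (s - t) * (real (ll j) * (s + t))" unfolding hs by (simp add: mult_ac)
   also have "\<dots> \<le> (s - t) * (real (ll j) * (2 * s))" using s by (intro mult_left_mono) auto
   also have "\<dots> = 2 * ((s - t) * (real (ll j) * s))" by (simp add: mult_ac)
   also have "\<dots> \<le> 2 * ((s - t) * 8)" using s ls by (intro mult_left_mono) auto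
   finally show ?thesis using c by (simp add: s_def t_def)
  qed
 qed
 fix n
 have "(\<Sum>j<n. io (\<lambda>Y. cov (sel (mm j) (ll j) Y) f)) \<le> (\<Sum>j<n. 16 * (sqrt (al j) - sqrt (al (Suc j))))"
  by (intro sum_mono le)
 also have "\<dots> = 16 * (sqrt (al 0) - sqrt (al n))"
  by (simp only: sum_distrib_left[symmetric] sum_lessThan_telescope'[of "\<lambda>j. sqrt (al j)"])
 also have "\<dots> \<le> 16" using al_bounds[of 0] al_bounds[of n] by (smt (verit) real_sqrt_ge_zero real_sqrt_le_1_iff)
 finally show "(\<Sum>j<n. io (\<lambda>Y. cov (sel (mm j) (ll j) Y) f)) \<le> 16" .
qed (rule io_nonneg)

lemma AE_eventually_uncovered:
 assumes f: "f = fst \<and> b = True \<or> f = snd \<and> b = False"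
 shows "AE Y in D. \<forall>p\<in>UNIV. eventually (\<lambda>j. \<not> cov (sel (mm j) (ll j) Y) f p) sequentially"
proof (rule AE_ball_countable'[OF _ countable_pts])
 fix p
 let ?A = "\<lambda>j. {Y. cov (sel (mm j) (ll j) Y) f p}"
 have r: "rset (\<lambda>Y. cov (sel (mm j) (ll j) Y) f)" and s: "sub (\<lambda>Y. cov (sel (mm j) (ll j) Y) f) b" for j
  using f rset_covs[OF ok_mm] sub_cov[OF ok_mm] by blast+
 have "AE Y in D. eventually (\<lambda>j. Y \<in> space D - ?A j) sequentially"
 proof (rule borel_cantelli_AE1)
  show "?A j \<in> events" for j by (intro pred_sets rsetD(1)[OF r])
  show "summable (\<lambda>j. prob (?A j))"
   by (rule summable_comparison_test[OF _ summable_cov[OF f]]) (use prob_le_io[OF r s] in auto)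
 qed (simp add: emeasure_eq_measure)
 then show "AE Y in D. eventually (\<lambda>j. \<not> cov (sel (mm j) (ll j) Y) f p) sequentially" by eventually_elim simp
qed

lemma AE_not_always:
 assumes A: "\<And>j. rset (A j)" "\<And>j. sub (A j) b" and lim: "(\<lambda>j. io (A j)) \<longlonglongrightarrow> 0"
 shows "AE Y in D. \<forall>p\<in>UNIV. \<not> eventually (\<lambda>j. A j Y p) sequentially"
proof (rule AE_ball_countable'[OF _ countable_pts])
 fix p
 have "AE Y in D. \<not> (\<forall>j\<ge>J. A j Y p)" for J
 proof -
  let ?N = "{Y. \<forall>j\<ge>J. A j Y p}"
  have m: "?N \<in> events" by (intro pred_sets pred_intros_countable pred_intros_logic rsetD(1)[OF A(1)]) simp
  have "prob ?N \<le> io (A j)" if "j \<ge> J" for j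
  proof -
   have "prob ?N \<le> prob {Y. A j Y p}" using that by (intro finite_measure_mono pred_sets rsetD(1)[OF A(1)]) auto
   also have "\<dots> \<le> io (A j)" by (rule prob_le_io[OF A])
   finally show ?thesis .
  qed
  then have "prob ?N \<le> 0" by (intro LIMSEQ_le_const[OF lim]) blast
  then have "prob ?N = 0" using measure_nonneg[of D ?N] by linarith
  then have "AE Y in D. Y \<notin> ?N" using m by (intro AE_not_in) (simp add: null_sets_def emeasure_eq_measure)
  then show ?thesis by eventually_elim simp
 qed
 then have "AE Y in D. \<forall>J. \<not> (\<forall>j\<ge>J. A j Y p)" by (simp add: AE_all_countable)
 then show "AE Y in D. \<not> eventually (\<lambda>j. A j Y p) sequentially"
  by eventually_elim (simp add: eventually_sequentially)
qed

definition mlim :: "'v env \<Rightarrow> 'v \<times> nat \<Rightarrow> 'v \<times> nat \<Rightarrow> bool" where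
 "mlim Y x y \<longleftrightarrow> eventually (\<lambda>j. mm j Y x y) sequentially"

lemma rrel_mlim: "rrel mlim"
 unfolding rrel_def
proof (intro conjI allI impI)
 show "Measurable.pred D (\<lambda>Y. mlim Y p q)" for p q
  unfolding mlim_def eventually_sequentially by (intro pred_intros_countable pred_intros_logic rrelD(1)[OF okD(1)[OF ok_mm]]) simp
 show "mlim (actz \<gamma> Y) (gp \<gamma> p) (gp \<gamma> q) = mlim Y p q" if "aut \<gamma>" for \<gamma> Y p q
  unfolding mlim_def by (simp only: rrelD(2)[OF okD(1)[OF ok_mm] that])
qed

lemma mlim_witness:
 assumes "mlim Y x y" "mlim Y x' y'"
 obtains j where "mm j Y x y" "mm j Y x' y'"
proof -
 have "eventually (\<lambda>j. mm j Y x y \<and> mm j Y x' y') sequentially"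
  using assms unfolding mlim_def by (rule eventually_conj)
 then show ?thesis using that eventually_happens' sequentially_bot by blast
qed

lemma mlim_props:
 "mlim Y x y \<Longrightarrow> HH Y x y" "mlim Y x y \<Longrightarrow> mlim Y x y' \<Longrightarrow> y = y'" "mlim Y x y \<Longrightarrow> mlim Y x' y \<Longrightarrow> x = x'"
 using mlim_witness okD[OF ok_mm] by metis+

text \<open>A point is covered only finitely often, so its partner stabilises. Having none from then
  on would mean being unmatched at all late stages, which has probability zero because the unmatched
  densities tend to zero.\<close>

theorem mlim_perfect:
 "AE Y in D. (\<forall>x. pt Y True x \<longrightarrow> (\<exists>y. mlim Y x y)) \<and> (\<forall>y. pt Y False y \<longrightarrow> (\<exists>x. mlim Y x y))"
proof -
 have 1: "AE Y in D. \<forall>p\<in>UNIV. \<not> eventually (\<lambda>j. unA (mm j) Y p) sequentially"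
  using al_tendsto by (intro AE_not_always[where b = True] rset_unA ok_mm sub_un(1)) (simp add: al_def[abs_def])
 have 2: "AE Y in D. \<forall>p\<in>UNIV. \<not> eventually (\<lambda>j. unB (mm j) Y p) sequentially"
  using al_tendsto by (intro AE_not_always[where b = False] rset_unB ok_mm sub_un(2)) (simp add: al_def[abs_def] io_unB[OF ok_mm])
 have 3: "AE Y in D. \<forall>p\<in>UNIV. eventually (\<lambda>j. \<not> cov (sel (mm j) (ll j) Y) fst p) sequentially"
  by (rule AE_eventually_uncovered[where b = True]) simp
 have 4: "AE Y in D. \<forall>p\<in>UNIV. eventually (\<lambda>j. \<not> cov (sel (mm j) (ll j) Y) snd p) sequentially"
  by (rule AE_eventually_uncovered[where b = False]) simp
 show ?thesis
  using 1 2 3 4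
 proof eventually_elim
  case (elim Y)
  have st1: "mm (Suc j) Y x = mm j Y x" if "\<not> cov (sel (mm j) (ll j) Y) fst x" for j x
   unfolding mm_Suc nxt_def by (intro ext augmentation.flip_uncov[OF ok_augmentation[OF ok_mm] that])
  have st2: "mm (Suc j) Y x y = mm j Y x y" if "\<not> cov (sel (mm j) (ll j) Y) snd y" for j x y
   unfolding mm_Suc nxt_def by (rule augmentation.flip_uncov2[OF ok_augmentation[OF ok_mm] that])
  show ?case
  proof (intro conjI allI impI)
   fix x assume x: "pt Y True x"
   obtain J where J: "\<And>j. j \<ge> J \<Longrightarrow> \<not> cov (sel (mm j) (ll j) Y) fst x"
    using elim(3) unfolding eventually_sequentially by blast
   have c: "mm j Y x = mm J Y x" if "j \<ge> J" for j
    using that by (induction rule: dec_induct) (simp_all add: st1 J del: mm.simps)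
   have "\<exists>y. mm J Y x y"
   proof (rule ccontr)
    assume "\<nexists>y. mm J Y x y"
    then have "unA (mm j) Y x" if "j \<ge> J" for j using c[OF that] x unfolding unA_def by simp
    then show False using elim(1) unfolding eventually_sequentially by blast
   qed
   then obtain y where "mm J Y x y" by blast
   then show "\<exists>y. mlim Y x y" unfolding mlim_def eventually_sequentially using c by metis
  next
   fix y assume y: "pt Y False y"
   obtain J where J: "\<And>j. j \<ge> J \<Longrightarrow> \<not> cov (sel (mm j) (ll j) Y) snd y"
    using elim(4) unfolding eventually_sequentially by blast
   have c: "mm j Y x y = mm J Y x y" if "j \<ge> J" for j x
    using that by (induction rule: dec_induct) (simp_all add: st2 J del: mm.simps)
   have "\<exists>x. mm J Y x y"
   proof (rule ccontr)
    assume "\<nexists>x. mm J Y x y"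
    then have "unB (mm j) Y y" if "j \<ge> J" for j using c[OF that] y unfolding unB_def by simp
    then show False using elim(2) unfolding eventually_sequentially by blast
   qed
   then obtain x where "mm J Y x y" by blast
   then show "\<exists>x. mlim Y x y" unfolding mlim_def eventually_sequentially using c by metis
  qed
 qed
qed

end

lemma ennreal_power2_le:
 assumes "a\<^sup>2 \<le> (ennreal y)\<^sup>2" "0 \<le> y"
 shows "a \<le> ennreal y"
proof (cases a)
 case (real x)
 have "ennreal (x\<^sup>2) \<le> ennreal (y\<^sup>2)" using assms real by (simp only: ennreal_power)
 then have "x\<^sup>2 \<le> y\<^sup>2" by (subst (asm) ennreal_le_iff) simp_all
 then have "x \<le> y" using assms(2) by (rule power2_le_imp_le)
 then show ?thesis unfolding real(2) by (rule ennreal_leI)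
next
 case top
 have "top \<le> ennreal (y\<^sup>2)" using assms by (simp add: top power2_eq_square ennreal_mult)
 then show ?thesis by (simp add: top_unique)
qed

section \<open>Tail of the limit matching\<close>

context env2 begin

text \<open>A partner at distance at least \<open>r\<close> forces a bad set of size at least
  \<open>bsize (r - rho - 1)\<close> through one of the two ends, and submultiplicativity makes this
  size comparable with \<open>bsize r\<close>. Counting all points at \<open>v\<close> on that event
  costs only a Cauchy-Schwarz inequality.\<close>

lemma mlim_tail:
 "\<exists>c>0. \<exists>R. \<forall>v. \<forall>r\<ge>R. (\<integral>\<^sup>+Y. of_nat (cnt Y True v) * of_bool (\<exists>i y. mlim Y (v, i) y \<and> r \<le> dd v (fst y)) \<partial>D)
  \<le> ennreal (exp (- c * real (bsize r)))"
proof -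
 define B where "B = real (bsize (rho + 1))"
 have B1: "B \<ge> 1" using bsize_ge[of "rho + 1"] by (simp add: B_def)
 \<comment> \<open>The first two entries exclude unconditional edges and truncated subtraction; the
   third makes the prefactor \<open>11 * B\<close> at most
   \<open>exp (real (bsize r) / (8 * B))\<close>, which consumes half of the available
   decay.\<close>
 define R where "R = Max {kp + 1, rho + 1, nat \<lceil>8 * B * ln (11 * B)\<rceil>}"
 have "(\<integral>\<^sup>+Y. of_nat (cnt Y True v) * of_bool (\<exists>i y. mlim Y (v, i) y \<and> r \<le> dd v (fst y)) \<partial>D)
  \<le> ennreal (exp (- (1 / (8 * B)) * real (bsize r)))" if r: "r \<ge> R" for v r
 proof -
  have r1: "r > kp" "r \<ge> rho + 1" and r2: "nat \<lceil>8 * B * ln (11 * B)\<rceil> \<le> r" using r by (auto simp: R_def)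
  define n where "n = bsize (r - rho - 1)"
  let ?Q = "\<lambda>Y. hasbad Y True v n \<or> far Y False v r"
  have mQ: "Measurable.pred D ?Q" by measurable
  have Q: "?Q Y" if "mlim Y (v, i) y" "r \<le> dd v (fst y)" for Y i y
  proof -
   have H: "Hd Y True v (fst y)" using mlim_props(1)[OF that(1)] by (simp add: HH_def)
   have "\<not> dd v (fst y) \<le> kp" using that(2) r1 by linarith
   then consider "reach Y True v (dd v (fst y))" | "reach Y False (fst y) (dd v (fst y))"
    using H unfolding Hd_def not_True_eq_False by blast
   then show ?thesis
   proof cases
    case 1
    have "n \<le> bsize (dd v (fst y) - rho - 1)" unfolding n_def using that(2) by (intro bsize_mono) simp
    then show ?thesis using 1 hasbad_mono unfolding reach_def by blast
   next
    case 2
    then show ?thesis using that(2) unfolding far_def by blast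
   qed
  qed
  let ?I = "\<integral>\<^sup>+Y. of_nat (cnt Y True v) * of_bool (?Q Y) \<partial>D"
  have n1: "n \<ge> 1" using bsize_ge[of "r - rho - 1"] by (simp add: n_def)
  have "prob {Y. ?Q Y} \<le> prob {Y. hasbad Y True v n} + prob {Y. far Y False v r}"
   unfolding Collect_disj_eq by (intro measure_Un_le pred_sets hasbad_measurable far_measurable)
  also have "\<dots> \<le> exp (- real n) + 6 * B * exp (- real n / 2)"
   unfolding B_def n_def by (intro add_mono prob_far[OF r1(2)] prob_hasbad n1[unfolded n_def])
  also have "exp (- real n) \<le> B * exp (- real n / 2)"
   using B1 mult_mono[of 1 B "exp (- real n)" "exp (- real n / 2)"] by simp
  finally have pQ: "prob {Y. ?Q Y} \<le> 7 * B * exp (- real n / 2)" by simp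
  have "?I\<^sup>2 \<le> 16 * ennreal (prob {Y. ?Q Y})" by (rule CS_cnt[OF mQ])
  also have "\<dots> \<le> ennreal (16 * (7 * B * exp (- real n / 2)))"
   using pQ B1 by (subst ennreal_mult) (auto intro!: mult_left_mono ennreal_leI)
  \<comment> \<open>11 is the least integer whose square exceeds 16 * 7.\<close>
  also have "\<dots> \<le> ennreal ((11 * B * exp (- real n / 4))\<^sup>2)"
  proof (intro ennreal_leI)
   have "(11 * B * exp (- real n / 4))\<^sup>2 = 121 * (B * B) * exp (- real n / 2)"
    by (simp add: power2_eq_square exp_add[symmetric] mult_ac)
   moreover have "B \<le> B * B" using B1 by simp
   then have "16 * (7 * B) \<le> 121 * (B * B)" using B1 by linarith
   then have "16 * (7 * B) * exp (- real n / 2) \<le> 121 * (B * B) * exp (- real n / 2)" by (intro mult_right_mono) auto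
   ultimately show "16 * (7 * B * exp (- real n / 2)) \<le> (11 * B * exp (- real n / 4))\<^sup>2" by simp
  qed
  finally have sq: "?I\<^sup>2 \<le> (ennreal (11 * B * exp (- real n / 4)))\<^sup>2" using B1 by (simp add: ennreal_power)
  have I: "?I \<le> ennreal (11 * B * exp (- real n / 4))" by (rule ennreal_power2_le[OF sq]) (use B1 in simp)
  have "(\<integral>\<^sup>+Y. of_nat (cnt Y True v) * of_bool (\<exists>i y. mlim Y (v, i) y \<and> r \<le> dd v (fst y)) \<partial>D) \<le> ?I"
  proof (intro nn_integral_mono mult_left_mono)
   fix Y
   show "of_bool (\<exists>i y. mlim Y (v, i) y \<and> r \<le> dd v (fst y)) \<le> (of_bool (?Q Y) :: ennreal)"
   proof (cases "\<exists>i y. mlim Y (v, i) y \<and> r \<le> dd v (fst y)")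
    case True
    then have "?Q Y" using Q by blast
    then show ?thesis using True by (simp only: of_bool_eq order_refl)
   next
    case False
    then show ?thesis by (simp only: of_bool_eq zero_le)
   qed
  qed simp
  also note I
  also have "11 * B * exp (- real n / 4) \<le> exp (- (1 / (8 * B)) * real (bsize r))"
  proof -
   have "bsize r \<le> bsize (rho + 1) * n" using bsize_add[of "rho + 1" "r - rho - 1"] r1 by (simp add: n_def)
   then have "real (bsize r) \<le> B * real n" unfolding B_def by (metis of_nat_le_iff of_nat_mult)
   then have bn: "real (bsize r) / (4 * B) \<le> real n / 4" using B1 by (simp add: field_simps)
   have "8 * B * ln (11 * B) \<le> real r" using r2 by linarith
   then have "8 * B * ln (11 * B) \<le> real (bsize r)" using bsize_ge[of r] by linarith
   then have "ln (11 * B) \<le> real (bsize r) / (8 * B)" using B1 by (simp add: field_simps)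
   then have "11 * B \<le> exp (real (bsize r) / (8 * B))" using B1 by (metis exp_ln exp_le_cancel_iff less_le_trans mult_pos_pos zero_less_numeral zero_less_one)
   then have "11 * B * exp (- real n / 4) \<le> exp (real (bsize r) / (8 * B)) * exp (- real n / 4)" by (intro mult_right_mono) auto
   also have "\<dots> \<le> exp (real (bsize r) / (8 * B)) * exp (- (real (bsize r) / (4 * B)))" using bn by (intro mult_left_mono) auto
   also have "\<dots> = exp (- (1 / (8 * B)) * real (bsize r))"
    using B1 by (simp add: exp_add[symmetric] field_simps)
   finally show ?thesis .
  qed
  finally show ?thesis by (simp add: ennreal_leI)
 qed
 then show ?thesis using B1 by (intro exI[of _ "1 / (8 * B)"] conjI exI[of _ R]) auto
qed

end

section \<open>Choice of the constants\<close>

context env begin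

text \<open>\<open>Lc\<close> can be taken linear in \<open>rho\<close> while
  \<open>(1 + hh) ^ rho\<close> grows exponentially, so a large \<open>rho\<close> satisfies both
  demands.\<close>

lemma ex_env1: "\<exists>rho Lc. env1 E D rho Lc (ln (real (bsize 1)))"
proof -
 define \<kappa> where "\<kappa> = ln (real (bsize 1))"
 have k: "\<kappa> > 0" unfolding \<kappa>_def using bsize_ge[of 1] by simp
 define x where "x = 1 / (1 + hh)"
 have x: "0 < x" "x < 1" using hh_pos by (auto simp: x_def)
 have "(\<lambda>n. x ^ n) \<longlonglongrightarrow> 0" "(\<lambda>n. real n * x ^ n) \<longlonglongrightarrow> 0"
  using x by (intro LIMSEQ_power_zero powser_times_n_limit_0; simp)+
 \<comment> \<open>15 in place of 14 pays for rounding \<open>Lc\<close> up to an integer.\<close>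
 then have "(\<lambda>n. (14 * (15 + 28 * \<kappa>)) * x ^ n + (14 * 24 * \<kappa>) * (real n * x ^ n)) \<longlonglongrightarrow> (14 * (15 + 28 * \<kappa>)) * 0 + (14 * 24 * \<kappa>) * 0"
  by (intro tendsto_add tendsto_mult tendsto_const)
 then have "eventually (\<lambda>n. (14 * (15 + 28 * \<kappa>)) * x ^ n + (14 * 24 * \<kappa>) * (real n * x ^ n) < 1) sequentially"
  by (intro order_tendstoD(2)) auto
 then obtain rho where rho: "(14 * (15 + 28 * \<kappa>)) * x ^ rho + (14 * 24 * \<kappa>) * (real rho * x ^ rho) < 1"
  unfolding eventually_sequentially by blast
 define Lc where "Lc = nat \<lceil>14 + 28 * \<kappa> + 24 * \<kappa> * real rho\<rceil>"
 have L: "real Lc \<ge> 14 + 28 * \<kappa> + 24 * \<kappa> * real rho" unfolding Lc_def by linarith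
 have pos: "14 + 28 * \<kappa> + 24 * \<kappa> * real rho \<ge> 0" using k by simp
 have "real Lc \<le> 15 + 28 * \<kappa> + 24 * \<kappa> * real rho" using pos unfolding Lc_def by (simp add: of_nat_nat) linarith
 then have "14 * real Lc * x ^ rho \<le> (14 * (15 + 28 * \<kappa> + 24 * \<kappa> * real rho)) * x ^ rho" using x by (intro mult_right_mono) auto
 also have "\<dots> = (14 * (15 + 28 * \<kappa>)) * x ^ rho + (14 * 24 * \<kappa>) * (real rho * x ^ rho)" by (simp add: algebra_simps)
 finally have "14 * real Lc * x ^ rho \<le> 1" using rho by linarith
 then have "14 * real Lc \<le> (1 + hh) ^ rho" using hh_pos by (simp add: x_def power_one_over field_simps)
 then have "env1 E D rho Lc \<kappa>" using L by unfold_locales (auto simp: \<kappa>_def)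
 then show ?thesis unfolding \<kappa>_def by blast
qed

end

context env1 begin

text \<open>By \<open>rr\<close> both ball sizes are linear in \<open>k\<close>, so the demand on
  \<open>k\<close> becomes smallness of a constant times k^2 lam^k. After that \<open>e0\<close> is
  explicit, and \<open>kp\<close> only has to be large.\<close>

lemma ex_env2: "\<exists>k kp e0. env2 E D rho Lc \<kappa> k kp e0"
proof -
 define b1 where "b1 = real (bsize 1)"
 define br where "br = real (bsize rho)"
 have b: "b1 > 0" "br > 0" using bsize_ge[of 1] bsize_ge[of rho] by (auto simp: b1_def br_def)
 have lp: "0 < lam ^ n" for n using lam_bounds by simp
 define M where "M = 12 * real Lc * b1 * (b1 * br)"
 have "(\<lambda>n. real n ^ 2 * lam ^ n) \<longlonglongrightarrow> 0"
 proof -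
  define y where "y = sqrt lam"
  have y: "0 < y" "y < 1" "lam = y\<^sup>2" using lam_bounds by (auto simp: y_def)
  have "(\<lambda>n. real n * y ^ n) \<longlonglongrightarrow> 0" using y by (intro powser_times_n_limit_0) simp
  then have "(\<lambda>n. (real n * y ^ n) ^ 2) \<longlonglongrightarrow> 0 ^ 2" by (rule tendsto_power)
  moreover have "(real n * y ^ n) ^ 2 = real n ^ 2 * lam ^ n" for n
   by (simp add: y(3) power_mult_distrib power_mult[symmetric] mult.commute)
  ultimately show ?thesis by simp
 qed
 then have "(\<lambda>n. M * (real n ^ 2 * lam ^ n)) \<longlonglongrightarrow> M * 0" by (intro tendsto_mult tendsto_const)
 then have "eventually (\<lambda>n. M * (real n ^ 2 * lam ^ n) < 1) sequentially" by (intro order_tendstoD(2)) auto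
 then have "eventually (\<lambda>n. M * (real n ^ 2 * lam ^ n) < 1 \<and> 2 \<le> n) sequentially"
  using eventually_ge_at_top[of "2 :: nat"] by (rule eventually_conj)
 then obtain k where k: "M * (real k ^ 2 * lam ^ k) < 1" "k \<ge> 2" using eventually_happens' sequentially_bot by blast
 have r1: "real (bsize (rr k)) \<le> real k * b1"
  unfolding b1_def using rr(2)[of k] k(2) by (metis of_nat_le_iff of_nat_mult one_le_numeral order_trans)
 have r2: "real (bsize (rr k + rho)) \<le> real k * b1 * br"
 proof -
  have "real (bsize (rr k + rho)) \<le> real (bsize (rr k)) * br"
   unfolding br_def using bsize_add[of "rr k" rho] by (metis of_nat_le_iff of_nat_mult)
  also have "\<dots> \<le> real k * b1 * br" using r1 b by (intro mult_right_mono) auto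
  finally show ?thesis .
 qed
 have "12 * real (Lc * bsize (rr k)) * real (bsize (rr k + rho)) * lam ^ k
   = 12 * real Lc * (real (bsize (rr k)) * real (bsize (rr k + rho))) * lam ^ k" by simp
 also have "\<dots> \<le> 12 * real Lc * ((real k * b1) * (real k * b1 * br)) * lam ^ k"
  using r1 r2 b lp[of k] by (intro mult_right_mono mult_left_mono mult_mono) auto
 also have "\<dots> = M * (real k ^ 2 * lam ^ k)" by (simp add: M_def power2_eq_square mult_ac)
 finally have ks: "12 * real (Lc * bsize (rr k)) * real (bsize (rr k + rho)) * lam ^ k \<le> 1" using k(1) by linarith
 define e0 where "e0 = min (1 / 4) (1 / (6 * real (bsize (rr k + rho))))"
 have e0: "0 < e0" using bsize_ge[of "rr k + rho"] by (simp add: e0_def)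
 have "0 < e0 ^ 4 / 256" using e0 by simp
 then obtain n where n: "lam ^ n < e0 ^ 4 / 256" using real_arch_pow_inv lam_bounds by blast
 define kp where "kp = n + (k + (rr k + rho))"
 have "lam ^ kp \<le> lam ^ n" using lam_bounds by (intro power_decreasing) (auto simp: kp_def)
 then have "env2 E D rho Lc \<kappa> k kp e0"
  using k(2) ks e0 n by unfold_locales (auto simp: kp_def e0_def)
 then show ?thesis by blast
qed

end

context env begin

theorem env_matching:
 "\<exists>m c R. rrel m \<and> (\<forall>Y x y. m Y x y \<longrightarrow> pt Y True x \<and> pt Y False y) \<and>
  (\<forall>Y x y y'. m Y x y \<longrightarrow> m Y x y' \<longrightarrow> y = y') \<and> (\<forall>Y x x' y. m Y x y \<longrightarrow> m Y x' y \<longrightarrow> x = x') \<and>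
  (AE Y in D. (\<forall>x. pt Y True x \<longrightarrow> (\<exists>y. m Y x y)) \<and> (\<forall>y. pt Y False y \<longrightarrow> (\<exists>x. m Y x y))) \<and>
  0 < c \<and> (\<forall>v. \<forall>r\<ge>R. (\<integral>\<^sup>+Y. of_nat (cnt Y True v) * of_bool (\<exists>i y. m Y (v, i) y \<and> r \<le> dd v (fst y)) \<partial>D)
    \<le> ennreal (exp (- c * real (bsize r))))"
proof -
 obtain rho Lc where "env1 E D rho Lc (ln (real (bsize 1)))" using ex_env1 by blast
 then interpret e1: env1 E D rho Lc "ln (real (bsize 1))" .
 obtain k kp e0 where "env2 E D rho Lc (ln (real (bsize 1))) k kp e0" using e1.ex_env2 by blast
 then interpret e2: env2 E D rho Lc "ln (real (bsize 1))" k kp e0 .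
 obtain c R where "0 < c" "\<forall>v. \<forall>r\<ge>R. (\<integral>\<^sup>+Y. of_nat (cnt Y True v) * of_bool (\<exists>i y. e2.mlim Y (v, i) y \<and> r \<le> dd v (fst y)) \<partial>D)
  \<le> ennreal (exp (- c * real (bsize r)))" using e2.mlim_tail by blast
 moreover have "\<forall>Y x y. e2.mlim Y x y \<longrightarrow> pt Y True x \<and> pt Y False y"
  using e2.mlim_props(1) unfolding e2.HH_def by blast
 moreover have "\<forall>Y x y y'. e2.mlim Y x y \<longrightarrow> e2.mlim Y x y' \<longrightarrow> y = y'" "\<forall>Y x x' y. e2.mlim Y x y \<longrightarrow> e2.mlim Y x' y \<longrightarrow> x = x'"
  using e2.mlim_props(2,3) by blast+
 ultimately show ?thesis using e2.rrel_mlim e2.mlim_perfect by blast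
qed

end

text \<open>On a countable type the points of mass zero together form a null set, so the measure is
  carried by its atoms.\<close>

lemma countable_measure_pmf:
 fixes N :: "'a measure"
 assumes N: "prob_space N" "sets N = UNIV" and c: "countable (UNIV :: 'a set)"
 shows "\<exists>p. measure_pmf p = N"
proof -
 interpret prob_space N by fact
 have "(\<Union>x\<in>{x. measure N {x} = 0}. {x}) \<in> null_sets N"
  by (rule null_sets_UN') (use N(2) countable_subset[OF subset_UNIV c] in \<open>auto simp: null_sets_def emeasure_eq_measure\<close>)
 then have "AE x in N. x \<notin> (\<Union>x\<in>{x. measure N {x} = 0}. {x})" by (rule AE_not_in)
 then have "AE x in N. measure N {x} \<noteq> 0" by eventually_elim simp
 then have "measure_pmf (Abs_pmf N) = N" using N by (intro Abs_pmf_inverse) auto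
 then show ?thesis by blast
qed

section \<open>Poisson processes and perturbed vertex sets as emission fields\<close>

lemma poisson_exp:
 "(\<integral>\<^sup>+n. ennreal (exp (s * real n)) \<partial>measure_pmf (poisson_pmf 1)) = ennreal (exp (exp s - 1))"
proof -
 have "(\<lambda>n. exp s ^ n /\<^sub>R fact n) sums exp (exp s)" by (rule exp_converges)
 then have "(\<lambda>n. exp s ^ n /\<^sub>R fact n * exp (- 1)) sums (exp (exp s) * exp (- 1))" by (rule sums_mult2)
 moreover have "exp s ^ n /\<^sub>R fact n * exp (- 1) = pmf (poisson_pmf 1) n * exp (s * real n)" for n
  by (simp add: exp_of_nat2_mult[symmetric] mult.commute divide_inverse)
 ultimately have "(\<lambda>n. pmf (poisson_pmf 1) n * exp (s * real n)) sums exp (exp s - 1)"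
  by (simp add: exp_add[symmetric])
 then have "(\<Sum>n. ennreal (pmf (poisson_pmf 1) n * exp (s * real n))) = ennreal (exp (exp s - 1))"
  by (intro suminf_ennreal_eq) auto
 then show ?thesis
  by (simp add: nn_integral_measure_pmf nn_integral_count_space_nat ennreal_mult del: pmf_poisson)
qed

lemma poisson_mean: "(\<integral>\<^sup>+n. of_nat n \<partial>measure_pmf (poisson_pmf 1)) = 1"
proof -
 have "(\<lambda>n. 1 ^ n /\<^sub>R fact n :: real) sums exp 1" by (rule exp_converges)
 then have "(\<lambda>n. 1 ^ n /\<^sub>R fact n * exp (- 1) :: real) sums (exp 1 * exp (- 1))" by (rule sums_mult2)
 moreover have "1 ^ n /\<^sub>R fact n * exp (- 1) = pmf (poisson_pmf 1) (Suc n) * real (Suc n)" for n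
  by (simp add: field_simps del: of_nat_Suc)
 ultimately have "(\<lambda>n. pmf (poisson_pmf 1) (Suc n) * real (Suc n)) sums 1"
  by (simp add: exp_add[symmetric] del: pmf_poisson of_nat_Suc)
 then have "(\<lambda>n. pmf (poisson_pmf 1) n * real n) sums 1"
  using sums_Suc[of "\<lambda>n. pmf (poisson_pmf 1) n * real n" 1] by (simp del: pmf_poisson of_nat_Suc)
 then have "(\<Sum>n. ennreal (pmf (poisson_pmf 1) n * real n)) = ennreal 1"
  by (intro suminf_ennreal_eq) auto
 then show ?thesis
  by (simp add: nn_integral_measure_pmf nn_integral_count_space_nat ennreal_mult ennreal_of_nat_eq_real_of_nat del: pmf_poisson)
qed

definition emit :: "('v \<Rightarrow> 'v \<times> nat) \<Rightarrow> 'v \<Rightarrow> nat" where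
 "emit y u = card {(v, j). fst (y v) = u \<and> j < snd (y v)}"

text \<open>The assumptions of \<open>emission\<close> for a single side, so that each process can
  be represented on its own.\<close>

definition emission_law :: "('v \<Rightarrow> 'v \<Rightarrow> bool) \<Rightarrow> ('v \<Rightarrow> ('v \<times> nat) pmf) \<Rightarrow> bool" where
 "emission_law E q \<longleftrightarrow> (\<forall>\<gamma> v. automorphism E \<gamma> \<longrightarrow> map_pmf (map_prod \<gamma> id) (q v) = q (\<gamma> v)) \<and>
  (\<forall>v. (\<integral>\<^sup>+y. of_nat (snd y) \<partial>measure_pmf (q v)) = 1) \<and>
  (\<forall>v W. \<forall>s\<in>{1, -1}. (\<integral>\<^sup>+y. ennreal (exp (s * (if fst y \<in> W then real (snd y) else 0))) \<partial>measure_pmf (q v))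
    \<le> ennreal (exp ((exp s - 1) * enn2real (\<integral>\<^sup>+y. of_nat (snd y) * indicator W (fst y) \<partial>measure_pmf (q v)))))"

lemma emission_lawD:
 assumes "emission_law E q"
 shows "automorphism E \<gamma> \<Longrightarrow> map_pmf (map_prod \<gamma> id) (q v) = q (\<gamma> v)"
  "(\<integral>\<^sup>+y. of_nat (snd y) \<partial>measure_pmf (q v)) = 1"
  "s \<in> {1, -1} \<Longrightarrow> (\<integral>\<^sup>+y. ennreal (exp (s * (if fst y \<in> W then real (snd y) else 0))) \<partial>measure_pmf (q v))
    \<le> ennreal (exp ((exp s - 1) * enn2real (\<integral>\<^sup>+y. of_nat (snd y) * indicator W (fst y) \<partial>measure_pmf (q v))))"
 using assms unfolding emission_law_def by blast+

lemma emission_law_poisson: "emission_law E (\<lambda>v. map_pmf (\<lambda>n. (v, n)) (poisson_pmf 1))"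
 unfolding emission_law_def
proof (intro conjI allI impI ballI)
 fix v :: 'a and W and s :: real
 show "(\<integral>\<^sup>+y. ennreal (exp (s * (if fst y \<in> W then real (snd y) else 0))) \<partial>measure_pmf (map_pmf (\<lambda>n. (v, n)) (poisson_pmf 1)))
    \<le> ennreal (exp ((exp s - 1) * enn2real (\<integral>\<^sup>+y. of_nat (snd y) * indicator W (fst y) \<partial>measure_pmf (map_pmf (\<lambda>n. (v, n)) (poisson_pmf 1)))))"
  by (cases "v \<in> W") (simp_all add: poisson_exp poisson_mean)
qed (simp_all add: pmf.map_comp comp_def poisson_mean)

text \<open>The number of points in \<open>W\<close> is a Bernoulli variable, and 1 + x <= exp x
  compares its exponential moments with those of a Poisson variable.\<close>

lemma emission_law_perturbed:
 assumes p: "\<And>\<gamma> v. automorphism E \<gamma> \<Longrightarrow> map_pmf \<gamma> (p v) = p (\<gamma> v)"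
 shows "emission_law E (\<lambda>v. map_pmf (\<lambda>u. (u, 1)) (p v))"
 unfolding emission_law_def
proof (intro conjI allI impI ballI)
 fix \<gamma> v assume g: "automorphism E \<gamma>"
 show "map_pmf (map_prod \<gamma> id) (map_pmf (\<lambda>u. (u, 1)) (p v)) = map_pmf (\<lambda>u. (u, 1)) (p (\<gamma> v))"
  unfolding p[OF g, symmetric] by (simp add: pmf.map_comp comp_def)
next
 fix v W and s :: real
 define t where "t = measure (measure_pmf (p v)) W"
 have t: "0 \<le> t" "t \<le> 1" by (simp_all add: t_def)
 have e: "ennreal (exp (s * (if u \<in> W then 1 else 0))) = ennreal (exp s) * indicator W u + indicator (- W) u" for u
  by (simp add: indicator_def)
 have "(\<integral>\<^sup>+u. ennreal (exp (s * (if u \<in> W then 1 else 0))) \<partial>measure_pmf (p v))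
   = ennreal (exp s) * emeasure (measure_pmf (p v)) W + emeasure (measure_pmf (p v)) (- W)"
  unfolding e by (subst nn_integral_add) (simp_all add: nn_integral_cmult)
 also have "emeasure (measure_pmf (p v)) (- W) = ennreal (1 - t)"
  using measure_pmf.prob_compl[of W "p v"] by (simp add: measure_pmf.emeasure_eq_measure t_def Compl_eq_Diff_UNIV)
 also have "ennreal (exp s) * emeasure (measure_pmf (p v)) W + ennreal (1 - t) = ennreal (exp s * t + (1 - t))"
  using t by (simp add: measure_pmf.emeasure_eq_measure t_def[symmetric] ennreal_mult ennreal_plus)
 also have "\<dots> \<le> ennreal (exp ((exp s - 1) * t))"
  using exp_ge_add_one_self[of "(exp s - 1) * t"] by (intro ennreal_leI) (simp add: algebra_simps)
 finally have "(\<integral>\<^sup>+u. ennreal (exp (s * (if u \<in> W then 1 else 0))) \<partial>measure_pmf (p v)) \<le> ennreal (exp ((exp s - 1) * t))" .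
 moreover have "enn2real (\<integral>\<^sup>+y. of_nat (snd y) * indicator W (fst y) \<partial>measure_pmf (map_pmf (\<lambda>u. (u, 1)) (p v))) = t"
  by (simp add: t_def measure_pmf.emeasure_eq_measure)
 ultimately show "(\<integral>\<^sup>+y. ennreal (exp (s * (if fst y \<in> W then real (snd y) else 0))) \<partial>measure_pmf (map_pmf (\<lambda>u. (u, 1)) (p v)))
    \<le> ennreal (exp ((exp s - 1) * enn2real (\<integral>\<^sup>+y. of_nat (snd y) * indicator W (fst y) \<partial>measure_pmf (map_pmf (\<lambda>u. (u, 1)) (p v)))))"
  by (simp only: nn_integral_map_pmf fst_conv snd_conv of_nat_1)
qed simp

lemma (in nonamenable_graph) process_emission:
 assumes P: "prob_space P" and \<Phi>: "perturbed_vertex_set E P \<Phi> \<or> poisson_process P \<Phi>"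
 shows "\<exists>q Y. emission_law E q \<and> Y \<in> P \<rightarrow>\<^sub>M (\<Pi>\<^sub>M v\<in>UNIV. count_space UNIV) \<and>
  distr P (\<Pi>\<^sub>M v\<in>UNIV. count_space UNIV) Y = (\<Pi>\<^sub>M v\<in>UNIV. measure_pmf (q v)) \<and> (AE \<omega> in P. \<Phi> \<omega> = emit (Y \<omega>))"
proof -
 interpret prob_space P by fact
 have law: "(\<lambda>\<omega> v. Z v \<omega>) \<in> P \<rightarrow>\<^sub>M (\<Pi>\<^sub>M v\<in>UNIV. count_space UNIV) \<and>
   distr P (\<Pi>\<^sub>M v\<in>UNIV. count_space UNIV) (\<lambda>\<omega> v. Z v \<omega>) = (\<Pi>\<^sub>M v\<in>UNIV. measure_pmf (q v))"
  if i: "indep_vars (\<lambda>_. count_space UNIV) Z UNIV" and d: "\<And>v. distr P (count_space UNIV) (Z v) = measure_pmf (q v)"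
  for Z :: "'v \<Rightarrow> _ \<Rightarrow> 'v \<times> nat" and q
 proof -
  have m: "Z v \<in> P \<rightarrow>\<^sub>M count_space UNIV" for v using i by (simp add: indep_vars_def)
  have "distr P (\<Pi>\<^sub>M v\<in>UNIV. count_space UNIV) (\<lambda>\<omega>. \<lambda>v\<in>UNIV. Z v \<omega>) = (\<Pi>\<^sub>M v\<in>UNIV. distr P (count_space UNIV) (Z v))"
   using i indep_vars_iff_distr_eq_PiM[of UNIV Z "\<lambda>_. count_space UNIV"] m by simp
  moreover have "(\<lambda>\<omega> v. Z v \<omega>) \<in> P \<rightarrow>\<^sub>M (\<Pi>\<^sub>M v\<in>UNIV. count_space UNIV)"
   using m by (intro measurable_PiM_single') auto
  ultimately show ?thesis by (simp add: d restrict_def)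
 qed
 from \<Phi> show ?thesis
 proof
  assume "perturbed_vertex_set E P \<Phi>"
  then obtain X where X: "indep_vars (\<lambda>_. count_space UNIV) X UNIV"
   "\<And>\<gamma> v. aut \<gamma> \<Longrightarrow> distr P (count_space UNIV) (\<lambda>\<omega>. \<gamma> (X v \<omega>)) = distr P (count_space UNIV) (X (\<gamma> v))"
   "AE \<omega> in P. \<forall>v. finite {u. X u \<omega> = v} \<and> \<Phi> \<omega> v = card {u. X u \<omega> = v}"
   unfolding perturbed_vertex_set_def by blast
  have m: "X v \<in> P \<rightarrow>\<^sub>M count_space UNIV" for v using X(1) by (simp add: indep_vars_def)
  have "\<exists>p. measure_pmf p = distr P (count_space UNIV) (X v)" for v
   by (intro countable_measure_pmf prob_space_distr m countable_V) simp
  then obtain p where p: "\<And>v. measure_pmf (p v) = distr P (count_space UNIV) (X v)" by metis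
  have pa: "map_pmf \<gamma> (p v) = p (\<gamma> v)" if g: "aut \<gamma>" for \<gamma> v
  proof -
   have "measure_pmf (map_pmf \<gamma> (p v)) = distr (distr P (count_space UNIV) (X v)) (count_space UNIV) \<gamma>"
    by (simp add: map_pmf_rep_eq p)
   also have "\<dots> = distr P (count_space UNIV) (\<lambda>\<omega>. \<gamma> (X v \<omega>))" using m by (subst distr_distr) (auto simp: comp_def)
   finally show ?thesis using X(2)[OF g, of v] by (simp add: p[symmetric] measure_pmf_inject)
  qed
  have i: "indep_vars (\<lambda>_. count_space UNIV) (\<lambda>v \<omega>. (X v \<omega>, 1 :: nat)) UNIV"
   by (rule indep_vars_compose2[OF X(1)]) simp
  have d: "distr P (count_space UNIV) (\<lambda>\<omega>. (X v \<omega>, 1 :: nat)) = measure_pmf (map_pmf (\<lambda>u. (u, 1)) (p v))" for v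
   unfolding map_pmf_rep_eq p using m by (subst distr_distr) (auto simp: comp_def)
  have "AE \<omega> in P. \<Phi> \<omega> = emit (\<lambda>v. (X v \<omega>, 1))"
   using X(3)
  proof eventually_elim
   case (elim \<omega>)
   have "{(v, j). X v \<omega> = u \<and> j < (1 :: nat)} = {v. X v \<omega> = u} \<times> {0}" for u by auto
   then show ?case using elim by (simp add: emit_def fun_eq_iff card_cartesian_product)
  qed
  then show ?thesis using law[OF i d] emission_law_perturbed[of E p, OF pa]
   by (intro exI[of _ "\<lambda>v. map_pmf (\<lambda>u. (u, 1)) (p v)"] exI[of _ "\<lambda>\<omega> v. (X v \<omega>, 1)"]) simp
 next
  assume "poisson_process P \<Phi>"
  then have X: "indep_vars (\<lambda>_. count_space UNIV) (\<lambda>v \<omega>. \<Phi> \<omega> v) UNIV"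
   "\<And>v. distr P (count_space UNIV) (\<lambda>\<omega>. \<Phi> \<omega> v) = measure_pmf (poisson_pmf 1)"
   unfolding poisson_process_def by auto
  have m: "(\<lambda>\<omega>. \<Phi> \<omega> v) \<in> P \<rightarrow>\<^sub>M count_space UNIV" for v using X(1) by (simp add: indep_vars_def)
  have i: "indep_vars (\<lambda>_. count_space UNIV) (\<lambda>v \<omega>. (v, \<Phi> \<omega> v)) UNIV"
   by (rule indep_vars_compose2[OF X(1)]) simp
  have d: "distr P (count_space UNIV) (\<lambda>\<omega>. (v, \<Phi> \<omega> v)) = measure_pmf (map_pmf (\<lambda>n. (v, n)) (poisson_pmf 1))" for v
   unfolding map_pmf_rep_eq X(2)[of v, symmetric] using m by (subst distr_distr) (auto simp: comp_def)
  have "{(v, j). v = u \<and> j < \<Phi> \<omega> v} = {u} \<times> {..<\<Phi> \<omega> u}" for u \<omega> by auto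
  then have "\<Phi> \<omega> = emit (\<lambda>v. (v, \<Phi> \<omega> v))" for \<omega> by (simp add: emit_def fun_eq_iff card_cartesian_product)
  then show ?thesis using law[OF i d] emission_law_poisson[of E]
   by (intro exI[of _ "\<lambda>v. map_pmf (\<lambda>n. (v, n)) (poisson_pmf 1)"] exI[of _ "\<lambda>\<omega> v. (v, \<Phi> \<omega> v)"]) simp
 qed
qed

lemma (in nonamenable_graph) joint_emission:
 assumes P: "prob_space P" and \<Phi>: "perturbed_vertex_set E P \<Phi> \<or> poisson_process P \<Phi>"
  and \<Phi>': "perturbed_vertex_set E P \<Phi>' \<or> poisson_process P \<Phi>'"
  and ind: "prob_space.indep_var P config_space \<Phi> config_space \<Phi>'"
 shows "\<exists>q. emission E q \<and> distr P (config_space \<Otimes>\<^sub>M config_space) (\<lambda>\<omega>. (\<Phi> \<omega>, \<Phi>' \<omega>)) =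
  distr (pmf_product.mu q) (config_space \<Otimes>\<^sub>M config_space) (\<lambda>x. (emission.tot x True, emission.tot x False))"
proof -
 interpret prob_space P by fact
 have rv: "\<Phi> \<in> P \<rightarrow>\<^sub>M config_space" "\<Phi>' \<in> P \<rightarrow>\<^sub>M config_space"
  and jd: "distr P config_space \<Phi> \<Otimes>\<^sub>M distr P config_space \<Phi>' = distr P (config_space \<Otimes>\<^sub>M config_space) (\<lambda>\<omega>. (\<Phi> \<omega>, \<Phi>' \<omega>))"
  using ind by (auto simp: indep_var_distribution_eq)
 obtain q1 Y1 where 1: "emission_law E q1" "Y1 \<in> P \<rightarrow>\<^sub>M (\<Pi>\<^sub>M v\<in>UNIV. count_space UNIV)"
  "distr P (\<Pi>\<^sub>M v\<in>UNIV. count_space UNIV) Y1 = (\<Pi>\<^sub>M v\<in>UNIV. measure_pmf (q1 v))" "AE \<omega> in P. \<Phi> \<omega> = emit (Y1 \<omega>)"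
  using process_emission[OF P \<Phi>] by blast
 obtain q2 Y2 where 2: "emission_law E q2" "Y2 \<in> P \<rightarrow>\<^sub>M (\<Pi>\<^sub>M v\<in>UNIV. count_space UNIV)"
  "distr P (\<Pi>\<^sub>M v\<in>UNIV. count_space UNIV) Y2 = (\<Pi>\<^sub>M v\<in>UNIV. measure_pmf (q2 v))" "AE \<omega> in P. \<Phi>' \<omega> = emit (Y2 \<omega>)"
  using process_emission[OF P \<Phi>'] by blast
 define q where "q i = (if fst i then q1 (snd i) else q2 (snd i))" for i :: "bool \<times> 'v"
 have q: "q (True, v) = q1 v" "q (False, v) = q2 v" for v by (simp_all add: q_def)
 have "emission E q"
 proof
  show "aut \<gamma> \<Longrightarrow> map_pmf (map_prod \<gamma> id) (q (b, v)) = q (b, \<gamma> v)" for \<gamma> b v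
   using emission_lawD(1)[OF 1(1)] emission_lawD(1)[OF 2(1)] by (cases b) (simp_all add: q)
  show "(\<integral>\<^sup>+y. of_nat (snd y) \<partial>measure_pmf (q i)) = 1" for i
   using emission_lawD(2)[OF 1(1)] emission_lawD(2)[OF 2(1)] by (simp add: q_def)
  show "(\<integral>\<^sup>+y. ennreal (exp (s * (if fst y \<in> W then real (snd y) else 0))) \<partial>measure_pmf (q i))
    \<le> ennreal (exp ((exp s - 1) * enn2real (\<integral>\<^sup>+y. of_nat (snd y) * indicator W (fst y) \<partial>measure_pmf (q i))))"
   if "s \<in> {1, -1}" for s W i
  proof (cases "fst i")
   case True
   then have qi: "q i = q1 (snd i)" by (simp add: q_def)
   show ?thesis unfolding qi by (rule emission_lawD(3)[OF 1(1) that])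
  next
   case False
   then have qi: "q i = q2 (snd i)" by (simp add: q_def)
   show ?thesis unfolding qi by (rule emission_lawD(3)[OF 2(1) that])
  qed
 qed
 then interpret e: emission E q .
 let ?C = "\<Pi>\<^sub>M v\<in>(UNIV :: 'v set). count_space (UNIV :: ('v \<times> nat) set)"
 let ?m1 = "\<Pi>\<^sub>M v\<in>UNIV. measure_pmf (q1 v)" and ?m2 = "\<Pi>\<^sub>M v\<in>UNIV. measure_pmf (q2 v)"
 have sC: "sets ?m1 = sets ?C" "sets ?m2 = sets ?C" by (auto intro!: sets_PiM_cong)
 \<comment> \<open>Glues a field for each side into one field over both sides; the product of the
   two laws becomes the law of the joint field.\<close>
 define mg where "mg y = (\<lambda>i. if fst i then fst y (snd i) else snd y (snd i))" for y :: "('v \<Rightarrow> 'v \<times> nat) \<times> ('v \<Rightarrow> 'v \<times> nat)" and i :: "bool \<times> 'v"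
 interpret a1: pmf_product q1 .
 interpret a2: pmf_product q2 .
 have m1: "a1.mu = ?m1" and m2: "a2.mu = ?m2" by (simp_all add: a1.mu_def a2.mu_def)
 interpret p1: prob_space ?m1 by (intro prob_space_PiM measure_pmf.prob_space_axioms)
 have ps2: "prob_space ?m2" by (intro prob_space_PiM measure_pmf.prob_space_axioms)
 interpret p2: prob_space ?m2 by (intro prob_space_PiM measure_pmf.prob_space_axioms)
 interpret pp: pair_prob_space ?m1 ?m2 ..
 have cm: "(\<lambda>y. y v) \<in> ?m1 \<rightarrow>\<^sub>M count_space UNIV" "(\<lambda>y. y v) \<in> ?m2 \<rightarrow>\<^sub>M count_space UNIV" for v
  using a1.measurable_coord a2.measurable_coord by (simp_all add: m1 m2)
 have mg: "mg \<in> ?m1 \<Otimes>\<^sub>M ?m2 \<rightarrow>\<^sub>M e.mu"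
 proof (rule e.measurable_into_mu)
  fix i :: "bool \<times> 'v"
  show "(\<lambda>y. mg y i) \<in> ?m1 \<Otimes>\<^sub>M ?m2 \<rightarrow>\<^sub>M count_space UNIV"
   unfolding mg_def by (cases "fst i") (simp_all add: measurable_compose[OF measurable_fst cm(1)] measurable_compose[OF measurable_snd cm(2)])
 qed
 have mu: "distr (?m1 \<Otimes>\<^sub>M ?m2) e.mu mg = e.mu"
 proof (rule e.mu_eqI)
  show "finite_measure (distr (?m1 \<Otimes>\<^sub>M ?m2) e.mu mg)" by (intro pp.finite_measure_distr mg)
 next
  fix J :: "(bool \<times> 'v) set" and A :: "bool \<times> 'v \<Rightarrow> ('v \<times> nat) set" assume J: "finite J"
  define K where "K b = {v. (b, v) \<in> J}" for b
  have fK: "finite (K b)" for b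
   using finite_vimageI[OF J, of "Pair b"] by (simp add: K_def vimage_def inj_on_def)
  have JK: "J = Pair True ` K True \<union> Pair False ` K False"
  proof (rule set_eqI)
   fix i show "i \<in> J \<longleftrightarrow> i \<in> Pair True ` K True \<union> Pair False ` K False"
    by (cases i; cases "fst i") (simp_all add: K_def image_iff)
  qed
  let ?T = "\<lambda>b. {y. \<forall>v\<in>K b. y v \<in> A (b, v)}"
  have pm: "Measurable.pred ?m1 (\<lambda>y. \<forall>v\<in>K b. y v \<in> A (b, v))" "Measurable.pred ?m2 (\<lambda>y. \<forall>v\<in>K b. y v \<in> A (b, v))" for b
   by (intro pred_intros_finite fK measurable_compose[OF cm(1)] measurable_compose[OF cm(2)]; simp)+
  have sp: "space ?m1 = UNIV" "space ?m2 = UNIV" by (simp_all add: space_PiM)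
  have mT: "?T b \<in> sets ?m1" "?T b \<in> sets ?m2" for b using pm[of b] by (simp_all add: pred_def sp)
  have pre: "mg -` {x. \<forall>i\<in>J. x i \<in> A i} \<inter> space (?m1 \<Otimes>\<^sub>M ?m2) = ?T True \<times> ?T False"
  proof -
   have "(\<forall>i\<in>J. x i \<in> A i) \<longleftrightarrow> (\<forall>v\<in>K True. x (True, v) \<in> A (True, v)) \<and> (\<forall>v\<in>K False. x (False, v) \<in> A (False, v))" for x
    by (subst JK) (simp add: ball_Un)
   then show ?thesis unfolding space_pair_measure sp by (auto simp: mg_def)
  qed
  have "{x. \<forall>i\<in>J. x i \<in> A i} \<in> sets e.mu"
  proof -
   have "Measurable.pred e.mu (\<lambda>x. \<forall>i\<in>J. x i \<in> A i)"
    by (intro pred_intros_finite J measurable_compose[OF e.measurable_coord]) simp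
   then show ?thesis by (simp add: pred_def e.mu_def space_PiM)
  qed
  then have "emeasure (distr (?m1 \<Otimes>\<^sub>M ?m2) e.mu mg) {x. \<forall>i\<in>J. x i \<in> A i} = emeasure ?m1 (?T True) * emeasure ?m2 (?T False)"
   by (simp only: emeasure_distr[OF mg] pre sigma_finite_measure.emeasure_pair_measure_Times[OF prob_space_imp_sigma_finite[OF ps2] mT(1) mT(2)])
  also have "emeasure ?m1 (?T True) = (\<Prod>v\<in>K True. emeasure (measure_pmf (q (True, v))) (A (True, v)))"
   using a1.emeasure_cylinder[OF fK, of True "\<lambda>v. A (True, v)"] by (simp add: m1 q_def)
  also have "emeasure ?m2 (?T False) = (\<Prod>v\<in>K False. emeasure (measure_pmf (q (False, v))) (A (False, v)))"
   using a2.emeasure_cylinder[OF fK, of False "\<lambda>v. A (False, v)"] by (simp add: m2 q_def)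
  also have "(\<Prod>v\<in>K True. emeasure (measure_pmf (q (True, v))) (A (True, v))) * (\<Prod>v\<in>K False. emeasure (measure_pmf (q (False, v))) (A (False, v)))
    = (\<Prod>i\<in>J. emeasure (measure_pmf (q i)) (A i))"
   by (subst JK, subst prod.union_disjoint) (auto simp: fK prod.reindex inj_on_def)
  finally show "emeasure (distr (?m1 \<Otimes>\<^sub>M ?m2) e.mu mg) {x. \<forall>i\<in>J. x i \<in> A i} = (\<Prod>i\<in>J. emeasure (measure_pmf (q i)) (A i))" .
 qed simp
 have tc: "(\<lambda>x. e.tot x b) \<in> e.mu \<rightarrow>\<^sub>M config_space" for b by (rule measurable_into_config[OF e.tot_measurable])
 have te: "e.tot (mg y) b = emit (if b then fst y else snd y)" for y b
  by (simp add: e.tot_def emit_def mg_def fun_eq_iff)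
 have em: "emit \<in> ?C \<rightarrow>\<^sub>M config_space"
 proof -
  have "(\<lambda>y. mg (y, y)) \<in> ?C \<rightarrow>\<^sub>M e.mu"
  proof (rule e.measurable_into_mu)
   fix i :: "bool \<times> 'v"
   have "(\<lambda>y. y (snd i)) \<in> ?C \<rightarrow>\<^sub>M count_space UNIV" by (rule measurable_component_singleton) simp
   then show "(\<lambda>y. mg (y, y) i) \<in> ?C \<rightarrow>\<^sub>M count_space UNIV" by (simp add: mg_def)
  qed
  from measurable_compose[OF this tc[of True]] show ?thesis by (simp add: te)
 qed
 have em1: "emit \<in> ?m1 \<rightarrow>\<^sub>M config_space" and em2: "emit \<in> ?m2 \<rightarrow>\<^sub>M config_space"
  using em unfolding measurable_cong_sets[OF sC(1) refl] measurable_cong_sets[OF sC(2) refl] by blast+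
 have l1: "distr P config_space \<Phi> = distr ?m1 config_space emit"
 proof -
  have "distr P config_space \<Phi> = distr P config_space (\<lambda>\<omega>. emit (Y1 \<omega>))"
   by (rule distr_cong_AE[OF refl refl 1(4) rv(1) measurable_compose[OF 1(2) em]])
  also have "\<dots> = distr (distr P ?C Y1) config_space emit" using distr_distr[OF em 1(2)] by (simp add: comp_def)
  finally show ?thesis by (simp add: 1(3))
 qed
 have l2: "distr P config_space \<Phi>' = distr ?m2 config_space emit"
 proof -
  have "distr P config_space \<Phi>' = distr P config_space (\<lambda>\<omega>. emit (Y2 \<omega>))"
   by (rule distr_cong_AE[OF refl refl 2(4) rv(2) measurable_compose[OF 2(2) em]])
  also have "\<dots> = distr (distr P ?C Y2) config_space emit" using distr_distr[OF em 2(2)] by (simp add: comp_def)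
  finally show ?thesis by (simp add: 2(3))
 qed
 have tt: "(\<lambda>x. (e.tot x True, e.tot x False)) \<in> e.mu \<rightarrow>\<^sub>M config_space \<Otimes>\<^sub>M config_space"
  by (intro measurable_Pair tc)
 have "sigma_finite_measure (distr ?m2 config_space emit)"
  by (intro prob_space_imp_sigma_finite prob_space.prob_space_distr[OF ps2] em2)
 then have "distr P (config_space \<Otimes>\<^sub>M config_space) (\<lambda>\<omega>. (\<Phi> \<omega>, \<Phi>' \<omega>)) =
   distr (?m1 \<Otimes>\<^sub>M ?m2) (config_space \<Otimes>\<^sub>M config_space) (\<lambda>(x, y). (emit x, emit y))"
  unfolding jd[symmetric] l1 l2 by (rule pair_measure_distr[OF em1 em2])
 also have "(\<lambda>(x, y). (emit x, emit y)) = (\<lambda>x. (e.tot x True, e.tot x False)) \<circ> mg"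
  by (simp add: fun_eq_iff te)
 also have "distr (?m1 \<Otimes>\<^sub>M ?m2) (config_space \<Otimes>\<^sub>M config_space) \<dots> = distr (distr (?m1 \<Otimes>\<^sub>M ?m2) e.mu mg) (config_space \<Otimes>\<^sub>M config_space) (\<lambda>x. (e.tot x True, e.tot x False))"
  by (rule distr_distr[OF tt mg, symmetric])
 finally show ?thesis using e.emission_axioms unfolding mu by blast
qed

section \<open>From matching relations to partial maps\<close>

definition matching_of :: "('p \<Rightarrow> 'r \<Rightarrow> bool) \<Rightarrow> 'p \<rightharpoonup> 'r" where
 "matching_of m x = (if \<exists>y. m x y then Some (THE y. m x y) else None)"

lemma matching_of_eq:
 assumes f: "\<forall>x y y'. m x y \<longrightarrow> m x y' \<longrightarrow> y = y'"
 shows "matching_of m x = Some y \<longleftrightarrow> m x y" "matching_of m x = None \<longleftrightarrow> \<not> (\<exists>y. m x y)"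
proof -
 have "(THE y. m x y) = z" if "m x z" for z using that f by (intro the_equality) blast+
 then show "matching_of m x = Some y \<longleftrightarrow> m x y" unfolding matching_of_def by (auto intro: exI)
qed (simp add: matching_of_def)

context env begin

lemma matching_of_gp:
 assumes g: "aut \<gamma>" and m: "\<And>p q. m' (gp \<gamma> p) (gp \<gamma> q) = m p q"
  and f: "\<forall>x y y'. m x y \<longrightarrow> m x y' \<longrightarrow> y = y'"
 shows "matching_of m' = act_matching \<gamma> (matching_of m)"
proof
 fix p :: "'v \<times> nat"
 have f': "\<forall>x y y'. m' x y \<longrightarrow> m' x y' \<longrightarrow> y = y'"
 proof (intro allI impI)
  fix x y y' assume that: "m' x y" "m' x y'"
  have "m (gp (inv \<gamma>) x) (gp (inv \<gamma>) y)" "m (gp (inv \<gamma>) x) (gp (inv \<gamma>) y')"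
   using that m[of "gp (inv \<gamma>) x"] gp_inv(1)[OF g] by metis+
  then have "gp (inv \<gamma>) y = gp (inv \<gamma>) y'" using f by blast
  then show "y = y'" using gp_inv(1)[OF g] by metis
 qed
 obtain v i where p: "p = (v, i)" by (cases p)
 have pi: "gp \<gamma> (inv \<gamma> v, i) = p" using g by (simp add: p)
 have act: "act_matching \<gamma> (matching_of m) p = map_option (gp \<gamma>) (matching_of m (inv \<gamma> v, i))"
  by (simp add: act_matching_def p gp_def[abs_def] case_prod_beta')
 show "matching_of m' p = act_matching \<gamma> (matching_of m) p"
 proof (cases "matching_of m (inv \<gamma> v, i)")
  case None
  then have "\<not> m (inv \<gamma> v, i) y" for y using matching_of_eq(2)[OF f] by blast
  then have "\<not> m' p (gp \<gamma> y)" for y using m[of "(inv \<gamma> v, i)" y] pi by simp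
  then have "\<not> m' p y" for y using gp_inv(1)[OF g] by metis
  then have "matching_of m' p = None" unfolding matching_of_def by simp
  then show ?thesis unfolding act None by simp
 next
  case (Some y)
  then have "m (inv \<gamma> v, i) y" using matching_of_eq(1)[OF f] by blast
  then have "m' p (gp \<gamma> y)" using m[of "(inv \<gamma> v, i)" y] pi by simp
  then have "matching_of m' p = Some (gp \<gamma> y)" using matching_of_eq(1)[OF f'] by blast
  then show ?thesis unfolding act Some by simp
 qed
qed

end

theorem theorem1p1:
  fixes E :: "'v \<Rightarrow> 'v \<Rightarrow> bool"
    and P :: "'w measure"
    and \<Phi> \<Phi>' :: "'w \<Rightarrow> 'v \<Rightarrow> nat"
  assumes "symp E" and "irreflp E"
    and "locally_finite E" and "graph_connected E" and "graph_transitive E"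
    and "nonamenable E" and "unimodular E"
    and "prob_space P"
    and "perturbed_vertex_set E P \<Phi> \<or> poisson_process P \<Phi>"
    and "perturbed_vertex_set E P \<Phi>' \<or> poisson_process P \<Phi>'"
    and "prob_space.indep_var P config_space \<Phi> config_space \<Phi>'"
    and "\<exists>\<O> :: 'w \<Rightarrow> 'v \<Rightarrow> real.
           is_factor E P \<Phi> \<Phi>' (\<Pi>\<^sub>M v\<in>UNIV. borel) act_field \<O> \<and>
           (AE \<omega> in P. inj (\<O> \<omega>))"
  shows "\<exists>c>0. \<exists>M :: 'w \<Rightarrow> ('v \<times> nat \<rightharpoonup> 'v \<times> nat).
           is_factor E P \<Phi> \<Phi>' matching_space act_matching M \<and>
           (AE \<omega> in P. perfect_matching (M \<omega>) (points (\<Phi> \<omega>)) (points (\<Phi>' \<omega>))) \<and>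
           (\<exists>R. \<forall>v. \<forall>r\<ge>R.
              (\<integral>\<^sup>+ \<omega>. of_nat (card {x \<in> points (\<Phi> \<omega>). fst x = v \<and>
                    (\<exists>y. M \<omega> x = Some y \<and> gdist E (fst y) (fst x) \<ge> r)}) \<partial>P)
              \<le> ennreal (exp (- c * real (card (gball E v r)))))"
proof -
 interpret nonamenable_graph E using assms(1-7) by unfold_locales
 interpret P: prob_space P by fact
 let ?cc = "config_space \<Otimes>\<^sub>M config_space :: (('v \<Rightarrow> nat) \<times> ('v \<Rightarrow> nat)) measure"
 let ?B = "\<Pi>\<^sub>M v\<in>(UNIV :: 'v set). (borel :: real measure)"
 let ?Z = "\<lambda>\<omega>. (\<Phi> \<omega>, \<Phi>' \<omega>)"
 obtain q where q: "emission E q" "distr P ?cc ?Z = distr (pmf_product.mu q) ?cc (\<lambda>x. (emission.tot x True, emission.tot x False))"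
  using joint_emission[OF assms(8-11)] by blast
 interpret e: emission E q by (rule q(1))
 let ?T = "\<lambda>x. (e.tot x True, e.tot x False)"
 have Z [measurable]: "?Z \<in> P \<rightarrow>\<^sub>M ?cc"
  using assms(11) unfolding P.indep_var_distribution_eq by (intro measurable_Pair) auto
 have T [measurable]: "?T \<in> e.mu \<rightarrow>\<^sub>M ?cc"
  by (intro measurable_Pair measurable_into_config[OF e.tot_measurable])
 \<comment> \<open>Almost sure measurable properties of the pair depend on its law alone, so they
   move freely between \<open>P\<close> and the emission space.\<close>
 have transfer: "(AE x in e.mu. Q (?T x)) \<longleftrightarrow> (AE \<omega> in P. Q (?Z \<omega>))" if "Measurable.pred ?cc Q" for Q
 proof -
  have s: "{z \<in> space ?cc. Q z} \<in> sets ?cc" using that by (simp add: pred_def)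
  show ?thesis using AE_distr_iff[OF Z s] AE_distr_iff[OF T s] unfolding q(2) by simp
 qed
 obtain \<O> where O: "is_factor E P \<Phi> \<Phi>' ?B act_field \<O>" "AE \<omega> in P. inj (\<O> \<omega>)" using assms(12) by blast
 obtain f where f [measurable]: "f \<in> ?cc \<rightarrow>\<^sub>M ?B" and fO: "AE \<omega> in P. \<O> \<omega> = f (?Z \<omega>)"
  and fa: "\<And>\<gamma>. aut \<gamma> \<Longrightarrow> AE \<omega> in P. f (act_field \<gamma> (\<Phi> \<omega>), act_field \<gamma> (\<Phi>' \<omega>)) = act_field \<gamma> (f (?Z \<omega>))"
  using O(1) unfolding is_factor_def by blast
 have fv: "(\<lambda>z. f z v) \<in> borel_measurable ?cc" for v
  using measurable_compose[OF f measurable_component_singleton[of v UNIV "\<lambda>_. borel"]] by simp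
 have f_inj: "AE \<omega> in P. inj (f (?Z \<omega>))" using fO O(2) by eventually_elim simp
 have acc: "(\<lambda>z. (act_field \<gamma> (fst z), act_field \<gamma> (snd z))) \<in> ?cc \<rightarrow>\<^sub>M ?cc" for \<gamma> by measurable
 have D: "env E (distr e.mu envM (\<lambda>x. (e.tot x True, e.tot x False, f (?T x))))"
 proof (rule e.env_emission[OF f])
  fix \<gamma> assume g: "aut \<gamma>"
  have eq: "f (act_field \<gamma> (fst z), act_field \<gamma> (snd z)) = act_field \<gamma> (f z) \<longleftrightarrow>
    (\<forall>v\<in>UNIV. f (act_field \<gamma> (fst z), act_field \<gamma> (snd z)) v = f z (inv \<gamma> v))" for z
   by (simp add: fun_eq_iff act_field_def)
  have "Measurable.pred ?cc (\<lambda>z. f (act_field \<gamma> (fst z), act_field \<gamma> (snd z)) = act_field \<gamma> (f z))"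
   unfolding eq
  proof (rule pred_Ball_countable[OF countable_V])
   fix v
   note [measurable] = fv measurable_compose[OF acc fv]
   show "Measurable.pred ?cc (\<lambda>z. f (act_field \<gamma> (fst z), act_field \<gamma> (snd z)) v = f z (inv \<gamma> v))"
    by measurable
  qed
  from transfer[OF this] fa[OF g]
  show "AE x in e.mu. f (act_field \<gamma> (e.tot x True), act_field \<gamma> (e.tot x False)) = act_field \<gamma> (f (?T x))" by simp
 next
  have eq: "inj (f z) \<longleftrightarrow> (\<forall>u\<in>UNIV. \<forall>v\<in>UNIV. f z u = f z v \<longrightarrow> u = v)" for z by (auto simp: inj_def)
  have "Measurable.pred ?cc (\<lambda>z. inj (f z))"
   unfolding eq
  proof (intro pred_Ball_countable[OF countable_V] pred_intros_logic)
   fix u v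
   note [measurable] = fv
   show "Measurable.pred ?cc (\<lambda>z. f z u = f z v)" by measurable
  qed simp
  from transfer[OF this] f_inj show "AE x in e.mu. inj (f (?T x))" by simp
 qed
 \<comment> \<open>The environment is a function of the pair of processes alone, which makes every
   matching read off it a function of the pair.\<close>
 define h where "h z = (fst z, snd z, f z)" for z
 have h [measurable]: "h \<in> ?cc \<rightarrow>\<^sub>M envM" unfolding h_def envM_def by measurable
 have hZ: "(\<lambda>\<omega>. h (?Z \<omega>)) \<in> P \<rightarrow>\<^sub>M envM" by measurable
 have DP: "distr e.mu envM (\<lambda>x. (e.tot x True, e.tot x False, f (?T x))) = distr P envM (\<lambda>\<omega>. h (?Z \<omega>))"
 proof -
  have "distr e.mu envM (\<lambda>x. (e.tot x True, e.tot x False, f (?T x))) = distr (distr e.mu ?cc ?T) envM h"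
   by (subst distr_distr[OF h T]) (simp add: comp_def h_def)
  also have "\<dots> = distr P envM (\<lambda>\<omega>. h (?Z \<omega>))" unfolding q(2)[symmetric]
   by (subst distr_distr[OF h Z]) (simp add: comp_def)
  finally show ?thesis .
 qed
 interpret v: env E "distr P envM (\<lambda>\<omega>. h (?Z \<omega>))" using D unfolding DP .
 obtain m c R where m: "v.rrel m" and mp': "\<forall>Y x y. m Y x y \<longrightarrow> v.pt Y True x \<and> v.pt Y False y"
  and mf': "\<forall>Y x y y'. m Y x y \<longrightarrow> m Y x y' \<longrightarrow> y = y'" and mi': "\<forall>Y x x' y. m Y x y \<longrightarrow> m Y x' y \<longrightarrow> x = x'"
  and perf: "AE Y in distr P envM (\<lambda>\<omega>. h (?Z \<omega>)). (\<forall>x. v.pt Y True x \<longrightarrow> (\<exists>y. m Y x y)) \<and> (\<forall>y. v.pt Y False y \<longrightarrow> (\<exists>x. m Y x y))"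
  and c: "0 < c" and tail': "\<forall>v. \<forall>r\<ge>R.
   (\<integral>\<^sup>+Y. of_nat (cnt Y True v) * of_bool (\<exists>i y. m Y (v, i) y \<and> r \<le> dd v (fst y)) \<partial>distr P envM (\<lambda>\<omega>. h (?Z \<omega>)))
    \<le> ennreal (exp (- c * real (bsize r)))"
  using v.env_matching by (elim exE conjE) (rule that; assumption)
 have mp: "m Y x y \<Longrightarrow> v.pt Y True x \<and> v.pt Y False y" for Y x y using mp' by blast
 have mi: "m Y x y \<Longrightarrow> m Y x' y \<Longrightarrow> x = x'" for Y x x' y using mi' by blast
 have mf: "\<forall>x y y'. m Y x y \<longrightarrow> m Y x y' \<longrightarrow> y = y'" for Y using mf' by blast
 have mm: "Measurable.pred envM (\<lambda>Y. m Y x y)" for x y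
  using v.rrelD(1)[OF m] by (subst (asm) measurable_cong_sets[OF sets_distr refl])
 have pts: "points (\<Phi> \<omega>) = {x. v.pt (h (?Z \<omega>)) True x}" "points (\<Phi>' \<omega>) = {x. v.pt (h (?Z \<omega>)) False x}" for \<omega>
  by (auto simp: points_def v.pt_def cnt_def h_def)
 define g where "g z = matching_of (m (h z))" for z
 have g: "g \<in> ?cc \<rightarrow>\<^sub>M matching_space"
  unfolding matching_space_def
 proof (rule measurable_PiM_single')
  fix x :: "'v \<times> nat"
  have co: "countable (UNIV :: ('v \<times> nat) option set)"
   using v.countable_pts by (simp add: UNIV_option_conv)
  have hm: "Measurable.pred ?cc (\<lambda>z. m (h z) x y)" for y by (rule measurable_compose[OF h mm])
  show "(\<lambda>z. g z x) \<in> ?cc \<rightarrow>\<^sub>M count_space UNIV"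
   unfolding measurable_count_space_eq_countable[OF co]
  proof (intro conjI ballI)
   fix a :: "('v \<times> nat) option"
   have "Measurable.pred ?cc (\<lambda>z. g z x = a)"
   proof (cases a)
    case None
    have eq: "g z x = a \<longleftrightarrow> \<not> (\<exists>y\<in>UNIV. m (h z) x y)" for z
     unfolding g_def None using matching_of_eq(2)[OF mf[of "h z"], of x] by blast
    show ?thesis unfolding eq by (intro pred_intros_logic pred_Bex_countable[OF v.countable_pts] hm)
   next
    case (Some y)
    have eq: "g z x = a \<longleftrightarrow> m (h z) x y" for z
     unfolding g_def Some by (rule matching_of_eq(1)[OF mf])
    show ?thesis unfolding eq by (rule hm)
   qed
   moreover have "(\<lambda>z. g z x) -` {a} \<inter> space ?cc = {z \<in> space ?cc. g z x = a}" by auto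
   ultimately show "(\<lambda>z. g z x) -` {a} \<inter> space ?cc \<in> sets ?cc" by (simp only: pred_def)
  qed simp
 qed (simp add: space_PiM)
 have fac: "is_factor E P \<Phi> \<Phi>' matching_space act_matching (\<lambda>\<omega>. g (?Z \<omega>))"
  unfolding is_factor_def
 proof (intro conjI bexI[of _ g] allI impI)
  show "(\<lambda>\<omega>. g (?Z \<omega>)) \<in> P \<rightarrow>\<^sub>M matching_space" by (rule measurable_compose[OF Z g])
  fix \<gamma> assume a: "aut \<gamma>"
  \<comment> \<open>The matching relation is exactly equivariant in the environment; the only
    exceptional set is the one where the labels fail to be equivariant.\<close>
  show "AE \<omega> in P. g (act_field \<gamma> (\<Phi> \<omega>), act_field \<gamma> (\<Phi>' \<omega>)) = act_matching \<gamma> (g (?Z \<omega>))"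
   using fa[OF a]
  proof eventually_elim
   case (elim \<omega>)
   then have "h (act_field \<gamma> (\<Phi> \<omega>), act_field \<gamma> (\<Phi>' \<omega>)) = actz \<gamma> (h (?Z \<omega>))" by (simp add: h_def actz_def)
   then show ?case unfolding g_def
    by (simp only:) (rule v.matching_of_gp[OF a v.rrelD(2)[OF m a] mf])
  qed
 qed (use g in simp_all)
 have gS: "g z x = Some y \<longleftrightarrow> m (h z) x y" for z x y unfolding g_def by (rule matching_of_eq(1)[OF mf])
 have pm: "AE \<omega> in P. perfect_matching (g (?Z \<omega>)) (points (\<Phi> \<omega>)) (points (\<Phi>' \<omega>))"
 proof -
  have "AE \<omega> in P. (\<forall>x. v.pt (h (?Z \<omega>)) True x \<longrightarrow> (\<exists>y. m (h (?Z \<omega>)) x y)) \<and> (\<forall>y. v.pt (h (?Z \<omega>)) False y \<longrightarrow> (\<exists>x. m (h (?Z \<omega>)) x y))"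
   by (rule AE_distrD[OF hZ perf])
  then show ?thesis
  proof eventually_elim
   case (elim \<omega>)
   let ?m = "m (h (?Z \<omega>))"
   have "x \<in> dom (g (?Z \<omega>)) \<longleftrightarrow> x \<in> points (\<Phi> \<omega>)" for x
   proof -
    have "x \<in> dom (g (?Z \<omega>)) \<longleftrightarrow> (\<exists>y. ?m x y)" by (simp add: dom_def gS)
    also have "\<dots> \<longleftrightarrow> v.pt (h (?Z \<omega>)) True x" using elim mp by blast
    finally show ?thesis unfolding pts by simp
   qed
   then have "dom (g (?Z \<omega>)) = points (\<Phi> \<omega>)" by blast
   moreover have "y \<in> ran (g (?Z \<omega>)) \<longleftrightarrow> y \<in> points (\<Phi>' \<omega>)" for y
   proof -
    have "y \<in> ran (g (?Z \<omega>)) \<longleftrightarrow> (\<exists>x. ?m x y)" by (simp add: ran_def gS)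
    also have "\<dots> \<longleftrightarrow> v.pt (h (?Z \<omega>)) False y" using elim mp by blast
    finally show ?thesis unfolding pts by simp
   qed
   then have "ran (g (?Z \<omega>)) = points (\<Phi>' \<omega>)" by blast
   moreover have "inj_on (g (?Z \<omega>)) (points (\<Phi> \<omega>))"
   proof (rule inj_onI)
    fix x x' assume x: "x \<in> points (\<Phi> \<omega>)" "g (?Z \<omega>) x = g (?Z \<omega>) x'"
    then obtain y where y: "?m x y" using elim unfolding pts by blast
    then have "g (?Z \<omega>) x = Some y" by (simp add: gS)
    then have "?m x' y" using x(2) gS by metis
    then show "x = x'" using y mi by blast
   qed
   ultimately show ?case unfolding perfect_matching_def matching_def by simp
  qed
 qed
 have "(\<integral>\<^sup>+ \<omega>. of_nat (card {x \<in> points (\<Phi> \<omega>). fst x = v \<and> (\<exists>y. g (?Z \<omega>) x = Some y \<and> gdist E (fst y) (fst x) \<ge> r)}) \<partial>P)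
   \<le> ennreal (exp (- c * real (card (gball E v r))))" if r: "r \<ge> R" for v r
 proof -
  let ?X = "\<lambda>\<omega>. {x \<in> points (\<Phi> \<omega>). fst x = v \<and> (\<exists>y. g (?Z \<omega>) x = Some y \<and> gdist E (fst y) (fst x) \<ge> r)}"
  let ?F = "\<lambda>Y. of_nat (cnt Y True v) * of_bool (\<exists>i y. m Y (v, i) y \<and> r \<le> dd v (fst y)) :: ennreal"
  \<comment> \<open>All points at \<open>v\<close> are counted as soon as one of them has a distant
    partner.\<close>
  have le: "of_nat (card (?X \<omega>)) \<le> ?F (h (?Z \<omega>))" for \<omega>
  proof (cases "\<exists>i y. m (h (?Z \<omega>)) (v, i) y \<and> r \<le> dd v (fst y)")
   case True
   have "?X \<omega> \<subseteq> {v} \<times> {1..\<Phi> \<omega> v}" by (auto simp: points_def)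
   then have "card (?X \<omega>) \<le> card ({v} \<times> {1..\<Phi> \<omega> v})" by (intro card_mono) auto
   also have "\<dots> = cnt (h (?Z \<omega>)) True v" by (simp add: cnt_def h_def card_cartesian_product)
   finally have "of_nat (card (?X \<omega>)) \<le> (of_nat (cnt (h (?Z \<omega>)) True v) :: ennreal)" by (rule of_nat_mono)
   then show ?thesis using True by (simp only: of_bool_eq mult_1_right)
  next
   case False
   have "x \<notin> ?X \<omega>" for x
   proof
    assume "x \<in> ?X \<omega>"
    then obtain y where y: "fst x = v" "g (?Z \<omega>) x = Some y" "r \<le> dd (fst y) v" by blast
    have "x = (v, snd x)" using y(1) by (cases x) simp
    then have "m (h (?Z \<omega>)) (v, snd x) y" using y(2) gS by metis
    then show False using False y(3) dd_sym by metis
   qed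
   then have "?X \<omega> = {}" by blast
   then show ?thesis by (simp only: card.empty of_nat_0 zero_le)
  qed
  have eq: "(\<exists>i y. m Y (v, i) y \<and> r \<le> dd v (fst y)) \<longleftrightarrow> (\<exists>i. \<exists>y\<in>UNIV. m Y (v, i) y \<and> r \<le> dd v (fst y))" for Y by simp
  have mE: "Measurable.pred envM (\<lambda>Y. \<exists>i y. m Y (v, i) y \<and> r \<le> dd v (fst y))"
   unfolding eq by (intro pred_intros_countable pred_Bex_countable[OF v.countable_pts] pred_intros_logic mm) simp
  have F: "?F \<in> borel_measurable envM"
  proof -
   let ?S = "{Y. \<exists>i y. m Y (v, i) y \<and> r \<le> dd v (fst y)}"
   have "?S \<in> sets envM" using mE by (simp only: pred_def space_envM UNIV_I simp_thms)
   then have "(\<lambda>Y. of_nat (cnt Y True v) * indicator ?S Y :: ennreal) \<in> borel_measurable envM"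
    by (intro borel_measurable_times_ennreal borel_measurable_indicator measurable_compose[OF cnt_measurable]) simp_all
   moreover have "indicator ?S Y = (of_bool (\<exists>i y. m Y (v, i) y \<and> r \<le> dd v (fst y)) :: ennreal)" for Y
    by (simp only: indicator_def mem_Collect_eq)
   ultimately show ?thesis by (simp only:)
  qed
  have F': "?F \<in> borel_measurable (distr P envM (\<lambda>\<omega>. h (?Z \<omega>)))" using F unfolding measurable_distr_eq1 .
  have "(\<integral>\<^sup>+ \<omega>. of_nat (card (?X \<omega>)) \<partial>P) \<le> (\<integral>\<^sup>+ \<omega>. ?F (h (?Z \<omega>)) \<partial>P)" by (intro nn_integral_mono le)
  also have "\<dots> = (\<integral>\<^sup>+Y. ?F Y \<partial>distr P envM (\<lambda>\<omega>. h (?Z \<omega>)))" by (rule nn_integral_distr[OF hZ F', symmetric])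
  also have "\<dots> \<le> ennreal (exp (- c * real (bsize r)))" using tail' r by blast
  finally show ?thesis by (simp only: card_gball)
 qed
 then show ?thesis using c fac pm by (intro exI[of _ c] conjI exI[of _ "\<lambda>\<omega>. g (?Z \<omega>)"] exI[of _ R]) blast+
qed

end
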